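(* The 2-category $\mathcal{B}i\mathcal{R}el$ of bicategories of relations and cartesian functors and transformations is equivalent to the locally full sub-2-category $\mathcal{U}Pt\mathcal{A}ll$ of $\mathcal{A}ll$ on the unitary pre-tabular allegories and unit-preserving functors.
   Context: A map in a locally ordered 2-category is a morphism $f$ having a right adjoint, written $f^\bullet$. Allegories. An allegory is a strict 2-category $\mathcal{A}$ whose hom-categories are posets with binary meets $\cap$, equipped with a strict involution $(-)^\circ\colon\mathcal{A}^{\mathrm{op}}\to\mathcal{A}$ that is the identity on objects and satisfies the modular law $sr\cap t\le(s\cap t r^\circ)r$ for all suitably typed $r,s,t$. An allegory functor is a 2-functor preserving $\cap$ and $(-)^\circ$. A transformation $\alpha\colon F\Rightarrow G$ of allegory functors is an oplax transformation (i.e. $\alpha_Y\circ Fs\le Gs\circ\alpha_X$ for every $s\colon X\to Y$) whose components are maps. These form the 2-category $\mathcal{A}ll$. A tabulation of $r\colon X\to Y$ is a pair of maps $f\colon Z\to X$, $g\colon Z\to Y$ with $r=gf^\circ$ and $f^\circ f\cap g^\circ g=1$. An allegory is pre-tabular if every morphism is contained in (is $\leq$) one that has a tabulation. A unit is an object $U$ such that $1_U$ is the top element of $\mathcal{A}(U,U)$ and for every $X$ there is $p\colon X\to U$ with $p^\circ p\ge1$; an allegory is unitary if it has a unit, and a functor is unit-preserving if it sends units to units. Bicategories of relations. A (locally ordered) cartesian bicategory is a locally partially ordered 2-category $\mathcal{C}$ such that: (1) $\mathcal{C}$ is symmetric monoidal, with $\otimes\colon\mathcal{C}\times\mathcal{C}\to\mathcal{C}$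 a pseudofunctor and coherent natural isomorphisms, with unit $I$; (2) every object $X$ is a commutative comonoid via maps $d_X\colon X\to X\otimes X$ and $e_X\colon X\to I$ (with right adjoints $d_X^\bullet$, $e_X^\bullet$), and this is the only such comonoid structure on $X$; (3) every morphism $r\colon X\to Y$ satisfies $d_Y r\le(r\otimes r)d_X$ and $e_Y r\le e_X$. A bicategory of relations is a cartesian bicategory in which every object is Frobenius: $d\,d^\bullet=(d^\bullet\otimes1)(1\otimes d)$. A cartesian functor is a (strong) monoidal 2-functor, and a cartesian transformation is an oplax transformation whose components are maps. *)

theory Defs
  imports "HOL-Library.FuncSet"
begin

section \<open>Categories\<close>

text \<open>
  All structures are records with explicit carriers inside arbitrary (universally quantified)
  types of objects and arrows. Values outside the carriers are irrelevant.
\<close>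

record ('o, 'a) cat_data =
  Obj :: "'o set"
  Arr :: "'a set"
  Dom :: "'a \<Rightarrow> 'o"
  Cod :: "'a \<Rightarrow> 'o"
  Ident :: "'o \<Rightarrow> 'a"
  Comp :: "'a \<Rightarrow> 'a \<Rightarrow> 'a"  (infixl "\<cdot>\<index>" 70)

definition hom :: "('o, 'a, 'z) cat_data_scheme \<Rightarrow> 'o \<Rightarrow> 'o \<Rightarrow> 'a set" where
  "hom C X Y = {f \<in> Arr C. Dom C f = X \<and> Cod C f = Y}"

locale category =
  fixes C :: "('o, 'a, 'z) cat_data_scheme" (structure)
  assumes Dom_in_Obj: "f \<in> Arr C \<Longrightarrow> Dom C f \<in> Obj C"
    and Cod_in_Obj: "f \<in> Arr C \<Longrightarrow> Cod C f \<in> Obj C"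
    and Ident_in_hom: "X \<in> Obj C \<Longrightarrow> Ident C X \<in> hom C X X"
    and Comp_in_hom: "\<lbrakk>f \<in> hom C X Y; g \<in> hom C Y Z\<rbrakk> \<Longrightarrow> g \<cdot> f \<in> hom C X Z"
    and Comp_Ident_right: "f \<in> hom C X Y \<Longrightarrow> f \<cdot> Ident C X = f"
    and Comp_Ident_left: "f \<in> hom C X Y \<Longrightarrow> Ident C Y \<cdot> f = f"
    and Comp_assoc: "\<lbrakk>f \<in> hom C W X; g \<in> hom C X Y; h \<in> hom C Y Z\<rbrakk>
        \<Longrightarrow> h \<cdot> g \<cdot> f = h \<cdot> (g \<cdot> f)"

definition is_functor ::
  "('o, 'a, 'z) cat_data_scheme \<Rightarrow> ('p, 'b, 'y) cat_data_scheme \<Rightarrow> ('o \<Rightarrow> 'p) \<Rightarrow> ('a \<Rightarrow> 'b) \<Rightarrow> bool"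
where
  "is_functor C D F0 F1 \<longleftrightarrow>
     (\<forall>X \<in> Obj C. F0 X \<in> Obj D) \<and>
     (\<forall>f \<in> Arr C. F1 f \<in> hom D (F0 (Dom C f)) (F0 (Cod C f))) \<and>
     (\<forall>X \<in> Obj C. F1 (Ident C X) = Ident D (F0 X)) \<and>
     (\<forall>f \<in> Arr C. \<forall>g \<in> Arr C. Dom C g = Cod C f \<longrightarrow> F1 (g \<cdot>\<^bsub>C\<^esub> f) = F1 g \<cdot>\<^bsub>D\<^esub> F1 f)"

definition inverse_arrows :: "('o, 'a, 'z) cat_data_scheme \<Rightarrow> 'a \<Rightarrow> 'a \<Rightarrow> bool" where
  "inverse_arrows C f g \<longleftrightarrow>
     f \<in> Arr C \<and> g \<in> hom C (Cod C f) (Dom C f) \<and>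
     g \<cdot>\<^bsub>C\<^esub> f = Ident C (Dom C f) \<and> f \<cdot>\<^bsub>C\<^esub> g = Ident C (Cod C f)"

definition is_iso :: "('o, 'a, 'z) cat_data_scheme \<Rightarrow> 'a \<Rightarrow> bool" where
  "is_iso C f \<longleftrightarrow> (\<exists>g. inverse_arrows C f g)"

definition inv_arr :: "('o, 'a, 'z) cat_data_scheme \<Rightarrow> 'a \<Rightarrow> 'a" where
  "inv_arr C f = (THE g. inverse_arrows C f g)"


section \<open>Strict 2-categories and their equivalence\<close>

record ('o, 'f, 't) two_cat_data = "('o, 'f) cat_data" +
  Cells :: "'t set"
  Src :: "'t \<Rightarrow> 'f"
  Tgt :: "'t \<Rightarrow> 'f"
  VIdent :: "'f \<Rightarrow> 't"
  VComp :: "'t \<Rightarrow> 't \<Rightarrow> 't"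
  HComp :: "'t \<Rightarrow> 't \<Rightarrow> 't"

text \<open>1-cells and 2-cells under vertical composition; objects and 2-cells under horizontal
  composition. In both, composites are written in the order of function composition.\<close>

definition vertical :: "('o, 'f, 't, 'z) two_cat_data_scheme \<Rightarrow> ('f, 't) cat_data" where
  "vertical T = \<lparr>Obj = Arr T, Arr = Cells T, Dom = Src T, Cod = Tgt T,
     Ident = VIdent T, Comp = VComp T\<rparr>"

definition horizontal :: "('o, 'f, 't, 'z) two_cat_data_scheme \<Rightarrow> ('o, 't) cat_data" where
  "horizontal T = \<lparr>Obj = Obj T, Arr = Cells T,
     Dom = (\<lambda>t. Dom T (Src T t)), Cod = (\<lambda>t. Cod T (Src T t)),
     Ident = (\<lambda>X. VIdent T (Ident T X)), Comp = HComp T\<rparr>"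

locale two_category = category T
  for T :: "('o, 'f, 't, 'z) two_cat_data_scheme" (structure) +
  assumes vertical_category: "category (vertical T)"
    and horizontal_category: "category (horizontal T)"
    and Dom_Src_Tgt: "t \<in> Cells T \<Longrightarrow> Dom T (Src T t) = Dom T (Tgt T t)"
    and Cod_Src_Tgt: "t \<in> Cells T \<Longrightarrow> Cod T (Src T t) = Cod T (Tgt T t)"
    and Src_HComp: "\<lbrakk>s \<in> Cells T; t \<in> Cells T; Dom T (Src T t) = Cod T (Src T s)\<rbrakk>
        \<Longrightarrow> Src T (HComp T t s) = Src T t \<cdot> Src T s"
    and Tgt_HComp: "\<lbrakk>s \<in> Cells T; t \<in> Cells T; Dom T (Src T t) = Cod T (Src T s)\<rbrakk>
        \<Longrightarrow> Tgt T (HComp T t s) = Tgt T t \<cdot> Tgt T s"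
    and HComp_VIdent: "\<lbrakk>f \<in> Arr T; g \<in> Arr T; Dom T g = Cod T f\<rbrakk>
        \<Longrightarrow> HComp T (VIdent T g) (VIdent T f) = VIdent T (g \<cdot> f)"
    and interchange: "\<lbrakk>s \<in> Cells T; s' \<in> Cells T; t \<in> Cells T; t' \<in> Cells T;
        Src T s' = Tgt T s; Src T t' = Tgt T t; Dom T (Src T t) = Cod T (Src T s)\<rbrakk>
        \<Longrightarrow> HComp T (VComp T t' t) (VComp T s' s) = VComp T (HComp T t' s') (HComp T t s)"

record ('o, 'f, 't, 'p, 'g, 'u) two_functor_data =
  F0 :: "'o \<Rightarrow> 'p"
  F1 :: "'f \<Rightarrow> 'g"
  F2 :: "'t \<Rightarrow> 'u"

definition two_functor ::
  "('o, 'f, 't, 'z) two_cat_data_scheme \<Rightarrow> ('p, 'g, 'u, 'y) two_cat_data_scheme \<Rightarrow>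
   ('o, 'f, 't, 'p, 'g, 'u) two_functor_data \<Rightarrow> bool"
where
  "two_functor S T F \<longleftrightarrow>
     is_functor S T (F0 F) (F1 F) \<and>
     is_functor (vertical S) (vertical T) (F1 F) (F2 F) \<and>
     is_functor (horizontal S) (horizontal T) (F0 F) (F2 F)"

definition two_functor_id :: "('o, 'f, 't, 'o, 'f, 't) two_functor_data" where
  "two_functor_id = \<lparr>F0 = (\<lambda>X. X), F1 = (\<lambda>f. f), F2 = (\<lambda>t. t)\<rparr>"

definition two_functor_comp ::
  "('p, 'g, 'u, 'q, 'h, 'v) two_functor_data \<Rightarrow> ('o, 'f, 't, 'p, 'g, 'u) two_functor_data \<Rightarrow>
   ('o, 'f, 't, 'q, 'h, 'v) two_functor_data"
where
  "two_functor_comp G F = \<lparr>F0 = F0 G \<circ> F0 F, F1 = F1 G \<circ> F1 F, F2 = F2 G \<circ> F2 F\<rparr>"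

definition two_natural_iso ::
  "('o, 'f, 't, 'z) two_cat_data_scheme \<Rightarrow> ('p, 'g, 'u, 'y) two_cat_data_scheme \<Rightarrow>
   ('o, 'f, 't, 'p, 'g, 'u) two_functor_data \<Rightarrow> ('o, 'f, 't, 'p, 'g, 'u) two_functor_data \<Rightarrow>
   ('o \<Rightarrow> 'g) \<Rightarrow> bool"
where
  "two_natural_iso S T F G \<eta> \<longleftrightarrow>
     (\<forall>X \<in> Obj S. \<eta> X \<in> hom T (F0 F X) (F0 G X) \<and> is_iso T (\<eta> X)) \<and>
     (\<forall>f \<in> Arr S. \<eta> (Cod S f) \<cdot>\<^bsub>T\<^esub> F1 F f = F1 G f \<cdot>\<^bsub>T\<^esub> \<eta> (Dom S f)) \<and>
     (\<forall>t \<in> Cells S. HComp T (VIdent T (\<eta> (Cod S (Src S t)))) (F2 F t)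
                  = HComp T (F2 G t) (VIdent T (\<eta> (Dom S (Src S t)))))"

text \<open>Equivalence in the strict (Cat-enriched) sense, which in particular implies
  biequivalence. That both sides satisfy the axioms of a 2-category is part of the assertion.\<close>

definition two_equivalent ::
  "('o, 'f, 't, 'z) two_cat_data_scheme \<Rightarrow> ('p, 'g, 'u, 'y) two_cat_data_scheme \<Rightarrow> bool"
where
  "two_equivalent S T \<longleftrightarrow>
     two_category S \<and> two_category T \<and>
     (\<exists>F G \<eta> \<epsilon>. two_functor S T F \<and> two_functor T S G \<and>
        two_natural_iso S S two_functor_id (two_functor_comp G F) \<eta> \<and>
        two_natural_iso T T (two_functor_comp F G) two_functor_id \<epsilon>)"

definition locally_full_sub ::
  "('o, 'f, 't) two_cat_data \<Rightarrow> ('o \<Rightarrow> bool) \<Rightarrow> ('f \<Rightarrow> bool) \<Rightarrow> ('o, 'f, 't) two_cat_data"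
where
  "locally_full_sub T P Q =
     (let A = {f \<in> Arr T. P (Dom T f) \<and> P (Cod T f) \<and> Q f}
      in T\<lparr>Obj := {X \<in> Obj T. P X}, Arr := A, Cells := {t \<in> Cells T. Src T t \<in> A \<and> Tgt T t \<in> A}\<rparr>)"


section \<open>Locally ordered 2-categories\<close>

text \<open>A 2-category whose hom-categories are posets is a category with a compatible partial
  order on each hom-set. The order is only meaningful between parallel arrows.\<close>

record ('o, 'a) ord_cat_data = "('o, 'a) cat_data" +
  Le :: "'a \<Rightarrow> 'a \<Rightarrow> bool"  (infix "\<sqsubseteq>\<index>" 50)

locale ord_category = category C
  for C :: "('o, 'a, 'z) ord_cat_data_scheme" (structure) +
  assumes Le_refl: "r \<in> hom C X Y \<Longrightarrow> r \<sqsubseteq> r"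
    and Le_trans: "\<lbrakk>r \<in> hom C X Y; s \<in> hom C X Y; t \<in> hom C X Y; r \<sqsubseteq> s; s \<sqsubseteq> t\<rbrakk> \<Longrightarrow> r \<sqsubseteq> t"
    and Le_antisym: "\<lbrakk>r \<in> hom C X Y; s \<in> hom C X Y; r \<sqsubseteq> s; s \<sqsubseteq> r\<rbrakk> \<Longrightarrow> r = s"
    and Comp_mono: "\<lbrakk>r \<in> hom C X Y; r' \<in> hom C X Y; s \<in> hom C Y Z; s' \<in> hom C Y Z;
        r \<sqsubseteq> r'; s \<sqsubseteq> s'\<rbrakk> \<Longrightarrow> s \<cdot> r \<sqsubseteq> s' \<cdot> r'"

definition is_right_adjoint :: "('o, 'a, 'z) ord_cat_data_scheme \<Rightarrow> 'a \<Rightarrow> 'a \<Rightarrow> bool" where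
  "is_right_adjoint C f g \<longleftrightarrow>
     f \<in> Arr C \<and> g \<in> hom C (Cod C f) (Dom C f) \<and>
     Ident C (Dom C f) \<sqsubseteq>\<^bsub>C\<^esub> g \<cdot>\<^bsub>C\<^esub> f \<and> f \<cdot>\<^bsub>C\<^esub> g \<sqsubseteq>\<^bsub>C\<^esub> Ident C (Cod C f)"

definition is_map :: "('o, 'a, 'z) ord_cat_data_scheme \<Rightarrow> 'a \<Rightarrow> bool" where
  "is_map C f \<longleftrightarrow> (\<exists>g. is_right_adjoint C f g)"

definition right_adj :: "('o, 'a, 'z) ord_cat_data_scheme \<Rightarrow> 'a \<Rightarrow> 'a"  ("(_\<^sup>\<bullet>\<index>)" [1000] 999) where
  "right_adj C f = (THE g. is_right_adjoint C f g)"

definition is_meet :: "('o, 'a, 'z) ord_cat_data_scheme \<Rightarrow> 'a \<Rightarrow> 'a \<Rightarrow> 'a \<Rightarrow> bool" where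
  "is_meet C r s m \<longleftrightarrow>
     m \<in> hom C (Dom C r) (Cod C r) \<and> m \<sqsubseteq>\<^bsub>C\<^esub> r \<and> m \<sqsubseteq>\<^bsub>C\<^esub> s \<and>
     (\<forall>u \<in> hom C (Dom C r) (Cod C r). u \<sqsubseteq>\<^bsub>C\<^esub> r \<and> u \<sqsubseteq>\<^bsub>C\<^esub> s \<longrightarrow> u \<sqsubseteq>\<^bsub>C\<^esub> m)"

definition meet :: "('o, 'a, 'z) ord_cat_data_scheme \<Rightarrow> 'a \<Rightarrow> 'a \<Rightarrow> 'a"  (infixl "\<sqinter>\<index>" 65) where
  "meet C r s = (THE m. is_meet C r s m)"

text \<open>Functors carry their domain and codomain and are undefined outside the carriers of the
  domain, so that equality of records is equality of functors.\<close>

record ('c, 'o, 'a) fun_data =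
  FDom :: 'c
  FCod :: 'c
  FObj :: "'o \<Rightarrow> 'o"
  FArr :: "'a \<Rightarrow> 'a"

definition ord_functor ::
  "(('o, 'a, 'z) ord_cat_data_scheme, 'o, 'a, 'y) fun_data_scheme \<Rightarrow> bool"
where
  "ord_functor F \<longleftrightarrow>
     is_functor (FDom F) (FCod F) (FObj F) (FArr F) \<and>
     FObj F \<in> extensional (Obj (FDom F)) \<and> FArr F \<in> extensional (Arr (FDom F)) \<and>
     (\<forall>r \<in> Arr (FDom F). \<forall>s \<in> Arr (FDom F).
        Dom (FDom F) r = Dom (FDom F) s \<and> Cod (FDom F) r = Cod (FDom F) s \<and>
        r \<sqsubseteq>\<^bsub>FDom F\<^esub> s \<longrightarrow> FArr F r \<sqsubseteq>\<^bsub>FCod F\<^esub> FArr F s)"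

definition fun_id :: "('o, 'a, 'z) ord_cat_data_scheme \<Rightarrow>
    (('o, 'a, 'z) ord_cat_data_scheme, 'o, 'a) fun_data" where
  "fun_id C = \<lparr>FDom = C, FCod = C, FObj = (\<lambda>X \<in> Obj C. X), FArr = (\<lambda>r \<in> Arr C. r)\<rparr>"

definition fun_comp ::
  "(('o, 'a, 'z) ord_cat_data_scheme, 'o, 'a, 'y) fun_data_scheme \<Rightarrow>
   (('o, 'a, 'z) ord_cat_data_scheme, 'o, 'a, 'y) fun_data_scheme \<Rightarrow>
   (('o, 'a, 'z) ord_cat_data_scheme, 'o, 'a) fun_data"
where
  "fun_comp G F = \<lparr>FDom = FDom F, FCod = FCod G,
     FObj = compose (Obj (FDom F)) (FObj G) (FObj F),
     FArr = compose (Arr (FDom F)) (FArr G) (FArr F)\<rparr>"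

record ('f, 'o, 'a) trans_data =
  TSrc :: 'f
  TTgt :: 'f
  TComp :: "'o \<Rightarrow> 'a"

text \<open>Oplax transformations; the coherence conditions on their 2-cells hold automatically
  because the hom-categories are posets.\<close>

definition oplax_transformation ::
  "((('o, 'a, 'z) ord_cat_data_scheme, 'o, 'a, 'y) fun_data_scheme, 'o, 'a) trans_data \<Rightarrow> bool"
where
  "oplax_transformation \<alpha> \<longleftrightarrow>
     (let F = TSrc \<alpha>; G = TTgt \<alpha>; A = FDom F; B = FCod F in
        FDom G = A \<and> FCod G = B \<and> TComp \<alpha> \<in> extensional (Obj A) \<and>
        (\<forall>X \<in> Obj A. TComp \<alpha> X \<in> hom B (FObj F X) (FObj G X)) \<and>
        (\<forall>s \<in> Arr A. TComp \<alpha> (Cod A s) \<cdot>\<^bsub>B\<^esub> FArr F s \<sqsubseteq>\<^bsub>B\<^esub> FArr G s \<cdot>\<^bsub>B\<^esub> TComp \<alpha> (Dom A s)))"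

definition map_components ::
  "((('o, 'a, 'z) ord_cat_data_scheme, 'o, 'a, 'y) fun_data_scheme, 'o, 'a) trans_data \<Rightarrow> bool"
where
  "map_components \<alpha> \<longleftrightarrow>
     (\<forall>X \<in> Obj (FDom (TSrc \<alpha>)). is_map (FCod (TSrc \<alpha>)) (TComp \<alpha> X))"

text \<open>The 2-category on given objects and functors whose 2-cells are all oplax transformations
  with map components. For \<open>\<alpha> : F \<Rightarrow> G\<close> and \<open>\<beta> : H \<Rightarrow> K\<close>, the horizontal composite is taken to
  be \<open>K \<alpha>\<^sub>X \<cdot> \<beta>\<^bsub>F X\<^esub>\<close>; for a merely oplax \<open>\<beta>\<close> it could differ from \<open>\<beta>\<^bsub>G X\<^esub> \<cdot> H \<alpha>\<^sub>X\<close>, but the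
  two agree when parallel maps of the codomain that are comparable are equal, as is the case in
  allegories and in bicategories of relations.\<close>

definition transformation_2cat ::
  "('o, 'a, 'z) ord_cat_data_scheme set \<Rightarrow>
   (('o, 'a, 'z) ord_cat_data_scheme, 'o, 'a, 'y) fun_data_scheme set \<Rightarrow>
   (('o, 'a, 'z) ord_cat_data_scheme \<Rightarrow>
      (('o, 'a, 'z) ord_cat_data_scheme, 'o, 'a, 'y) fun_data_scheme) \<Rightarrow>
   ((('o, 'a, 'z) ord_cat_data_scheme, 'o, 'a, 'y) fun_data_scheme \<Rightarrow>
      (('o, 'a, 'z) ord_cat_data_scheme, 'o, 'a, 'y) fun_data_scheme \<Rightarrow>
      (('o, 'a, 'z) ord_cat_data_scheme, 'o, 'a, 'y) fun_data_scheme) \<Rightarrow>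
   (('o, 'a, 'z) ord_cat_data_scheme,
    (('o, 'a, 'z) ord_cat_data_scheme, 'o, 'a, 'y) fun_data_scheme,
    ((('o, 'a, 'z) ord_cat_data_scheme, 'o, 'a, 'y) fun_data_scheme, 'o, 'a) trans_data)
   two_cat_data"
where
  "transformation_2cat Objects Functors idf compf =
     \<lparr>Obj = Objects, Arr = Functors, Dom = FDom, Cod = FCod, Ident = idf, Comp = compf,
      Cells = {\<alpha>. TSrc \<alpha> \<in> Functors \<and> TTgt \<alpha> \<in> Functors \<and>
                  oplax_transformation \<alpha> \<and> map_components \<alpha>},
      Src = TSrc, Tgt = TTgt,
      VIdent = (\<lambda>F. \<lparr>TSrc = F, TTgt = F,
        TComp = (\<lambda>X \<in> Obj (FDom F). Ident (FCod F) (FObj F X))\<rparr>),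
      VComp = (\<lambda>\<beta> \<alpha>. \<lparr>TSrc = TSrc \<alpha>, TTgt = TTgt \<beta>,
        TComp = (\<lambda>X \<in> Obj (FDom (TSrc \<alpha>)). TComp \<beta> X \<cdot>\<^bsub>FCod (TSrc \<alpha>)\<^esub> TComp \<alpha> X)\<rparr>),
      HComp = (\<lambda>\<beta> \<alpha>. \<lparr>TSrc = compf (TSrc \<beta>) (TSrc \<alpha>), TTgt = compf (TTgt \<beta>) (TTgt \<alpha>),
        TComp = (\<lambda>X \<in> Obj (FDom (TSrc \<alpha>)).
          FArr (TTgt \<beta>) (TComp \<alpha> X) \<cdot>\<^bsub>FCod (TSrc \<beta>)\<^esub> TComp \<beta> (FObj (TSrc \<alpha>) X))\<rparr>)\<rparr>"


section \<open>Allegories\<close>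

record ('o, 'a) allegory_data = "('o, 'a) ord_cat_data" +
  Conv :: "'a \<Rightarrow> 'a"  ("(_\<degree>\<index>)" [1000] 999)

locale allegory = ord_category A
  for A :: "('o, 'a, 'z) allegory_data_scheme" (structure) +
  assumes meet_exists: "\<lbrakk>r \<in> hom A X Y; s \<in> hom A X Y\<rbrakk> \<Longrightarrow> \<exists>m. is_meet A r s m"
    and Conv_in_hom: "r \<in> hom A X Y \<Longrightarrow> r\<degree> \<in> hom A Y X"
    and Conv_mono: "\<lbrakk>r \<in> hom A X Y; s \<in> hom A X Y; r \<sqsubseteq> s\<rbrakk> \<Longrightarrow> r\<degree> \<sqsubseteq> s\<degree>"
    and Conv_Ident: "X \<in> Obj A \<Longrightarrow> (Ident A X)\<degree> = Ident A X"
    and Conv_Comp: "\<lbrakk>r \<in> hom A X Y; s \<in> hom A Y Z\<rbrakk> \<Longrightarrow> (s \<cdot> r)\<degree> = r\<degree> \<cdot> s\<degree>"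
    and Conv_Conv: "r \<in> hom A X Y \<Longrightarrow> (r\<degree>)\<degree> = r"
    and modular_law: "\<lbrakk>r \<in> hom A X Y; s \<in> hom A Y Z; t \<in> hom A X Z\<rbrakk>
        \<Longrightarrow> (s \<cdot> r) \<sqinter> t \<sqsubseteq> (s \<sqinter> (t \<cdot> r\<degree>)) \<cdot> r"

definition is_tabulation :: "('o, 'a, 'z) allegory_data_scheme \<Rightarrow> 'a \<Rightarrow> 'a \<Rightarrow> 'a \<Rightarrow> bool" where
  "is_tabulation A r f g \<longleftrightarrow>
     (\<exists>Z \<in> Obj A. f \<in> hom A Z (Dom A r) \<and> g \<in> hom A Z (Cod A r) \<and> is_map A f \<and> is_map A g \<and>
        r = g \<cdot>\<^bsub>A\<^esub> f\<degree>\<^bsub>A\<^esub> \<and>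
        (f\<degree>\<^bsub>A\<^esub> \<cdot>\<^bsub>A\<^esub> f) \<sqinter>\<^bsub>A\<^esub> (g\<degree>\<^bsub>A\<^esub> \<cdot>\<^bsub>A\<^esub> g) = Ident A Z)"

definition pre_tabular :: "('o, 'a, 'z) allegory_data_scheme \<Rightarrow> bool" where
  "pre_tabular A \<longleftrightarrow>
     (\<forall>r \<in> Arr A. \<exists>s \<in> hom A (Dom A r) (Cod A r). r \<sqsubseteq>\<^bsub>A\<^esub> s \<and> (\<exists>f g. is_tabulation A s f g))"

definition is_unit :: "('o, 'a, 'z) allegory_data_scheme \<Rightarrow> 'o \<Rightarrow> bool" where
  "is_unit A U \<longleftrightarrow>
     U \<in> Obj A \<and> (\<forall>r \<in> hom A U U. r \<sqsubseteq>\<^bsub>A\<^esub> Ident A U) \<and>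
     (\<forall>X \<in> Obj A. \<exists>p \<in> hom A X U. Ident A X \<sqsubseteq>\<^bsub>A\<^esub> p\<degree>\<^bsub>A\<^esub> \<cdot>\<^bsub>A\<^esub> p)"

definition unitary :: "('o, 'a, 'z) allegory_data_scheme \<Rightarrow> bool" where
  "unitary A \<longleftrightarrow> (\<exists>U. is_unit A U)"

type_synonym ('o, 'a) allegory_fun = "(('o, 'a) allegory_data, 'o, 'a) fun_data"

definition allegory_functor :: "('o, 'a) allegory_fun \<Rightarrow> bool" where
  "allegory_functor F \<longleftrightarrow>
     allegory (FDom F) \<and> allegory (FCod F) \<and> ord_functor F \<and>
     (\<forall>r \<in> Arr (FDom F). \<forall>s \<in> hom (FDom F) (Dom (FDom F) r) (Cod (FDom F) r).
        FArr F (r \<sqinter>\<^bsub>FDom F\<^esub> s) = FArr F r \<sqinter>\<^bsub>FCod F\<^esub> FArr F s) \<and>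
     (\<forall>r \<in> Arr (FDom F). FArr F (r\<degree>\<^bsub>FDom F\<^esub>) = (FArr F r)\<degree>\<^bsub>FCod F\<^esub>)"

definition unit_preserving :: "('o, 'a) allegory_fun \<Rightarrow> bool" where
  "unit_preserving F \<longleftrightarrow> (\<forall>U. is_unit (FDom F) U \<longrightarrow> is_unit (FCod F) (FObj F U))"

type_synonym ('o, 'a) allegory_2cat =
  "(('o, 'a) allegory_data, ('o, 'a) allegory_fun,
    (('o, 'a) allegory_fun, 'o, 'a) trans_data) two_cat_data"

definition All_2cat :: "('o, 'a) allegory_2cat" where
  "All_2cat = transformation_2cat {A. allegory A} {F. allegory_functor F} fun_id fun_comp"

definition UPtAll_2cat :: "('o, 'a) allegory_2cat" where
  "UPtAll_2cat =
     locally_full_sub All_2cat (\<lambda>A. unitary A \<and> pre_tabular A) unit_preserving"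


section \<open>Bicategories of relations\<close>

text \<open>Since the hom-categories are posets, invertible 2-cells are identities: the tensor product
  is a strict 2-functor, equivalences are isomorphisms, and the structure of a symmetric monoidal
  bicategory reduces to a symmetric monoidal structure in the usual sense on the underlying
  category, with monotone tensor. The arrows \<open>Dup\<close> and \<open>Del\<close> are the comonoid maps
  \<open>d\<close>, \<open>e\<close>.\<close>

record ('o, 'a) cart_data = "('o, 'a) ord_cat_data" +
  TensObj :: "'o \<Rightarrow> 'o \<Rightarrow> 'o"  (infixl "\<odot>\<index>" 75)
  Tens :: "'a \<Rightarrow> 'a \<Rightarrow> 'a"  (infixl "\<otimes>\<index>" 75)
  UnitObj :: 'o
  Assoc :: "'o \<Rightarrow> 'o \<Rightarrow> 'o \<Rightarrow> 'a"
  LUnit :: "'o \<Rightarrow> 'a"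
  RUnit :: "'o \<Rightarrow> 'a"
  Braid :: "'o \<Rightarrow> 'o \<Rightarrow> 'a"
  Dup :: "'o \<Rightarrow> 'a"
  Del :: "'o \<Rightarrow> 'a"

locale symmetric_monoidal_ord_category = ord_category C
  for C :: "('o, 'a, 'z) cart_data_scheme" (structure) +
  assumes UnitObj_in_Obj: "UnitObj C \<in> Obj C"
    and TensObj_in_Obj: "\<lbrakk>X \<in> Obj C; Y \<in> Obj C\<rbrakk> \<Longrightarrow> X \<odot> Y \<in> Obj C"
    and Tens_in_hom: "\<lbrakk>r \<in> hom C X X'; s \<in> hom C Y Y'\<rbrakk> \<Longrightarrow> r \<otimes> s \<in> hom C (X \<odot> Y) (X' \<odot> Y')"
    and Tens_Ident: "\<lbrakk>X \<in> Obj C; Y \<in> Obj C\<rbrakk> \<Longrightarrow> Ident C X \<otimes> Ident C Y = Ident C (X \<odot> Y)"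
    and Tens_Comp: "\<lbrakk>r \<in> hom C X X'; r' \<in> hom C X' X''; s \<in> hom C Y Y'; s' \<in> hom C Y' Y''\<rbrakk>
        \<Longrightarrow> (r' \<cdot> r) \<otimes> (s' \<cdot> s) = (r' \<otimes> s') \<cdot> (r \<otimes> s)"
    and Tens_mono: "\<lbrakk>r \<in> hom C X X'; r' \<in> hom C X X'; s \<in> hom C Y Y'; s' \<in> hom C Y Y';
        r \<sqsubseteq> r'; s \<sqsubseteq> s'\<rbrakk> \<Longrightarrow> r \<otimes> s \<sqsubseteq> r' \<otimes> s'"
    and Assoc_iso: "\<lbrakk>X \<in> Obj C; Y \<in> Obj C; Z \<in> Obj C\<rbrakk>
        \<Longrightarrow> Assoc C X Y Z \<in> hom C (X \<odot> Y \<odot> Z) (X \<odot> (Y \<odot> Z)) \<and> is_iso C (Assoc C X Y Z)"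
    and LUnit_iso: "X \<in> Obj C \<Longrightarrow> LUnit C X \<in> hom C (UnitObj C \<odot> X) X \<and> is_iso C (LUnit C X)"
    and RUnit_iso: "X \<in> Obj C \<Longrightarrow> RUnit C X \<in> hom C (X \<odot> UnitObj C) X \<and> is_iso C (RUnit C X)"
    and Braid_iso: "\<lbrakk>X \<in> Obj C; Y \<in> Obj C\<rbrakk>
        \<Longrightarrow> Braid C X Y \<in> hom C (X \<odot> Y) (Y \<odot> X) \<and> is_iso C (Braid C X Y)"
    and Assoc_natural: "\<lbrakk>r \<in> hom C X X'; s \<in> hom C Y Y'; t \<in> hom C Z Z'\<rbrakk>
        \<Longrightarrow> Assoc C X' Y' Z' \<cdot> (r \<otimes> s \<otimes> t) = (r \<otimes> (s \<otimes> t)) \<cdot> Assoc C X Y Z"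
    and LUnit_natural: "r \<in> hom C X X'
        \<Longrightarrow> LUnit C X' \<cdot> (Ident C (UnitObj C) \<otimes> r) = r \<cdot> LUnit C X"
    and RUnit_natural: "r \<in> hom C X X'
        \<Longrightarrow> RUnit C X' \<cdot> (r \<otimes> Ident C (UnitObj C)) = r \<cdot> RUnit C X"
    and Braid_natural: "\<lbrakk>r \<in> hom C X X'; s \<in> hom C Y Y'\<rbrakk>
        \<Longrightarrow> Braid C X' Y' \<cdot> (r \<otimes> s) = (s \<otimes> r) \<cdot> Braid C X Y"
    and pentagon: "\<lbrakk>W \<in> Obj C; X \<in> Obj C; Y \<in> Obj C; Z \<in> Obj C\<rbrakk>
        \<Longrightarrow> Assoc C W X (Y \<odot> Z) \<cdot> Assoc C (W \<odot> X) Y Z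
          = (Ident C W \<otimes> Assoc C X Y Z) \<cdot> Assoc C W (X \<odot> Y) Z \<cdot> (Assoc C W X Y \<otimes> Ident C Z)"
    and triangle: "\<lbrakk>X \<in> Obj C; Y \<in> Obj C\<rbrakk>
        \<Longrightarrow> (Ident C X \<otimes> LUnit C Y) \<cdot> Assoc C X (UnitObj C) Y = RUnit C X \<otimes> Ident C Y"
    and hexagon: "\<lbrakk>X \<in> Obj C; Y \<in> Obj C; Z \<in> Obj C\<rbrakk>
        \<Longrightarrow> Assoc C Y Z X \<cdot> Braid C X (Y \<odot> Z) \<cdot> Assoc C X Y Z
          = (Ident C Y \<otimes> Braid C X Z) \<cdot> Assoc C Y X Z \<cdot> (Braid C X Y \<otimes> Ident C Z)"
    and Braid_symmetric: "\<lbrakk>X \<in> Obj C; Y \<in> Obj C\<rbrakk>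
        \<Longrightarrow> Braid C Y X \<cdot> Braid C X Y = Ident C (X \<odot> Y)"

definition commutative_comonoid ::
  "('o, 'a, 'z) cart_data_scheme \<Rightarrow> 'o \<Rightarrow> 'a \<Rightarrow> 'a \<Rightarrow> bool"
where
  "commutative_comonoid C X d e \<longleftrightarrow>
     d \<in> hom C X (X \<odot>\<^bsub>C\<^esub> X) \<and> e \<in> hom C X (UnitObj C) \<and>
     Assoc C X X X \<cdot>\<^bsub>C\<^esub> (d \<otimes>\<^bsub>C\<^esub> Ident C X) \<cdot>\<^bsub>C\<^esub> d = (Ident C X \<otimes>\<^bsub>C\<^esub> d) \<cdot>\<^bsub>C\<^esub> d \<and>
     LUnit C X \<cdot>\<^bsub>C\<^esub> (e \<otimes>\<^bsub>C\<^esub> Ident C X) \<cdot>\<^bsub>C\<^esub> d = Ident C X \<and>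
     RUnit C X \<cdot>\<^bsub>C\<^esub> (Ident C X \<otimes>\<^bsub>C\<^esub> e) \<cdot>\<^bsub>C\<^esub> d = Ident C X \<and>
     Braid C X X \<cdot>\<^bsub>C\<^esub> d = d"

locale cartesian_bicategory = symmetric_monoidal_ord_category C
  for C :: "('o, 'a, 'z) cart_data_scheme" (structure) +
  assumes comonoid: "X \<in> Obj C \<Longrightarrow> commutative_comonoid C X (Dup C X) (Del C X)"
    and Dup_map: "X \<in> Obj C \<Longrightarrow> is_map C (Dup C X)"
    and Del_map: "X \<in> Obj C \<Longrightarrow> is_map C (Del C X)"
    and comonoid_unique: "\<lbrakk>X \<in> Obj C; commutative_comonoid C X d e; is_map C d; is_map C e\<rbrakk>
        \<Longrightarrow> d = Dup C X \<and> e = Del C X"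
    and Dup_lax: "r \<in> hom C X Y \<Longrightarrow> Dup C Y \<cdot> r \<sqsubseteq> (r \<otimes> r) \<cdot> Dup C X"
    and Del_lax: "r \<in> hom C X Y \<Longrightarrow> Del C Y \<cdot> r \<sqsubseteq> Del C X"

locale bicategory_of_relations = cartesian_bicategory C
  for C :: "('o, 'a, 'z) cart_data_scheme" (structure) +
  assumes frobenius: "X \<in> Obj C \<Longrightarrow>
      Dup C X \<cdot> (Dup C X)\<^sup>\<bullet>
        = ((Dup C X)\<^sup>\<bullet> \<otimes> Ident C X) \<cdot> inv_arr C (Assoc C X X X) \<cdot> (Ident C X \<otimes> Dup C X)"

text \<open>A strong monoidal functor \<open>F\<close> carries isomorphisms
  \<open>FMult (X, Y) : F X \<odot> F Y \<rightarrow> F (X \<odot> Y)\<close> and \<open>FUnit : I \<rightarrow> F I\<close>.\<close>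

record ('c, 'o, 'a) mon_fun_data = "('c, 'o, 'a) fun_data" +
  FMult :: "'o \<times> 'o \<Rightarrow> 'a"
  FUnit :: 'a

type_synonym ('o, 'a) cart_fun = "(('o, 'a) cart_data, 'o, 'a) mon_fun_data"

definition strong_monoidal :: "('o, 'a) cart_fun \<Rightarrow> bool" where
  "strong_monoidal F \<longleftrightarrow>
     (let C = FDom F; D = FCod F; I = UnitObj C; J = UnitObj D in
        FMult F \<in> extensional (Obj C \<times> Obj C) \<and>
        (\<forall>X \<in> Obj C. \<forall>Y \<in> Obj C.
           FMult F (X, Y) \<in> hom D (FObj F X \<odot>\<^bsub>D\<^esub> FObj F Y) (FObj F (X \<odot>\<^bsub>C\<^esub> Y)) \<and>
           is_iso D (FMult F (X, Y))) \<and>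
        FUnit F \<in> hom D J (FObj F I) \<and> is_iso D (FUnit F) \<and>
        (\<forall>r \<in> Arr C. \<forall>s \<in> Arr C.
           FMult F (Cod C r, Cod C s) \<cdot>\<^bsub>D\<^esub> (FArr F r \<otimes>\<^bsub>D\<^esub> FArr F s)
             = FArr F (r \<otimes>\<^bsub>C\<^esub> s) \<cdot>\<^bsub>D\<^esub> FMult F (Dom C r, Dom C s)) \<and>
        (\<forall>X \<in> Obj C. \<forall>Y \<in> Obj C. \<forall>Z \<in> Obj C.
           FArr F (Assoc C X Y Z) \<cdot>\<^bsub>D\<^esub> FMult F (X \<odot>\<^bsub>C\<^esub> Y, Z)
               \<cdot>\<^bsub>D\<^esub> (FMult F (X, Y) \<otimes>\<^bsub>D\<^esub> Ident D (FObj F Z))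
             = FMult F (X, Y \<odot>\<^bsub>C\<^esub> Z) \<cdot>\<^bsub>D\<^esub> (Ident D (FObj F X) \<otimes>\<^bsub>D\<^esub> FMult F (Y, Z))
               \<cdot>\<^bsub>D\<^esub> Assoc D (FObj F X) (FObj F Y) (FObj F Z)) \<and>
        (\<forall>X \<in> Obj C.
           FArr F (LUnit C X) \<cdot>\<^bsub>D\<^esub> FMult F (I, X) \<cdot>\<^bsub>D\<^esub> (FUnit F \<otimes>\<^bsub>D\<^esub> Ident D (FObj F X))
             = LUnit D (FObj F X)) \<and>
        (\<forall>X \<in> Obj C.
           FArr F (RUnit C X) \<cdot>\<^bsub>D\<^esub> FMult F (X, I) \<cdot>\<^bsub>D\<^esub> (Ident D (FObj F X) \<otimes>\<^bsub>D\<^esub> FUnit F)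
             = RUnit D (FObj F X)))"

definition cartesian_functor :: "('o, 'a) cart_fun \<Rightarrow> bool" where
  "cartesian_functor F \<longleftrightarrow>
     bicategory_of_relations (FDom F) \<and> bicategory_of_relations (FCod F) \<and>
     ord_functor F \<and> strong_monoidal F"

definition cart_fun_id :: "('o, 'a) cart_data \<Rightarrow> ('o, 'a) cart_fun" where
  "cart_fun_id C = fun_data.extend (fun_id C)
     \<lparr>FMult = (\<lambda>(X, Y) \<in> Obj C \<times> Obj C. Ident C (X \<odot>\<^bsub>C\<^esub> Y)), FUnit = Ident C (UnitObj C)\<rparr>"

definition cart_fun_comp :: "('o, 'a) cart_fun \<Rightarrow> ('o, 'a) cart_fun \<Rightarrow> ('o, 'a) cart_fun" where
  "cart_fun_comp G F = fun_data.extend (fun_comp G F)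
     \<lparr>FMult = (\<lambda>(X, Y) \<in> Obj (FDom F) \<times> Obj (FDom F).
        FArr G (FMult F (X, Y)) \<cdot>\<^bsub>FCod G\<^esub> FMult G (FObj F X, FObj F Y)),
      FUnit = FArr G (FUnit F) \<cdot>\<^bsub>FCod G\<^esub> FUnit G\<rparr>"

type_synonym ('o, 'a) cart_2cat =
  "(('o, 'a) cart_data, ('o, 'a) cart_fun, (('o, 'a) cart_fun, 'o, 'a) trans_data) two_cat_data"

definition BiRel_2cat :: "('o, 'a) cart_2cat" where
  "BiRel_2cat = transformation_2cat {C. bicategory_of_relations C} {F. cartesian_functor F}
     cart_fun_id cart_fun_comp"

end

theory Submission
  imports Defs
begin

text \<open>
  Both 2-categories consist of ordered categories with extra structure, and in both cases the
  extra structure is determined by the underlying ordered category: the converse in a pre-tabular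
  allegory is determined outright, the tensor product of a bicategory of relations up to a unique
  isomorphism. The equivalence is therefore the identity on underlying ordered categories, and
  what has to be shown is that the two kinds of structure exist on the same ordered categories and
  are respected by the same functors.

  \<^emph>\<open>From bicategories of relations to allegories.\<close> Let \<open>e\<close> denote the map to the unit object. For
  \<open>r : X \<rightarrow> Y\<close> and \<open>a : W \<rightarrow> X\<close>, \<open>b : W \<rightarrow> Y\<close> the predicate \<open>e (r a \<sqinter> b) : W \<rightarrow> I\<close> says that \<open>r\<close>
  relates a value of \<open>a\<close> to a value of \<open>b\<close>, and the converse \<open>r'\<close> is characterized by
  \<open>e (r a \<sqinter> b) = e (a \<sqinter> r' b)\<close>. With this definition, compatibility with composition and
  involutivity are immediate. The Frobenius law enters in one form only (\<open>meet_map_restrict\<close>): if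
  \<open>b\<close> is a map, then \<open>s \<sqinter> b\<close> is the restriction of \<open>b\<close> to the predicate \<open>e (s \<sqinter> b)\<close>. Since
  restriction commutes with meets and with later composition, a relation can be recovered from its
  predicate (\<open>graph_le\<close>), converses exist (\<open>conv_of_exists\<close>), and the modular law holds
  (\<open>modular\<close>). The argument needs the tensor product to be the product of maps, which is where
  the uniqueness of comonoid structures is used: the tensor product of two comonoids is a comonoid
  (\<open>comonoid_tensor\<close>, by coherence), hence is the given one (\<open>pair_projections\<close>). The two
  projections then tabulate the top relation.

  \<^emph>\<open>From allegories to bicategories of relations.\<close> In a unitary pre-tabular allegory every top
  relation is tabulated, and the tabulating objects are products of maps. The tensor product of
  relations is \<open>p\<^sub>1\<^sup>\<circ> r p\<^sub>1 \<sqinter> p\<^sub>2\<^sup>\<circ> s p\<^sub>2\<close>; everything about it follows from the identity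
  \<open>cv_Tuple_comp_Tuple\<close>, whose nontrivial inclusion is reduced to coreflexives by means of a span
  lying over everything. The coherence laws are equations between maps into products, so they are
  checked on components, and a commutative comonoid consisting of maps must be the diagonal.

  \<^emph>\<open>Functors.\<close> The comparison isomorphisms of a strong monoidal functor are the only ones compatible
  with projections (\<open>projection_compatible\<close>), and they exist as soon as the functor preserves meets
  and the unit object, for then it preserves the span over everything. Converses are preserved for
  free, because every relation is composed of maps, converses of maps and coreflexives (\<open>f_cv\<close>).

  \<^emph>\<open>Transformations\<close> only see the ordered category. In both cases comparable parallel maps are equal,
  which makes horizontal composition strictly functorial (\<open>two_category_T\<close>), and the equivalence is
  then formal (\<open>two_equivalent_transformation_2cats\<close>).
\<close>

section \<open>Ordered categories and their maps\<close>

text \<open>Typing is expressed by domains and codomains, which can be computed for composites, rather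
  than by membership in hom-sets, where the objects in between would have to be supplied.\<close>

lemma hom_iff [simp]:
  "f \<in> hom C X Y \<longleftrightarrow> f \<in> Arr C \<and> Dom C f = X \<and> Cod C f = Y"
  by (auto simp: hom_def)

context category
begin

lemma Arr_Comp [simp]: "\<lbrakk>f \<in> Arr C; g \<in> Arr C; Dom C g = Cod C f\<rbrakk> \<Longrightarrow> g \<cdot> f \<in> Arr C"
  and Dom_Comp [simp]: "\<lbrakk>f \<in> Arr C; g \<in> Arr C; Dom C g = Cod C f\<rbrakk> \<Longrightarrow> Dom C (g \<cdot> f) = Dom C f"
  and Cod_Comp [simp]: "\<lbrakk>f \<in> Arr C; g \<in> Arr C; Dom C g = Cod C f\<rbrakk> \<Longrightarrow> Cod C (g \<cdot> f) = Cod C g"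
  using Comp_in_hom[of f "Dom C f" "Cod C f" g "Cod C g"] by auto

lemma Arr_Ident [simp]: "X \<in> Obj C \<Longrightarrow> Ident C X \<in> Arr C"
  and Dom_Ident [simp]: "X \<in> Obj C \<Longrightarrow> Dom C (Ident C X) = X"
  and Cod_Ident [simp]: "X \<in> Obj C \<Longrightarrow> Cod C (Ident C X) = X"
  using Ident_in_hom[of X] by auto

lemma Comp_Ident [simp]:
  shows "\<lbrakk>f \<in> Arr C; Dom C f = X\<rbrakk> \<Longrightarrow> f \<cdot> Ident C X = f"
    and "\<lbrakk>f \<in> Arr C; Cod C f = X\<rbrakk> \<Longrightarrow> Ident C X \<cdot> f = f"
  using Comp_Ident_right[of f X "Cod C f"] Comp_Ident_left[of f "Dom C f" X] by auto

lemma Comp_assoc' [simp]: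
  "\<lbrakk>f \<in> Arr C; g \<in> Arr C; h \<in> Arr C; Dom C g = Cod C f; Dom C h = Cod C g\<rbrakk>
     \<Longrightarrow> h \<cdot> g \<cdot> f = h \<cdot> (g \<cdot> f)"
  using Comp_assoc[of f "Dom C f" "Cod C f" g "Cod C g" h "Cod C h"] by auto

lemma Obj_Dom_Cod [simp]: "f \<in> Arr C \<Longrightarrow> Dom C f \<in> Obj C" "f \<in> Arr C \<Longrightarrow> Cod C f \<in> Obj C"
  using Dom_in_Obj Cod_in_Obj by auto

lemma inverse_arrows_unique:
  assumes "inverse_arrows C f g" "inverse_arrows C f h" shows "g = h"
proof -
  have "g = g \<cdot> (f \<cdot> h)" using assms by (simp add: inverse_arrows_def)
  also have "\<dots> = (g \<cdot> f) \<cdot> h" using assms unfolding inverse_arrows_def by (subst Comp_assoc') auto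
  also have "\<dots> = h" using assms by (simp add: inverse_arrows_def)
  finally show ?thesis .
qed

lemma inv_arr_eq: "inverse_arrows C f g \<Longrightarrow> inv_arr C f = g"
  unfolding inv_arr_def using inverse_arrows_unique by blast

lemma iso_inv_arr:
  assumes "is_iso C f"
  shows "f \<in> Arr C" "inv_arr C f \<in> Arr C" "Dom C (inv_arr C f) = Cod C f"
    "Cod C (inv_arr C f) = Dom C f" "inv_arr C f \<cdot> f = Ident C (Dom C f)"
    "f \<cdot> inv_arr C f = Ident C (Cod C f)" "inverse_arrows C f (inv_arr C f)"
proof -
  obtain g where "inverse_arrows C f g" using assms by (auto simp: is_iso_def)
  then show *: "inverse_arrows C f (inv_arr C f)" using inv_arr_eq by simp
  from * show "f \<in> Arr C" "inv_arr C f \<in> Arr C" "Dom C (inv_arr C f) = Cod C f"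
    "Cod C (inv_arr C f) = Dom C f" "inv_arr C f \<cdot> f = Ident C (Dom C f)"
    "f \<cdot> inv_arr C f = Ident C (Cod C f)"
    by (simp_all add: inverse_arrows_def)
qed

end

text \<open>The typed form of the order: it can be chained without carrying hom-set memberships.\<close>

definition le :: "('o, 'a, 'z) ord_cat_data_scheme \<Rightarrow> 'a \<Rightarrow> 'a \<Rightarrow> bool"  (infix "\<preceq>\<index>" 50) where
  "r \<preceq>\<^bsub>C\<^esub> s \<longleftrightarrow> r \<in> Arr C \<and> s \<in> Arr C \<and> Dom C r = Dom C s \<and> Cod C r = Cod C s \<and> r \<sqsubseteq>\<^bsub>C\<^esub> s"

lemma eq_le_trans [trans]: "r = s \<Longrightarrow> s \<preceq>\<^bsub>C\<^esub> t \<Longrightarrow> r \<preceq>\<^bsub>C\<^esub> t"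
  and le_eq_trans [trans]: "r \<preceq>\<^bsub>C\<^esub> s \<Longrightarrow> s = t \<Longrightarrow> r \<preceq>\<^bsub>C\<^esub> t"
  by simp_all

context ord_category
begin

lemma le_refl [simp]: "r \<in> Arr C \<Longrightarrow> r \<preceq> r"
  using Le_refl[of r "Dom C r" "Cod C r"] by (auto simp: le_def)

lemma le_trans [trans]: "r \<preceq> s \<Longrightarrow> s \<preceq> t \<Longrightarrow> r \<preceq> t"
  using Le_trans[of r "Dom C r" "Cod C r" s t] by (auto simp: le_def)

lemma le_antisym: "r \<preceq> s \<Longrightarrow> s \<preceq> r \<Longrightarrow> r = s"
  using Le_antisym[of r "Dom C r" "Cod C r" s] by (auto simp: le_def)

lemma le_typed:
  assumes "r \<preceq> s"
  shows "r \<in> Arr C" "s \<in> Arr C" "Dom C r = Dom C s" "Cod C r = Cod C s"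
  using assms by (auto simp: le_def)

lemma comp_le: "\<lbrakk>r \<preceq> r'; s \<preceq> s'; Dom C s = Cod C r\<rbrakk> \<Longrightarrow> s \<cdot> r \<preceq> s' \<cdot> r'"
  using Comp_mono[of r "Dom C r" "Cod C r" r' s "Cod C s" s'] by (auto simp: le_def)

lemma comp_le_left: "\<lbrakk>s \<preceq> s'; f \<in> Arr C; Dom C s = Cod C f\<rbrakk> \<Longrightarrow> s \<cdot> f \<preceq> s' \<cdot> f"
  by (rule comp_le) auto

lemma comp_le_right: "\<lbrakk>s \<preceq> s'; f \<in> Arr C; Dom C f = Cod C s\<rbrakk> \<Longrightarrow> f \<cdot> s \<preceq> f \<cdot> s'"
  by (rule comp_le) auto

definition adj :: "'a \<Rightarrow> 'a \<Rightarrow> bool" where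
  "adj f g \<longleftrightarrow> f \<in> Arr C \<and> g \<in> Arr C \<and> Dom C g = Cod C f \<and> Cod C g = Dom C f \<and>
     Ident C (Dom C f) \<preceq> g \<cdot> f \<and> f \<cdot> g \<preceq> Ident C (Cod C f)"

lemma adj_iff: "is_right_adjoint C f g \<longleftrightarrow> adj f g"
  by (auto simp: is_right_adjoint_def adj_def le_def)

lemma adj_unique:
  assumes "adj f g" "adj f h" shows "g = h"
proof -
  have *: "g \<preceq> h" if "adj f g" "adj f h" for g h
  proof -
    have t: "f \<in> Arr C" "g \<in> Arr C" "h \<in> Arr C" "Dom C g = Cod C f" "Cod C g = Dom C f"
      "Dom C h = Cod C f" "Cod C h = Dom C f" using that by (auto simp: adj_def)
    have "Ident C (Dom C f) \<cdot> g \<preceq> (h \<cdot> f) \<cdot> g"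
      by (rule comp_le_left) (use that t in \<open>auto simp: adj_def\<close>)
    then have "g \<preceq> h \<cdot> (f \<cdot> g)" using t by simp
    also have "\<dots> \<preceq> h \<cdot> Ident C (Cod C f)"
      by (rule comp_le_right) (use that t in \<open>auto simp: adj_def\<close>)
    finally show ?thesis using t by simp
  qed
  show ?thesis using *[OF assms] *[OF assms(2,1)] by (rule le_antisym)
qed

lemma right_adj_eq: "adj f g \<Longrightarrow> f\<^sup>\<bullet> = g"
  unfolding right_adj_def by (rule the_equality) (auto simp: adj_iff intro: adj_unique)

lemma map_adj: "is_map C f \<Longrightarrow> adj f (f\<^sup>\<bullet>)"
  by (auto simp: is_map_def adj_iff dest: right_adj_eq)

lemma adj_map: "adj f g \<Longrightarrow> is_map C f"
  by (auto simp: is_map_def adj_iff)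

lemma map_typed:
  assumes "is_map C f"
  shows "f \<in> Arr C" "f\<^sup>\<bullet> \<in> Arr C" "Dom C (f\<^sup>\<bullet>) = Cod C f" "Cod C (f\<^sup>\<bullet>) = Dom C f"
    "Ident C (Dom C f) \<preceq> f\<^sup>\<bullet> \<cdot> f" "f \<cdot> f\<^sup>\<bullet> \<preceq> Ident C (Cod C f)"
  using map_adj[OF assms] by (auto simp: adj_def)

lemma adj_Ident: "X \<in> Obj C \<Longrightarrow> adj (Ident C X) (Ident C X)"
  by (simp add: adj_def)

lemma adj_Comp:
  assumes "adj f f'" "adj g g'" "Dom C g = Cod C f"
  shows "adj (g \<cdot> f) (f' \<cdot> g')"
proof -
  have t: "f \<in> Arr C" "f' \<in> Arr C" "Dom C f' = Cod C f" "Cod C f' = Dom C f"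
     "g \<in> Arr C" "g' \<in> Arr C" "Dom C g' = Cod C g" "Cod C g' = Dom C g" "Dom C g = Cod C f"
    using assms by (auto simp: adj_def)
  have "Ident C (Dom C f) \<preceq> f' \<cdot> f" using assms by (simp add: adj_def)
  also have "\<dots> = f' \<cdot> (Ident C (Dom C g) \<cdot> f)" using t by simp
  also have "\<dots> \<preceq> f' \<cdot> ((g' \<cdot> g) \<cdot> f)"
    by (intro comp_le_right comp_le_left) (use assms t in \<open>auto simp: adj_def\<close>)
  finally have 1: "Ident C (Dom C f) \<preceq> (f' \<cdot> g') \<cdot> (g \<cdot> f)" using t by simp
  have "(g \<cdot> f) \<cdot> (f' \<cdot> g') = g \<cdot> ((f \<cdot> f') \<cdot> g')" using t by simp
  also have "\<dots> \<preceq> g \<cdot> (Ident C (Cod C f) \<cdot> g')"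
    by (intro comp_le_right comp_le_left) (use assms t in \<open>auto simp: adj_def\<close>)
  also have "\<dots> = g \<cdot> g'" using t by simp
  also have "\<dots> \<preceq> Ident C (Cod C g)" using assms by (simp add: adj_def)
  finally show ?thesis using 1 t by (simp add: adj_def)
qed

lemma map_Ident [simp]: "X \<in> Obj C \<Longrightarrow> is_map C (Ident C X)"
  using adj_Ident adj_map by blast

lemma map_Comp [simp]: "\<lbrakk>is_map C f; is_map C g; Dom C g = Cod C f\<rbrakk> \<Longrightarrow> is_map C (g \<cdot> f)"
  using adj_Comp adj_map map_adj by blast

lemma right_adj_Comp: "\<lbrakk>is_map C f; is_map C g; Dom C g = Cod C f\<rbrakk> \<Longrightarrow> (g \<cdot> f)\<^sup>\<bullet> = f\<^sup>\<bullet> \<cdot> g\<^sup>\<bullet>"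
  using adj_Comp right_adj_eq map_adj by blast

lemma right_adj_Ident: "X \<in> Obj C \<Longrightarrow> (Ident C X)\<^sup>\<bullet> = Ident C X"
  using adj_Ident right_adj_eq by blast

lemma inverse_arrows_adj: "inverse_arrows C f g \<Longrightarrow> adj f g"
  by (auto simp: inverse_arrows_def adj_def)

lemma iso_map: "is_iso C f \<Longrightarrow> is_map C f"
  by (auto simp: is_iso_def intro: adj_map inverse_arrows_adj)

lemma iso_right_adj: "is_iso C f \<Longrightarrow> f\<^sup>\<bullet> = inv_arr C f"
  using iso_inv_arr(7) inverse_arrows_adj right_adj_eq by blast

lemma map_transpose_left:
  assumes "is_map C f" "r \<in> Arr C" "Cod C r = Dom C f" "f \<cdot> r \<preceq> s"
  shows "r \<preceq> f\<^sup>\<bullet> \<cdot> s"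
proof -
  note t = map_typed[OF assms(1)] assms(2,3) le_typed[OF assms(4)]
  have "Ident C (Dom C f) \<cdot> r \<preceq> (f\<^sup>\<bullet> \<cdot> f) \<cdot> r" by (rule comp_le_left) (use t in auto)
  then have "r \<preceq> f\<^sup>\<bullet> \<cdot> (f \<cdot> r)" using t by simp
  also have "\<dots> \<preceq> f\<^sup>\<bullet> \<cdot> s" by (rule comp_le_right) (use t assms(4) in auto)
  finally show ?thesis .
qed

lemma map_transpose_left':
  assumes "is_map C f" "s \<in> Arr C" "Cod C s = Cod C f" "r \<preceq> f\<^sup>\<bullet> \<cdot> s"
  shows "f \<cdot> r \<preceq> s"
proof -
  note t = map_typed[OF assms(1)] assms(2,3) le_typed[OF assms(4)]
  have "f \<cdot> r \<preceq> f \<cdot> (f\<^sup>\<bullet> \<cdot> s)" by (rule comp_le_right) (use t assms(4) in auto)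
  also have "\<dots> = (f \<cdot> f\<^sup>\<bullet>) \<cdot> s" using t by simp
  also have "\<dots> \<preceq> Ident C (Cod C f) \<cdot> s" by (rule comp_le_left) (use t in auto)
  finally show ?thesis using t by simp
qed

lemma is_meet_unique: "\<lbrakk>is_meet C r s m; is_meet C r s m'; r \<in> Arr C\<rbrakk> \<Longrightarrow> m = m'"
  unfolding is_meet_def using Le_antisym by blast

end

locale meet_ord_category = ord_category C
  for C :: "('o, 'a, 'z) ord_cat_data_scheme" (structure) +
  assumes meets: "\<lbrakk>r \<in> hom C X Y; s \<in> hom C X Y\<rbrakk> \<Longrightarrow> \<exists>m. is_meet C r s m"
begin

definition parallel :: "'a \<Rightarrow> 'a \<Rightarrow> bool" where
  "parallel r s \<longleftrightarrow> r \<in> Arr C \<and> s \<in> Arr C \<and> Dom C r = Dom C s \<and> Cod C r = Cod C s"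

lemma meet_is_meet: "parallel r s \<Longrightarrow> is_meet C r s (r \<sqinter> s)"
  unfolding parallel_def meet_def using meets[of r "Dom C r" "Cod C r" s] is_meet_unique
  by (metis (no_types, lifting) hom_iff the_equality)

lemma meet_typed [simp]:
  assumes "r \<in> Arr C" "s \<in> Arr C" "Dom C r = Dom C s" "Cod C r = Cod C s"
  shows "r \<sqinter> s \<in> Arr C" "Dom C (r \<sqinter> s) = Dom C s" "Cod C (r \<sqinter> s) = Cod C s"
  using meet_is_meet[of r s] assms unfolding parallel_def is_meet_def by auto

lemma meet_le:
  assumes "r \<in> Arr C" "s \<in> Arr C" "Dom C r = Dom C s" "Cod C r = Cod C s"
  shows "r \<sqinter> s \<preceq> r" "r \<sqinter> s \<preceq> s"
  using meet_is_meet[of r s] assms unfolding parallel_def is_meet_def le_def by auto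

lemma le_meet: "u \<preceq> r \<Longrightarrow> u \<preceq> s \<Longrightarrow> u \<preceq> r \<sqinter> s"
  using meet_is_meet[of r s] unfolding parallel_def is_meet_def le_def by auto

lemma meet_commute:
  assumes "r \<in> Arr C" "s \<in> Arr C" "Dom C r = Dom C s" "Cod C r = Cod C s"
  shows "r \<sqinter> s = s \<sqinter> r"
  using assms by (intro le_antisym le_meet meet_le) auto

lemma meet_mono: "r \<preceq> r' \<Longrightarrow> s \<preceq> s' \<Longrightarrow> Dom C r = Dom C s \<Longrightarrow> Cod C r = Cod C s \<Longrightarrow> r \<sqinter> s \<preceq> r' \<sqinter> s'"
  using le_typed[of r r'] le_typed[of s s']
  by (intro le_meet le_trans[OF meet_le(1), of r s r'] le_trans[OF meet_le(2), of r s s']) auto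

lemma meet_assoc:
  assumes "r \<in> Arr C" "s \<in> Arr C" "t \<in> Arr C" "Dom C r = Dom C s" "Cod C r = Cod C s"
    "Dom C t = Dom C s" "Cod C t = Cod C s"
  shows "(r \<sqinter> s) \<sqinter> t = r \<sqinter> (s \<sqinter> t)"
proof (rule le_antisym)
  have 1: "(r \<sqinter> s) \<sqinter> t \<preceq> r \<sqinter> s" "(r \<sqinter> s) \<sqinter> t \<preceq> t" using assms by (auto intro!: meet_le)
  have 2: "r \<sqinter> s \<preceq> r" "r \<sqinter> s \<preceq> s" using assms by (auto intro!: meet_le)
  show "(r \<sqinter> s) \<sqinter> t \<preceq> r \<sqinter> (s \<sqinter> t)"
    by (intro le_meet le_trans[OF 1(1) 2(1)] le_trans[OF 1(1) 2(2)] 1(2))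
  have 1: "r \<sqinter> (s \<sqinter> t) \<preceq> r" "r \<sqinter> (s \<sqinter> t) \<preceq> s \<sqinter> t" using assms by (auto intro!: meet_le)
  have 2: "s \<sqinter> t \<preceq> s" "s \<sqinter> t \<preceq> t" using assms by (auto intro!: meet_le)
  show "r \<sqinter> (s \<sqinter> t) \<preceq> (r \<sqinter> s) \<sqinter> t"
    by (intro le_meet le_trans[OF 1(2) 2(1)] le_trans[OF 1(2) 2(2)] 1(1))
qed

lemma meet_absorb: "r \<preceq> s \<Longrightarrow> r \<sqinter> s = r"
  using le_typed[of r s] by (intro le_antisym le_meet meet_le) auto

lemma meet_eqI:
  "\<lbrakk>m \<preceq> r; m \<preceq> s; \<And>u. u \<preceq> r \<Longrightarrow> u \<preceq> s \<Longrightarrow> u \<preceq> m\<rbrakk> \<Longrightarrow> r \<sqinter> s = m"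
  using le_typed[of m r] le_typed[of m s] by (metis le_antisym le_meet meet_le(1,2))

lemma right_adj_meet:
  assumes "is_map C f" "r \<in> Arr C" "s \<in> Arr C" "Dom C r = Dom C s" "Cod C r = Cod C f" "Cod C s = Cod C f"
  shows "f\<^sup>\<bullet> \<cdot> (r \<sqinter> s) = (f\<^sup>\<bullet> \<cdot> r) \<sqinter> (f\<^sup>\<bullet> \<cdot> s)"
proof (rule sym, rule meet_eqI)
  note t = map_typed[OF assms(1)] assms
  show "f\<^sup>\<bullet> \<cdot> (r \<sqinter> s) \<preceq> f\<^sup>\<bullet> \<cdot> r" "f\<^sup>\<bullet> \<cdot> (r \<sqinter> s) \<preceq> f\<^sup>\<bullet> \<cdot> s"
    using t by (auto intro!: comp_le_right meet_le)
  fix u assume u: "u \<preceq> f\<^sup>\<bullet> \<cdot> r" "u \<preceq> f\<^sup>\<bullet> \<cdot> s"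
  note tu = le_typed[OF u(1)]
  have "f \<cdot> u \<preceq> r \<sqinter> s" using u t by (intro le_meet map_transpose_left') auto
  then show "u \<preceq> f\<^sup>\<bullet> \<cdot> (r \<sqinter> s)" using t tu by (intro map_transpose_left) auto
qed

end

section \<open>Coherence in symmetric monoidal ordered categories\<close>

context category
begin

text \<open>Turns an equation between composites into a rewrite rule for composites associated to
  the right.\<close>

lemma comp_extend:
  "\<lbrakk>b \<cdot> a = c; f \<in> Arr C; a \<in> Arr C; b \<in> Arr C; Dom C a = Cod C f; Dom C b = Cod C a\<rbrakk>
    \<Longrightarrow> b \<cdot> (a \<cdot> f) = c \<cdot> f"
  by (subst Comp_assoc'[symmetric]) simp_all

lemma iso_epi:
  assumes "is_iso C h" "f \<cdot> h = g \<cdot> h" "f \<in> Arr C" "g \<in> Arr C" "Dom C f = Cod C h" "Dom C g = Cod C h"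
  shows "f = g"
proof -
  note t = iso_inv_arr[OF assms(1)]
  have *: "k = k \<cdot> h \<cdot> inv_arr C h" if "k \<in> Arr C" "Dom C k = Cod C h" for k
    using that t by simp
  show ?thesis using *[of f] *[of g] assms by metis
qed

lemma iso_mono:
  assumes "is_iso C h" "h \<cdot> f = h \<cdot> g" "f \<in> Arr C" "g \<in> Arr C" "Cod C f = Dom C h" "Cod C g = Dom C h"
  shows "f = g"
proof -
  note t = iso_inv_arr[OF assms(1)]
  have *: "k = inv_arr C h \<cdot> (h \<cdot> k)" if "k \<in> Arr C" "Cod C k = Dom C h" for k
    using that t by (simp add: comp_extend[OF t(5)])
  show ?thesis using *[of f] *[of g] assms by simp
qed

lemma is_isoI:
  "\<lbrakk>f \<in> Arr C; g \<in> Arr C; Dom C g = Cod C f; Cod C g = Dom C f; g \<cdot> f = Ident C (Dom C f);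
    f \<cdot> g = Ident C (Cod C f)\<rbrakk> \<Longrightarrow> is_iso C f"
  by (auto simp: is_iso_def inverse_arrows_def)

lemma iso_Comp:
  assumes "is_iso C f" "is_iso C g" "Dom C g = Cod C f" shows "is_iso C (g \<cdot> f)"
proof -
  note t = iso_inv_arr[OF assms(1)] iso_inv_arr[OF assms(2)] assms(3)
  show ?thesis by (rule is_isoI[where g = "inv_arr C f \<cdot> inv_arr C g"])
    (use t in \<open>simp_all add: comp_extend[OF t(5)] comp_extend[OF t(6)] comp_extend[OF t(12)] comp_extend[OF t(13)]\<close>)
qed

end

context symmetric_monoidal_ord_category
begin

abbreviation (input) unit_object ("\<I>") where "\<I> \<equiv> UnitObj C"
abbreviation (input) identity ("\<one>") where "\<one> \<equiv> Ident C"
abbreviation (input) associator ("\<alpha>") where "\<alpha> \<equiv> Assoc C"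
abbreviation (input) associator_inv ("\<beta>") where "\<beta> X Y Z \<equiv> inv_arr C (Assoc C X Y Z)"
abbreviation (input) braiding ("\<sigma>") where "\<sigma> \<equiv> Braid C"
abbreviation (input) lunitor ("\<ll>") where "\<ll> \<equiv> LUnit C"
abbreviation (input) runitor ("\<rr>") where "\<rr> \<equiv> RUnit C"

lemma Obj_Tens [simp]: "\<I> \<in> Obj C" "X \<in> Obj C \<Longrightarrow> Y \<in> Obj C \<Longrightarrow> X \<odot> Y \<in> Obj C"
  using UnitObj_in_Obj TensObj_in_Obj by auto

lemma Tens_typed [simp]:
  assumes "r \<in> Arr C" "s \<in> Arr C"
  shows "r \<otimes> s \<in> Arr C" "Dom C (r \<otimes> s) = Dom C r \<odot> Dom C s" "Cod C (r \<otimes> s) = Cod C r \<odot> Cod C s"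
  using Tens_in_hom[of r "Dom C r" "Cod C r" s "Dom C s" "Cod C s"] assms by auto

declare Tens_Ident [simp]

lemma Assoc_typed [simp]:
  assumes "X \<in> Obj C" "Y \<in> Obj C" "Z \<in> Obj C"
  shows "\<alpha> X Y Z \<in> Arr C" "Dom C (\<alpha> X Y Z) = X \<odot> Y \<odot> Z" "Cod C (\<alpha> X Y Z) = X \<odot> (Y \<odot> Z)"
    "is_iso C (\<alpha> X Y Z)"
  using Assoc_iso[OF assms] by auto

lemma Assoc_inv_typed [simp]:
  assumes "X \<in> Obj C" "Y \<in> Obj C" "Z \<in> Obj C"
  shows "\<beta> X Y Z \<in> Arr C" "Dom C (\<beta> X Y Z) = X \<odot> (Y \<odot> Z)" "Cod C (\<beta> X Y Z) = X \<odot> Y \<odot> Z"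
    "\<alpha> X Y Z \<cdot> \<beta> X Y Z = \<one> (X \<odot> (Y \<odot> Z))" "\<beta> X Y Z \<cdot> \<alpha> X Y Z = \<one> (X \<odot> Y \<odot> Z)"
  using iso_inv_arr[of "\<alpha> X Y Z"] assms by simp_all

lemma Assoc_inv_extend [simp]:
  assumes "X \<in> Obj C" "Y \<in> Obj C" "Z \<in> Obj C" "f \<in> Arr C"
  shows "Cod C f = X \<odot> (Y \<odot> Z) \<Longrightarrow> \<alpha> X Y Z \<cdot> (\<beta> X Y Z \<cdot> f) = f"
    "Cod C f = X \<odot> Y \<odot> Z \<Longrightarrow> \<beta> X Y Z \<cdot> (\<alpha> X Y Z \<cdot> f) = f"
  using assms by (simp_all add: comp_extend[OF Assoc_inv_typed(4)] comp_extend[OF Assoc_inv_typed(5)])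

lemma LUnit_typed [simp]:
  assumes "X \<in> Obj C"
  shows "\<ll> X \<in> Arr C" "Dom C (\<ll> X) = \<I> \<odot> X" "Cod C (\<ll> X) = X" "is_iso C (\<ll> X)"
  using LUnit_iso[OF assms] by auto

lemma RUnit_typed [simp]:
  assumes "X \<in> Obj C"
  shows "\<rr> X \<in> Arr C" "Dom C (\<rr> X) = X \<odot> \<I>" "Cod C (\<rr> X) = X" "is_iso C (\<rr> X)"
  using RUnit_iso[OF assms] by auto

lemma Braid_typed [simp]:
  assumes "X \<in> Obj C" "Y \<in> Obj C"
  shows "\<sigma> X Y \<in> Arr C" "Dom C (\<sigma> X Y) = X \<odot> Y" "Cod C (\<sigma> X Y) = Y \<odot> X" "is_iso C (\<sigma> X Y)"
  using Braid_iso[OF assms] by auto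

lemma Tens_merge:
  "\<lbrakk>r \<in> Arr C; s \<in> Arr C; r' \<in> Arr C; s' \<in> Arr C; Dom C r' = Cod C r; Dom C s' = Cod C s\<rbrakk>
    \<Longrightarrow> (r' \<otimes> s') \<cdot> (r \<otimes> s) = (r' \<cdot> r) \<otimes> (s' \<cdot> s)"
  using Tens_Comp[of r "Dom C r" "Cod C r" r' "Cod C r'" s "Dom C s" "Cod C s" s' "Cod C s'"] by simp

lemma Tens_merge_extend:
  "\<lbrakk>r \<in> Arr C; s \<in> Arr C; r' \<in> Arr C; s' \<in> Arr C; Dom C r' = Cod C r; Dom C s' = Cod C s;
     f \<in> Arr C; Cod C f = Dom C r \<odot> Dom C s\<rbrakk>
    \<Longrightarrow> (r' \<otimes> s') \<cdot> ((r \<otimes> s) \<cdot> f) = ((r' \<cdot> r) \<otimes> (s' \<cdot> s)) \<cdot> f"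
  by (simp add: comp_extend[OF Tens_merge])

lemmas merge = Tens_merge Tens_merge_extend

lemma whisker_left: "\<lbrakk>X \<in> Obj C; f \<in> Arr C; g \<in> Arr C; Dom C g = Cod C f\<rbrakk>
    \<Longrightarrow> \<one> X \<otimes> (g \<cdot> f) = (\<one> X \<otimes> g) \<cdot> (\<one> X \<otimes> f)"
  and whisker_right: "\<lbrakk>X \<in> Obj C; f \<in> Arr C; g \<in> Arr C; Dom C g = Cod C f\<rbrakk>
    \<Longrightarrow> (g \<cdot> f) \<otimes> \<one> X = (g \<otimes> \<one> X) \<cdot> (f \<otimes> \<one> X)"
  by (simp_all add: merge)

lemmas whisker = whisker_left whisker_right

lemma Assoc_nat: "\<lbrakk>r \<in> Arr C; s \<in> Arr C; t \<in> Arr C; X = Cod C r; Y = Cod C s; Z = Cod C t\<rbrakk>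
    \<Longrightarrow> \<alpha> X Y Z \<cdot> (r \<otimes> s \<otimes> t) = (r \<otimes> (s \<otimes> t)) \<cdot> \<alpha> (Dom C r) (Dom C s) (Dom C t)"
  using Assoc_natural[of r "Dom C r" "Cod C r" s "Dom C s" "Cod C s" t "Dom C t" "Cod C t"] by simp

lemma Assoc_nat_right: "\<lbrakk>X \<in> Obj C; Y \<in> Obj C; t \<in> Arr C; Z = Cod C t\<rbrakk>
    \<Longrightarrow> \<alpha> X Y Z \<cdot> (\<one> (X \<odot> Y) \<otimes> t) = (\<one> X \<otimes> (\<one> Y \<otimes> t)) \<cdot> \<alpha> X Y (Dom C t)"
  using Assoc_nat[of "\<one> X" "\<one> Y" t] by simp

lemma Assoc_nat_left: "\<lbrakk>r \<in> Arr C; Y \<in> Obj C; Z \<in> Obj C; X = Cod C r\<rbrakk>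
    \<Longrightarrow> \<alpha> X Y Z \<cdot> (r \<otimes> \<one> Y \<otimes> \<one> Z) = (r \<otimes> \<one> (Y \<odot> Z)) \<cdot> \<alpha> (Dom C r) Y Z"
  using Assoc_nat[of r "\<one> Y" "\<one> Z"] by simp

lemma LUnit_nat: "\<lbrakk>r \<in> Arr C; X = Cod C r\<rbrakk> \<Longrightarrow> \<ll> X \<cdot> (\<one> \<I> \<otimes> r) = r \<cdot> \<ll> (Dom C r)"
  using LUnit_natural[of r "Dom C r" "Cod C r"] by simp

lemma RUnit_nat: "\<lbrakk>r \<in> Arr C; X = Cod C r\<rbrakk> \<Longrightarrow> \<rr> X \<cdot> (r \<otimes> \<one> \<I>) = r \<cdot> \<rr> (Dom C r)"
  using RUnit_natural[of r "Dom C r" "Cod C r"] by simp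

lemma Braid_nat: "\<lbrakk>r \<in> Arr C; s \<in> Arr C; X = Cod C r; Y = Cod C s\<rbrakk>
    \<Longrightarrow> \<sigma> X Y \<cdot> (r \<otimes> s) = (s \<otimes> r) \<cdot> \<sigma> (Dom C r) (Dom C s)"
  using Braid_natural[of r "Dom C r" "Cod C r" s "Dom C s" "Cod C s"] by simp

lemmas nat = Assoc_nat Assoc_nat_left Assoc_nat_right LUnit_nat RUnit_nat Braid_nat
lemmas nat_extend = comp_extend[OF Assoc_nat] comp_extend[OF Assoc_nat_left]
  comp_extend[OF Assoc_nat_right] comp_extend[OF LUnit_nat] comp_extend[OF RUnit_nat]
  comp_extend[OF Braid_nat]

lemma Assoc_inv_nat: "\<lbrakk>r \<in> Arr C; s \<in> Arr C; t \<in> Arr C; X = Cod C r; Y = Cod C s; Z = Cod C t\<rbrakk>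
    \<Longrightarrow> \<beta> X Y Z \<cdot> (r \<otimes> (s \<otimes> t)) = (r \<otimes> s \<otimes> t) \<cdot> \<beta> (Dom C r) (Dom C s) (Dom C t)"
  by (rule iso_mono[of "\<alpha> X Y Z"]) (simp_all add: nat_extend nat)

lemma iso_Tens:
  assumes "is_iso C f" "is_iso C g" shows "is_iso C (f \<otimes> g)"
  by (rule is_isoI[where g = "inv_arr C f \<otimes> inv_arr C g"])
    (use iso_inv_arr[OF assms(1)] iso_inv_arr[OF assms(2)] in \<open>simp_all add: merge\<close>)

lemma iso_Ident [simp]: "X \<in> Obj C \<Longrightarrow> is_iso C (\<one> X)"
  by (rule is_isoI[where g = "\<one> X"]) auto

lemma unit_whisker_left:
  assumes "f \<in> Arr C" "g \<in> Arr C" "Dom C f = Dom C g" "Cod C f = Cod C g" "\<one> \<I> \<otimes> f = \<one> \<I> \<otimes> g"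
  shows "f = g"
proof (rule iso_epi[of "\<ll> (Dom C f)"])
  show "f \<cdot> \<ll> (Dom C f) = g \<cdot> \<ll> (Dom C f)"
    using LUnit_nat[of f "Cod C f"] LUnit_nat[of g "Cod C g"] assms by simp
qed (use assms in auto)

lemma unit_whisker_right:
  assumes "f \<in> Arr C" "g \<in> Arr C" "Dom C f = Dom C g" "Cod C f = Cod C g" "f \<otimes> \<one> \<I> = g \<otimes> \<one> \<I>"
  shows "f = g"
proof (rule iso_epi[of "\<rr> (Dom C f)"])
  show "f \<cdot> \<rr> (Dom C f) = g \<cdot> \<rr> (Dom C f)"
    using RUnit_nat[of f "Cod C f"] RUnit_nat[of g "Cod C g"] assms by simp
qed (use assms in auto)

lemma pentagon': "\<lbrakk>W \<in> Obj C; X \<in> Obj C; Y \<in> Obj C; Z \<in> Obj C\<rbrakk>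
  \<Longrightarrow> (\<one> W \<otimes> \<alpha> X Y Z) \<cdot> (\<alpha> W (X \<odot> Y) Z \<cdot> (\<alpha> W X Y \<otimes> \<one> Z)) = \<alpha> W X (Y \<odot> Z) \<cdot> \<alpha> (W \<odot> X) Y Z"
  by (simp add: pentagon)

text \<open>Kelly's unit laws, by his argument: tensoring with the unit object is faithful, and after
  tensoring the pentagon and the triangle apply.\<close>

lemma LUnit_Tens:
  assumes [simp]: "X \<in> Obj C" "Y \<in> Obj C"
  shows "\<ll> (X \<odot> Y) \<cdot> \<alpha> \<I> X Y = \<ll> X \<otimes> \<one> Y"
proof (rule unit_whisker_left)
  let ?h = "\<alpha> \<I> (\<I> \<odot> X) Y \<cdot> (\<alpha> \<I> \<I> X \<otimes> \<one> Y)"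
  have "(\<one> \<I> \<otimes> (\<ll> (X \<odot> Y) \<cdot> \<alpha> \<I> X Y)) \<cdot> ?h = (\<one> \<I> \<otimes> \<ll> (X \<odot> Y)) \<cdot> ((\<one> \<I> \<otimes> \<alpha> \<I> X Y) \<cdot> ?h)"
    by (simp add: whisker)
  also have "\<dots> = ((\<one> \<I> \<otimes> \<ll> (X \<odot> Y)) \<cdot> \<alpha> \<I> \<I> (X \<odot> Y)) \<cdot> \<alpha> (\<I> \<odot> \<I>) X Y"
    by (simp add: pentagon' del: Tens_Ident)
  also have "\<dots> = \<alpha> \<I> X Y \<cdot> ((\<rr> \<I> \<otimes> \<one> X) \<otimes> \<one> Y)"
    by (simp only: triangle assms Obj_Tens) (simp add: nat)
  also have "\<dots> = \<alpha> \<I> X Y \<cdot> (((\<one> \<I> \<otimes> \<ll> X) \<otimes> \<one> Y) \<cdot> (\<alpha> \<I> \<I> X \<otimes> \<one> Y))"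
    by (simp add: triangle[symmetric] whisker)
  also have "\<dots> = (\<one> \<I> \<otimes> (\<ll> X \<otimes> \<one> Y)) \<cdot> ?h"
    by (simp add: nat_extend)
  finally show "\<one> \<I> \<otimes> (\<ll> (X \<odot> Y) \<cdot> \<alpha> \<I> X Y) = \<one> \<I> \<otimes> (\<ll> X \<otimes> \<one> Y)"
    by - (rule iso_epi[of ?h], simp_all add: iso_Comp iso_Tens)
qed simp_all

lemma RUnit_Tens:
  assumes [simp]: "X \<in> Obj C" "Y \<in> Obj C"
  shows "(\<one> X \<otimes> \<rr> Y) \<cdot> \<alpha> X Y \<I> = \<rr> (X \<odot> Y)"
proof (rule unit_whisker_right)
  have "\<alpha> X Y \<I> \<cdot> (\<rr> (X \<odot> Y) \<otimes> \<one> \<I>) = \<alpha> X Y \<I> \<cdot> ((\<one> (X \<odot> Y) \<otimes> \<ll> \<I>) \<cdot> \<alpha> (X \<odot> Y) \<I> \<I>)"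
    by (simp add: triangle)
  also have "\<dots> = (\<one> X \<otimes> (\<one> Y \<otimes> \<ll> \<I>)) \<cdot> (\<alpha> X Y (\<I> \<odot> \<I>) \<cdot> \<alpha> (X \<odot> Y) \<I> \<I>)"
    by (simp add: nat_extend)
  also have "\<dots> = (\<one> X \<otimes> ((\<one> Y \<otimes> \<ll> \<I>) \<cdot> \<alpha> Y \<I> \<I>)) \<cdot> (\<alpha> X (Y \<odot> \<I>) \<I> \<cdot> (\<alpha> X Y \<I> \<otimes> \<one> \<I>))"
    by (simp add: pentagon whisker)
  also have "\<dots> = \<alpha> X Y \<I> \<cdot> (((\<one> X \<otimes> \<rr> Y) \<cdot> \<alpha> X Y \<I>) \<otimes> \<one> \<I>)"
    by (simp add: triangle whisker nat_extend)
  finally show "((\<one> X \<otimes> \<rr> Y) \<cdot> \<alpha> X Y \<I>) \<otimes> \<one> \<I> = \<rr> (X \<odot> Y) \<otimes> \<one> \<I>"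
    by - (rule iso_mono[of "\<alpha> X Y \<I>"], simp_all)
qed simp_all

text \<open>The hexagon at the unit object, followed by cancellation.\<close>

lemma LUnit_Braid:
  assumes [simp]: "X \<in> Obj C"
  shows "\<ll> X \<cdot> \<sigma> X \<I> = \<rr> X"
proof (rule unit_whisker_right)
  have "\<sigma> X \<I> \<cdot> (\<rr> X \<otimes> \<one> \<I>) = \<sigma> X \<I> \<cdot> ((\<one> X \<otimes> \<ll> \<I>) \<cdot> \<alpha> X \<I> \<I>)"
    by (simp add: triangle)
  also have "\<dots> = \<ll> (\<I> \<odot> X) \<cdot> (\<alpha> \<I> \<I> X \<cdot> \<sigma> X (\<I> \<odot> \<I>) \<cdot> \<alpha> X \<I> \<I>)"
    by (simp add: nat_extend comp_extend[OF LUnit_Tens])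
  also have "\<dots> = \<ll> (\<I> \<odot> X) \<cdot> ((\<one> \<I> \<otimes> \<sigma> X \<I>) \<cdot> \<alpha> \<I> X \<I> \<cdot> (\<sigma> X \<I> \<otimes> \<one> \<I>))"
    by (simp only: hexagon assms Obj_Tens)
  also have "\<dots> = \<sigma> X \<I> \<cdot> ((\<ll> X \<cdot> \<sigma> X \<I>) \<otimes> \<one> \<I>)"
    by (simp add: nat_extend comp_extend[OF LUnit_Tens] whisker)
  finally show "(\<ll> X \<cdot> \<sigma> X \<I>) \<otimes> \<one> \<I> = \<rr> X \<otimes> \<one> \<I>"
    by - (rule iso_mono[of "\<sigma> X \<I>"], simp_all)
qed simp_all

lemma RUnit_Braid: "X \<in> Obj C \<Longrightarrow> \<rr> X \<cdot> \<sigma> \<I> X = \<ll> X"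
  by (simp add: LUnit_Braid[symmetric] Braid_symmetric)

end

context symmetric_monoidal_ord_category
begin

text \<open>Coherence computations become manageable when all tensor products are bracketed to the right
  and every operation acts on the head \<open>X\<close> of \<open>X \<odot> W\<close>, with a passive tail \<open>W\<close>: the braiding acts
  as \<open>swap\<close>, and a comonoid turns \<open>X \<odot> _\<close> into a comonad with comultiplication \<open>dup_on\<close> and counit
  \<open>del_on\<close>. Associators then only occur at the seams.\<close>

definition swap :: "'o \<Rightarrow> 'o \<Rightarrow> 'o \<Rightarrow> 'a" where
  "swap X Y W = \<alpha> Y X W \<cdot> (\<sigma> X Y \<otimes> \<one> W) \<cdot> \<beta> X Y W"

definition dup_on :: "'o \<Rightarrow> 'a \<Rightarrow> 'o \<Rightarrow> 'a" where
  "dup_on X d W = \<alpha> X X W \<cdot> (d \<otimes> \<one> W)"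

definition del_on :: "'a \<Rightarrow> 'o \<Rightarrow> 'a" where
  "del_on e W = \<ll> W \<cdot> (e \<otimes> \<one> W)"

lemma swap_typed [simp]:
  assumes "X \<in> Obj C" "Y \<in> Obj C" "W \<in> Obj C"
  shows "swap X Y W \<in> Arr C" "Dom C (swap X Y W) = X \<odot> (Y \<odot> W)" "Cod C (swap X Y W) = Y \<odot> (X \<odot> W)"
  using assms by (simp_all add: swap_def)

lemma Braid_Braid: "\<lbrakk>X \<in> Obj C; Y \<in> Obj C; W \<in> Obj C\<rbrakk>
    \<Longrightarrow> (\<sigma> Y X \<otimes> \<one> W) \<cdot> (\<sigma> X Y \<otimes> \<one> W) = \<one> (X \<odot> Y \<odot> W)"
  by (simp add: merge Braid_symmetric)

lemma swap_swap:
  assumes "X \<in> Obj C" "Y \<in> Obj C" "W \<in> Obj C"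
  shows "swap Y X W \<cdot> swap X Y W = \<one> (X \<odot> (Y \<odot> W))"
  using assms by (simp add: swap_def comp_extend[OF Braid_Braid])

lemma swap_nat:
  assumes [simp]: "r \<in> Arr C" "s \<in> Arr C" "t \<in> Arr C" and "X = Cod C r" "Y = Cod C s" "W = Cod C t"
  shows "swap X Y W \<cdot> (r \<otimes> (s \<otimes> t)) = (s \<otimes> (r \<otimes> t)) \<cdot> swap (Dom C r) (Dom C s) (Dom C t)"
proof -
  have "(\<sigma> X Y \<otimes> \<one> W) \<cdot> (r \<otimes> s \<otimes> t) = (s \<otimes> r \<otimes> t) \<cdot> (\<sigma> (Dom C r) (Dom C s) \<otimes> \<one> (Dom C t))"
    using assms by (simp add: merge nat)
  from comp_extend[OF this] show ?thesis using assms
    by (simp add: swap_def Assoc_inv_nat nat_extend)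
qed

lemma swap_nat1: "\<lbrakk>r \<in> Arr C; Y \<in> Obj C; W \<in> Obj C; X = Cod C r\<rbrakk>
    \<Longrightarrow> swap X Y W \<cdot> (r \<otimes> \<one> (Y \<odot> W)) = (\<one> Y \<otimes> (r \<otimes> \<one> W)) \<cdot> swap (Dom C r) Y W"
  using swap_nat[of r "\<one> Y" "\<one> W"] by simp

lemma swap_nat3: "\<lbrakk>t \<in> Arr C; X \<in> Obj C; Y \<in> Obj C; W = Cod C t\<rbrakk>
    \<Longrightarrow> swap X Y W \<cdot> (\<one> X \<otimes> (\<one> Y \<otimes> t)) = (\<one> Y \<otimes> (\<one> X \<otimes> t)) \<cdot> swap X Y (Dom C t)"
  using swap_nat[of "\<one> X" "\<one> Y" t] by simp

lemma pentagon_inv: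
  assumes [simp]: "W \<in> Obj C" "X \<in> Obj C" "Y \<in> Obj C" "Z \<in> Obj C"
  shows "\<alpha> W (X \<odot> Y) Z \<cdot> (\<alpha> W X Y \<otimes> \<one> Z) \<cdot> \<beta> (W \<odot> X) Y Z
    = (\<one> W \<otimes> \<beta> X Y Z) \<cdot> \<alpha> W X (Y \<odot> Z)"
proof -
  have 1: "(\<one> W \<otimes> \<beta> X Y Z) \<cdot> (\<one> W \<otimes> \<alpha> X Y Z) = \<one> (W \<odot> (X \<odot> Y \<odot> Z))"
    by (simp add: merge)
  have "\<alpha> W (X \<odot> Y) Z \<cdot> (\<alpha> W X Y \<otimes> \<one> Z)
    = (\<one> W \<otimes> \<beta> X Y Z) \<cdot> ((\<one> W \<otimes> \<alpha> X Y Z) \<cdot> (\<alpha> W (X \<odot> Y) Z \<cdot> (\<alpha> W X Y \<otimes> \<one> Z)))"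
    by (simp add: comp_extend[OF 1])
  also have "\<dots> = (\<one> W \<otimes> \<beta> X Y Z) \<cdot> (\<alpha> W X (Y \<odot> Z) \<cdot> \<alpha> (W \<odot> X) Y Z)"
    by (simp add: pentagon')
  finally show ?thesis by simp
qed

text \<open>Splitting the passive tail of \<open>swap\<close> is a double application of the pentagon.\<close>

lemma swap_module:
  assumes [simp]: "X \<in> Obj C" "Y \<in> Obj C" "V \<in> Obj C" "W \<in> Obj C"
  shows "(\<one> Y \<otimes> \<alpha> X V W) \<cdot> (\<alpha> Y (X \<odot> V) W \<cdot> (swap X Y V \<otimes> \<one> W))
    = swap X Y (V \<odot> W) \<cdot> ((\<one> X \<otimes> \<alpha> Y V W) \<cdot> \<alpha> X (Y \<odot> V) W)"
proof (rule iso_epi[of "\<alpha> X Y V \<otimes> \<one> W"])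
  have 1: "(\<beta> X Y V \<otimes> \<one> W) \<cdot> (\<alpha> X Y V \<otimes> \<one> W) = \<one> (X \<odot> Y \<odot> V \<odot> W)" by (simp add: merge)
  have "((\<one> Y \<otimes> \<alpha> X V W) \<cdot> (\<alpha> Y (X \<odot> V) W \<cdot> (swap X Y V \<otimes> \<one> W))) \<cdot> (\<alpha> X Y V \<otimes> \<one> W)
    = ((\<one> Y \<otimes> \<alpha> X V W) \<cdot> (\<alpha> Y (X \<odot> V) W \<cdot> (\<alpha> Y X V \<otimes> \<one> W))) \<cdot> (\<sigma> X Y \<otimes> \<one> V \<otimes> \<one> W)"
    by (simp add: swap_def whisker 1)
  also have "\<dots> = \<alpha> Y X (V \<odot> W) \<cdot> (\<sigma> X Y \<otimes> \<one> (V \<odot> W)) \<cdot> \<alpha> (X \<odot> Y) V W"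
    by (simp only: pentagon' assms Obj_Tens) (simp add: nat)
  also have "\<dots> = swap X Y (V \<odot> W) \<cdot> (\<alpha> X Y (V \<odot> W) \<cdot> \<alpha> (X \<odot> Y) V W)"
    by (simp add: swap_def)
  also have "\<dots> = (swap X Y (V \<odot> W) \<cdot> ((\<one> X \<otimes> \<alpha> Y V W) \<cdot> \<alpha> X (Y \<odot> V) W)) \<cdot> (\<alpha> X Y V \<otimes> \<one> W)"
    by (simp add: pentagon)
  finally show "((\<one> Y \<otimes> \<alpha> X V W) \<cdot> (\<alpha> Y (X \<odot> V) W \<cdot> (swap X Y V \<otimes> \<one> W))) \<cdot> (\<alpha> X Y V \<otimes> \<one> W)
    = (swap X Y (V \<odot> W) \<cdot> ((\<one> X \<otimes> \<alpha> Y V W) \<cdot> \<alpha> X (Y \<odot> V) W)) \<cdot> (\<alpha> X Y V \<otimes> \<one> W)" .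
qed (simp_all add: iso_Tens)

lemma Braid_Tens_left:
  assumes [simp]: "X \<in> Obj C" "Y \<in> Obj C" "Z \<in> Obj C"
  shows "\<sigma> (X \<odot> Y) Z = swap X Z Y \<cdot> ((\<one> X \<otimes> \<sigma> Y Z) \<cdot> \<alpha> X Y Z)"
proof -
  have 1: "(\<one> X \<otimes> \<sigma> Y Z) \<cdot> (\<one> X \<otimes> \<sigma> Z Y) = \<one> (X \<odot> (Z \<odot> Y))"
    by (simp add: merge Braid_symmetric)
  have "\<beta> X Y Z \<cdot> (\<alpha> X Y Z \<cdot> \<sigma> Z (X \<odot> Y) \<cdot> \<alpha> Z X Y)
      = \<beta> X Y Z \<cdot> ((\<one> X \<otimes> \<sigma> Z Y) \<cdot> \<alpha> X Z Y \<cdot> (\<sigma> Z X \<otimes> \<one> Y))"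
    by (simp only: hexagon assms)
  then have E: "\<sigma> Z (X \<odot> Y) \<cdot> \<alpha> Z X Y = \<beta> X Y Z \<cdot> ((\<one> X \<otimes> \<sigma> Z Y) \<cdot> \<alpha> X Z Y \<cdot> (\<sigma> Z X \<otimes> \<one> Y))"
    by simp
  have 2: "\<sigma> Z (X \<odot> Y) \<cdot> (\<alpha> Z X Y \<cdot> ((\<sigma> X Z \<otimes> \<one> Y) \<cdot> (\<beta> X Z Y \<cdot> ((\<one> X \<otimes> \<sigma> Y Z) \<cdot> \<alpha> X Y Z))))
    = \<beta> X Y Z \<cdot> ((\<one> X \<otimes> \<sigma> Z Y) \<cdot> \<alpha> X Z Y \<cdot> (\<sigma> Z X \<otimes> \<one> Y)) \<cdot>
       ((\<sigma> X Z \<otimes> \<one> Y) \<cdot> (\<beta> X Z Y \<cdot> ((\<one> X \<otimes> \<sigma> Y Z) \<cdot> \<alpha> X Y Z)))"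
    by (simp add: comp_extend[OF E])
  have 3: "(\<one> X \<otimes> \<sigma> Z Y) \<cdot> (\<one> X \<otimes> \<sigma> Y Z) = \<one> (X \<odot> (Y \<odot> Z))"
    by (simp add: merge Braid_symmetric)
  have "\<sigma> Z (X \<odot> Y) \<cdot> (\<alpha> Z X Y \<cdot> ((\<sigma> X Z \<otimes> \<one> Y) \<cdot> (\<beta> X Z Y \<cdot> ((\<one> X \<otimes> \<sigma> Y Z) \<cdot> \<alpha> X Y Z)))) = \<one> (X \<odot> Y \<odot> Z)"
    by (simp add: 2 comp_extend[OF Braid_Braid] comp_extend[OF 3])
  also have "\<dots> = \<sigma> Z (X \<odot> Y) \<cdot> \<sigma> (X \<odot> Y) Z" by (simp add: Braid_symmetric)
  finally have "\<alpha> Z X Y \<cdot> ((\<sigma> X Z \<otimes> \<one> Y) \<cdot> (\<beta> X Z Y \<cdot> ((\<one> X \<otimes> \<sigma> Y Z) \<cdot> \<alpha> X Y Z))) = \<sigma> (X \<odot> Y) Z"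
    by (rule iso_mono[rotated]) simp_all
  then show ?thesis by (simp add: swap_def)
qed

text \<open>The hexagon in tail form: a composite factor is exchanged one component after the other.\<close>

lemma swap_Tens_left:
  assumes [simp]: "X \<in> Obj C" "Y \<in> Obj C" "Z \<in> Obj C" "W \<in> Obj C"
  shows "(\<one> Z \<otimes> \<alpha> X Y W) \<cdot> swap (X \<odot> Y) Z W = swap X Z (Y \<odot> W) \<cdot> ((\<one> X \<otimes> swap Y Z W) \<cdot> \<alpha> X Y (Z \<odot> W))"
proof -
  have 1: "(\<alpha> X Y Z \<otimes> \<one> W) \<cdot> \<beta> (X \<odot> Y) Z W = \<beta> X (Y \<odot> Z) W \<cdot> ((\<one> X \<otimes> \<beta> Y Z W) \<cdot> \<alpha> X Y (Z \<odot> W))"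
    using pentagon_inv[of X Y Z W] by - (rule iso_mono[of "\<alpha> X (Y \<odot> Z) W"], simp_all)
  have "(\<one> Z \<otimes> \<alpha> X Y W) \<cdot> swap (X \<odot> Y) Z W
    = ((\<one> Z \<otimes> \<alpha> X Y W) \<cdot> (\<alpha> Z (X \<odot> Y) W \<cdot> (swap X Z Y \<otimes> \<one> W))) \<cdot>
       ((\<one> X \<otimes> \<sigma> Y Z \<otimes> \<one> W) \<cdot> ((\<alpha> X Y Z \<otimes> \<one> W) \<cdot> \<beta> (X \<odot> Y) Z W))"
    by (simp add: swap_def[of "X \<odot> Y"] Braid_Tens_left whisker)
  also have "\<dots> = swap X Z (Y \<odot> W) \<cdot> (((\<one> X \<otimes> \<alpha> Z Y W) \<cdot> \<alpha> X (Z \<odot> Y) W) \<cdot>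
       ((\<one> X \<otimes> \<sigma> Y Z \<otimes> \<one> W) \<cdot> (\<beta> X (Y \<odot> Z) W \<cdot> ((\<one> X \<otimes> \<beta> Y Z W) \<cdot> \<alpha> X Y (Z \<odot> W)))))"
    by (simp only: swap_module 1 assms) simp
  also have "\<dots> = swap X Z (Y \<odot> W) \<cdot> ((\<one> X \<otimes> swap Y Z W) \<cdot> \<alpha> X Y (Z \<odot> W))"
    by (simp add: swap_def[of Y] whisker nat_extend)
  finally show ?thesis .
qed

lemma LUnit_swap:
  assumes [simp]: "Y \<in> Obj C" "W \<in> Obj C"
  shows "(\<one> Y \<otimes> \<ll> W) \<cdot> swap \<I> Y W = \<ll> (Y \<odot> W)"
proof -
  have "(\<one> Y \<otimes> \<ll> W) \<cdot> swap \<I> Y W = ((\<rr> Y \<cdot> \<sigma> \<I> Y) \<otimes> \<one> W) \<cdot> \<beta> \<I> Y W"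
    by (simp add: swap_def comp_extend[OF triangle] whisker)
  also have "\<dots> = \<ll> (Y \<odot> W)"
    by (simp add: RUnit_Braid LUnit_Tens[symmetric])
  finally show ?thesis .
qed

end

locale comonoid_object = symmetric_monoidal_ord_category C
  for C :: "('o, 'a, 'z) cart_data_scheme" (structure) +
  fixes X d e
  assumes X [simp]: "X \<in> Obj C" and comonoid: "commutative_comonoid C X d e"
begin

lemma d_typed [simp]: "d \<in> Arr C" "Dom C d = X" "Cod C d = X \<odot> X"
  and e_typed [simp]: "e \<in> Arr C" "Dom C e = X" "Cod C e = \<I>"
  using comonoid by (auto simp: commutative_comonoid_def)

lemma coassoc: "\<alpha> X X X \<cdot> ((d \<otimes> \<one> X) \<cdot> d) = (\<one> X \<otimes> d) \<cdot> d"
  and counit_left: "\<ll> X \<cdot> ((e \<otimes> \<one> X) \<cdot> d) = \<one> X"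
  and counit_right: "\<rr> X \<cdot> ((\<one> X \<otimes> e) \<cdot> d) = \<one> X"
  and cocomm: "\<sigma> X X \<cdot> d = d"
  using comonoid by (simp_all add: commutative_comonoid_def)

abbreviation (input) "D \<equiv> dup_on X d"
abbreviation (input) "E \<equiv> del_on e"

lemma D_typed [simp]: "W \<in> Obj C \<Longrightarrow> D W \<in> Arr C" "W \<in> Obj C \<Longrightarrow> Dom C (D W) = X \<odot> W"
    "W \<in> Obj C \<Longrightarrow> Cod C (D W) = X \<odot> (X \<odot> W)"
  by (simp_all add: dup_on_def)

lemma E_typed [simp]: "W \<in> Obj C \<Longrightarrow> E W \<in> Arr C" "W \<in> Obj C \<Longrightarrow> Dom C (E W) = X \<odot> W"
    "W \<in> Obj C \<Longrightarrow> Cod C (E W) = W"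
  by (simp_all add: del_on_def)

lemma D_nat: "\<lbrakk>w \<in> Arr C; W = Cod C w\<rbrakk> \<Longrightarrow> D W \<cdot> (\<one> X \<otimes> w) = (\<one> X \<otimes> (\<one> X \<otimes> w)) \<cdot> D (Dom C w)"
proof -
  assume [simp]: "w \<in> Arr C" "W = Cod C w"
  have "(d \<otimes> \<one> W) \<cdot> (\<one> X \<otimes> w) = (\<one> (X \<odot> X) \<otimes> w) \<cdot> (d \<otimes> \<one> (Dom C w))" by (simp add: merge)
  then show ?thesis by (simp add: dup_on_def nat_extend)
qed

lemma E_nat: "\<lbrakk>w \<in> Arr C; W = Cod C w\<rbrakk> \<Longrightarrow> E W \<cdot> (\<one> X \<otimes> w) = w \<cdot> E (Dom C w)"
proof -
  assume [simp]: "w \<in> Arr C" "W = Cod C w"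
  have "(e \<otimes> \<one> W) \<cdot> (\<one> X \<otimes> w) = (\<one> \<I> \<otimes> w) \<cdot> (e \<otimes> \<one> (Dom C w))" by (simp add: merge)
  then show ?thesis by (simp add: del_on_def nat_extend)
qed

lemma D_coassoc:
  assumes [simp]: "W \<in> Obj C"
  shows "D (X \<odot> W) \<cdot> D W = (\<one> X \<otimes> D W) \<cdot> D W"
proof -
  have "D (X \<odot> W) \<cdot> D W = (\<alpha> X X (X \<odot> W) \<cdot> \<alpha> (X \<odot> X) X W) \<cdot> ((d \<otimes> \<one> X \<otimes> \<one> W) \<cdot> (d \<otimes> \<one> W))"
    by (simp add: dup_on_def nat_extend)
  also have "\<dots> = (\<one> X \<otimes> \<alpha> X X W) \<cdot> (\<alpha> X (X \<odot> X) W \<cdot> ((\<alpha> X X X \<cdot> ((d \<otimes> \<one> X) \<cdot> d)) \<otimes> \<one> W))"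
    by (simp add: pentagon whisker)
  also have "\<dots> = (\<one> X \<otimes> D W) \<cdot> D W"
    by (simp only: coassoc) (simp add: dup_on_def whisker nat_extend)
  finally show ?thesis .
qed

lemma D_counit_left: "W \<in> Obj C \<Longrightarrow> E (X \<odot> W) \<cdot> D W = \<one> (X \<odot> W)"
proof -
  assume [simp]: "W \<in> Obj C"
  have "E (X \<odot> W) \<cdot> D W = (\<ll> (X \<odot> W) \<cdot> \<alpha> \<I> X W) \<cdot> ((e \<otimes> \<one> X \<otimes> \<one> W) \<cdot> (d \<otimes> \<one> W))"
    by (simp add: dup_on_def del_on_def nat_extend)
  also have "\<dots> = (\<ll> X \<cdot> ((e \<otimes> \<one> X) \<cdot> d)) \<otimes> \<one> W"
    by (simp only: LUnit_Tens X \<open>W \<in> Obj C\<close>) (simp add: whisker)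
  finally show ?thesis by (simp add: counit_left)
qed

lemma D_counit_right: "W \<in> Obj C \<Longrightarrow> (\<one> X \<otimes> E W) \<cdot> D W = \<one> (X \<odot> W)"
proof -
  assume [simp]: "W \<in> Obj C"
  have "(\<one> X \<otimes> E W) \<cdot> D W = ((\<one> X \<otimes> \<ll> W) \<cdot> \<alpha> X \<I> W) \<cdot> ((\<one> X \<otimes> e \<otimes> \<one> W) \<cdot> (d \<otimes> \<one> W))"
    by (simp add: dup_on_def del_on_def nat_extend whisker)
  also have "\<dots> = (\<rr> X \<cdot> ((\<one> X \<otimes> e) \<cdot> d)) \<otimes> \<one> W"
    by (simp only: triangle X \<open>W \<in> Obj C\<close>) (simp add: whisker)
  finally show ?thesis by (simp add: counit_right)
qed

lemma swap_D: "W \<in> Obj C \<Longrightarrow> swap X X W \<cdot> D W = D W"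
  using cocomm by (simp add: swap_def dup_on_def merge)

lemma D_self: "D X \<cdot> d = (\<one> X \<otimes> d) \<cdot> d"
  by (simp add: dup_on_def coassoc)

lemma E_self: "E X \<cdot> d = \<one> X"
  by (simp add: del_on_def counit_left)

lemma D_module: "V \<in> Obj C \<Longrightarrow> W \<in> Obj C \<Longrightarrow>
   (\<one> X \<otimes> \<alpha> X V W) \<cdot> (\<alpha> X (X \<odot> V) W \<cdot> (D V \<otimes> \<one> W)) = D (V \<odot> W) \<cdot> \<alpha> X V W"
proof -
  assume [simp]: "V \<in> Obj C" "W \<in> Obj C"
  have "(\<one> X \<otimes> \<alpha> X V W) \<cdot> (\<alpha> X (X \<odot> V) W \<cdot> (D V \<otimes> \<one> W))
    = ((\<one> X \<otimes> \<alpha> X V W) \<cdot> (\<alpha> X (X \<odot> V) W \<cdot> (\<alpha> X X V \<otimes> \<one> W))) \<cdot> (d \<otimes> \<one> V \<otimes> \<one> W)"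
    by (simp add: dup_on_def whisker)
  also have "\<dots> = D (V \<odot> W) \<cdot> \<alpha> X V W"
    by (simp only: pentagon' X \<open>V \<in> Obj C\<close> \<open>W \<in> Obj C\<close>) (simp add: dup_on_def nat)
  finally show ?thesis .
qed

text \<open>This and the next three lemmas say that \<open>swap\<close> is a distributive law between the comonads of two
  comonoids; that is what makes the composite of the two a comonad again.\<close>

lemma D_swap:
  assumes [simp]: "Y \<in> Obj C" "W \<in> Obj C"
  shows "(\<one> Y \<otimes> D W) \<cdot> swap X Y W = swap X Y (X \<odot> W) \<cdot> ((\<one> X \<otimes> swap X Y W) \<cdot> D (Y \<odot> W))"
proof -
  have "(\<one> Y \<otimes> D W) \<cdot> swap X Y W = ((\<one> Y \<otimes> \<alpha> X X W) \<cdot> swap (X \<odot> X) Y W) \<cdot> (d \<otimes> \<one> (Y \<odot> W))"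
    by (simp add: dup_on_def whisker swap_nat1)
  also have "\<dots> = swap X Y (X \<odot> W) \<cdot> ((\<one> X \<otimes> swap X Y W) \<cdot> D (Y \<odot> W))"
    by (simp only: swap_Tens_left X assms) (simp add: dup_on_def)
  finally show ?thesis .
qed

lemma swap_D_after:
  assumes [simp]: "Y \<in> Obj C" "W \<in> Obj C"
  shows "D (Y \<odot> W) \<cdot> swap Y X W = (\<one> X \<otimes> swap Y X W) \<cdot> (swap Y X (X \<odot> W) \<cdot> (\<one> Y \<otimes> D W))"
proof -
  have 1: "(\<one> X \<otimes> swap Y X W) \<cdot> (\<one> X \<otimes> swap X Y W) = \<one> (X \<odot> (X \<odot> (Y \<odot> W)))"
    by (simp add: merge swap_swap)
  have "(\<one> X \<otimes> swap Y X W) \<cdot> (swap Y X (X \<odot> W) \<cdot> ((\<one> Y \<otimes> D W) \<cdot> swap X Y W))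
     = D (Y \<odot> W)"
    by (simp only: D_swap assms) (simp add: comp_extend[OF swap_swap] comp_extend[OF 1])
  then have "((\<one> X \<otimes> swap Y X W) \<cdot> (swap Y X (X \<odot> W) \<cdot> ((\<one> Y \<otimes> D W) \<cdot> swap X Y W))) \<cdot> swap Y X W
     = D (Y \<odot> W) \<cdot> swap Y X W" by simp
  then show ?thesis by (simp add: swap_swap)
qed

lemma E_swap:
  assumes [simp]: "Y \<in> Obj C" "W \<in> Obj C"
  shows "(\<one> Y \<otimes> E W) \<cdot> swap X Y W = E (Y \<odot> W)"
proof -
  have "(\<one> Y \<otimes> E W) \<cdot> swap X Y W = ((\<one> Y \<otimes> \<ll> W) \<cdot> swap \<I> Y W) \<cdot> (e \<otimes> \<one> (Y \<odot> W))"
    by (simp add: del_on_def whisker swap_nat1)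
  also have "\<dots> = E (Y \<odot> W)"
    by (simp only: LUnit_swap assms) (simp add: del_on_def)
  finally show ?thesis .
qed

lemma swap_E:
  assumes [simp]: "Y \<in> Obj C" "W \<in> Obj C"
  shows "E (Y \<odot> W) \<cdot> swap Y X W = \<one> Y \<otimes> E W"
proof -
  have "E (Y \<odot> W) \<cdot> swap Y X W = ((\<one> Y \<otimes> E W) \<cdot> swap X Y W) \<cdot> swap Y X W"
    by (simp only: E_swap assms)
  then show ?thesis by (simp add: swap_swap)
qed

end

section \<open>The tensor product of two commutative comonoids\<close>

locale comonoid_pair = symmetric_monoidal_ord_category C + L: comonoid_object C X dX eX + R: comonoid_object C Y dY eY
  for C :: "('o, 'a, 'z) cart_data_scheme" (structure) and X dX eX Y dY eY
begin

abbreviation (input) "DupX \<equiv> dup_on X dX"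
abbreviation (input) "DupY \<equiv> dup_on Y dY"
abbreviation (input) "DelX \<equiv> del_on eX"
abbreviation (input) "DelY \<equiv> del_on eY"

text \<open>The comultiplication of the tensor product, with its target bracketed to the right. The last
  factor \<open>Y\<close> is its own tail, so that \<open>dY\<close> itself appears instead of \<open>dup_on\<close>.\<close>

definition dup_unbracketed :: 'a where
  "dup_unbracketed = (\<one> X \<otimes> swap X Y Y) \<cdot> (DupX (Y \<odot> Y) \<cdot> (\<one> X \<otimes> dY))"

abbreviation (input) "\<delta> \<equiv> dup_unbracketed"

definition dup_tensor :: 'a where
  "dup_tensor = \<beta> X Y (X \<odot> Y) \<cdot> \<delta>"

definition del_tensor :: 'a where
  "del_tensor = eY \<cdot> DelX Y"

lemma dup_typed [simp]: "\<delta> \<in> Arr C" "Dom C \<delta> = X \<odot> Y" "Cod C \<delta> = X \<odot> (Y \<odot> (X \<odot> Y))"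
  "dup_tensor \<in> Arr C" "Dom C dup_tensor = X \<odot> Y" "Cod C dup_tensor = X \<odot> Y \<odot> (X \<odot> Y)"
  "del_tensor \<in> Arr C" "Dom C del_tensor = X \<odot> Y" "Cod C del_tensor = \<I>"
  by (simp_all add: dup_tensor_def dup_unbracketed_def del_tensor_def)

lemma Assoc_dup_tensor: "\<alpha> X Y (X \<odot> Y) \<cdot> dup_tensor = \<delta>"
  by (simp add: dup_tensor_def)

text \<open>Seen on right-bracketed objects with an arbitrary tail, the comultiplication is that of a
  composite of two comonads along the distributive law \<open>swap\<close>.\<close>

lemma dup_tensor_whisker:
  assumes [simp]: "W \<in> Obj C"
  shows "\<alpha> X Y (X \<odot> (Y \<odot> W)) \<cdot> ((\<one> (X \<odot> Y) \<otimes> \<alpha> X Y W) \<cdot> (\<alpha> (X \<odot> Y) (X \<odot> Y) W \<cdot> (dup_tensor \<otimes> \<one> W)))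
    = (\<one> X \<otimes> swap X Y (Y \<odot> W)) \<cdot> (DupX (Y \<odot> (Y \<odot> W)) \<cdot> ((\<one> X \<otimes> DupY W) \<cdot> \<alpha> X Y W))"
proof -
  let ?Q = "X \<odot> Y"
  have 1: "\<alpha> X Y (?Q \<odot> W) \<cdot> (\<alpha> ?Q ?Q W \<cdot> (\<beta> X Y ?Q \<otimes> \<one> W)) = (\<one> X \<otimes> \<alpha> Y ?Q W) \<cdot> \<alpha> X (Y \<odot> ?Q) W"
  proof (rule iso_epi[of "\<alpha> X Y ?Q \<otimes> \<one> W"])
    show "(\<alpha> X Y (?Q \<odot> W) \<cdot> (\<alpha> ?Q ?Q W \<cdot> (\<beta> X Y ?Q \<otimes> \<one> W))) \<cdot> (\<alpha> X Y ?Q \<otimes> \<one> W)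
      = ((\<one> X \<otimes> \<alpha> Y ?Q W) \<cdot> \<alpha> X (Y \<odot> ?Q) W) \<cdot> (\<alpha> X Y ?Q \<otimes> \<one> W)"
      using pentagon'[of X Y ?Q W] by (simp add: Tens_merge)
  qed (simp_all add: iso_Tens)
  have "\<alpha> X Y (X \<odot> (Y \<odot> W)) \<cdot> ((\<one> ?Q \<otimes> \<alpha> X Y W) \<cdot> (\<alpha> ?Q ?Q W \<cdot> (dup_tensor \<otimes> \<one> W)))
    = (\<one> X \<otimes> (\<one> Y \<otimes> \<alpha> X Y W)) \<cdot> ((\<alpha> X Y (?Q \<odot> W) \<cdot> (\<alpha> ?Q ?Q W \<cdot> (\<beta> X Y ?Q \<otimes> \<one> W))) \<cdot> (\<delta> \<otimes> \<one> W))"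
    by (simp add: dup_tensor_def whisker nat_extend)
  also have "\<dots> = (\<one> X \<otimes> ((\<one> Y \<otimes> \<alpha> X Y W) \<cdot> (\<alpha> Y ?Q W \<cdot> (swap X Y Y \<otimes> \<one> W)))) \<cdot>
      (\<alpha> X (X \<odot> (Y \<odot> Y)) W \<cdot> ((DupX (Y \<odot> Y) \<otimes> \<one> W) \<cdot> (\<one> X \<otimes> dY \<otimes> \<one> W)))"
    by (simp only: 1) (simp add: dup_unbracketed_def whisker nat_extend)
  also have "\<dots> = (\<one> X \<otimes> swap X Y (Y \<odot> W)) \<cdot> ((\<one> X \<otimes> (\<one> X \<otimes> \<alpha> Y Y W)) \<cdot>
      (((\<one> X \<otimes> \<alpha> X (Y \<odot> Y) W) \<cdot> (\<alpha> X (X \<odot> (Y \<odot> Y)) W \<cdot> (DupX (Y \<odot> Y) \<otimes> \<one> W))) \<cdot> (\<one> X \<otimes> dY \<otimes> \<one> W)))"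
    by (simp only: swap_module L.X R.X assms) (simp add: whisker)
  also have "\<dots> = (\<one> X \<otimes> swap X Y (Y \<odot> W)) \<cdot> (((\<one> X \<otimes> (\<one> X \<otimes> \<alpha> Y Y W)) \<cdot> DupX (Y \<odot> Y \<odot> W)) \<cdot>
     (\<alpha> X (Y \<odot> Y) W \<cdot> (\<one> X \<otimes> dY \<otimes> \<one> W)))"
    by (simp only: L.D_module L.X R.X assms Obj_Tens) simp
  also have "\<dots> = (\<one> X \<otimes> swap X Y (Y \<odot> W)) \<cdot> ((DupX (Y \<odot> (Y \<odot> W)) \<cdot> (\<one> X \<otimes> \<alpha> Y Y W)) \<cdot>
     (\<alpha> X (Y \<odot> Y) W \<cdot> (\<one> X \<otimes> dY \<otimes> \<one> W)))"
    by (simp add: L.D_nat)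
  also have "\<dots> = (\<one> X \<otimes> swap X Y (Y \<odot> W)) \<cdot> (DupX (Y \<odot> (Y \<odot> W)) \<cdot> ((\<one> X \<otimes> DupY W) \<cdot> \<alpha> X Y W))"
    by (simp add: dup_on_def[of Y] whisker nat)
  finally show ?thesis .
qed

text \<open>Coassociativity of a composite comonad: both sides are brought into the form \<open>?m\<close>, in which
  all duplications precede all exchanges.\<close>

lemma dup_unbracketed_coassoc:
  "(\<one> X \<otimes> swap X Y (Y \<odot> (X \<odot> Y))) \<cdot> (DupX (Y \<odot> (Y \<odot> (X \<odot> Y))) \<cdot> ((\<one> X \<otimes> DupY (X \<odot> Y)) \<cdot> \<delta>))
    = (\<one> X \<otimes> (\<one> Y \<otimes> \<delta>)) \<cdot> \<delta>"
proof -
  let ?YY = "Y \<odot> Y" and ?Q = "X \<odot> Y"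
  let ?k = "(\<one> X \<otimes> ((\<one> Y \<otimes> dY) \<cdot> dY))"
  let ?m = "(\<one> X \<otimes> swap X Y (Y \<odot> ?Q)) \<cdot> ((\<one> X \<otimes> (\<one> X \<otimes> (\<one> Y \<otimes> swap X Y Y))) \<cdot>
     ((\<one> X \<otimes> (\<one> X \<otimes> swap X Y ?YY)) \<cdot> ((\<one> X \<otimes> DupX (Y \<odot> ?YY)) \<cdot> (DupX (Y \<odot> ?YY) \<cdot> ?k))))"
  have 1: "DupY ?Q \<cdot> swap X Y Y = (\<one> Y \<otimes> swap X Y Y) \<cdot> (swap X Y ?YY \<cdot> (\<one> X \<otimes> DupY Y))"
    by (rule R.swap_D_after) simp_all
  have "(\<one> X \<otimes> DupY ?Q) \<cdot> \<delta> = (\<one> X \<otimes> (DupY ?Q \<cdot> swap X Y Y)) \<cdot> (DupX ?YY \<cdot> (\<one> X \<otimes> dY))"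
    by (simp add: dup_unbracketed_def whisker)
  also have "\<dots> = (\<one> X \<otimes> (\<one> Y \<otimes> swap X Y Y)) \<cdot> ((\<one> X \<otimes> swap X Y ?YY) \<cdot>
      ((\<one> X \<otimes> (\<one> X \<otimes> DupY Y)) \<cdot> (DupX ?YY \<cdot> (\<one> X \<otimes> dY))))"
    by (simp only: 1) (simp add: whisker)
  also have "(\<one> X \<otimes> (\<one> X \<otimes> DupY Y)) \<cdot> (DupX ?YY \<cdot> (\<one> X \<otimes> dY)) = DupX (Y \<odot> ?YY) \<cdot> (\<one> X \<otimes> (DupY Y \<cdot> dY))"
    by (simp add: whisker comp_extend[OF L.D_nat])
  also have "DupY Y \<cdot> dY = (\<one> Y \<otimes> dY) \<cdot> dY" by (rule R.D_self)
  finally have 2: "(\<one> X \<otimes> DupY ?Q) \<cdot> \<delta> = (\<one> X \<otimes> ((\<one> Y \<otimes> swap X Y Y) \<cdot> swap X Y ?YY)) \<cdot> (DupX (Y \<odot> ?YY) \<cdot> ?k)"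
    by (simp add: whisker)
  have "(\<one> X \<otimes> swap X Y (Y \<odot> ?Q)) \<cdot> (DupX (Y \<odot> (Y \<odot> ?Q)) \<cdot> ((\<one> X \<otimes> DupY ?Q) \<cdot> \<delta>))
    = (\<one> X \<otimes> swap X Y (Y \<odot> ?Q)) \<cdot> ((\<one> X \<otimes> (\<one> X \<otimes> ((\<one> Y \<otimes> swap X Y Y) \<cdot> swap X Y ?YY))) \<cdot>
       ((DupX (X \<odot> (Y \<odot> ?YY)) \<cdot> DupX (Y \<odot> ?YY)) \<cdot> ?k))"
    by (simp only: 2) (simp add: comp_extend[OF L.D_nat] whisker_left[symmetric])
  also have "\<dots> = ?m"
    by (subst L.D_coassoc) (simp_all add: whisker)
  finally have l: "(\<one> X \<otimes> swap X Y (Y \<odot> ?Q)) \<cdot> (DupX (Y \<odot> (Y \<odot> ?Q)) \<cdot> ((\<one> X \<otimes> DupY ?Q) \<cdot> \<delta>)) = ?m" .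
  have 3: "(\<one> Y \<otimes> DupX ?YY) \<cdot> ((\<one> Y \<otimes> (\<one> X \<otimes> dY)) \<cdot> swap X Y Y)
     = swap X Y (X \<odot> ?YY) \<cdot> ((\<one> X \<otimes> swap X Y ?YY) \<cdot> (DupX (Y \<odot> ?YY) \<cdot> (\<one> X \<otimes> (\<one> Y \<otimes> dY))))"
  proof -
    have "(\<one> Y \<otimes> DupX ?YY) \<cdot> ((\<one> Y \<otimes> (\<one> X \<otimes> dY)) \<cdot> swap X Y Y)
       = ((\<one> Y \<otimes> DupX ?YY) \<cdot> swap X Y ?YY) \<cdot> (\<one> X \<otimes> (\<one> Y \<otimes> dY))"
      by (simp add: swap_nat3)
    then show ?thesis by (simp add: L.D_swap)
  qed
  have "(\<one> X \<otimes> (\<one> Y \<otimes> \<delta>)) \<cdot> \<delta>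
    = (\<one> X \<otimes> (\<one> Y \<otimes> (\<one> X \<otimes> swap X Y Y))) \<cdot>
      ((\<one> X \<otimes> ((\<one> Y \<otimes> DupX ?YY) \<cdot> ((\<one> Y \<otimes> (\<one> X \<otimes> dY)) \<cdot> swap X Y Y))) \<cdot> (DupX ?YY \<cdot> (\<one> X \<otimes> dY)))"
    by (simp add: dup_unbracketed_def whisker)
  also have "\<dots> = (\<one> X \<otimes> ((\<one> Y \<otimes> (\<one> X \<otimes> swap X Y Y)) \<cdot> swap X Y (X \<odot> ?YY))) \<cdot> ((\<one> X \<otimes> (\<one> X \<otimes> swap X Y ?YY)) \<cdot>
      ((\<one> X \<otimes> DupX (Y \<odot> ?YY)) \<cdot> ((\<one> X \<otimes> (\<one> X \<otimes> (\<one> Y \<otimes> dY))) \<cdot> (DupX ?YY \<cdot> (\<one> X \<otimes> dY)))))"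
    by (simp only: 3) (simp add: whisker)
  also have "(\<one> X \<otimes> (\<one> X \<otimes> (\<one> Y \<otimes> dY))) \<cdot> (DupX ?YY \<cdot> (\<one> X \<otimes> dY)) = DupX (Y \<odot> ?YY) \<cdot> ?k"
    by (simp add: whisker comp_extend[OF L.D_nat])
  also have "(\<one> Y \<otimes> (\<one> X \<otimes> swap X Y Y)) \<cdot> swap X Y (X \<odot> ?YY)
     = swap X Y (Y \<odot> ?Q) \<cdot> (\<one> X \<otimes> (\<one> Y \<otimes> swap X Y Y))"
    by (simp add: swap_nat3)
  finally show ?thesis by (simp add: l whisker)
qed

lemma dup_tensor_coassoc:
  "\<alpha> (X \<odot> Y) (X \<odot> Y) (X \<odot> Y) \<cdot> ((dup_tensor \<otimes> \<one> (X \<odot> Y)) \<cdot> dup_tensor) = (\<one> (X \<odot> Y) \<otimes> dup_tensor) \<cdot> dup_tensor"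
proof -
  let ?Q = "X \<odot> Y"
  let ?M = "\<alpha> X Y (X \<odot> (Y \<odot> ?Q)) \<cdot> (\<one> ?Q \<otimes> \<alpha> X Y ?Q)"
  have "?M \<cdot> (\<alpha> ?Q ?Q ?Q \<cdot> ((dup_tensor \<otimes> \<one> ?Q) \<cdot> dup_tensor))
    = (\<alpha> X Y (X \<odot> (Y \<odot> ?Q)) \<cdot> ((\<one> ?Q \<otimes> \<alpha> X Y ?Q) \<cdot> (\<alpha> ?Q ?Q ?Q \<cdot> (dup_tensor \<otimes> \<one> ?Q)))) \<cdot> dup_tensor"
    by simp
  also have "\<dots> = (\<one> X \<otimes> (\<one> Y \<otimes> \<delta>)) \<cdot> \<delta>"
    by (simp only: dup_tensor_whisker L.X R.X Obj_Tens) (simp add: Assoc_dup_tensor dup_unbracketed_coassoc)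
  also have "\<dots> = \<alpha> X Y (X \<odot> (Y \<odot> ?Q)) \<cdot> ((\<one> ?Q \<otimes> \<delta>) \<cdot> dup_tensor)"
    by (simp add: nat_extend Assoc_dup_tensor)
  also have "\<dots> = ?M \<cdot> ((\<one> ?Q \<otimes> dup_tensor) \<cdot> dup_tensor)"
    by (simp add: Assoc_dup_tensor[symmetric] whisker)
  finally show ?thesis
    by - (rule iso_mono[of ?M], simp_all add: iso_Comp iso_Tens)
qed

lemma del_tensor_whisker: "W \<in> Obj C \<Longrightarrow>
   \<ll> W \<cdot> (del_tensor \<otimes> \<one> W) = DelY W \<cdot> (DelX (Y \<odot> W) \<cdot> \<alpha> X Y W)"
proof -
  assume [simp]: "W \<in> Obj C"
  have "\<ll> W \<cdot> (del_tensor \<otimes> \<one> W) = DelY W \<cdot> ((\<ll> Y \<otimes> \<one> W) \<cdot> (eX \<otimes> \<one> Y \<otimes> \<one> W))"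
    by (simp add: del_tensor_def del_on_def whisker)
  also have "\<dots> = DelY W \<cdot> (DelX (Y \<odot> W) \<cdot> \<alpha> X Y W)"
    by (simp add: LUnit_Tens[symmetric] del_on_def[of eX] nat)
  finally show ?thesis .
qed

lemma dup_tensor_counit_left: "\<ll> (X \<odot> Y) \<cdot> ((del_tensor \<otimes> \<one> (X \<odot> Y)) \<cdot> dup_tensor) = \<one> (X \<odot> Y)"
proof -
  let ?Q = "X \<odot> Y" and ?YY = "Y \<odot> Y"
  have "\<ll> ?Q \<cdot> ((del_tensor \<otimes> \<one> ?Q) \<cdot> dup_tensor) = DelY ?Q \<cdot> (DelX (Y \<odot> ?Q) \<cdot> \<delta>)"
    by (simp add: comp_extend[OF del_tensor_whisker] Assoc_dup_tensor)
  also have "DelX (Y \<odot> ?Q) \<cdot> \<delta> = swap X Y Y \<cdot> ((DelX (X \<odot> ?YY) \<cdot> DupX ?YY) \<cdot> (\<one> X \<otimes> dY))"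
    by (simp add: dup_unbracketed_def comp_extend[OF L.E_nat])
  also have "\<dots> = swap X Y Y \<cdot> (\<one> X \<otimes> dY)"
    by (subst L.D_counit_left) simp_all
  also have "DelY ?Q \<cdot> \<dots> = (\<one> X \<otimes> DelY Y) \<cdot> (\<one> X \<otimes> dY)"
    by (simp add: comp_extend[OF R.swap_E])
  also have "\<dots> = \<one> ?Q"
    by (simp add: merge R.E_self)
  finally show ?thesis .
qed

lemma dup_tensor_counit_right: "\<rr> (X \<odot> Y) \<cdot> ((\<one> (X \<odot> Y) \<otimes> del_tensor) \<cdot> dup_tensor) = \<one> (X \<odot> Y)"
proof -
  let ?Q = "X \<odot> Y" and ?YY = "Y \<odot> Y"
  have "\<rr> ?Q \<cdot> ((\<one> ?Q \<otimes> del_tensor) \<cdot> dup_tensor) = (\<one> X \<otimes> (\<rr> Y \<cdot> (\<one> Y \<otimes> del_tensor))) \<cdot> \<delta>"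
    by (simp add: RUnit_Tens[symmetric] nat_extend Assoc_dup_tensor whisker)
  also have "\<dots> = (\<one> X \<otimes> (\<rr> Y \<cdot> ((\<one> Y \<otimes> eY) \<cdot> ((\<one> Y \<otimes> DelX Y) \<cdot> swap X Y Y)))) \<cdot> (DupX ?YY \<cdot> (\<one> X \<otimes> dY))"
    by (simp add: del_tensor_def dup_unbracketed_def whisker)
  also have "\<dots> = (\<one> X \<otimes> (\<rr> Y \<cdot> (\<one> Y \<otimes> eY))) \<cdot> (((\<one> X \<otimes> DelX ?YY) \<cdot> DupX ?YY) \<cdot> (\<one> X \<otimes> dY))"
    by (subst L.E_swap) (simp_all add: whisker)
  also have "\<dots> = (\<one> X \<otimes> (\<rr> Y \<cdot> ((\<one> Y \<otimes> eY) \<cdot> dY)))"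
    by (subst L.D_counit_right) (simp_all add: whisker)
  finally show ?thesis by (simp add: R.counit_right)
qed

lemma dup_tensor_cocomm: "\<sigma> (X \<odot> Y) (X \<odot> Y) \<cdot> dup_tensor = dup_tensor"
proof -
  let ?Q = "X \<odot> Y" and ?YY = "Y \<odot> Y"
  have a: "\<alpha> X Y ?Q \<cdot> (\<sigma> ?Q ?Q \<cdot> \<alpha> ?Q X Y) = (\<one> X \<otimes> \<sigma> ?Q Y) \<cdot> (\<alpha> X ?Q Y \<cdot> (\<sigma> ?Q X \<otimes> \<one> Y))"
    using hexagon[of ?Q X Y] by simp
  have "\<alpha> X Y ?Q \<cdot> \<sigma> ?Q ?Q = (\<alpha> X Y ?Q \<cdot> (\<sigma> ?Q ?Q \<cdot> \<alpha> ?Q X Y)) \<cdot> \<beta> ?Q X Y" by simp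
  also have "\<dots> = (\<one> X \<otimes> \<sigma> ?Q Y) \<cdot> swap ?Q X Y" by (simp only: a) (simp add: swap_def)
  also have "\<dots> = (\<one> X \<otimes> (swap X Y Y \<cdot> (\<one> X \<otimes> \<sigma> Y Y))) \<cdot> ((\<one> X \<otimes> \<alpha> X Y Y) \<cdot> swap ?Q X Y)"
    by (simp add: Braid_Tens_left whisker)
  also have "\<dots> = (\<one> X \<otimes> (swap X Y Y \<cdot> (\<one> X \<otimes> \<sigma> Y Y))) \<cdot> (swap X X ?YY \<cdot> ((\<one> X \<otimes> swap Y X Y) \<cdot> \<alpha> X Y ?Q))"
    by (subst swap_Tens_left) simp_all
  finally have b: "\<alpha> X Y ?Q \<cdot> \<sigma> ?Q ?Q =
     (\<one> X \<otimes> (swap X Y Y \<cdot> (\<one> X \<otimes> \<sigma> Y Y))) \<cdot> (swap X X ?YY \<cdot> ((\<one> X \<otimes> swap Y X Y) \<cdot> \<alpha> X Y ?Q))" .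
  have c: "(\<one> X \<otimes> swap Y X Y) \<cdot> (\<one> X \<otimes> swap X Y Y) = \<one> (X \<odot> (X \<odot> ?YY))"
    by (simp add: merge swap_swap)
  have d: "(\<one> X \<otimes> \<sigma> Y Y) \<cdot> (\<one> X \<otimes> dY) = \<one> X \<otimes> dY" by (simp add: merge R.cocomm)
  have "\<alpha> X Y ?Q \<cdot> (\<sigma> ?Q ?Q \<cdot> dup_tensor) = (\<alpha> X Y ?Q \<cdot> \<sigma> ?Q ?Q) \<cdot> dup_tensor" by simp
  also have "\<dots> = (\<one> X \<otimes> (swap X Y Y \<cdot> (\<one> X \<otimes> \<sigma> Y Y))) \<cdot> (swap X X ?YY \<cdot> (DupX ?YY \<cdot> (\<one> X \<otimes> dY)))"
    by (simp only: b) (simp add: Assoc_dup_tensor, simp add: dup_unbracketed_def comp_extend[OF c])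
  also have "\<dots> = (\<one> X \<otimes> swap X Y Y) \<cdot> ((\<one> X \<otimes> (\<one> X \<otimes> \<sigma> Y Y)) \<cdot> (DupX ?YY \<cdot> (\<one> X \<otimes> dY)))"
    by (simp add: comp_extend[OF L.swap_D] whisker)
  also have "\<dots> = \<delta>"
    using d L.D_nat[of "\<sigma> Y Y" ?YY] comp_extend[OF L.D_nat[of "\<sigma> Y Y" ?YY], of "\<one> X \<otimes> dY"]
    by (simp add: dup_unbracketed_def)
  also have "\<dots> = \<alpha> X Y ?Q \<cdot> dup_tensor" by (simp add: Assoc_dup_tensor)
  finally show ?thesis by - (rule iso_mono[of "\<alpha> X Y ?Q"], simp_all)
qed

lemma comonoid_tensor: "commutative_comonoid C (X \<odot> Y) dup_tensor del_tensor"
  using dup_tensor_coassoc dup_tensor_counit_left dup_tensor_counit_right dup_tensor_cocomm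
  by (simp add: commutative_comonoid_def)

text \<open>Deleting \<open>Y\<close> from the first copy and \<open>X\<close> from the second leaves each factor once. As soon as
  the comonoid on \<open>X \<odot> Y\<close> is known to be this one, the two projections form a product cone.\<close>

lemma projections_dup_tensor:
  "((\<rr> X \<cdot> (\<one> X \<otimes> eY)) \<otimes> (\<ll> Y \<cdot> (eX \<otimes> \<one> Y))) \<cdot> dup_tensor = \<one> (X \<odot> Y)"
proof -
  let ?Q = "X \<odot> Y" and ?YY = "Y \<odot> Y"
  have "((\<rr> X \<cdot> (\<one> X \<otimes> eY)) \<otimes> (\<ll> Y \<cdot> (eX \<otimes> \<one> Y)))
     = (\<one> X \<otimes> DelX Y) \<cdot> ((\<rr> X \<otimes> \<one> ?Q) \<cdot> (\<one> X \<otimes> eY \<otimes> \<one> ?Q))"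
    by (simp add: merge del_on_def)
  also have "\<dots> = (\<one> X \<otimes> DelX Y) \<cdot> ((\<one> X \<otimes> DelY ?Q) \<cdot> \<alpha> X Y ?Q)"
    by (simp add: triangle[symmetric] del_on_def[of eY] whisker nat)
  finally have "((\<rr> X \<cdot> (\<one> X \<otimes> eY)) \<otimes> (\<ll> Y \<cdot> (eX \<otimes> \<one> Y))) \<cdot> dup_tensor
     = (\<one> X \<otimes> DelX Y) \<cdot> ((\<one> X \<otimes> DelY ?Q) \<cdot> \<delta>)"
    by (simp add: Assoc_dup_tensor)
  also have "\<dots> = (\<one> X \<otimes> DelX Y) \<cdot> ((\<one> X \<otimes> (DelY ?Q \<cdot> swap X Y Y)) \<cdot> (DupX ?YY \<cdot> (\<one> X \<otimes> dY)))"
    by (simp add: dup_unbracketed_def whisker)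
  also have "\<dots> = (\<one> X \<otimes> (DelX Y \<cdot> (\<one> X \<otimes> DelY Y))) \<cdot> (DupX ?YY \<cdot> (\<one> X \<otimes> dY))"
    by (subst R.swap_E) (simp_all add: whisker)
  also have "\<dots> = (\<one> X \<otimes> DelY Y) \<cdot> (((\<one> X \<otimes> DelX ?YY) \<cdot> DupX ?YY) \<cdot> (\<one> X \<otimes> dY))"
    by (simp add: L.E_nat whisker)
  also have "\<dots> = (\<one> X \<otimes> DelY Y) \<cdot> (\<one> X \<otimes> dY)"
    by (subst L.D_counit_right) simp_all
  also have "\<dots> = \<one> ?Q" by (simp add: merge R.E_self)
  finally show ?thesis .
qed

end

section \<open>Cartesian bicategories\<close>

context symmetric_monoidal_ord_category
begin

lemma Tens_le: "r \<preceq> r' \<Longrightarrow> s \<preceq> s' \<Longrightarrow> r \<otimes> s \<preceq> r' \<otimes> s'"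
  using Tens_mono[of r "Dom C r" "Cod C r" r' s "Dom C s" "Cod C s" s'] by (auto simp: le_def)

lemma adj_Tens:
  assumes "adj f f'" "adj g g'" shows "adj (f \<otimes> g) (f' \<otimes> g')"
proof -
  have t: "f \<in> Arr C" "f' \<in> Arr C" "Dom C f' = Cod C f" "Cod C f' = Dom C f"
     "g \<in> Arr C" "g' \<in> Arr C" "Dom C g' = Cod C g" "Cod C g' = Dom C g"
    using assms by (auto simp: adj_def)
  have "\<one> (Dom C f) \<otimes> \<one> (Dom C g) \<preceq> (f' \<cdot> f) \<otimes> (g' \<cdot> g)"
    "(f \<cdot> f') \<otimes> (g \<cdot> g') \<preceq> \<one> (Cod C f) \<otimes> \<one> (Cod C g)"
    using assms by (auto simp: adj_def simp del: Tens_Ident intro: Tens_le)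
  then show ?thesis using t by (simp add: adj_def merge)
qed

lemma map_Tens [simp]: "is_map C f \<Longrightarrow> is_map C g \<Longrightarrow> is_map C (f \<otimes> g)"
  using adj_Tens adj_map map_adj by blast

lemma right_adj_Tens: "is_map C f \<Longrightarrow> is_map C g \<Longrightarrow> (f \<otimes> g)\<^sup>\<bullet> = f\<^sup>\<bullet> \<otimes> g\<^sup>\<bullet>"
  using adj_Tens right_adj_eq map_adj by blast

lemma structural_maps [simp]:
  "X \<in> Obj C \<Longrightarrow> Y \<in> Obj C \<Longrightarrow> Z \<in> Obj C \<Longrightarrow> is_map C (\<alpha> X Y Z)"
  "X \<in> Obj C \<Longrightarrow> Y \<in> Obj C \<Longrightarrow> Z \<in> Obj C \<Longrightarrow> is_map C (\<beta> X Y Z)"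
  "X \<in> Obj C \<Longrightarrow> Y \<in> Obj C \<Longrightarrow> is_map C (\<sigma> X Y)"
  "X \<in> Obj C \<Longrightarrow> is_map C (\<ll> X)" "X \<in> Obj C \<Longrightarrow> is_map C (\<rr> X)"
  by (auto intro!: iso_map is_isoI[where f = "\<beta> X Y Z" and g = "\<alpha> X Y Z"])

end

context cartesian_bicategory
begin

lemma Dup_typed [simp]:
  assumes "X \<in> Obj C"
  shows "Dup C X \<in> Arr C" "Dom C (Dup C X) = X" "Cod C (Dup C X) = X \<odot> X" "is_map C (Dup C X)"
    "Del C X \<in> Arr C" "Dom C (Del C X) = X" "Cod C (Del C X) = \<I>" "is_map C (Del C X)"
  using comonoid[OF assms] Dup_map[OF assms] Del_map[OF assms] by (auto simp: commutative_comonoid_def)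

lemma comonoid_object: "X \<in> Obj C \<Longrightarrow> comonoid_object C X (Dup C X) (Del C X)"
  by unfold_locales (auto intro: comonoid)

lemmas Dup_coassoc = comonoid_object.coassoc[OF comonoid_object]
lemmas counit = comonoid_object.counit_left[OF comonoid_object] comonoid_object.counit_right[OF comonoid_object]

lemma Dup_le: "\<lbrakk>r \<in> Arr C; X = Cod C r\<rbrakk> \<Longrightarrow> Dup C X \<cdot> r \<preceq> (r \<otimes> r) \<cdot> Dup C (Dom C r)"
  using Dup_lax[of r "Dom C r" "Cod C r"] by (simp add: le_def)

lemma Del_le: "\<lbrakk>r \<in> Arr C; X = Cod C r\<rbrakk> \<Longrightarrow> Del C X \<cdot> r \<preceq> Del C (Dom C r)"
  using Del_lax[of r "Dom C r" "Cod C r"] by (simp add: le_def)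

lemma right_adj_typed [simp]:
  assumes "is_map C f"
  shows "f\<^sup>\<bullet> \<in> Arr C" "Dom C (f\<^sup>\<bullet>) = Cod C f" "Cod C (f\<^sup>\<bullet>) = Dom C f"
  using map_typed[OF assms] by auto

lemma map_Arr: "is_map C f \<Longrightarrow> f \<in> Arr C"
  by (rule map_typed)

text \<open>Lax naturality at a map and at its right adjoint gives the two inequalities.\<close>

lemma Del_nat:
  assumes "is_map C f" "X = Cod C f" shows "Del C X \<cdot> f = Del C (Dom C f)"
proof (rule le_antisym)
  note t [simp] = map_typed(1-4)[OF assms(1)]
  show "Del C X \<cdot> f \<preceq> Del C (Dom C f)" using assms by (intro Del_le) auto
  have "Del C (Dom C f) \<cdot> \<one> (Dom C f) \<preceq> Del C (Dom C f) \<cdot> (f\<^sup>\<bullet> \<cdot> f)"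
    using map_typed[OF assms(1)] by (intro comp_le_right) auto
  also have "\<dots> = (Del C (Dom C f) \<cdot> f\<^sup>\<bullet>) \<cdot> f" by simp
  also have "\<dots> \<preceq> Del C X \<cdot> f"
    using Del_le[of "f\<^sup>\<bullet>" "Dom C f"] assms by (intro comp_le_left) auto
  finally show "Del C (Dom C f) \<preceq> Del C X \<cdot> f" by simp
qed

lemma Dup_nat:
  assumes "is_map C f" "X = Cod C f" shows "Dup C X \<cdot> f = (f \<otimes> f) \<cdot> Dup C (Dom C f)"
proof (rule le_antisym)
  note t [simp] = map_typed(1-4)[OF assms(1)]
  show "Dup C X \<cdot> f \<preceq> (f \<otimes> f) \<cdot> Dup C (Dom C f)" using assms by (intro Dup_le) auto
  have "((f \<otimes> f) \<cdot> Dup C (Dom C f)) \<cdot> \<one> (Dom C f) \<preceq> ((f \<otimes> f) \<cdot> Dup C (Dom C f)) \<cdot> (f\<^sup>\<bullet> \<cdot> f)"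
    using map_typed[OF assms(1)] by (intro comp_le_right) auto
  also have "\<dots> = (f \<otimes> f) \<cdot> ((Dup C (Dom C f) \<cdot> f\<^sup>\<bullet>) \<cdot> f)" by simp
  also have "\<dots> \<preceq> (f \<otimes> f) \<cdot> (((f\<^sup>\<bullet> \<otimes> f\<^sup>\<bullet>) \<cdot> Dup C X) \<cdot> f)"
    using Dup_le[of "f\<^sup>\<bullet>" "Dom C f"] assms by (intro comp_le_left comp_le_right) auto
  also have "\<dots> = ((f \<cdot> f\<^sup>\<bullet>) \<otimes> (f \<cdot> f\<^sup>\<bullet>)) \<cdot> (Dup C X \<cdot> f)"
    using assms by (simp add: merge)
  also have "\<dots> \<preceq> (\<one> X \<otimes> \<one> X) \<cdot> (Dup C X \<cdot> f)"
    using map_typed[OF assms(1)] assms by (intro comp_le_left Tens_le) auto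
  finally show "(f \<otimes> f) \<cdot> Dup C (Dom C f) \<preceq> Dup C X \<cdot> f" using assms by simp
qed

text \<open>The counit of the unit object splits: naturality of the right unitor turns the counit law
  into a right inverse, and lax naturality forces that split map to be the identity.\<close>

lemma Del_unit [simp]: "Del C \<I> = \<one> \<I>"
proof -
  let ?e = "Del C \<I>" and ?d = "Dup C \<I>"
  let ?l = "inv_arr C (\<ll> \<I>)" and ?r = "inv_arr C (\<rr> \<I>)"
  note inv [simp] = iso_inv_arr(2-6)[OF LUnit_typed(4)[OF Obj_Tens(1)], simplified]
    iso_inv_arr(2-6)[OF RUnit_typed(4)[OF Obj_Tens(1)], simplified]
  \<comment> \<open>The factor after the comultiplication makes up for using the right unitor on one side of the
    counit law and the left one on the other.\<close>
  define g where "g = \<rr> \<I> \<cdot> (?d \<cdot> (\<ll> \<I> \<cdot> ?r))"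
  have g [simp]: "g \<in> Arr C" "Dom C g = \<I>" "Cod C g = \<I>" by (simp_all add: g_def)
  have nat: "?e \<cdot> \<rr> \<I> = \<rr> \<I> \<cdot> (?e \<otimes> \<one> \<I>)" using RUnit_nat[of ?e \<I>] by simp
  have *: "(?e \<otimes> \<one> \<I>) \<cdot> ?d = ?l"
  proof (rule iso_mono[of "\<ll> \<I>"])
    show "\<ll> \<I> \<cdot> ((?e \<otimes> \<one> \<I>) \<cdot> ?d) = \<ll> \<I> \<cdot> ?l" using counit(1)[of \<I>] by simp
  qed simp_all
  have "?e \<cdot> g = \<rr> \<I> \<cdot> (((?e \<otimes> \<one> \<I>) \<cdot> ?d) \<cdot> (\<ll> \<I> \<cdot> ?r))"
    by (simp add: g_def comp_extend[OF nat])
  also have "\<dots> = \<one> \<I>" by (simp add: * comp_extend[OF inv(4)])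
  finally have eg: "?e \<cdot> g = \<one> \<I>" .
  have "?e \<cdot> g \<preceq> ?e" using Del_le[of g \<I>] by simp
  then have 1: "\<one> \<I> \<preceq> ?e" by (simp add: eg)
  have "?e \<cdot> ?e = ?e"
    using Del_le[of ?e \<I>] comp_le_left[OF 1, of ?e] by (intro le_antisym) auto
  then have "?e \<cdot> (?e \<cdot> g) = ?e \<cdot> g" by (simp add: comp_extend)
  then show ?thesis by (simp add: eg)
qed

lemma map_to_unit: "is_map C f \<Longrightarrow> Cod C f = \<I> \<Longrightarrow> f = Del C (Dom C f)"
  using Del_nat[of f \<I>] map_Arr[of f] by simp

definition pair :: "'a \<Rightarrow> 'a \<Rightarrow> 'a" where
  "pair r s = (r \<otimes> s) \<cdot> Dup C (Dom C s)"

definition p1 :: "'o \<Rightarrow> 'o \<Rightarrow> 'a" where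
  "p1 X Y = \<rr> X \<cdot> (\<one> X \<otimes> Del C Y)"

definition p2 :: "'o \<Rightarrow> 'o \<Rightarrow> 'a" where
  "p2 X Y = \<ll> Y \<cdot> (Del C X \<otimes> \<one> Y)"

lemma pair_typed [simp]:
  assumes "r \<in> Arr C" "s \<in> Arr C" "Dom C r = Dom C s"
  shows "pair r s \<in> Arr C" "Dom C (pair r s) = Dom C s" "Cod C (pair r s) = Cod C r \<odot> Cod C s"
    "is_map C r \<Longrightarrow> is_map C s \<Longrightarrow> is_map C (pair r s)"
  using assms by (simp_all add: pair_def)

lemma projections_typed [simp]:
  assumes "X \<in> Obj C" "Y \<in> Obj C"
  shows "p1 X Y \<in> Arr C" "Dom C (p1 X Y) = X \<odot> Y" "Cod C (p1 X Y) = X" "is_map C (p1 X Y)"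
    "p2 X Y \<in> Arr C" "Dom C (p2 X Y) = X \<odot> Y" "Cod C (p2 X Y) = Y" "is_map C (p2 X Y)"
  using assms iso_map[OF RUnit_typed(4)] iso_map[OF LUnit_typed(4)] by (simp_all add: p1_def p2_def)

lemma pair_comp_map:
  "\<lbrakk>is_map C f; r \<in> Arr C; s \<in> Arr C; Dom C r = Cod C f; Dom C s = Cod C f\<rbrakk>
    \<Longrightarrow> pair r s \<cdot> f = pair (r \<cdot> f) (s \<cdot> f)"
  using map_Arr[of f] by (simp add: pair_def Dup_nat merge)

lemma Tens_pair:
  "\<lbrakk>r \<in> Arr C; s \<in> Arr C; Dom C r = Dom C s; t \<in> Arr C; u \<in> Arr C; Dom C t = Cod C r; Dom C u = Cod C s\<rbrakk>
    \<Longrightarrow> (t \<otimes> u) \<cdot> pair r s = pair (t \<cdot> r) (u \<cdot> s)"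
  by (simp add: pair_def merge)

lemma p1_pair:
  assumes [simp]: "r \<in> Arr C" "s \<in> Arr C" "Dom C r = Dom C s" "X = Cod C r" "Y = Cod C s"
    and "Del C Y \<cdot> s = Del C (Dom C s)"
  shows "p1 X Y \<cdot> pair r s = r"
proof -
  have "p1 X Y \<cdot> pair r s = (\<rr> X \<cdot> (r \<otimes> \<one> \<I>)) \<cdot> ((\<one> (Dom C s) \<otimes> Del C (Dom C s)) \<cdot> Dup C (Dom C s))"
    using assms(6) by (simp add: p1_def pair_def merge)
  then show ?thesis by (simp add: nat counit)
qed

lemma p2_pair:
  assumes [simp]: "r \<in> Arr C" "s \<in> Arr C" "Dom C r = Dom C s" "X = Cod C r" "Y = Cod C s"
    and "Del C X \<cdot> r = Del C (Dom C r)"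
  shows "p2 X Y \<cdot> pair r s = s"
proof -
  have "p2 X Y \<cdot> pair r s = (\<ll> Y \<cdot> (\<one> \<I> \<otimes> s)) \<cdot> ((Del C (Dom C s) \<otimes> \<one> (Dom C s)) \<cdot> Dup C (Dom C s))"
    using assms(6) by (simp add: p2_def pair_def merge)
  then show ?thesis by (simp add: nat counit)
qed

lemma projection_pair_maps:
  assumes "is_map C f" "is_map C g" "Dom C f = Dom C g" "X = Cod C f" "Y = Cod C g"
  shows "p1 X Y \<cdot> pair f g = f" "p2 X Y \<cdot> pair f g = g"
  using assms map_Arr by (auto intro!: p1_pair p2_pair simp: Del_nat)

text \<open>The uniqueness of comonoid structures enters here: it identifies the comonoid on \<open>X \<odot> Y\<close> with
  the tensor product of those on \<open>X\<close> and \<open>Y\<close>, for which the claim is a computation.\<close>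

lemma pair_projections:
  assumes [simp]: "X \<in> Obj C" "Y \<in> Obj C"
  shows "pair (p1 X Y) (p2 X Y) = \<one> (X \<odot> Y)"
proof -
  interpret P: comonoid_pair C X "Dup C X" "Del C X" Y "Dup C Y" "Del C Y"
    by (intro comonoid_pair.intro comonoid_object symmetric_monoidal_ord_category_axioms) simp_all
  have "is_map C P.dup_tensor"
    by (simp add: P.dup_tensor_def P.dup_unbracketed_def swap_def dup_on_def)
  moreover have "is_map C P.del_tensor"
    by (simp add: P.del_tensor_def del_on_def)
  ultimately have "P.dup_tensor = Dup C (X \<odot> Y)"
    using comonoid_unique[OF _ P.comonoid_tensor] by simp
  with P.projections_dup_tensor show ?thesis
    by (simp add: pair_def p1_def[symmetric] p2_def[symmetric])
qed

lemma Tens_eq_pair: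
  "\<lbrakk>r \<in> Arr C; s \<in> Arr C; X = Dom C r; Y = Dom C s\<rbrakk> \<Longrightarrow> r \<otimes> s = pair (r \<cdot> p1 X Y) (s \<cdot> p2 X Y)"
  by (hypsubst, subst Tens_pair[symmetric]) (simp_all add: pair_projections)

lemma top_le: "\<lbrakk>r \<in> Arr C; X = Dom C r; Y = Cod C r\<rbrakk> \<Longrightarrow> r \<preceq> (Del C Y)\<^sup>\<bullet> \<cdot> Del C X"
  using Del_le[of r Y] by (intro map_transpose_left) auto

text \<open>By the counit laws the inverses of the unitors are maps built from \<open>Dup\<close> and \<open>Del\<close>, and the
  right adjoint of an invertible map is its inverse.\<close>

lemma Dup_adj_Del:
  assumes [simp]: "X \<in> Obj C"
  shows "(Dup C X)\<^sup>\<bullet> \<cdot> (\<one> X \<otimes> (Del C X)\<^sup>\<bullet>) = \<rr> X" "(Dup C X)\<^sup>\<bullet> \<cdot> ((Del C X)\<^sup>\<bullet> \<otimes> \<one> X) = \<ll> X"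
proof -
  have "inverse_arrows C (\<rr> X) ((\<one> X \<otimes> Del C X) \<cdot> Dup C X)" (is "inverse_arrows C _ ?f")
  proof -
    have "?f \<cdot> \<rr> X = (\<one> X \<otimes> Del C X) \<cdot> Dup C X \<cdot> \<rr> X" by simp
    have 1: "\<rr> X \<cdot> ?f = \<one> X" using counit by simp
    then have "\<rr> X \<cdot> (?f \<cdot> \<rr> X) = \<rr> X \<cdot> \<one> (X \<odot> \<I>)" using comp_extend[OF 1, of "\<rr> X"] by simp
    then have "?f \<cdot> \<rr> X = \<one> (X \<odot> \<I>)" by - (rule iso_mono[of "\<rr> X"], simp_all)
    with 1 show ?thesis by (simp add: inverse_arrows_def)
  qed
  then have "adj ?f (\<rr> X)" by (intro inverse_arrows_adj) (auto simp: inverse_arrows_def)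
  then have "?f\<^sup>\<bullet> = \<rr> X" by (rule right_adj_eq)
  then show "(Dup C X)\<^sup>\<bullet> \<cdot> (\<one> X \<otimes> (Del C X)\<^sup>\<bullet>) = \<rr> X"
    by (simp add: right_adj_Comp right_adj_Tens right_adj_Ident)
  have "inverse_arrows C (\<ll> X) ((Del C X \<otimes> \<one> X) \<cdot> Dup C X)" (is "inverse_arrows C _ ?f")
  proof -
    have 1: "\<ll> X \<cdot> ?f = \<one> X" using counit by simp
    then have "\<ll> X \<cdot> (?f \<cdot> \<ll> X) = \<ll> X \<cdot> \<one> (\<I> \<odot> X)" using comp_extend[OF 1, of "\<ll> X"] by simp
    then have "?f \<cdot> \<ll> X = \<one> (\<I> \<odot> X)" by - (rule iso_mono[of "\<ll> X"], simp_all)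
    with 1 show ?thesis by (simp add: inverse_arrows_def)
  qed
  then have "adj ?f (\<ll> X)" by (intro inverse_arrows_adj) (auto simp: inverse_arrows_def)
  then have "?f\<^sup>\<bullet> = \<ll> X" by (rule right_adj_eq)
  then show "(Dup C X)\<^sup>\<bullet> \<cdot> ((Del C X)\<^sup>\<bullet> \<otimes> \<one> X) = \<ll> X"
    by (simp add: right_adj_Comp right_adj_Tens right_adj_Ident)
qed

text \<open>A relation of the form \<open>(Del C X)\<^sup>\<bullet> \<cdot> \<phi>\<close> ignores its target, so meeting with it only imposes
  the predicate \<open>\<phi>\<close> on the source.\<close>

lemma Dup_adj_pair_top:
  assumes [simp]: "r \<in> Arr C" "\<phi> \<in> Arr C" "Dom C \<phi> = Dom C r" "Cod C \<phi> = \<I>" "X = Cod C r"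
  shows "(Dup C X)\<^sup>\<bullet> \<cdot> pair r ((Del C X)\<^sup>\<bullet> \<cdot> \<phi>) = \<rr> X \<cdot> pair r \<phi>"
    "(Dup C X)\<^sup>\<bullet> \<cdot> pair ((Del C X)\<^sup>\<bullet> \<cdot> \<phi>) r = \<ll> X \<cdot> pair \<phi> r"
proof -
  have "pair r ((Del C X)\<^sup>\<bullet> \<cdot> \<phi>) = (\<one> X \<otimes> (Del C X)\<^sup>\<bullet>) \<cdot> pair r \<phi>"
    "pair ((Del C X)\<^sup>\<bullet> \<cdot> \<phi>) r = ((Del C X)\<^sup>\<bullet> \<otimes> \<one> X) \<cdot> pair \<phi> r" by (simp_all add: Tens_pair)
  then show "(Dup C X)\<^sup>\<bullet> \<cdot> pair r ((Del C X)\<^sup>\<bullet> \<cdot> \<phi>) = \<rr> X \<cdot> pair r \<phi>"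
    "(Dup C X)\<^sup>\<bullet> \<cdot> pair ((Del C X)\<^sup>\<bullet> \<cdot> \<phi>) r = \<ll> X \<cdot> pair \<phi> r"
    by (simp_all add: comp_extend[OF Dup_adj_Del(1)] comp_extend[OF Dup_adj_Del(2)])
qed

lemma pair_le: "\<lbrakk>r \<preceq> r'; s \<preceq> s'; Dom C r = Dom C s\<rbrakk> \<Longrightarrow> pair r s \<preceq> pair r' s'"
  using le_typed[of r r'] le_typed[of s s'] by (auto simp: pair_def intro!: comp_le_left Tens_le)

lemma pair_Del:
  assumes [simp]: "r \<in> Arr C"
  shows "\<rr> (Cod C r) \<cdot> pair r (Del C (Dom C r)) = r" "\<ll> (Cod C r) \<cdot> pair (Del C (Dom C r)) r = r"
  using p1_pair[of r "\<one> (Dom C r)" "Cod C r" "Dom C r"] p2_pair[of "\<one> (Dom C r)" r "Dom C r" "Cod C r"]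
  by (simp_all add: p1_def p2_def Tens_pair)

text \<open>The meet is \<open>Dup\<^sup>\<bullet> (r \<otimes> s) Dup\<close>: it lies below both relations because replacing one of them by the
  top relation turns it into the other, and it is the greatest lower bound by lax naturality of
  \<open>Dup\<close>.\<close>

lemma is_meet_pair:
  assumes [simp]: "r \<in> Arr C" "s \<in> Arr C" "Dom C r = Dom C s" "Cod C r = Cod C s"
  shows "is_meet C r s ((Dup C (Cod C s))\<^sup>\<bullet> \<cdot> pair r s)"
proof -
  let ?Y = "Cod C s"
  have t: "r \<preceq> (Del C ?Y)\<^sup>\<bullet> \<cdot> Del C (Dom C s)" "s \<preceq> (Del C ?Y)\<^sup>\<bullet> \<cdot> Del C (Dom C s)"
    by (auto intro: top_le)
  have "(Dup C ?Y)\<^sup>\<bullet> \<cdot> pair r s \<preceq> (Dup C ?Y)\<^sup>\<bullet> \<cdot> pair r ((Del C ?Y)\<^sup>\<bullet> \<cdot> Del C (Dom C s))"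
    by (intro comp_le_right pair_le t) auto
  also have "\<dots> = r" using pair_Del[of r] by (simp add: Dup_adj_pair_top)
  finally have 1: "(Dup C ?Y)\<^sup>\<bullet> \<cdot> pair r s \<preceq> r" .
  have "(Dup C ?Y)\<^sup>\<bullet> \<cdot> pair r s \<preceq> (Dup C ?Y)\<^sup>\<bullet> \<cdot> pair ((Del C ?Y)\<^sup>\<bullet> \<cdot> Del C (Dom C s)) s"
    by (intro comp_le_right pair_le t) auto
  also have "\<dots> = s" using pair_Del[of s] by (simp add: Dup_adj_pair_top)
  finally have 2: "(Dup C ?Y)\<^sup>\<bullet> \<cdot> pair r s \<preceq> s" .
  have 3: "u \<preceq> (Dup C ?Y)\<^sup>\<bullet> \<cdot> pair r s" if "u \<preceq> r" "u \<preceq> s" for u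
  proof (rule map_transpose_left)
    note [simp] = le_typed[OF that(2)]
    have "Dup C ?Y \<cdot> u \<preceq> pair u u" using Dup_le[of u ?Y] by (simp add: pair_def)
    also have "\<dots> \<preceq> pair r s" using that by (intro pair_le) auto
    finally show "Dup C ?Y \<cdot> u \<preceq> pair r s" .
  qed (use le_typed[OF that(2)] in auto)
  from 1 2 3 show ?thesis by (auto simp: is_meet_def le_def)
qed


sublocale meet_ord_category C
  using is_meet_pair by unfold_locales force

lemma meet_eq_pair:
  "\<lbrakk>r \<in> Arr C; s \<in> Arr C; Dom C r = Dom C s; Cod C r = Cod C s\<rbrakk>
    \<Longrightarrow> r \<sqinter> s = (Dup C (Cod C s))\<^sup>\<bullet> \<cdot> pair r s"
  using is_meet_unique[OF meet_is_meet is_meet_pair] by (simp add: parallel_def)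

lemma meet_comp_map:
  assumes "is_map C f" "r \<in> Arr C" "s \<in> Arr C" "Dom C r = Cod C f" "Dom C s = Cod C f" "Cod C r = Cod C s"
  shows "(r \<sqinter> s) \<cdot> f = (r \<cdot> f) \<sqinter> (s \<cdot> f)"
  using assms map_Arr[of f] by (simp add: meet_eq_pair pair_comp_map)

lemma pair_eq_meet:
  assumes [simp]: "r \<in> Arr C" "s \<in> Arr C" "Dom C r = Dom C s" and "X = Cod C r" "Y = Cod C s"
  shows "pair r s = ((p1 X Y)\<^sup>\<bullet> \<cdot> r) \<sqinter> ((p2 X Y)\<^sup>\<bullet> \<cdot> s)"
proof -
  have [simp]: "X \<in> Obj C" "Y \<in> Obj C" "Cod C r = X" "Cod C s = Y" using assms by auto
  have "(Dup C (X \<odot> Y))\<^sup>\<bullet> \<cdot> ((p1 X Y)\<^sup>\<bullet> \<otimes> (p2 X Y)\<^sup>\<bullet>) = (pair (p1 X Y) (p2 X Y))\<^sup>\<bullet>"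
    by (simp add: pair_def right_adj_Comp right_adj_Tens)
  also have "\<dots> = \<one> (X \<odot> Y)" by (simp add: pair_projections right_adj_Ident)
  finally have 1: "(Dup C (X \<odot> Y))\<^sup>\<bullet> \<cdot> ((p1 X Y)\<^sup>\<bullet> \<otimes> (p2 X Y)\<^sup>\<bullet>) = \<one> (X \<odot> Y)" .
  have "((p1 X Y)\<^sup>\<bullet> \<cdot> r) \<sqinter> ((p2 X Y)\<^sup>\<bullet> \<cdot> s) = (Dup C (X \<odot> Y))\<^sup>\<bullet> \<cdot> (((p1 X Y)\<^sup>\<bullet> \<otimes> (p2 X Y)\<^sup>\<bullet>) \<cdot> pair r s)"
    by (simp add: meet_eq_pair Tens_pair)
  then show ?thesis by (simp add: comp_extend[OF 1])
qed

lemma p1_le_pair: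
  "\<lbrakk>r \<in> Arr C; s \<in> Arr C; Dom C r = Dom C s; X = Cod C r; Y = Cod C s\<rbrakk> \<Longrightarrow> p1 X Y \<cdot> pair r s \<preceq> r"
  by (rule map_transpose_left', simp_all add: pair_eq_meet, rule meet_le, simp_all)

text \<open>The restriction of a relation to a predicate on its source. In this form it visibly commutes
  with composition after it (\<open>comp_restrict\<close>); the equivalent form as a meet (\<open>restrict_eq_meet\<close>)
  shows that it is compatible with meets.\<close>

definition restrict_to :: "'a \<Rightarrow> 'a \<Rightarrow> 'a"  (infixl "\<restriction>" 70) where
  "r \<restriction> \<phi> = \<ll> (Cod C r) \<cdot> pair \<phi> r"

lemma restrict_eq_meet:
  "\<lbrakk>r \<in> Arr C; \<phi> \<in> Arr C; Dom C \<phi> = Dom C r; Cod C \<phi> = \<I>\<rbrakk>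
    \<Longrightarrow> r \<restriction> \<phi> = ((Del C (Cod C r))\<^sup>\<bullet> \<cdot> \<phi>) \<sqinter> r"
  by (simp add: restrict_to_def meet_eq_pair Dup_adj_pair_top)

lemma restrict_typed [simp]:
  assumes "r \<in> Arr C" "\<phi> \<in> Arr C" "Dom C \<phi> = Dom C r" "Cod C \<phi> = \<I>"
  shows "r \<restriction> \<phi> \<in> Arr C" "Dom C (r \<restriction> \<phi>) = Dom C r" "Cod C (r \<restriction> \<phi>) = Cod C r"
  using assms by (simp_all add: restrict_to_def)

lemma comp_restrict:
  "\<lbrakk>r \<in> Arr C; \<phi> \<in> Arr C; Dom C \<phi> = Dom C r; Cod C \<phi> = \<I>; t \<in> Arr C; Dom C t = Cod C r\<rbrakk>
    \<Longrightarrow> t \<cdot> (r \<restriction> \<phi>) = (t \<cdot> r) \<restriction> \<phi>"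
  using Tens_pair[of \<phi> r "\<one> \<I>" t] comp_extend[OF LUnit_nat[of t "Cod C t"], of "pair \<phi> r"]
  by (simp add: restrict_to_def)

lemma restrict_comp_map:
  "\<lbrakk>r \<in> Arr C; \<phi> \<in> Arr C; Dom C \<phi> = Dom C r; Cod C \<phi> = \<I>; is_map C f; Cod C f = Dom C r\<rbrakk>
    \<Longrightarrow> (r \<restriction> \<phi>) \<cdot> f = (r \<cdot> f) \<restriction> (\<phi> \<cdot> f)"
  using map_Arr[of f] by (simp add: restrict_to_def pair_comp_map)

lemma restrict_le: "\<lbrakk>r \<in> Arr C; \<phi> \<in> Arr C; Dom C \<phi> = Dom C r; Cod C \<phi> = \<I>\<rbrakk> \<Longrightarrow> r \<restriction> \<phi> \<preceq> r"
  by (simp add: restrict_eq_meet meet_le)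

lemma restrict_mono:
  "\<lbrakk>r \<in> Arr C; Dom C \<phi> = Dom C r; Cod C \<phi> = \<I>; \<phi> \<preceq> \<psi>\<rbrakk> \<Longrightarrow> r \<restriction> \<phi> \<preceq> r \<restriction> \<psi>"
  using le_typed[of \<phi> \<psi>] by (auto simp: restrict_eq_meet intro!: meet_mono comp_le_right)

lemma restrict_meet:
  "\<lbrakk>r \<in> Arr C; s \<in> Arr C; Dom C r = Dom C s; Cod C r = Cod C s; \<phi> \<in> Arr C; Dom C \<phi> = Dom C s; Cod C \<phi> = \<I>\<rbrakk>
    \<Longrightarrow> (r \<restriction> \<phi>) \<sqinter> s = (r \<sqinter> s) \<restriction> \<phi>"
  by (simp add: restrict_eq_meet meet_assoc)

lemma restrict_pair:
  assumes [simp]: "r \<in> Arr C" "s \<in> Arr C" "Dom C r = Dom C s" "\<phi> \<in> Arr C" "Dom C \<phi> = Dom C s" "Cod C \<phi> = \<I>"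
  shows "pair (r \<restriction> \<phi>) s = (pair r s) \<restriction> \<phi>"
  by (simp add: pair_eq_meet comp_restrict restrict_meet)

lemma restrict_predicate:
  "\<lbrakk>\<psi> \<in> Arr C; \<phi> \<in> Arr C; Dom C \<phi> = Dom C \<psi>; Cod C \<phi> = \<I>; Cod C \<psi> = \<I>\<rbrakk> \<Longrightarrow> \<psi> \<restriction> \<phi> = \<phi> \<sqinter> \<psi>"
  by (simp add: restrict_eq_meet right_adj_Ident)

end

section \<open>Converses in bicategories of relations\<close>

context cartesian_bicategory
begin

lemma Assoc_inv_pair:
  assumes [simp]: "r \<in> Arr C" "s \<in> Arr C" "t \<in> Arr C" "Dom C r = Dom C t" "Dom C s = Dom C t"
    and X: "X = Cod C r" "Y = Cod C s" "Z = Cod C t"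
  shows "\<beta> X Y Z \<cdot> pair r (pair s t) = pair (pair r s) t"
proof -
  let ?d = "Dup C (Dom C t)"
  have "\<alpha> X Y Z \<cdot> pair (pair r s) t = (\<alpha> X Y Z \<cdot> (r \<otimes> s \<otimes> t)) \<cdot> ((?d \<otimes> \<one> (Dom C t)) \<cdot> ?d)"
    using X by (simp add: pair_def merge)
  also have "\<dots> = (r \<otimes> (s \<otimes> t)) \<cdot> (\<alpha> (Dom C t) (Dom C t) (Dom C t) \<cdot> ((?d \<otimes> \<one> (Dom C t)) \<cdot> ?d))"
    using X by (simp add: nat)
  also have "\<dots> = pair r (pair s t)"
    by (simp add: Dup_coassoc) (simp add: pair_def merge)
  finally have "\<beta> X Y Z \<cdot> (\<alpha> X Y Z \<cdot> pair (pair r s) t) = \<beta> X Y Z \<cdot> pair r (pair s t)"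
    by (rule arg_cong)
  then show ?thesis using X by simp
qed

lemma total_pred: "\<lbrakk>\<phi> \<in> Arr C; Cod C \<phi> = \<I>\<rbrakk> \<Longrightarrow> \<phi> \<preceq> Del C (Dom C \<phi>)"
  using Del_le[of \<phi> \<I>] by simp

end

context bicategory_of_relations
begin

text \<open>The Frobenius law moves the duplication of \<open>s \<sqinter> b\<close> to \<open>b\<close>, where it is harmless because \<open>b\<close> is a
  map.\<close>

lemma Dup_meet_map:
  assumes b: "is_map C b" and [simp]: "s \<in> Arr C" "Dom C s = Dom C b" "Cod C s = Y" "Cod C b = Y"
  shows "Dup C Y \<cdot> (s \<sqinter> b) = pair (s \<sqinter> b) b"
proof -
  note [simp] = map_Arr[OF b]
  have Y [simp]: "Y \<in> Obj C" using Obj_Dom_Cod(2)[of b] by simp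
  have "Dup C Y \<cdot> (s \<sqinter> b) = (Dup C Y \<cdot> (Dup C Y)\<^sup>\<bullet>) \<cdot> pair s b" by (simp add: meet_eq_pair)
  also have "\<dots> = ((Dup C Y)\<^sup>\<bullet> \<otimes> \<one> Y) \<cdot> (\<beta> Y Y Y \<cdot> ((\<one> Y \<otimes> Dup C Y) \<cdot> pair s b))"
    by (simp only: frobenius Y) simp
  also have "(\<one> Y \<otimes> Dup C Y) \<cdot> pair s b = pair s (pair b b)"
    using Dup_nat[OF b, of Y] by (simp add: Tens_pair) (simp add: pair_def)
  also have "\<beta> Y Y Y \<cdot> pair s (pair b b) = pair (pair s b) b"
    by (simp add: Assoc_inv_pair)
  also have "((Dup C Y)\<^sup>\<bullet> \<otimes> \<one> Y) \<cdot> \<dots> = pair (s \<sqinter> b) b"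
    by (simp add: Tens_pair meet_eq_pair)
  finally show ?thesis .
qed

text \<open>All that will be needed of the Frobenius law: whether a value of a map \<open>b\<close> belongs to \<open>s\<close> is a
  matter of the source alone, so \<open>s \<sqinter> b\<close> is \<open>b\<close> on the points where the two meet.\<close>

lemma meet_map_restrict:
  assumes b: "is_map C b" and [simp]: "s \<in> Arr C" "Dom C s = Dom C b" "Cod C s = Y" "Cod C b = Y"
  shows "s \<sqinter> b = b \<restriction> (Del C Y \<cdot> (s \<sqinter> b))" "b \<sqinter> s = b \<restriction> (Del C Y \<cdot> (b \<sqinter> s))"
proof -
  note [simp] = map_Arr[OF b]
  have Y [simp]: "Y \<in> Obj C" using Obj_Dom_Cod(2)[of b] by simp
  have 1: "(Del C Y \<otimes> \<one> Y) \<cdot> (Dup C Y \<cdot> (s \<sqinter> b)) = pair (Del C Y \<cdot> (s \<sqinter> b)) b"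
    by (simp only: Dup_meet_map assms) (simp add: Tens_pair)
  have "s \<sqinter> b = (\<ll> Y \<cdot> ((Del C Y \<otimes> \<one> Y) \<cdot> Dup C Y)) \<cdot> (s \<sqinter> b)" by (simp only: counit Y) simp
  also have "\<dots> = b \<restriction> (Del C Y \<cdot> (s \<sqinter> b))" using 1 by (simp add: restrict_to_def)
  finally show *: "s \<sqinter> b = b \<restriction> (Del C Y \<cdot> (s \<sqinter> b))" .
  show "b \<sqinter> s = b \<restriction> (Del C Y \<cdot> (b \<sqinter> s))" using * by (simp add: meet_commute[of b s])
qed

text \<open>Converses as adjoints with respect to the bilinear form that sends two relations with a common
  source to the predicate saying that their values meet. Closure under composition and symmetry are
  then clear. The test relations \<open>a\<close> and \<open>b\<close> range over all relations, not only over maps: the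
  proof of the modular law substitutes meets for them.\<close>

definition conv_of :: "'a \<Rightarrow> 'a \<Rightarrow> bool" where
  "conv_of r r' \<longleftrightarrow> r \<in> Arr C \<and> r' \<in> Arr C \<and> Dom C r' = Cod C r \<and> Cod C r' = Dom C r \<and>
     (\<forall>a \<in> Arr C. \<forall>b \<in> Arr C. Dom C a = Dom C b \<and> Cod C a = Dom C r \<and> Cod C b = Cod C r \<longrightarrow>
        Del C (Cod C r) \<cdot> ((r \<cdot> a) \<sqinter> b) = Del C (Dom C r) \<cdot> (a \<sqinter> (r' \<cdot> b)))"

lemma conv_ofD:
  assumes "conv_of r r'"
  shows "r \<in> Arr C" "r' \<in> Arr C" "Dom C r' = Cod C r" "Cod C r' = Dom C r"
    "\<lbrakk>a \<in> Arr C; b \<in> Arr C; Dom C a = Dom C b; Cod C a = Dom C r; Cod C b = Cod C r; X = Dom C r; Y = Cod C r\<rbrakk> \<Longrightarrow>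
        Del C Y \<cdot> ((r \<cdot> a) \<sqinter> b) = Del C X \<cdot> (a \<sqinter> (r' \<cdot> b))"
  using assms by (auto simp: conv_of_def)

lemma conv_of_sym: "conv_of r r' \<Longrightarrow> conv_of r' r"
  unfolding conv_of_def by (auto simp: meet_commute)

lemma conv_of_Ident: "X \<in> Obj C \<Longrightarrow> conv_of (\<one> X) (\<one> X)"
  by (simp add: conv_of_def)

lemma conv_of_Comp: "\<lbrakk>conv_of r r'; conv_of s s'; Dom C s = Cod C r\<rbrakk> \<Longrightarrow> conv_of (s \<cdot> r) (r' \<cdot> s')"
  unfolding conv_of_def by simp

text \<open>The order is detected on graphs: the predicate \<open>e (r p\<^sub>1 \<sqinter> p\<^sub>2)\<close> determines \<open>r p\<^sub>1 \<sqinter> p\<^sub>2\<close> since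
  \<open>p\<^sub>2\<close> is a map, and precomposing the latter with \<open>pair \<one> r\<close> gives \<open>r \<sqinter> r = r\<close>.\<close>

lemma graph_le:
  assumes [simp]: "r \<in> Arr C" "s \<in> Arr C" "X = Dom C r" "Dom C s = Dom C r" "Y = Cod C r" "Cod C s = Cod C r"
    and le: "Del C Y \<cdot> ((r \<cdot> p1 X Y) \<sqinter> p2 X Y) \<preceq> Del C Y \<cdot> ((s \<cdot> p1 X Y) \<sqinter> p2 X Y)"
  shows "r \<preceq> s"
proof -
  have X: "Dom C r = X" "Cod C r = Y" "Dom C s = X" "Cod C s = Y" "X \<in> Obj C" "Y \<in> Obj C" by auto
  note [simp] = X and [simp del] = assms(3,5) assms(4,6)
  let ?p = "p1 X Y" and ?q = "p2 X Y"
  have "(r \<cdot> ?p) \<sqinter> ?q = ?q \<restriction> (Del C Y \<cdot> ((r \<cdot> ?p) \<sqinter> ?q))" by (rule meet_map_restrict) simp_all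
  also have "\<dots> \<preceq> ?q \<restriction> (Del C Y \<cdot> ((s \<cdot> ?p) \<sqinter> ?q))" by (rule restrict_mono) (simp_all add: le)
  also have "\<dots> = (s \<cdot> ?p) \<sqinter> ?q" by (rule meet_map_restrict[symmetric]) simp_all
  also have "\<dots> \<preceq> s \<cdot> ?p" by (rule meet_le) simp_all
  finally have 1: "((r \<cdot> ?p) \<sqinter> ?q) \<cdot> pair (\<one> X) r \<preceq> (s \<cdot> ?p) \<cdot> pair (\<one> X) r"
    by (rule comp_le_left) simp_all
  have "((r \<cdot> ?p) \<sqinter> ?q) = (Dup C Y)\<^sup>\<bullet> \<cdot> (r \<otimes> \<one> Y)"
    using Tens_eq_pair[of r "\<one> Y" X Y] by (simp add: meet_eq_pair)
  then have "((r \<cdot> ?p) \<sqinter> ?q) \<cdot> pair (\<one> X) r = r \<sqinter> r"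
    by (simp add: Tens_pair meet_eq_pair[of r r])
  then have "r = ((r \<cdot> ?p) \<sqinter> ?q) \<cdot> pair (\<one> X) r" by (simp add: meet_absorb)
  also note 1
  also have "(s \<cdot> ?p) \<cdot> pair (\<one> X) r \<preceq> s"
    using comp_le_right[OF p1_le_pair[of "\<one> X" r X Y], of s] by simp
  finally show ?thesis .
qed

lemma conv_of_mono:
  assumes "conv_of r r'" "conv_of s s'" "r \<preceq> s" shows "r' \<preceq> s'"
proof -
  note t [simp] = conv_ofD(1-4)[OF assms(1)] conv_ofD(1-4)[OF assms(2)] le_typed(3,4)[OF assms(3)]
  let ?X = "Dom C s" and ?Y = "Cod C s"
  let ?p = "p1 ?Y ?X" and ?q = "p2 ?Y ?X"
  have "Del C ?X \<cdot> ((r' \<cdot> ?p) \<sqinter> ?q) = Del C ?Y \<cdot> (?p \<sqinter> (r \<cdot> ?q))"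
    by (rule conv_ofD(5)[OF conv_of_sym[OF assms(1)]]) simp_all
  also have "\<dots> \<preceq> Del C ?Y \<cdot> (?p \<sqinter> (s \<cdot> ?q))"
    using assms(3) by (auto intro!: comp_le_right meet_mono comp_le_left)
  also have "\<dots> = Del C ?X \<cdot> ((s' \<cdot> ?p) \<sqinter> ?q)"
    by (rule conv_ofD(5)[OF conv_of_sym[OF assms(2)], symmetric]) simp_all
  finally show ?thesis by - (rule graph_le[of _ _ ?Y ?X], simp_all)
qed

lemma conv_of_unique: "conv_of r r' \<Longrightarrow> conv_of r r'' \<Longrightarrow> r' = r''"
  using conv_of_mono[of r r' r r''] conv_of_mono[of r r'' r r'] conv_ofD(1) by (auto intro: le_antisym)

text \<open>The converse relates \<open>y\<close> to those \<open>x\<close> for which \<open>(x, y)\<close> satisfies the graph predicate \<open>\<phi>\<close> of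
  \<open>r\<close>. It suffices to compare the graph predicates of \<open>r\<close> and \<open>r'\<close>, because arbitrary test relations
  arise from the projections by precomposition with their pairing.\<close>

lemma conv_of_exists:
  assumes r [simp]: "r \<in> Arr C"
  shows "\<exists>r'. conv_of r r'"
proof -
  define X Y where "X = Dom C r" and "Y = Cod C r"
  have [simp]: "Dom C r = X" "Cod C r = Y" "X \<in> Obj C" "Y \<in> Obj C" by (simp_all add: X_def Y_def)
  define Q where "Q = X \<odot> Y"
  have Q [simp]: "X \<odot> Y = Q" "Q \<in> Obj C" by (simp_all add: Q_def)
  define p q where "p = p1 X Y" and "q = p2 X Y"
  have pq [simp]: "p \<in> Arr C" "Dom C p = Q" "Cod C p = X" "is_map C p"
    "q \<in> Arr C" "Dom C q = Q" "Cod C q = Y" "is_map C q"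
    by (simp_all add: p_def q_def)
  define \<phi> where "\<phi> = Del C Y \<cdot> ((r \<cdot> p) \<sqinter> q)"
  have \<phi> [simp]: "\<phi> \<in> Arr C" "Dom C \<phi> = Q" "Cod C \<phi> = \<I>" by (simp_all add: \<phi>_def)
  define r' where "r' = (p \<restriction> \<phi>) \<cdot> q\<^sup>\<bullet>"
  have r' [simp]: "r' \<in> Arr C" "Dom C r' = Y" "Cod C r' = X" by (simp_all add: r'_def)
  have graph: "(Dup C X)\<^sup>\<bullet> \<cdot> (\<one> X \<otimes> s) = p1 X Z \<sqinter> (s \<cdot> p2 X Z)"
    if "s \<in> Arr C" "Dom C s = Z" "Cod C s = X" for s Z
  proof -
    have [simp]: "Z \<in> Obj C" using that Obj_Dom_Cod(1)[of s] by simp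
    show ?thesis using that Tens_eq_pair[of "\<one> X" s X Z] by (simp add: meet_eq_pair)
  qed
  have "Del C X \<cdot> (p \<sqinter> (r' \<cdot> q)) = \<phi>"
  proof (rule le_antisym)
    have qq: "\<one> Q \<preceq> q\<^sup>\<bullet> \<cdot> q" using map_typed(5)[OF pq(8)] by simp
    have "\<phi> = Del C Q \<restriction> \<phi>"
      using meet_absorb[OF total_pred[OF \<phi>(1,3)]] by (simp add: restrict_predicate)
    also have "\<dots> = Del C X \<cdot> (p \<restriction> \<phi>)" by (simp add: comp_restrict Del_nat)
    also have "\<dots> \<preceq> Del C X \<cdot> (p \<sqinter> (r' \<cdot> q))"
      using comp_le_right[OF qq, of "p \<restriction> \<phi>"]
      by (auto intro!: comp_le_right le_meet restrict_le simp: r'_def)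
    finally show "\<phi> \<preceq> Del C X \<cdot> (p \<sqinter> (r' \<cdot> q))" .
    define P where "P = X \<odot> Q"
    have P [simp]: "X \<odot> Q = P" "P \<in> Obj C" by (simp_all add: P_def)
    define u v where "u = p1 X Q" and "v = p2 X Q"
    have uv [simp]: "u \<in> Arr C" "Dom C u = P" "Cod C u = X" "is_map C u"
      "v \<in> Arr C" "Dom C v = P" "Cod C v = Q" "is_map C v"
      by (simp_all add: u_def v_def)
    \<comment> \<open>\<open>P\<close> consists of triples \<open>(x, (x', y))\<close>, and \<open>\<psi>\<close> says that \<open>x = x'\<close>; under \<open>\<psi>\<close> the predicate
      \<open>\<phi> (x', y)\<close> may be replaced by \<open>\<phi> (x, y)\<close>.\<close>
    define \<psi> where "\<psi> = Del C X \<cdot> (u \<sqinter> (p \<cdot> v))"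
    have \<psi> [simp]: "\<psi> \<in> Arr C" "Dom C \<psi> = P" "Cod C \<psi> = \<I>" by (simp_all add: \<psi>_def)
    have "pair (p \<cdot> v) (q \<cdot> v) = v"
      using pair_comp_map[of v p q] by (simp add: p_def q_def pair_projections)
    then have "v \<restriction> \<psi> = pair ((p \<cdot> v) \<restriction> \<psi>) (q \<cdot> v)" by (simp add: restrict_pair)
    also have "(p \<cdot> v) \<restriction> \<psi> = u \<sqinter> (p \<cdot> v)"
      unfolding \<psi>_def by (rule meet_map_restrict[symmetric]) simp_all
    also have "pair (u \<sqinter> (p \<cdot> v)) (q \<cdot> v) \<preceq> pair u (q \<cdot> v)"
      by (auto intro!: pair_le meet_le)
    also have "pair u (q \<cdot> v) = \<one> X \<otimes> q"
      using Tens_eq_pair[of "\<one> X" q X Q] by (simp add: u_def v_def)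
    finally have v\<psi>: "v \<restriction> \<psi> \<preceq> \<one> X \<otimes> q" .
    have "Del C X \<cdot> ((Dup C X)\<^sup>\<bullet> \<cdot> (\<one> X \<otimes> (p \<restriction> \<phi>))) = Del C X \<cdot> (u \<sqinter> ((p \<cdot> v) \<restriction> (\<phi> \<cdot> v)))"
      by (simp add: graph restrict_comp_map u_def[symmetric] v_def[symmetric])
    also have "\<dots> = Del C X \<cdot> ((u \<sqinter> (p \<cdot> v)) \<restriction> (\<phi> \<cdot> v))"
      using restrict_meet[of "p \<cdot> v" u "\<phi> \<cdot> v"] by (simp add: meet_commute[of u])
    also have "\<dots> = \<psi> \<restriction> (\<phi> \<cdot> v)" by (simp add: comp_restrict \<psi>_def)
    also have "\<dots> = (\<phi> \<cdot> v) \<restriction> \<psi>" by (simp add: restrict_predicate meet_commute)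
    also have "\<dots> = \<phi> \<cdot> (v \<restriction> \<psi>)" by (simp add: comp_restrict)
    also have "\<dots> \<preceq> \<phi> \<cdot> (\<one> X \<otimes> q)" using v\<psi> by (rule comp_le_right) simp_all
    finally have 1: "Del C X \<cdot> ((Dup C X)\<^sup>\<bullet> \<cdot> (\<one> X \<otimes> (p \<restriction> \<phi>))) \<preceq> \<phi> \<cdot> (\<one> X \<otimes> q)" .
    have "Del C X \<cdot> (p \<sqinter> (r' \<cdot> q)) = (Del C X \<cdot> ((Dup C X)\<^sup>\<bullet> \<cdot> (\<one> X \<otimes> (p \<restriction> \<phi>)))) \<cdot> (\<one> X \<otimes> q\<^sup>\<bullet>)"
      using graph[of r' Y] by (simp add: p_def[symmetric] q_def[symmetric] merge) (simp add: r'_def)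
    also have "\<dots> \<preceq> (\<phi> \<cdot> (\<one> X \<otimes> q)) \<cdot> (\<one> X \<otimes> q\<^sup>\<bullet>)"
      using 1 by (rule comp_le_left) simp_all
    also have "\<dots> = \<phi> \<cdot> (\<one> X \<otimes> (q \<cdot> q\<^sup>\<bullet>))" by (simp add: merge)
    also have "\<dots> \<preceq> \<phi> \<cdot> (\<one> X \<otimes> \<one> Y)"
      using map_typed(6)[OF pq(8)] by (intro comp_le_right Tens_le) simp_all
    finally show "Del C X \<cdot> (p \<sqinter> (r' \<cdot> q)) \<preceq> \<phi>" by simp
  qed
  then have eq: "Del C Y \<cdot> ((Dup C Y)\<^sup>\<bullet> \<cdot> (r \<otimes> \<one> Y)) = Del C X \<cdot> ((Dup C X)\<^sup>\<bullet> \<cdot> (\<one> X \<otimes> r'))"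
    using graph[of r' Y] Tens_eq_pair[of r "\<one> Y" X Y]
    by (simp add: p_def[symmetric] q_def[symmetric] \<phi>_def meet_eq_pair)
  have "Del C Y \<cdot> ((r \<cdot> a) \<sqinter> b) = Del C X \<cdot> (a \<sqinter> (r' \<cdot> b))"
    if [simp]: "a \<in> Arr C" "b \<in> Arr C" "Dom C a = Dom C b" "Cod C a = X" "Cod C b = Y" for a b
  proof -
    have "Del C Y \<cdot> ((r \<cdot> a) \<sqinter> b) = (Del C Y \<cdot> ((Dup C Y)\<^sup>\<bullet> \<cdot> (r \<otimes> \<one> Y))) \<cdot> pair a b"
      by (simp add: Tens_pair meet_eq_pair)
    also have "\<dots> = Del C X \<cdot> (a \<sqinter> (r' \<cdot> b))"
      unfolding eq by (simp add: Tens_pair meet_eq_pair)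
    finally show ?thesis .
  qed
  then have "conv_of r r'" by (simp add: conv_of_def)
  then show ?thesis ..
qed

definition conv :: "'a \<Rightarrow> 'a" where
  "conv r = (SOME r'. conv_of r r')"

lemma conv: "r \<in> Arr C \<Longrightarrow> conv_of r (conv r)"
  unfolding conv_def using conv_of_exists by (rule someI_ex)

lemma conv_eq: "conv_of r r' \<Longrightarrow> conv r = r'"
  using conv conv_of_unique conv_ofD(1) by blast

lemma conv_typed [simp]:
  "r \<in> Arr C \<Longrightarrow> conv r \<in> Arr C" "r \<in> Arr C \<Longrightarrow> Dom C (conv r) = Cod C r" "r \<in> Arr C \<Longrightarrow> Cod C (conv r) = Dom C r"
  using conv_ofD[OF conv] by auto

lemma conv_conv: "r \<in> Arr C \<Longrightarrow> conv (conv r) = r"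
  by (rule conv_eq, rule conv_of_sym, rule conv)

lemma conv_mono: "r \<preceq> s \<Longrightarrow> conv r \<preceq> conv s"
  using conv_of_mono[OF conv conv] le_typed by auto

lemma conv_Comp: "\<lbrakk>r \<in> Arr C; s \<in> Arr C; Dom C s = Cod C r\<rbrakk> \<Longrightarrow> conv (s \<cdot> r) = conv r \<cdot> conv s"
  by (rule conv_eq, rule conv_of_Comp) (simp_all add: conv)

text \<open>Tested against the projections \<open>a\<close>, \<open>b\<close>, which are maps, the term \<open>t\<close> on the left only contributes
  the condition \<open>\<phi>\<close> that \<open>t a\<close> meets \<open>b\<close>, equivalently that \<open>a\<close> meets \<open>conv t b\<close>. Being a condition on
  the source, \<open>\<phi>\<close> can be moved from \<open>b\<close> to \<open>a\<close>.\<close>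

lemma modular:
  assumes [simp]: "r \<in> Arr C" "s \<in> Arr C" "t \<in> Arr C" "Dom C r = X" "Cod C r = Y" "Dom C s = Y" "Cod C s = Z"
    "Dom C t = X" "Cod C t = Z"
  shows "(s \<cdot> r) \<sqinter> t \<preceq> (s \<sqinter> (t \<cdot> conv r)) \<cdot> r"
proof (rule graph_le[of _ _ X Z])
  have [simp]: "X \<in> Obj C" "Y \<in> Obj C" "Z \<in> Obj C"
    using Obj_Dom_Cod[of r] Obj_Dom_Cod[of t] by simp_all
  define a b where "a = p1 X Z" and "b = p2 X Z"
  define W where "W = X \<odot> Z"
  have [simp]: "a \<in> Arr C" "b \<in> Arr C" "Dom C a = W" "Cod C a = X" "Dom C b = W" "Cod C b = Z"
    "is_map C a" "is_map C b" by (simp_all add: a_def b_def W_def)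
  let ?w = "s \<sqinter> (t \<cdot> conv r)" and ?m = "conv s \<sqinter> (r \<cdot> conv t)"
  define \<phi> where "\<phi> = Del C Z \<cdot> ((t \<cdot> a) \<sqinter> b)"
  have \<phi> [simp]: "\<phi> \<in> Arr C" "Dom C \<phi> = W" "Cod C \<phi> = \<I>" by (simp_all add: \<phi>_def)
  have \<phi>': "\<phi> = Del C X \<cdot> (a \<sqinter> (conv t \<cdot> b))"
    unfolding \<phi>_def by (rule conv_ofD(5)[OF conv]) simp_all
  have m: "?m \<preceq> conv ?w"
  proof -
    have "conv ?m \<preceq> conv (conv s)" "conv ?m \<preceq> conv (r \<cdot> conv t)"
      by (auto intro!: conv_mono meet_le)
    then have "conv ?m \<preceq> ?w" by (intro le_meet) (simp_all add: conv_Comp conv_conv)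
    from conv_mono[OF this] show ?thesis by (simp add: conv_conv)
  qed
  have "Del C Z \<cdot> (((s \<cdot> r) \<sqinter> t) \<cdot> a \<sqinter> b) = Del C Z \<cdot> ((s \<cdot> (r \<cdot> a)) \<sqinter> ((t \<cdot> a) \<sqinter> b))"
    by (simp add: meet_comp_map meet_assoc)
  also have "\<dots> = Del C Y \<cdot> ((r \<cdot> a) \<sqinter> (conv s \<cdot> ((t \<cdot> a) \<sqinter> b)))"
    by (rule conv_ofD(5)[OF conv]) simp_all
  also have "(t \<cdot> a) \<sqinter> b = b \<restriction> \<phi>" unfolding \<phi>_def by (rule meet_map_restrict) simp_all
  also have "conv s \<cdot> (b \<restriction> \<phi>) = (conv s \<cdot> b) \<restriction> \<phi>" by (simp add: comp_restrict)
  also have "(r \<cdot> a) \<sqinter> \<dots> = ((r \<cdot> a) \<restriction> \<phi>) \<sqinter> (conv s \<cdot> b)"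
    using restrict_meet[of "conv s \<cdot> b" "r \<cdot> a" \<phi>] restrict_meet[of "r \<cdot> a" "conv s \<cdot> b" \<phi>]
    by (simp add: meet_commute[of "r \<cdot> a"] meet_commute[of "(r \<cdot> a) \<restriction> \<phi>"])
  also have "(r \<cdot> a) \<restriction> \<phi> = r \<cdot> (a \<restriction> \<phi>)" by (simp add: comp_restrict)
  also have "a \<restriction> \<phi> = a \<sqinter> (conv t \<cdot> b)" unfolding \<phi>' by (rule meet_map_restrict[symmetric]) simp_all
  also have "Del C Y \<cdot> ((r \<cdot> (a \<sqinter> (conv t \<cdot> b))) \<sqinter> (conv s \<cdot> b))
      \<preceq> Del C Y \<cdot> ((r \<cdot> a) \<sqinter> (conv ?w \<cdot> b))"
  proof (rule comp_le_right[OF le_meet])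
    let ?l = "(r \<cdot> (a \<sqinter> (conv t \<cdot> b))) \<sqinter> (conv s \<cdot> b)"
    have l: "?l \<preceq> r \<cdot> (a \<sqinter> (conv t \<cdot> b))" "?l \<preceq> conv s \<cdot> b" by (auto intro!: meet_le)
    have l1: "r \<cdot> (a \<sqinter> (conv t \<cdot> b)) \<preceq> r \<cdot> a" "r \<cdot> (a \<sqinter> (conv t \<cdot> b)) \<preceq> r \<cdot> (conv t \<cdot> b)"
      by (auto intro!: comp_le_right meet_le)
    show "?l \<preceq> r \<cdot> a" by (rule le_trans[OF l(1) l1(1)])
    have "?l \<preceq> (conv s \<cdot> b) \<sqinter> (r \<cdot> (conv t \<cdot> b))"
      by (intro le_meet l(2) le_trans[OF l(1) l1(2)])
    also have "\<dots> = ?m \<cdot> b" by (simp add: meet_comp_map)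
    also have "\<dots> \<preceq> conv ?w \<cdot> b" using m by (rule comp_le_left) simp_all
    finally show "?l \<preceq> conv ?w \<cdot> b" .
  qed simp_all
  also have "\<dots> = Del C Z \<cdot> ((?w \<cdot> (r \<cdot> a)) \<sqinter> b)"
    by (rule conv_ofD(5)[OF conv, symmetric]) simp_all
  finally show "Del C Z \<cdot> (((s \<cdot> r) \<sqinter> t) \<cdot> p1 X Z \<sqinter> p2 X Z) \<preceq> Del C Z \<cdot> ((?w \<cdot> r) \<cdot> p1 X Z \<sqinter> p2 X Z)"
    by (simp add: a_def b_def)
qed simp_all

end

section \<open>The calculus of maps and converses\<close>

text \<open>The axioms of an allegory, stated for a converse operation on an arbitrary ordered category
  instead of one that is part of the structure. In this way the calculus applies to allegories and,
  with \<open>conv\<close>, to bicategories of relations alike.\<close>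

locale conv_ord_category = meet_ord_category C
  for C :: "('o, 'a, 'z) ord_cat_data_scheme" (structure) +
  fixes cv :: "'a \<Rightarrow> 'a"  ("(_\<^sup>\<circ>)" [1000] 999)
  assumes cv_typed [simp]: "r \<in> Arr C \<Longrightarrow> r\<^sup>\<circ> \<in> Arr C" "r \<in> Arr C \<Longrightarrow> Dom C (r\<^sup>\<circ>) = Cod C r"
      "r \<in> Arr C \<Longrightarrow> Cod C (r\<^sup>\<circ>) = Dom C r"
    and cv_mono: "r \<preceq> s \<Longrightarrow> r\<^sup>\<circ> \<preceq> s\<^sup>\<circ>"
    and cv_Ident [simp]: "X \<in> Obj C \<Longrightarrow> (Ident C X)\<^sup>\<circ> = Ident C X"
    and cv_Comp [simp]: "\<lbrakk>r \<in> Arr C; s \<in> Arr C; Dom C s = Cod C r\<rbrakk> \<Longrightarrow> (s \<cdot> r)\<^sup>\<circ> = r\<^sup>\<circ> \<cdot> s\<^sup>\<circ>"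
    and cv_cv [simp]: "r \<in> Arr C \<Longrightarrow> (r\<^sup>\<circ>)\<^sup>\<circ> = r"
    and modular: "\<lbrakk>r \<in> Arr C; s \<in> Arr C; t \<in> Arr C; Dom C s = Cod C r; Dom C t = Dom C r; Cod C t = Cod C s\<rbrakk>
        \<Longrightarrow> (s \<cdot> r) \<sqinter> t \<preceq> (s \<sqinter> (t \<cdot> r\<^sup>\<circ>)) \<cdot> r"
begin

lemma cv_meet [simp]:
  assumes [simp]: "r \<in> Arr C" "s \<in> Arr C" "Dom C r = Dom C s" "Cod C r = Cod C s"
  shows "(r \<sqinter> s)\<^sup>\<circ> = r\<^sup>\<circ> \<sqinter> s\<^sup>\<circ>"
proof (rule le_antisym)
  show "(r \<sqinter> s)\<^sup>\<circ> \<preceq> r\<^sup>\<circ> \<sqinter> s\<^sup>\<circ>" by (auto intro!: le_meet cv_mono meet_le)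
  have "(r\<^sup>\<circ> \<sqinter> s\<^sup>\<circ>)\<^sup>\<circ> \<preceq> (r\<^sup>\<circ>)\<^sup>\<circ> \<sqinter> (s\<^sup>\<circ>)\<^sup>\<circ>" by (intro le_meet cv_mono meet_le) auto
  from cv_mono[OF this] show "r\<^sup>\<circ> \<sqinter> s\<^sup>\<circ> \<preceq> (r \<sqinter> s)\<^sup>\<circ>" by simp
qed

lemma modular_left:
  assumes [simp]: "r \<in> Arr C" "s \<in> Arr C" "t \<in> Arr C" "Dom C s = Cod C r" "Dom C t = Dom C r" "Cod C t = Cod C s"
  shows "(s \<cdot> r) \<sqinter> t \<preceq> s \<cdot> (r \<sqinter> (s\<^sup>\<circ> \<cdot> t))"
  using cv_mono[OF modular[of "s\<^sup>\<circ>" "r\<^sup>\<circ>" "t\<^sup>\<circ>"]] by simp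

text \<open>The modular law bounds the unit of the adjunction by \<open>(g \<sqinter> f\<^sup>\<circ>) f\<close>.\<close>

lemma adj_le_cv:
  assumes "adj f g" shows "g \<preceq> f\<^sup>\<circ>"
proof -
  note t [simp] = assms[unfolded adj_def, THEN conjunct1] assms[unfolded adj_def, THEN conjunct2, THEN conjunct1]
  have [simp]: "Dom C g = Cod C f" "Cod C g = Dom C f" using assms by (auto simp: adj_def)
  let ?X = "Dom C f"
  have a: "Ident C ?X \<preceq> g \<cdot> f" "f \<cdot> g \<preceq> Ident C (Cod C f)" using assms by (auto simp: adj_def)
  have "Ident C ?X \<preceq> (g \<cdot> f) \<sqinter> Ident C ?X" using a by (intro le_meet) auto
  also have "\<dots> \<preceq> (g \<sqinter> f\<^sup>\<circ>) \<cdot> f" using modular[of f g "Ident C ?X"] by simp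
  finally have "Ident C ?X \<cdot> g \<preceq> ((g \<sqinter> f\<^sup>\<circ>) \<cdot> f) \<cdot> g" by (rule comp_le_left) auto
  then have "g \<preceq> (g \<sqinter> f\<^sup>\<circ>) \<cdot> (f \<cdot> g)" by simp
  also have "\<dots> \<preceq> (g \<sqinter> f\<^sup>\<circ>) \<cdot> Ident C (Cod C f)" using a by (intro comp_le_right) auto
  also have "\<dots> = g \<sqinter> f\<^sup>\<circ>" by simp
  also have "\<dots> \<preceq> f\<^sup>\<circ>" by (rule meet_le) auto
  finally show ?thesis .
qed

lemma adj_cv:
  assumes "adj f g" shows "g = f\<^sup>\<circ>"
proof (rule le_antisym)
  have [simp]: "f \<in> Arr C" "g \<in> Arr C" "Dom C g = Cod C f" "Cod C g = Dom C f" using assms by (auto simp: adj_def)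
  show "g \<preceq> f\<^sup>\<circ>" using assms by (rule adj_le_cv)
  have "Ident C (Dom C f) \<preceq> g \<cdot> f" "f \<cdot> g \<preceq> Ident C (Cod C f)" using assms by (auto simp: adj_def)
  from this[THEN cv_mono] have "adj (g\<^sup>\<circ>) (f\<^sup>\<circ>)" by (simp add: adj_def)
  from adj_le_cv[OF this] show "f\<^sup>\<circ> \<preceq> g" by simp
qed

lemma map_cv: "is_map C f \<Longrightarrow> f\<^sup>\<bullet> = f\<^sup>\<circ>"
  by (rule adj_cv, rule map_adj)

lemma map_unit: "is_map C f \<Longrightarrow> X = Dom C f \<Longrightarrow> Ident C X \<preceq> f\<^sup>\<circ> \<cdot> f"
  and map_counit: "is_map C f \<Longrightarrow> X = Cod C f \<Longrightarrow> f \<cdot> f\<^sup>\<circ> \<preceq> Ident C X"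
  using map_typed(5,6)[of f] map_cv by auto

lemma mapI:
  "\<lbrakk>f \<in> Arr C; Ident C (Dom C f) \<preceq> f\<^sup>\<circ> \<cdot> f; f \<cdot> f\<^sup>\<circ> \<preceq> Ident C (Cod C f)\<rbrakk> \<Longrightarrow> is_map C f"
  by (rule adj_map[of _ "f\<^sup>\<circ>"]) (simp add: adj_def)

lemma map_Arr: "is_map C f \<Longrightarrow> f \<in> Arr C"
  by (rule map_typed)

lemma map_le_eq:
  assumes "is_map C f" "is_map C g" "f \<preceq> g" shows "f = g"
proof (rule le_antisym[OF assms(3)])
  note [simp] = map_Arr[OF assms(1)] map_Arr[OF assms(2)] le_typed(3,4)[OF assms(3)]
  have "g \<cdot> Ident C (Dom C f) \<preceq> g \<cdot> (f\<^sup>\<circ> \<cdot> f)" using map_unit[OF assms(1)] by (intro comp_le_right) auto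
  then have "g \<preceq> g \<cdot> (f\<^sup>\<circ> \<cdot> f)" by simp
  also have "\<dots> \<preceq> g \<cdot> (g\<^sup>\<circ> \<cdot> f)" using assms(3) by (intro comp_le_right comp_le_left cv_mono) auto
  also have "\<dots> = (g \<cdot> g\<^sup>\<circ>) \<cdot> f" by simp
  also have "\<dots> \<preceq> Ident C (Cod C g) \<cdot> f" using map_counit[OF assms(2)] by (intro comp_le_left) auto
  finally show "g \<preceq> f" by simp
qed

lemma meet_comp_map:
  assumes "is_map C f" and [simp]: "r \<in> Arr C" "s \<in> Arr C" "Dom C r = Cod C f" "Dom C s = Cod C f" "Cod C r = Cod C s"
  shows "(r \<sqinter> s) \<cdot> f = (r \<cdot> f) \<sqinter> (s \<cdot> f)"
proof (rule le_antisym)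
  note [simp] = map_Arr[OF assms(1)]
  show "(r \<sqinter> s) \<cdot> f \<preceq> (r \<cdot> f) \<sqinter> (s \<cdot> f)"
    by (intro le_meet comp_le_left meet_le) auto
  have "(r \<cdot> f) \<sqinter> (s \<cdot> f) \<preceq> (r \<sqinter> ((s \<cdot> f) \<cdot> f\<^sup>\<circ>)) \<cdot> f" by (rule modular) auto
  also have "\<dots> \<preceq> (r \<sqinter> (s \<cdot> Ident C (Cod C f))) \<cdot> f"
    using comp_le_right[OF map_counit[OF assms(1)], of "Cod C f" s]
    by (intro comp_le_left meet_mono) auto
  finally show "(r \<cdot> f) \<sqinter> (s \<cdot> f) \<preceq> (r \<sqinter> s) \<cdot> f" by simp
qed

lemma cv_map_comp_meet:
  "\<lbrakk>is_map C f; r \<in> Arr C; s \<in> Arr C; Dom C r = Dom C s; Cod C r = Cod C f; Cod C s = Cod C f\<rbrakk>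
    \<Longrightarrow> f\<^sup>\<circ> \<cdot> (r \<sqinter> s) = (f\<^sup>\<circ> \<cdot> r) \<sqinter> (f\<^sup>\<circ> \<cdot> s)"
  using right_adj_meet[of f r s] by (simp add: map_cv)

lemma le_self_cv_self:
  assumes [simp]: "r \<in> Arr C" shows "r \<preceq> r \<cdot> (r\<^sup>\<circ> \<cdot> r)"
proof -
  have "r \<preceq> (r \<cdot> Ident C (Dom C r)) \<sqinter> r" by (intro le_meet) auto
  also have "\<dots> \<preceq> r \<cdot> (Ident C (Dom C r) \<sqinter> (r\<^sup>\<circ> \<cdot> r))" by (rule modular_left) auto
  also have "\<dots> \<preceq> r \<cdot> (r\<^sup>\<circ> \<cdot> r)" by (intro comp_le_right meet_le) auto
  finally show ?thesis .
qed

lemma coreflexive: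
  assumes "c \<preceq> Ident C X" and X [simp]: "X \<in> Obj C"
  shows "c\<^sup>\<circ> = c" "c \<cdot> c = c"
proof -
  have [simp]: "c \<in> Arr C" "Dom C c = X" "Cod C c = X" using le_typed[OF assms(1)] by auto
  have 0: "c\<^sup>\<circ> \<preceq> Ident C X" using cv_mono[OF assms(1)] by simp
  have 1: "c \<preceq> c\<^sup>\<circ>"
  proof -
    have "c \<preceq> c \<cdot> (c\<^sup>\<circ> \<cdot> c)" by (rule le_self_cv_self) simp
    also have "\<dots> \<preceq> Ident C X \<cdot> (c\<^sup>\<circ> \<cdot> Ident C X)" using assms by (intro comp_le comp_le_right) auto
    finally show ?thesis by simp
  qed
  then show c: "c\<^sup>\<circ> = c" using cv_mono[OF 1] by (intro le_antisym) auto
  show "c \<cdot> c = c"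
  proof (rule le_antisym)
    show "c \<cdot> c \<preceq> c" using comp_le_right[OF assms(1), of c] by simp
    have "c \<preceq> c \<cdot> (c\<^sup>\<circ> \<cdot> c)" by (rule le_self_cv_self) simp
    also have "\<dots> \<preceq> c \<cdot> (Ident C X \<cdot> c)" using 0 by (intro comp_le_right comp_le_left) auto
    finally show "c \<preceq> c \<cdot> c" by simp
  qed
qed

text \<open>A relation contained in a span is cut out by the coreflexive of those points of the apex whose
  images it relates. This reduces statements about arbitrary relations to statements about
  coreflexives.\<close>

lemma le_span_decomp:
  assumes f: "is_map C f" and g: "is_map C g" and r: "r \<preceq> g \<cdot> f\<^sup>\<circ>" and [simp]: "Dom C g = W" "Dom C f = W"
  shows "r = g \<cdot> ((Ident C W \<sqinter> (g\<^sup>\<circ> \<cdot> (r \<cdot> f))) \<cdot> f\<^sup>\<circ>)"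
proof -
  note [simp] = map_Arr[OF f] map_Arr[OF g]
  have [simp]: "W \<in> Obj C" using Obj_Dom_Cod(1)[of f] by simp
  have [simp]: "r \<in> Arr C" "Dom C r = Cod C f" "Cod C r = Cod C g" using le_typed[OF r] by auto
  let ?c = "Ident C W \<sqinter> (g\<^sup>\<circ> \<cdot> (r \<cdot> f))"
  have "r = (g \<cdot> f\<^sup>\<circ>) \<sqinter> r" using meet_absorb[OF r] meet_commute[of r "g \<cdot> f\<^sup>\<circ>"] by simp
  also have "\<dots> \<preceq> (g \<sqinter> (r \<cdot> f)) \<cdot> f\<^sup>\<circ>" using modular[of "f\<^sup>\<circ>" g r] by simp
  also have "\<dots> \<preceq> (g \<cdot> ?c) \<cdot> f\<^sup>\<circ>"
    using modular_left[of "Ident C W" g "r \<cdot> f"] by (intro comp_le_left) auto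
  finally have 1: "r \<preceq> g \<cdot> (?c \<cdot> f\<^sup>\<circ>)" by simp
  have "g \<cdot> (?c \<cdot> f\<^sup>\<circ>) \<preceq> g \<cdot> ((g\<^sup>\<circ> \<cdot> (r \<cdot> f)) \<cdot> f\<^sup>\<circ>)" by (intro comp_le_right comp_le_left meet_le) auto
  also have "\<dots> = (g \<cdot> g\<^sup>\<circ>) \<cdot> (r \<cdot> (f \<cdot> f\<^sup>\<circ>))" by simp
  also have "\<dots> \<preceq> Ident C (Cod C g) \<cdot> (r \<cdot> Ident C (Cod C f))"
    using map_counit[OF f] map_counit[OF g] by (intro comp_le comp_le_right) auto
  finally show ?thesis using 1 by (intro le_antisym) auto
qed

text \<open>The universal property of tabulations. Single-valuedness of \<open>k\<close> is joint monicity; totality is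
  the modular law applied on both sides of \<open>1 \<le> q\<^sup>\<circ> g f\<^sup>\<circ> p\<close>.\<close>

lemma tabulation_factor:
  assumes maps: "is_map C f" "is_map C g" "is_map C p" "is_map C q"
    and [simp]: "Dom C f = Z" "Dom C g = Z" "Dom C p = W" "Dom C q = W" "Cod C p = Cod C f" "Cod C q = Cod C g"
    and mono: "(f\<^sup>\<circ> \<cdot> f) \<sqinter> (g\<^sup>\<circ> \<cdot> g) = Ident C Z" and le: "q \<cdot> p\<^sup>\<circ> \<preceq> g \<cdot> f\<^sup>\<circ>"
  defines "k \<equiv> (f\<^sup>\<circ> \<cdot> p) \<sqinter> (g\<^sup>\<circ> \<cdot> q)"
  shows "is_map C k" "f \<cdot> k = p" "g \<cdot> k = q"
proof -
  note [simp] = maps[THEN map_Arr]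
  have [simp]: "W \<in> Obj C" "Z \<in> Obj C" using Obj_Dom_Cod(1)[of p] Obj_Dom_Cod(1)[of f] by auto
  have k [simp]: "k \<in> Arr C" "Dom C k = W" "Cod C k = Z" by (simp_all add: k_def)
  have k1: "k \<preceq> f\<^sup>\<circ> \<cdot> p" "k \<preceq> g\<^sup>\<circ> \<cdot> q" by (auto simp: k_def intro!: meet_le)
  have k2: "k\<^sup>\<circ> \<preceq> p\<^sup>\<circ> \<cdot> f" "k\<^sup>\<circ> \<preceq> q\<^sup>\<circ> \<cdot> g" using k1[THEN cv_mono] by simp_all
  have 1: "k \<cdot> k\<^sup>\<circ> \<preceq> f\<^sup>\<circ> \<cdot> ((p \<cdot> p\<^sup>\<circ>) \<cdot> f)" "k \<cdot> k\<^sup>\<circ> \<preceq> g\<^sup>\<circ> \<cdot> ((q \<cdot> q\<^sup>\<circ>) \<cdot> g)"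
    using comp_le[OF k2(1) k1(1)] comp_le[OF k2(2) k1(2)] by simp_all
  have "f\<^sup>\<circ> \<cdot> ((p \<cdot> p\<^sup>\<circ>) \<cdot> f) \<preceq> f\<^sup>\<circ> \<cdot> (Ident C (Cod C f) \<cdot> f)"
     "g\<^sup>\<circ> \<cdot> ((q \<cdot> q\<^sup>\<circ>) \<cdot> g) \<preceq> g\<^sup>\<circ> \<cdot> (Ident C (Cod C g) \<cdot> g)"
    using map_counit[OF maps(3)] map_counit[OF maps(4)] by (auto intro!: comp_le_right comp_le_left simp del: Comp_Ident Comp_assoc')
  then have 2: "f\<^sup>\<circ> \<cdot> ((p \<cdot> p\<^sup>\<circ>) \<cdot> f) \<preceq> f\<^sup>\<circ> \<cdot> f" "g\<^sup>\<circ> \<cdot> ((q \<cdot> q\<^sup>\<circ>) \<cdot> g) \<preceq> g\<^sup>\<circ> \<cdot> g" by simp_all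
  have "k \<cdot> k\<^sup>\<circ> \<preceq> (f\<^sup>\<circ> \<cdot> f) \<sqinter> (g\<^sup>\<circ> \<cdot> g)"
    by (intro le_meet le_trans[OF 1(1) 2(1)] le_trans[OF 1(2) 2(2)])
  then have kk: "k \<cdot> k\<^sup>\<circ> \<preceq> Ident C Z" by (simp add: mono)
  let ?I = "Ident C W"
  let ?t = "(q\<^sup>\<circ> \<cdot> g) \<sqinter> (p\<^sup>\<circ> \<cdot> f)"
  have "?I \<cdot> ?I \<preceq> (q\<^sup>\<circ> \<cdot> q) \<cdot> (p\<^sup>\<circ> \<cdot> p)"
    using map_unit[OF maps(3)] map_unit[OF maps(4)] by (intro comp_le) auto
  then have "?I \<preceq> q\<^sup>\<circ> \<cdot> ((q \<cdot> p\<^sup>\<circ>) \<cdot> p)" by simp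
  also have "\<dots> \<preceq> q\<^sup>\<circ> \<cdot> ((g \<cdot> f\<^sup>\<circ>) \<cdot> p)" using le by (intro comp_le_right comp_le_left) auto
  finally have "?I \<preceq> ((q\<^sup>\<circ> \<cdot> g) \<cdot> (f\<^sup>\<circ> \<cdot> p)) \<sqinter> ?I" by (intro le_meet) auto
  also have "\<dots> \<preceq> ?t \<cdot> (f\<^sup>\<circ> \<cdot> p)" using modular[of "f\<^sup>\<circ> \<cdot> p" "q\<^sup>\<circ> \<cdot> g" ?I] by simp
  finally have "?I \<preceq> (?t \<cdot> (f\<^sup>\<circ> \<cdot> p)) \<sqinter> ?I" by (intro le_meet) auto
  also have "\<dots> \<preceq> ?t \<cdot> ((f\<^sup>\<circ> \<cdot> p) \<sqinter> ?t\<^sup>\<circ>)" using modular_left[of "f\<^sup>\<circ> \<cdot> p" ?t ?I] by simp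
  also have "\<dots> \<preceq> k\<^sup>\<circ> \<cdot> k"
  proof (rule comp_le)
    show "?t \<preceq> k\<^sup>\<circ>" by (simp add: k_def meet_commute[of "p\<^sup>\<circ> \<cdot> f"])
    then have "?t\<^sup>\<circ> \<preceq> k" using cv_mono[OF \<open>?t \<preceq> k\<^sup>\<circ>\<close>] by simp
    then show "(f\<^sup>\<circ> \<cdot> p) \<sqinter> ?t\<^sup>\<circ> \<preceq> k" by (rule le_trans[rotated]) (auto intro!: meet_le)
  qed auto
  finally show map: "is_map C k" using kk by (intro mapI) auto
  have "f \<cdot> k \<preceq> f \<cdot> (f\<^sup>\<circ> \<cdot> p)" using k1 by (intro comp_le_right) auto
  also have "\<dots> = (f \<cdot> f\<^sup>\<circ>) \<cdot> p" by simp
  also have "\<dots> \<preceq> Ident C (Cod C f) \<cdot> p" using map_counit[OF maps(1)] by (intro comp_le_left) auto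
  finally show "f \<cdot> k = p" using maps map by (intro map_le_eq) auto
  have "g \<cdot> k \<preceq> g \<cdot> (g\<^sup>\<circ> \<cdot> q)" using k1 by (intro comp_le_right) auto
  also have "\<dots> = (g \<cdot> g\<^sup>\<circ>) \<cdot> q" by simp
  also have "\<dots> \<preceq> Ident C (Cod C g) \<cdot> q" using map_counit[OF maps(2)] by (intro comp_le_left) auto
  finally show "g \<cdot> k = q" using maps map by (intro map_le_eq) auto
qed

lemma domain_meet:
  assumes [simp]: "r \<in> Arr C" "s \<in> Arr C" "Dom C r = W" "Dom C s = W" "Cod C r = Cod C s"
  shows "Ident C W \<sqinter> (r\<^sup>\<circ> \<cdot> s) \<preceq> (r \<sqinter> s)\<^sup>\<circ> \<cdot> (r \<sqinter> s)"
proof -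
  have [simp]: "W \<in> Obj C" using Obj_Dom_Cod(1)[of r] by simp
  let ?I = "Ident C W"
  have "?I \<sqinter> (r\<^sup>\<circ> \<cdot> s) = (r\<^sup>\<circ> \<cdot> s) \<sqinter> ?I" by (rule meet_commute) auto
  also have "\<dots> \<preceq> (r\<^sup>\<circ> \<sqinter> s\<^sup>\<circ>) \<cdot> s" using modular[of s "r\<^sup>\<circ>" ?I] by simp
  finally have "?I \<sqinter> (r\<^sup>\<circ> \<cdot> s) \<preceq> ((r \<sqinter> s)\<^sup>\<circ> \<cdot> s) \<sqinter> ?I" by (intro le_meet) (auto intro!: meet_le)
  also have "\<dots> \<preceq> (r \<sqinter> s)\<^sup>\<circ> \<cdot> (s \<sqinter> (r \<sqinter> s))" using modular_left[of s "(r \<sqinter> s)\<^sup>\<circ>" ?I] by simp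
  also have "\<dots> \<preceq> (r \<sqinter> s)\<^sup>\<circ> \<cdot> (r \<sqinter> s)" by (intro comp_le_right meet_le) auto
  finally show ?thesis .
qed

lemma domain_comp:
  assumes [simp]: "w \<in> Arr C" "g \<in> Arr C" "Dom C g = Cod C w" "Dom C w = W"
  shows "Ident C W \<sqinter> ((g \<cdot> w)\<^sup>\<circ> \<cdot> (g \<cdot> w)) \<preceq> w\<^sup>\<circ> \<cdot> w"
proof -
  have [simp]: "W \<in> Obj C" using Obj_Dom_Cod(1)[of w] by simp
  let ?I = "Ident C W"
  have "?I \<sqinter> ((g \<cdot> w)\<^sup>\<circ> \<cdot> (g \<cdot> w)) = ((w\<^sup>\<circ> \<cdot> (g\<^sup>\<circ> \<cdot> g)) \<cdot> w) \<sqinter> ?I" by (simp add: meet_commute)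
  also have "\<dots> \<preceq> ((w\<^sup>\<circ> \<cdot> (g\<^sup>\<circ> \<cdot> g)) \<sqinter> w\<^sup>\<circ>) \<cdot> w"
    using modular[of w "w\<^sup>\<circ> \<cdot> (g\<^sup>\<circ> \<cdot> g)" ?I] by simp
  also have "\<dots> \<preceq> w\<^sup>\<circ> \<cdot> w" by (intro comp_le_left meet_le) auto
  finally show ?thesis .
qed

end

section \<open>Products of objects related by a dominating span\<close>

text \<open>What unitarity and pre-tabularity amount to: a unit object, and for any two objects a jointly
  monic span of maps under which every relation between them lies.\<close>

locale conv_product_category = conv_ord_category C cv
  for C :: "('o, 'a, 'z) ord_cat_data_scheme" (structure) and cv :: "'a \<Rightarrow> 'a"  ("(_\<^sup>\<circ>)" [1000] 999) +
  fixes U :: 'o and Pr :: "'o \<Rightarrow> 'o \<Rightarrow> 'o"  (infixl "\<times>\<times>" 75) and P1 P2 :: "'o \<Rightarrow> 'o \<Rightarrow> 'a"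
  assumes U_Obj [simp]: "U \<in> Obj C"
    and U_top: "\<lbrakk>r \<in> Arr C; Dom C r = U; Cod C r = U\<rbrakk> \<Longrightarrow> r \<preceq> Ident C U"
    and U_total: "X \<in> Obj C \<Longrightarrow> \<exists>p \<in> Arr C. Dom C p = X \<and> Cod C p = U \<and> Ident C X \<preceq> p\<^sup>\<circ> \<cdot> p"
    and Pr_Obj [simp]: "\<lbrakk>X \<in> Obj C; Y \<in> Obj C\<rbrakk> \<Longrightarrow> X \<times>\<times> Y \<in> Obj C"
    and P1_typed [simp]: "\<lbrakk>X \<in> Obj C; Y \<in> Obj C\<rbrakk> \<Longrightarrow> Dom C (P1 X Y) = X \<times>\<times> Y"
      "\<lbrakk>X \<in> Obj C; Y \<in> Obj C\<rbrakk> \<Longrightarrow> Cod C (P1 X Y) = X" "\<lbrakk>X \<in> Obj C; Y \<in> Obj C\<rbrakk> \<Longrightarrow> is_map C (P1 X Y)"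
    and P2_typed [simp]: "\<lbrakk>X \<in> Obj C; Y \<in> Obj C\<rbrakk> \<Longrightarrow> Dom C (P2 X Y) = X \<times>\<times> Y"
      "\<lbrakk>X \<in> Obj C; Y \<in> Obj C\<rbrakk> \<Longrightarrow> Cod C (P2 X Y) = Y" "\<lbrakk>X \<in> Obj C; Y \<in> Obj C\<rbrakk> \<Longrightarrow> is_map C (P2 X Y)"
    and span_top: "\<lbrakk>r \<in> Arr C; Dom C r = X; Cod C r = Y\<rbrakk> \<Longrightarrow> r \<preceq> P2 X Y \<cdot> (P1 X Y)\<^sup>\<circ>"
    and span_mono: "\<lbrakk>X \<in> Obj C; Y \<in> Obj C\<rbrakk>
      \<Longrightarrow> ((P1 X Y)\<^sup>\<circ> \<cdot> P1 X Y) \<sqinter> ((P2 X Y)\<^sup>\<circ> \<cdot> P2 X Y) = Ident C (X \<times>\<times> Y)"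
begin

lemma P_Arr [simp]: "\<lbrakk>X \<in> Obj C; Y \<in> Obj C\<rbrakk> \<Longrightarrow> P1 X Y \<in> Arr C" "\<lbrakk>X \<in> Obj C; Y \<in> Obj C\<rbrakk> \<Longrightarrow> P2 X Y \<in> Arr C"
  by (auto intro: map_Arr)

definition bang :: "'o \<Rightarrow> 'a" where
  "bang X = (SOME p. p \<in> Arr C \<and> Dom C p = X \<and> Cod C p = U \<and> Ident C X \<preceq> p\<^sup>\<circ> \<cdot> p)"

lemma bang: "X \<in> Obj C \<Longrightarrow> bang X \<in> Arr C \<and> Dom C (bang X) = X \<and> Cod C (bang X) = U \<and> Ident C X \<preceq> (bang X)\<^sup>\<circ> \<cdot> bang X"
  unfolding bang_def by (rule someI_ex) (use U_total in blast)

lemma bang_typed [simp]: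
  assumes [simp]: "X \<in> Obj C"
  shows "bang X \<in> Arr C" "Dom C (bang X) = X" "Cod C (bang X) = U" "is_map C (bang X)"
  using bang[OF assms] U_top[of "bang X \<cdot> (bang X)\<^sup>\<circ>"] by (auto intro!: mapI)

lemma le_bang:
  assumes [simp]: "r \<in> Arr C" "Cod C r = U" "Dom C r = X"
  shows "r \<preceq> bang X"
proof -
  have [simp]: "X \<in> Obj C" using Obj_Dom_Cod(1)[of r] by simp
  have "r \<cdot> Ident C X \<preceq> r \<cdot> ((bang X)\<^sup>\<circ> \<cdot> bang X)"
    using bang[of X] by (intro comp_le_right) auto
  then have "r \<preceq> (r \<cdot> (bang X)\<^sup>\<circ>) \<cdot> bang X" by simp
  also have "\<dots> \<preceq> Ident C U \<cdot> bang X" by (intro comp_le_left U_top) auto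
  finally show ?thesis by simp
qed

lemma map_to_U: "\<lbrakk>is_map C f; Cod C f = U; Dom C f = X\<rbrakk> \<Longrightarrow> f = bang X"
  using le_bang[of f X] map_Arr[of f] Obj_Dom_Cod(1)[of f] by (intro map_le_eq) auto

lemma bang_nat [simp]: "\<lbrakk>is_map C f; Cod C f = X\<rbrakk> \<Longrightarrow> bang X \<cdot> f = bang (Dom C f)"
  using map_Arr[of f] by (intro map_to_U) auto

text \<open>For maps these are pairing and product; for relations the definitions still make sense, but the
  projections need not give back the components.\<close>

definition Tuple :: "'a \<Rightarrow> 'a \<Rightarrow> 'a" where
  "Tuple r s = ((P1 (Cod C r) (Cod C s))\<^sup>\<circ> \<cdot> r) \<sqinter> ((P2 (Cod C r) (Cod C s))\<^sup>\<circ> \<cdot> s)"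

definition Times :: "'a \<Rightarrow> 'a \<Rightarrow> 'a" where
  "Times r s = Tuple (r \<cdot> P1 (Dom C r) (Dom C s)) (s \<cdot> P2 (Dom C r) (Dom C s))"

lemma Tuple_typed [simp]:
  assumes "r \<in> Arr C" "s \<in> Arr C" "Dom C r = Dom C s"
  shows "Tuple r s \<in> Arr C" "Dom C (Tuple r s) = Dom C s" "Cod C (Tuple r s) = Cod C r \<times>\<times> Cod C s"
  using assms by (simp_all add: Tuple_def)

lemma Times_typed [simp]:
  assumes "r \<in> Arr C" "s \<in> Arr C"
  shows "Times r s \<in> Arr C" "Dom C (Times r s) = Dom C r \<times>\<times> Dom C s" "Cod C (Times r s) = Cod C r \<times>\<times> Cod C s"
  using assms by (simp_all add: Times_def)

lemma Tuple_map:
  assumes f: "is_map C f" and g: "is_map C g" and [simp]: "Dom C f = Dom C g" "X = Cod C f" "Y = Cod C g"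
  shows "is_map C (Tuple f g)" "P1 X Y \<cdot> Tuple f g = f" "P2 X Y \<cdot> Tuple f g = g"
proof -
  note [simp] = map_Arr[OF f] map_Arr[OF g]
  have le: "g \<cdot> f\<^sup>\<circ> \<preceq> P2 X Y \<cdot> (P1 X Y)\<^sup>\<circ>" by (rule span_top) auto
  have "is_map C (((P1 X Y)\<^sup>\<circ> \<cdot> f) \<sqinter> ((P2 X Y)\<^sup>\<circ> \<cdot> g))"
    "P1 X Y \<cdot> (((P1 X Y)\<^sup>\<circ> \<cdot> f) \<sqinter> ((P2 X Y)\<^sup>\<circ> \<cdot> g)) = f"
    "P2 X Y \<cdot> (((P1 X Y)\<^sup>\<circ> \<cdot> f) \<sqinter> ((P2 X Y)\<^sup>\<circ> \<cdot> g)) = g"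
    by (rule tabulation_factor[of "P1 X Y" "P2 X Y" f g "X \<times>\<times> Y" "Dom C g"];
      use f g le span_mono in simp)+
  then show "is_map C (Tuple f g)" "P1 X Y \<cdot> Tuple f g = f" "P2 X Y \<cdot> Tuple f g = g"
    by (simp_all add: Tuple_def)
qed

lemma Tuple_map' [simp]: "\<lbrakk>is_map C f; is_map C g; Dom C f = Dom C g\<rbrakk> \<Longrightarrow> is_map C (Tuple f g)"
  by (rule Tuple_map) auto

lemma P_Tuple [simp]:
  assumes "is_map C f" "is_map C g" "Dom C f = Dom C g" "Cod C f = X" "Cod C g = Y"
  shows "P1 X Y \<cdot> Tuple f g = f" "P2 X Y \<cdot> Tuple f g = g"
    "h \<in> Arr C \<Longrightarrow> Cod C h = Dom C g \<Longrightarrow> P1 X Y \<cdot> (Tuple f g \<cdot> h) = f \<cdot> h"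
    "h \<in> Arr C \<Longrightarrow> Cod C h = Dom C g \<Longrightarrow> P2 X Y \<cdot> (Tuple f g \<cdot> h) = g \<cdot> h"
proof -
  show *: "P1 X Y \<cdot> Tuple f g = f" "P2 X Y \<cdot> Tuple f g = g" using Tuple_map[of f g X Y] assms by auto
  note [simp] = map_Arr[OF assms(1)] map_Arr[OF assms(2)] assms(3-)
  have [simp]: "X \<in> Obj C" "Y \<in> Obj C" using Obj_Dom_Cod(2)[of f] Obj_Dom_Cod(2)[of g] by auto
  show "h \<in> Arr C \<Longrightarrow> Cod C h = Dom C g \<Longrightarrow> P1 X Y \<cdot> (Tuple f g \<cdot> h) = f \<cdot> h"
    "h \<in> Arr C \<Longrightarrow> Cod C h = Dom C g \<Longrightarrow> P2 X Y \<cdot> (Tuple f g \<cdot> h) = g \<cdot> h"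
    using * by (simp_all add: comp_extend[OF *(1)] comp_extend[OF *(2)])
qed

lemma Tuple_comp_map:
  "\<lbrakk>is_map C f; r \<in> Arr C; s \<in> Arr C; Dom C r = Cod C f; Dom C s = Cod C f\<rbrakk>
    \<Longrightarrow> Tuple r s \<cdot> f = Tuple (r \<cdot> f) (s \<cdot> f)"
  using map_Arr[of f] by (simp add: Tuple_def meet_comp_map)

lemma Tuple_projections [simp]: "\<lbrakk>X \<in> Obj C; Y \<in> Obj C\<rbrakk> \<Longrightarrow> Tuple (P1 X Y) (P2 X Y) = Ident C (X \<times>\<times> Y)"
  by (simp add: Tuple_def span_mono)

lemma Tuple_ext:
  assumes f: "is_map C f" and g: "is_map C g" and [simp]: "Dom C f = Dom C g" "Cod C f = X \<times>\<times> Y" "Cod C g = X \<times>\<times> Y"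
     "X \<in> Obj C" "Y \<in> Obj C" and eq: "P1 X Y \<cdot> f = P1 X Y \<cdot> g" "P2 X Y \<cdot> f = P2 X Y \<cdot> g"
  shows "f = g"
proof -
  have "h = Tuple (P1 X Y \<cdot> h) (P2 X Y \<cdot> h)" if "is_map C h" "Cod C h = X \<times>\<times> Y" for h
    using Tuple_comp_map[of h "P1 X Y" "P2 X Y"] that map_Arr[of h] by simp
  from this[of f] this[of g] f g eq show ?thesis by simp
qed

lemma Tuple_mono: "\<lbrakk>r \<preceq> r'; s \<preceq> s'; Dom C r = Dom C s\<rbrakk> \<Longrightarrow> Tuple r s \<preceq> Tuple r' s'"
  using le_typed[of r r'] le_typed[of s s'] by (auto simp: Tuple_def intro!: meet_mono comp_le_right)

lemma Tuple_le:
  assumes [simp]: "r \<in> Arr C" "s \<in> Arr C" "Dom C r = Dom C s" "Cod C r = X" "Cod C s = Y"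
  shows "Tuple r s \<preceq> (P1 X Y)\<^sup>\<circ> \<cdot> r" "Tuple r s \<preceq> (P2 X Y)\<^sup>\<circ> \<cdot> s"
proof -
  have [simp]: "X \<in> Obj C" "Y \<in> Obj C" using Obj_Dom_Cod(2)[of r] Obj_Dom_Cod(2)[of s] by auto
  show "Tuple r s \<preceq> (P1 X Y)\<^sup>\<circ> \<cdot> r" "Tuple r s \<preceq> (P2 X Y)\<^sup>\<circ> \<cdot> s"
    by (simp_all add: Tuple_def meet_le)
qed

lemma P2_cv_P1: "\<lbrakk>r \<in> Arr C; Dom C r = Y; Cod C r = X\<rbrakk> \<Longrightarrow> r \<preceq> P1 X Y \<cdot> (P2 X Y)\<^sup>\<circ>"
  using cv_mono[OF span_top[of "r\<^sup>\<circ>" X Y]] Obj_Dom_Cod[of r] by simp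

text \<open>A point of a product is a pair of points: a coreflexive contained in the domains of both
  components is contained in the domain of their pairing.\<close>

lemma domain_Tuple:
  assumes [simp]: "u \<in> Arr C" "v \<in> Arr C" "Dom C u = W" "Dom C v = W"
    and c: "c \<preceq> Ident C W" "c \<preceq> u\<^sup>\<circ> \<cdot> u" "c \<preceq> v\<^sup>\<circ> \<cdot> v"
  shows "c \<preceq> (Tuple u v)\<^sup>\<circ> \<cdot> Tuple u v"
proof -
  define X Y where "X = Cod C u" and "Y = Cod C v"
  have XY [simp]: "Cod C u = X" "Cod C v = Y" "X \<in> Obj C" "Y \<in> Obj C" by (simp_all add: X_def Y_def)
  have [simp]: "W \<in> Obj C" using Obj_Dom_Cod(1)[of u] by simp
  have [simp]: "c \<in> Arr C" "Dom C c = W" "Cod C c = W" using le_typed[OF c(1)] by auto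
  note cc = coreflexive[OF c(1)]
  let ?w = "Tuple u v" and ?T = "P1 X Y \<cdot> (P2 X Y)\<^sup>\<circ>"
  \<comment> \<open>On \<open>c\<close> the relation \<open>v\<close> is defined, so there \<open>u\<close> is contained in the first component of the
    pairing; and a relation is defined wherever a composite with it is.\<close>
  have uc: "u \<cdot> c \<preceq> u" using comp_le_right[OF c(1), of u] by simp
  have "u \<cdot> c \<preceq> u \<cdot> (v\<^sup>\<circ> \<cdot> v)" using c(3) by (intro comp_le_right) auto
  also have "\<dots> = (u \<cdot> v\<^sup>\<circ>) \<cdot> v" by simp
  also have "\<dots> \<preceq> ?T \<cdot> v" by (intro comp_le_left P2_cv_P1) auto
  finally have "u \<cdot> c \<preceq> (P1 X Y \<cdot> ((P2 X Y)\<^sup>\<circ> \<cdot> v)) \<sqinter> u" using uc by (intro le_meet) auto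
  also have "\<dots> \<preceq> P1 X Y \<cdot> (((P2 X Y)\<^sup>\<circ> \<cdot> v) \<sqinter> ((P1 X Y)\<^sup>\<circ> \<cdot> u))"
    by (rule modular_left) auto
  also have "\<dots> = P1 X Y \<cdot> ?w" by (simp add: Tuple_def meet_commute)
  finally have 1: "u \<cdot> c \<preceq> P1 X Y \<cdot> ?w" .
  have "c = c \<cdot> (c \<cdot> c)" using cc by simp
  also have "\<dots> \<preceq> c \<cdot> ((u\<^sup>\<circ> \<cdot> u) \<cdot> c)" using c(2) by (intro comp_le_right comp_le_left) auto
  also have "\<dots> = (u \<cdot> c)\<^sup>\<circ> \<cdot> (u \<cdot> c)" using cc by simp
  also have "\<dots> \<preceq> (P1 X Y \<cdot> ?w)\<^sup>\<circ> \<cdot> (P1 X Y \<cdot> ?w)" using comp_le[OF 1 cv_mono[OF 1]] by simp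
  finally have "c \<preceq> Ident C W \<sqinter> ((P1 X Y \<cdot> ?w)\<^sup>\<circ> \<cdot> (P1 X Y \<cdot> ?w))" using c(1) by (intro le_meet)
  also have "\<dots> \<preceq> ?w\<^sup>\<circ> \<cdot> ?w" by (rule domain_comp) auto
  finally show ?thesis .
qed

text \<open>The fundamental identity of products of relations. The inclusion from right to left is a
  statement about points; a span dominating everything reduces it to coreflexives.\<close>

lemma cv_Tuple_comp_Tuple:
  assumes [simp]: "r \<in> Arr C" "s \<in> Arr C" "Dom C r = Dom C s" "r' \<in> Arr C" "s' \<in> Arr C" "Dom C r' = Dom C s'"
     "Cod C r' = Cod C r" "Cod C s' = Cod C s"
  shows "(Tuple r s)\<^sup>\<circ> \<cdot> Tuple r' s' = (r\<^sup>\<circ> \<cdot> r') \<sqinter> (s\<^sup>\<circ> \<cdot> s')"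
proof (rule le_antisym)
  define X Y Z Z' where "X = Cod C r" and "Y = Cod C s" and "Z = Dom C s" and "Z' = Dom C s'"
  have XY [simp]: "Cod C r = X" "Cod C s = Y" "Dom C s = Z" "Dom C s' = Z'" "X \<in> Obj C" "Y \<in> Obj C"
     "Z \<in> Obj C" "Z' \<in> Obj C"
    by (simp_all add: X_def Y_def Z_def Z'_def)
  let ?a = "P1 X Y" and ?b = "P2 X Y"
  have "(Tuple r s)\<^sup>\<circ> \<cdot> Tuple r' s' \<preceq> (?a\<^sup>\<circ> \<cdot> r)\<^sup>\<circ> \<cdot> (?a\<^sup>\<circ> \<cdot> r')" by (intro comp_le cv_mono Tuple_le) auto
  also have "\<dots> = r\<^sup>\<circ> \<cdot> ((?a \<cdot> ?a\<^sup>\<circ>) \<cdot> r')" by simp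
  also have "\<dots> \<preceq> r\<^sup>\<circ> \<cdot> (Ident C X \<cdot> r')" by (intro comp_le_right comp_le_left map_counit) auto
  finally have 1: "(Tuple r s)\<^sup>\<circ> \<cdot> Tuple r' s' \<preceq> r\<^sup>\<circ> \<cdot> r'" by simp
  have "(Tuple r s)\<^sup>\<circ> \<cdot> Tuple r' s' \<preceq> (?b\<^sup>\<circ> \<cdot> s)\<^sup>\<circ> \<cdot> (?b\<^sup>\<circ> \<cdot> s')" by (intro comp_le cv_mono Tuple_le) auto
  also have "\<dots> = s\<^sup>\<circ> \<cdot> ((?b \<cdot> ?b\<^sup>\<circ>) \<cdot> s')" by simp
  also have "\<dots> \<preceq> s\<^sup>\<circ> \<cdot> (Ident C Y \<cdot> s')" by (intro comp_le_right comp_le_left map_counit) auto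
  finally have 2: "(Tuple r s)\<^sup>\<circ> \<cdot> Tuple r' s' \<preceq> s\<^sup>\<circ> \<cdot> s'" by simp
  from 1 2 show "(Tuple r s)\<^sup>\<circ> \<cdot> Tuple r' s' \<preceq> (r\<^sup>\<circ> \<cdot> r') \<sqinter> (s\<^sup>\<circ> \<cdot> s')" by (rule le_meet)
  define W p q where "W = Z' \<times>\<times> Z" and "p = P1 Z' Z" and "q = P2 Z' Z"
  have W [simp]: "W \<in> Obj C" "p \<in> Arr C" "Dom C p = W" "Cod C p = Z'" "q \<in> Arr C" "Dom C q = W" "Cod C q = Z"
    and pq: "is_map C p" "is_map C q" by (simp_all add: W_def p_def q_def)
  define x where "x = (r\<^sup>\<circ> \<cdot> r') \<sqinter> (s\<^sup>\<circ> \<cdot> s')"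
  have x [simp]: "x \<in> Arr C" "Dom C x = Z'" "Cod C x = Z" by (simp_all add: x_def)
  have x1: "x \<preceq> r\<^sup>\<circ> \<cdot> r'" "x \<preceq> s\<^sup>\<circ> \<cdot> s'" by (auto simp: x_def intro!: meet_le)
  define c where "c = Ident C W \<sqinter> (q\<^sup>\<circ> \<cdot> (x \<cdot> p))"
  have xc: "x = q \<cdot> (c \<cdot> p\<^sup>\<circ>)"
    unfolding c_def by (rule le_span_decomp[OF pq]) (simp_all add: p_def q_def W_def span_top)
  have c [simp]: "c \<in> Arr C" "Dom C c = W" "Cod C c = W" by (simp_all add: c_def)
  let ?u = "(r \<cdot> q) \<sqinter> (r' \<cdot> p)" and ?v = "(s \<cdot> q) \<sqinter> (s' \<cdot> p)"
  have cI: "c \<preceq> Ident C W" by (simp add: c_def meet_le)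
  have c0: "c \<preceq> q\<^sup>\<circ> \<cdot> (x \<cdot> p)" by (simp add: c_def meet_le)
  have cr: "c \<preceq> (r \<cdot> q)\<^sup>\<circ> \<cdot> (r' \<cdot> p)"
    using le_trans[OF c0 comp_le_right[OF comp_le_left[OF x1(1)]]] by simp
  have cs: "c \<preceq> (s \<cdot> q)\<^sup>\<circ> \<cdot> (s' \<cdot> p)"
    using le_trans[OF c0 comp_le_right[OF comp_le_left[OF x1(2)]]] by simp
  have "c \<preceq> (Tuple ?u ?v)\<^sup>\<circ> \<cdot> Tuple ?u ?v"
  proof (rule domain_Tuple)
    show "c \<preceq> ?u\<^sup>\<circ> \<cdot> ?u"
      by (rule le_trans[OF le_meet[OF cI cr]], rule domain_meet) simp_all
    show "c \<preceq> ?v\<^sup>\<circ> \<cdot> ?v"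
      by (rule le_trans[OF le_meet[OF cI cs]], rule domain_meet) simp_all
  qed (use cI in simp_all)
  also have "\<dots> \<preceq> (Tuple (r \<cdot> q) (s \<cdot> q))\<^sup>\<circ> \<cdot> Tuple (r' \<cdot> p) (s' \<cdot> p)"
    by (intro comp_le cv_mono Tuple_mono meet_le) auto
  also have "\<dots> = q\<^sup>\<circ> \<cdot> (((Tuple r s)\<^sup>\<circ> \<cdot> Tuple r' s') \<cdot> p)"
    using pq by (simp add: Tuple_comp_map[symmetric])
  finally have c2: "c \<preceq> q\<^sup>\<circ> \<cdot> (((Tuple r s)\<^sup>\<circ> \<cdot> Tuple r' s') \<cdot> p)" .
  have "x \<preceq> q \<cdot> ((q\<^sup>\<circ> \<cdot> (((Tuple r s)\<^sup>\<circ> \<cdot> Tuple r' s') \<cdot> p)) \<cdot> p\<^sup>\<circ>)"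
    using comp_le_right[OF comp_le_left[OF c2]] by (subst xc) simp
  also have "\<dots> = (q \<cdot> q\<^sup>\<circ>) \<cdot> (((Tuple r s)\<^sup>\<circ> \<cdot> Tuple r' s') \<cdot> (p \<cdot> p\<^sup>\<circ>))" by simp
  also have "\<dots> \<preceq> Ident C Z \<cdot> (((Tuple r s)\<^sup>\<circ> \<cdot> Tuple r' s') \<cdot> Ident C Z')"
    using pq by (intro comp_le comp_le_right map_counit) auto
  finally show "(r\<^sup>\<circ> \<cdot> r') \<sqinter> (s\<^sup>\<circ> \<cdot> s') \<preceq> (Tuple r s)\<^sup>\<circ> \<cdot> Tuple r' s'" by (simp add: x_def)
qed

lemma Times_eq:
  "\<lbrakk>r \<in> Arr C; s \<in> Arr C; Dom C r = X; Dom C s = Y; Cod C r = X'; Cod C s = Y'\<rbrakk> \<Longrightarrow>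
    Times r s = ((P1 X' Y')\<^sup>\<circ> \<cdot> (r \<cdot> P1 X Y)) \<sqinter> ((P2 X' Y')\<^sup>\<circ> \<cdot> (s \<cdot> P2 X Y))"
  using Obj_Dom_Cod[of r] Obj_Dom_Cod[of s] by (simp add: Times_def Tuple_def)

lemma cv_Times: "\<lbrakk>r \<in> Arr C; s \<in> Arr C\<rbrakk> \<Longrightarrow> (Times r s)\<^sup>\<circ> = Times (r\<^sup>\<circ>) (s\<^sup>\<circ>)"
  by (simp add: Times_eq)

lemma Times_Tuple:
  assumes [simp]: "r \<in> Arr C" "s \<in> Arr C" "Dom C r = Dom C s" "t \<in> Arr C" "u \<in> Arr C" "Dom C t = Cod C r" "Dom C u = Cod C s"
  shows "Times t u \<cdot> Tuple r s = Tuple (t \<cdot> r) (u \<cdot> s)"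
proof -
  have "Times t u \<cdot> Tuple r s = ((Times t u)\<^sup>\<circ>)\<^sup>\<circ> \<cdot> Tuple r s" by simp
  also have "(Times t u)\<^sup>\<circ> = Tuple (t\<^sup>\<circ> \<cdot> P1 (Cod C t) (Cod C u)) (u\<^sup>\<circ> \<cdot> P2 (Cod C t) (Cod C u))"
    by (subst cv_Times) (simp_all add: Times_def)
  also have "\<dots>\<^sup>\<circ> \<cdot> Tuple r s = Tuple (t \<cdot> r) (u \<cdot> s)"
    by (subst cv_Tuple_comp_Tuple) (simp_all add: Tuple_def)
  finally show ?thesis .
qed

lemma Times_Comp:
  "\<lbrakk>r \<in> Arr C; s \<in> Arr C; t \<in> Arr C; u \<in> Arr C; Dom C t = Cod C r; Dom C u = Cod C s\<rbrakk>
    \<Longrightarrow> Times t u \<cdot> Times r s = Times (t \<cdot> r) (u \<cdot> s)"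
  by (simp add: Times_def[of r] Times_Tuple) (simp add: Times_def)

lemma Times_Ident: "\<lbrakk>X \<in> Obj C; Y \<in> Obj C\<rbrakk> \<Longrightarrow> Times (Ident C X) (Ident C Y) = Ident C (X \<times>\<times> Y)"
  by (simp add: Times_def)

lemma Times_mono: "\<lbrakk>r \<preceq> r'; s \<preceq> s'\<rbrakk> \<Longrightarrow> Times r s \<preceq> Times r' s'"
  using le_typed[of r r'] le_typed[of s s'] by (auto simp: Times_def intro!: Tuple_mono comp_le_left)

lemma P1_Tuple_map:
  assumes f: "is_map C f" and [simp]: "r \<in> Arr C" "Dom C r = Dom C f" "Cod C r = X" "Cod C f = Y"
  shows "P1 X Y \<cdot> Tuple r f = r"
proof (rule le_antisym)
  note [simp] = map_Arr[OF f]
  have [simp]: "X \<in> Obj C" "Y \<in> Obj C" using Obj_Dom_Cod(2)[of r] Obj_Dom_Cod(2)[of f] by auto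
  let ?a = "P1 X Y" and ?b = "P2 X Y"
  have "?a \<cdot> Tuple r f \<preceq> ?a \<cdot> (?a\<^sup>\<circ> \<cdot> r)" by (intro comp_le_right Tuple_le) auto
  also have "\<dots> = (?a \<cdot> ?a\<^sup>\<circ>) \<cdot> r" by simp
  also have "\<dots> \<preceq> Ident C X \<cdot> r" by (intro comp_le_left map_counit) auto
  finally show "?a \<cdot> Tuple r f \<preceq> r" by simp
  have "r \<cdot> Ident C (Dom C f) \<preceq> r \<cdot> (f\<^sup>\<circ> \<cdot> f)" by (intro comp_le_right map_unit f) auto
  then have "r \<preceq> (r \<cdot> f\<^sup>\<circ>) \<cdot> f" by simp
  also have "\<dots> \<preceq> (?a \<cdot> ?b\<^sup>\<circ>) \<cdot> f" by (intro comp_le_left P2_cv_P1) auto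
  finally have "r \<preceq> (?a \<cdot> (?b\<^sup>\<circ> \<cdot> f)) \<sqinter> r" by (intro le_meet) auto
  also have "\<dots> \<preceq> ?a \<cdot> ((?b\<^sup>\<circ> \<cdot> f) \<sqinter> (?a\<^sup>\<circ> \<cdot> r))" by (rule modular_left) auto
  also have "\<dots> = ?a \<cdot> Tuple r f" by (simp add: Tuple_def meet_commute)
  finally show "r \<preceq> ?a \<cdot> Tuple r f" .
qed

lemma P2_Tuple_map:
  assumes f: "is_map C f" and [simp]: "r \<in> Arr C" "Dom C r = Dom C f" "Cod C r = Y" "Cod C f = X"
  shows "P2 X Y \<cdot> Tuple f r = r"
proof (rule le_antisym)
  note [simp] = map_Arr[OF f]
  have [simp]: "X \<in> Obj C" "Y \<in> Obj C" using Obj_Dom_Cod(2)[of r] Obj_Dom_Cod(2)[of f] by auto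
  let ?a = "P1 X Y" and ?b = "P2 X Y"
  have "?b \<cdot> Tuple f r \<preceq> ?b \<cdot> (?b\<^sup>\<circ> \<cdot> r)" by (intro comp_le_right Tuple_le) auto
  also have "\<dots> = (?b \<cdot> ?b\<^sup>\<circ>) \<cdot> r" by simp
  also have "\<dots> \<preceq> Ident C Y \<cdot> r" by (intro comp_le_left map_counit) auto
  finally show "?b \<cdot> Tuple f r \<preceq> r" by simp
  have "r \<cdot> Ident C (Dom C f) \<preceq> r \<cdot> (f\<^sup>\<circ> \<cdot> f)" by (intro comp_le_right map_unit f) auto
  then have "r \<preceq> (r \<cdot> f\<^sup>\<circ>) \<cdot> f" by simp
  also have "\<dots> \<preceq> (?b \<cdot> ?a\<^sup>\<circ>) \<cdot> f" by (intro comp_le_left span_top) auto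
  finally have "r \<preceq> (?b \<cdot> (?a\<^sup>\<circ> \<cdot> f)) \<sqinter> r" by (intro le_meet) auto
  also have "\<dots> \<preceq> ?b \<cdot> ((?a\<^sup>\<circ> \<cdot> f) \<sqinter> (?b\<^sup>\<circ> \<cdot> r))" by (rule modular_left) auto
  also have "\<dots> = ?b \<cdot> Tuple f r" by (simp add: Tuple_def)
  finally show "r \<preceq> ?b \<cdot> Tuple f r" .
qed

definition assoc :: "'o \<Rightarrow> 'o \<Rightarrow> 'o \<Rightarrow> 'a" where
  "assoc X Y Z = Tuple (P1 X Y \<cdot> P1 (X \<times>\<times> Y) Z) (Tuple (P2 X Y \<cdot> P1 (X \<times>\<times> Y) Z) (P2 (X \<times>\<times> Y) Z))"

definition assoc_inv :: "'o \<Rightarrow> 'o \<Rightarrow> 'o \<Rightarrow> 'a" where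
  "assoc_inv X Y Z = Tuple (Tuple (P1 X (Y \<times>\<times> Z)) (P1 Y Z \<cdot> P2 X (Y \<times>\<times> Z))) (P2 Y Z \<cdot> P2 X (Y \<times>\<times> Z))"

definition exchange :: "'o \<Rightarrow> 'o \<Rightarrow> 'a" where
  "exchange X Y = Tuple (P2 X Y) (P1 X Y)"

definition diag :: "'o \<Rightarrow> 'a" where
  "diag X = Tuple (Ident C X) (Ident C X)"

lemma structure_typed [simp]:
  assumes "X \<in> Obj C" "Y \<in> Obj C" "Z \<in> Obj C"
  shows "assoc X Y Z \<in> Arr C" "Dom C (assoc X Y Z) = X \<times>\<times> Y \<times>\<times> Z" "Cod C (assoc X Y Z) = X \<times>\<times> (Y \<times>\<times> Z)" "is_map C (assoc X Y Z)"
    "assoc_inv X Y Z \<in> Arr C" "Cod C (assoc_inv X Y Z) = X \<times>\<times> Y \<times>\<times> Z" "Dom C (assoc_inv X Y Z) = X \<times>\<times> (Y \<times>\<times> Z)" "is_map C (assoc_inv X Y Z)"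
  using assms by (simp_all add: assoc_def assoc_inv_def)

lemma exchange_typed [simp]:
  assumes "X \<in> Obj C" "Y \<in> Obj C"
  shows "exchange X Y \<in> Arr C" "Dom C (exchange X Y) = X \<times>\<times> Y" "Cod C (exchange X Y) = Y \<times>\<times> X" "is_map C (exchange X Y)"
  using assms by (simp_all add: exchange_def)

lemma diag_typed [simp]:
  assumes "X \<in> Obj C"
  shows "diag X \<in> Arr C" "Dom C (diag X) = X" "Cod C (diag X) = X \<times>\<times> X" "is_map C (diag X)"
  using assms by (simp_all add: diag_def)

lemma Times_map [simp]: "is_map C f \<Longrightarrow> is_map C g \<Longrightarrow> is_map C (Times f g)"
  using map_Arr[of f] map_Arr[of g] by (simp add: Times_def)

lemma assoc_inverse:
  assumes [simp]: "X \<in> Obj C" "Y \<in> Obj C" "Z \<in> Obj C"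
  shows "inverse_arrows C (assoc X Y Z) (assoc_inv X Y Z)"
proof -
  have "assoc_inv X Y Z \<cdot> assoc X Y Z = Ident C (X \<times>\<times> Y \<times>\<times> Z)"
  proof (rule Tuple_ext[of _ _ "X \<times>\<times> Y" Z])
    show "P1 (X \<times>\<times> Y) Z \<cdot> (assoc_inv X Y Z \<cdot> assoc X Y Z) = P1 (X \<times>\<times> Y) Z \<cdot> Ident C (X \<times>\<times> Y \<times>\<times> Z)"
      by (rule Tuple_ext[of _ _ X Y]) (simp_all add: assoc_def assoc_inv_def)
  qed (simp_all add: assoc_def assoc_inv_def)
  moreover have "assoc X Y Z \<cdot> assoc_inv X Y Z = Ident C (X \<times>\<times> (Y \<times>\<times> Z))"
  proof (rule Tuple_ext[of _ _ X "Y \<times>\<times> Z"])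
    show "P2 X (Y \<times>\<times> Z) \<cdot> (assoc X Y Z \<cdot> assoc_inv X Y Z) = P2 X (Y \<times>\<times> Z) \<cdot> Ident C (X \<times>\<times> (Y \<times>\<times> Z))"
      by (rule Tuple_ext[of _ _ Y Z]) (simp_all add: assoc_def assoc_inv_def)
  qed (simp_all add: assoc_def assoc_inv_def)
  ultimately show ?thesis by (simp add: inverse_arrows_def)
qed

lemma inverse_cv: "inverse_arrows C f g \<Longrightarrow> g = f\<^sup>\<circ>"
  by (rule adj_cv, rule inverse_arrows_adj)

text \<open>The associator is the converse of its inverse, which is a pairing of maps; so the fundamental
  identity evaluates it on tuples of arbitrary relations.\<close>

lemma assoc_Tuple:
  assumes [simp]: "r \<in> Arr C" "s \<in> Arr C" "t \<in> Arr C" "Dom C r = Dom C t" "Dom C s = Dom C t"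
    "Cod C r = X" "Cod C s = Y" "Cod C t = Z"
  shows "assoc X Y Z \<cdot> Tuple (Tuple r s) t = Tuple r (Tuple s t)"
proof -
  have [simp]: "X \<in> Obj C" "Y \<in> Obj C" "Z \<in> Obj C"
    using Obj_Dom_Cod(2)[of r] Obj_Dom_Cod(2)[of s] Obj_Dom_Cod(2)[of t] by auto
  have "assoc X Y Z = (assoc_inv X Y Z)\<^sup>\<circ>"
    using inverse_cv[OF assoc_inverse[of X Y Z]] by simp
  then have "assoc X Y Z \<cdot> Tuple (Tuple r s) t =
     (((P1 X (Y \<times>\<times> Z))\<^sup>\<circ> \<cdot> r) \<sqinter> ((P1 Y Z \<cdot> P2 X (Y \<times>\<times> Z))\<^sup>\<circ> \<cdot> s)) \<sqinter> ((P2 Y Z \<cdot> P2 X (Y \<times>\<times> Z))\<^sup>\<circ> \<cdot> t)"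
    by (simp add: assoc_inv_def cv_Tuple_comp_Tuple)
  also have "\<dots> = Tuple r (Tuple s t)"
    by (simp add: Tuple_def meet_assoc cv_map_comp_meet)
  finally show ?thesis .
qed

lemma exchange_inverse:
  assumes [simp]: "X \<in> Obj C" "Y \<in> Obj C"
  shows "exchange Y X \<cdot> exchange X Y = Ident C (X \<times>\<times> Y)"
  by (rule Tuple_ext[of _ _ X Y]) (simp_all add: exchange_def)

lemma exchange_Tuple:
  assumes [simp]: "r \<in> Arr C" "s \<in> Arr C" "Dom C r = Dom C s" "Cod C r = X" "Cod C s = Y"
  shows "exchange X Y \<cdot> Tuple r s = Tuple s r"
proof -
  have [simp]: "X \<in> Obj C" "Y \<in> Obj C" using Obj_Dom_Cod(2)[of r] Obj_Dom_Cod(2)[of s] by auto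
  have "inverse_arrows C (exchange Y X) (exchange X Y)"
    by (simp add: inverse_arrows_def exchange_inverse)
  then have "exchange X Y = (exchange Y X)\<^sup>\<circ>" by (rule inverse_cv)
  then have "exchange X Y \<cdot> Tuple r s = ((P2 Y X)\<^sup>\<circ> \<cdot> r) \<sqinter> ((P1 Y X)\<^sup>\<circ> \<cdot> s)"
    by (simp add: exchange_def cv_Tuple_comp_Tuple)
  also have "\<dots> = Tuple s r" by (simp add: Tuple_def meet_commute)
  finally show ?thesis .
qed

end

section \<open>From products to bicategories of relations\<close>

text \<open>Equality of the fields shared by bicategories of relations and allegories. Everything that is
  defined from the order and the composition is invariant under it.\<close>

definition same_ord_cat :: "('o, 'a, 'z) ord_cat_data_scheme \<Rightarrow> ('o, 'a, 'y) ord_cat_data_scheme \<Rightarrow> bool" where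
  "same_ord_cat C D \<longleftrightarrow> Obj C = Obj D \<and> Arr C = Arr D \<and> Dom C = Dom D \<and> Cod C = Cod D \<and>
     Ident C = Ident D \<and> Comp C = Comp D \<and> Le C = Le D"

lemma same_ord_cat_sym: "same_ord_cat C D \<Longrightarrow> same_ord_cat D C"
  by (simp add: same_ord_cat_def)

lemma same_ord_cat_trans: "same_ord_cat C D \<Longrightarrow> same_ord_cat D E \<Longrightarrow> same_ord_cat C E"
  by (simp add: same_ord_cat_def)

lemma same_ord_catD:
  assumes "same_ord_cat C D"
  shows "Obj C = Obj D" "Arr C = Arr D" "Dom C = Dom D" "Cod C = Cod D" "Ident C = Ident D"
    "Comp C = Comp D" "Le C = Le D"
    and "hom C = hom D" "is_map C = is_map D" "is_iso C = is_iso D" "le C = le D" "is_meet C = is_meet D"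
    "meet C = meet D" "right_adj C = right_adj D" "inv_arr C = inv_arr D"
    "inverse_arrows C = inverse_arrows D"
proof -
  note * = assms[unfolded same_ord_cat_def]
  show h: "hom C = hom D" using * by (simp add: fun_eq_iff set_eq_iff)
  have r: "is_right_adjoint C = is_right_adjoint D"
    using * by (simp add: fun_eq_iff is_right_adjoint_def)
  show "is_map C = is_map D" "right_adj C = right_adj D"
    using r by (simp_all add: fun_eq_iff is_map_def right_adj_def)
  show i: "inverse_arrows C = inverse_arrows D"
    using * by (simp add: fun_eq_iff inverse_arrows_def)
  then show "is_iso C = is_iso D" "inv_arr C = inv_arr D" by (simp_all add: fun_eq_iff is_iso_def inv_arr_def)
  show "le C = le D" using * by (simp add: fun_eq_iff le_def)
  show m: "is_meet C = is_meet D" using * h by (simp add: fun_eq_iff is_meet_def)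
  then show "meet C = meet D" by (simp add: fun_eq_iff meet_def)
qed (use assms in \<open>simp_all add: same_ord_cat_def\<close>)

lemma same_ord_cat_category: "same_ord_cat C D \<Longrightarrow> category C \<longleftrightarrow> category D"
  by (simp add: category_def same_ord_catD)

lemma same_ord_cat_ord_category: "same_ord_cat C D \<Longrightarrow> ord_category C \<longleftrightarrow> ord_category D"
  by (simp add: ord_category_def ord_category_axioms_def same_ord_cat_category same_ord_catD)

context conv_product_category
begin

lemma assoc_nat:
  assumes [simp]: "r \<in> Arr C" "s \<in> Arr C" "t \<in> Arr C"
  shows "assoc (Cod C r) (Cod C s) (Cod C t) \<cdot> Times (Times r s) t
    = Times r (Times s t) \<cdot> assoc (Dom C r) (Dom C s) (Dom C t)"
  by (simp add: Times_def[of "Times r s"] assoc_def[of "Dom C r"] Times_Tuple)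
     (simp add: Times_def[of r s] Tuple_comp_map assoc_Tuple)

lemma LUnit_nat: "r \<in> Arr C \<Longrightarrow> P2 U (Cod C r) \<cdot> Times (Ident C U) r = r \<cdot> P2 U (Dom C r)"
  by (simp add: Times_def P2_Tuple_map)

lemma RUnit_nat: "r \<in> Arr C \<Longrightarrow> P1 (Cod C r) U \<cdot> Times r (Ident C U) = r \<cdot> P1 (Dom C r) U"
  by (simp add: Times_def P1_Tuple_map)

lemma exchange_nat: "\<lbrakk>r \<in> Arr C; s \<in> Arr C\<rbrakk> \<Longrightarrow>
    exchange (Cod C r) (Cod C s) \<cdot> Times r s = Times s r \<cdot> exchange (Dom C r) (Dom C s)"
  by (simp add: Times_def[of r s] exchange_Tuple) (simp add: exchange_def Times_Tuple)

lemma LUnit_inverse: "X \<in> Obj C \<Longrightarrow> inverse_arrows C (P2 U X) (Tuple (bang X) (Ident C X))"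
proof -
  assume [simp]: "X \<in> Obj C"
  have b: "P1 U X = bang (U \<times>\<times> X)" by (rule map_to_U) auto
  have "Tuple (bang X) (Ident C X) \<cdot> P2 U X = Ident C (U \<times>\<times> X)"
    by (rule Tuple_ext[of _ _ U X]) (simp_all add: b)
  then show ?thesis by (simp add: inverse_arrows_def)
qed

lemma RUnit_inverse: "X \<in> Obj C \<Longrightarrow> inverse_arrows C (P1 X U) (Tuple (Ident C X) (bang X))"
proof -
  assume [simp]: "X \<in> Obj C"
  have b: "P2 X U = bang (X \<times>\<times> U)" by (rule map_to_U) auto
  have "Tuple (Ident C X) (bang X) \<cdot> P1 X U = Ident C (X \<times>\<times> U)"
    by (rule Tuple_ext[of _ _ X U]) (simp_all add: b)
  then show ?thesis by (simp add: inverse_arrows_def)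
qed

lemma P_Times:
  assumes f: "is_map C f" and g: "is_map C g" and [simp]: "Cod C f = X" "Cod C g = Y"
  shows "P1 X Y \<cdot> Times f g = f \<cdot> P1 (Dom C f) (Dom C g)"
    "P2 X Y \<cdot> Times f g = g \<cdot> P2 (Dom C f) (Dom C g)"
  using f g map_Arr[OF f] map_Arr[OF g] by (simp_all add: Times_def)

lemma P_assoc:
  assumes [simp]: "X \<in> Obj C" "Y \<in> Obj C" "Z \<in> Obj C"
  shows "P1 X (Y \<times>\<times> Z) \<cdot> assoc X Y Z = P1 X Y \<cdot> P1 (X \<times>\<times> Y) Z"
    "P2 X (Y \<times>\<times> Z) \<cdot> assoc X Y Z = Tuple (P2 X Y \<cdot> P1 (X \<times>\<times> Y) Z) (P2 (X \<times>\<times> Y) Z)"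
  by (simp_all add: assoc_def)

lemma P_exchange:
  assumes [simp]: "X \<in> Obj C" "Y \<in> Obj C"
  shows "P1 Y X \<cdot> exchange X Y = P2 X Y" "P2 Y X \<cdot> exchange X Y = P1 X Y"
  by (simp_all add: exchange_def)

lemmas P_simps = P_Times P_assoc P_exchange comp_extend[OF P_Times(1)] comp_extend[OF P_Times(2)]
  comp_extend[OF P_assoc(1)] comp_extend[OF P_assoc(2)] comp_extend[OF P_exchange(1)] comp_extend[OF P_exchange(2)]

lemma assoc_pentagon:
  assumes [simp]: "W \<in> Obj C" "X \<in> Obj C" "Y \<in> Obj C" "Z \<in> Obj C"
  shows "assoc W X (Y \<times>\<times> Z) \<cdot> assoc (W \<times>\<times> X) Y Z
    = Times (Ident C W) (assoc X Y Z) \<cdot> (assoc W (X \<times>\<times> Y) Z \<cdot> Times (assoc W X Y) (Ident C Z))" (is "?l = ?r")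
proof (rule Tuple_ext[of _ _ W "X \<times>\<times> (Y \<times>\<times> Z)"])
  show "P2 W (X \<times>\<times> (Y \<times>\<times> Z)) \<cdot> ?l = P2 W (X \<times>\<times> (Y \<times>\<times> Z)) \<cdot> ?r"
  proof (rule Tuple_ext[of _ _ X "Y \<times>\<times> Z"])
    show "P2 X (Y \<times>\<times> Z) \<cdot> (P2 W (X \<times>\<times> (Y \<times>\<times> Z)) \<cdot> ?l) = P2 X (Y \<times>\<times> Z) \<cdot> (P2 W (X \<times>\<times> (Y \<times>\<times> Z)) \<cdot> ?r)"
      by (rule Tuple_ext[of _ _ Y Z]) (simp_all add: P_simps)
  qed (simp_all add: P_simps)
qed (simp_all add: P_simps)

lemma assoc_triangle:
  assumes [simp]: "X \<in> Obj C" "Y \<in> Obj C"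
  shows "Times (Ident C X) (P2 U Y) \<cdot> assoc X U Y = Times (P1 X U) (Ident C Y)"
  by (rule Tuple_ext[of _ _ X Y]) (simp_all add: P_simps)

lemma exchange_hexagon:
  assumes [simp]: "X \<in> Obj C" "Y \<in> Obj C" "Z \<in> Obj C"
  shows "assoc Y Z X \<cdot> (exchange X (Y \<times>\<times> Z) \<cdot> assoc X Y Z)
    = Times (Ident C Y) (exchange X Z) \<cdot> (assoc Y X Z \<cdot> Times (exchange X Y) (Ident C Z))" (is "?l = ?r")
proof (rule Tuple_ext[of _ _ Y "Z \<times>\<times> X"])
  show "P2 Y (Z \<times>\<times> X) \<cdot> ?l = P2 Y (Z \<times>\<times> X) \<cdot> ?r"
    by (rule Tuple_ext[of _ _ Z X]) (simp_all add: P_simps)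
qed (simp_all add: P_simps)

lemma diag_eq: "X \<in> Obj C \<Longrightarrow> diag X = (P1 X X)\<^sup>\<circ> \<sqinter> (P2 X X)\<^sup>\<circ>"
  by (simp add: diag_def Tuple_def)

lemma diag_lax:
  assumes [simp]: "r \<in> Arr C"
  shows "diag (Cod C r) \<cdot> r \<preceq> Times r r \<cdot> diag (Dom C r)"
proof -
  let ?Y = "Cod C r"
  have "diag ?Y \<cdot> r \<preceq> ((P1 ?Y ?Y)\<^sup>\<circ> \<cdot> r) \<sqinter> ((P2 ?Y ?Y)\<^sup>\<circ> \<cdot> r)"
    by (intro le_meet comp_le_left) (auto simp: diag_eq meet_le)
  also have "\<dots> = Times r r \<cdot> diag (Dom C r)"
    by (simp add: diag_def Times_Tuple) (simp add: Tuple_def)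
  finally show ?thesis .
qed

text \<open>Both sides are the coreflexive \<open>1 \<sqinter> p\<^sup>\<circ> q\<close> of the pairs with equal components.\<close>

lemma diag_frobenius:
  assumes [simp]: "X \<in> Obj C"
  shows "diag X \<cdot> (diag X)\<^sup>\<circ> = Times ((diag X)\<^sup>\<circ>) (Ident C X) \<cdot> (assoc_inv X X X \<cdot> Times (Ident C X) (diag X))"
proof -
  define p q where "p = P1 X X" and "q = P2 X X"
  define Q where "Q = X \<times>\<times> X"
  have [simp]: "Q \<in> Obj C" "p \<in> Arr C" "q \<in> Arr C" "Dom C p = Q" "Dom C q = Q" "Cod C p = X" "Cod C q = X"
    "is_map C p" "is_map C q"
    by (simp_all add: p_def q_def Q_def)
  have d: "diag X = p\<^sup>\<circ> \<sqinter> q\<^sup>\<circ>" "(diag X)\<^sup>\<circ> = p \<sqinter> q" by (simp_all add: diag_eq p_def q_def)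
  have 1: "assoc_inv X X X \<cdot> Times (Ident C X) (diag X) = Tuple (Ident C Q) q"
  proof (rule Tuple_ext[of _ _ Q X], goal_cases)
    case 8
    show ?case
      by (rule Tuple_ext[of _ _ X X]) (simp_all add: Q_def q_def assoc_inv_def Times_def diag_def)
  qed (simp_all add: Q_def q_def assoc_inv_def Times_def diag_def)
  have 2: "Times ((diag X)\<^sup>\<circ>) (Ident C X) = (Tuple (diag X \<cdot> p) q)\<^sup>\<circ>"
    using cv_Times[of "diag X" "Ident C X"] by (simp add: Times_def[of "diag X"] p_def q_def)
  have "Times ((diag X)\<^sup>\<circ>) (Ident C X) \<cdot> (assoc_inv X X X \<cdot> Times (Ident C X) (diag X))
     = (p\<^sup>\<circ> \<cdot> (diag X)\<^sup>\<circ>) \<sqinter> (q\<^sup>\<circ> \<cdot> q)"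
    by (simp add: 1 2 cv_Tuple_comp_Tuple Q_def)
  also have "\<dots> = ((p\<^sup>\<circ> \<cdot> p) \<sqinter> (p\<^sup>\<circ> \<cdot> q)) \<sqinter> (q\<^sup>\<circ> \<cdot> q)" by (simp add: d cv_map_comp_meet)
  also have "\<dots> = ((p\<^sup>\<circ> \<cdot> p) \<sqinter> (q\<^sup>\<circ> \<cdot> q)) \<sqinter> (p\<^sup>\<circ> \<cdot> q)"
    by (simp add: meet_assoc meet_commute[of "p\<^sup>\<circ> \<cdot> q" "q\<^sup>\<circ> \<cdot> q"])
  also have "\<dots> = Ident C Q \<sqinter> (p\<^sup>\<circ> \<cdot> q)" by (simp add: p_def q_def Q_def span_mono)
  also have "\<dots> = diag X \<cdot> (diag X)\<^sup>\<circ>"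
  proof (rule le_antisym)
    let ?c = "Ident C Q \<sqinter> (p\<^sup>\<circ> \<cdot> q)"
    have c1: "?c \<preceq> Ident C Q" "?c \<preceq> p\<^sup>\<circ> \<cdot> q" by (simp_all add: meet_le)
    note cc = coreflexive[OF c1(1)]
    have "p \<cdot> ?c \<preceq> p \<cdot> Ident C Q" using c1(1) by (intro comp_le_right) auto
    then have p1: "p \<cdot> ?c \<preceq> p" by simp
    have "p \<cdot> ?c \<preceq> p \<cdot> (p\<^sup>\<circ> \<cdot> q)" using c1(2) by (intro comp_le_right) auto
    also have "\<dots> = (p \<cdot> p\<^sup>\<circ>) \<cdot> q" by simp
    also have "\<dots> \<preceq> Ident C X \<cdot> q" by (intro comp_le_left map_counit) auto
    finally have pc: "p \<cdot> ?c \<preceq> (diag X)\<^sup>\<circ>" using p1 by (simp add: d le_meet)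
    have "?c = ?c \<cdot> (?c \<cdot> ?c)" using cc by simp
    also have "\<dots> = ?c \<cdot> (Ident C Q \<cdot> ?c)" using cc by simp
    also have "\<dots> \<preceq> ?c \<cdot> ((p\<^sup>\<circ> \<cdot> p) \<cdot> ?c)"
      using map_unit[of p Q] by (intro comp_le_right comp_le_left) auto
    also have "\<dots> = (p \<cdot> ?c)\<^sup>\<circ> \<cdot> (p \<cdot> ?c)" using cc by simp
    also have "\<dots> \<preceq> ((diag X)\<^sup>\<circ>)\<^sup>\<circ> \<cdot> (diag X)\<^sup>\<circ>" using comp_le[OF pc cv_mono[OF pc]] by simp
    finally show "?c \<preceq> diag X \<cdot> (diag X)\<^sup>\<circ>" by simp
    have dp: "diag X \<preceq> p\<^sup>\<circ>" "(diag X)\<^sup>\<circ> \<preceq> q" unfolding d by (auto simp: meet_le)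
    show "diag X \<cdot> (diag X)\<^sup>\<circ> \<preceq> ?c"
      using map_counit[of "diag X" Q] comp_le[OF dp(2,1)] by (intro le_meet) (auto simp: Q_def)
  qed
  finally show ?thesis ..
qed

definition rel_cart :: "('o, 'a) cart_data" where
  "rel_cart = \<lparr>Obj = Obj C, Arr = Arr C, Dom = Dom C, Cod = Cod C, Ident = Ident C, Comp = Comp C,
     Le = Le C, TensObj = Pr, Tens = Times, UnitObj = U, Assoc = assoc, LUnit = (\<lambda>X. P2 U X),
     RUnit = (\<lambda>X. P1 X U), Braid = exchange, Dup = diag, Del = bang\<rparr>"

lemma same_rel_cart: "same_ord_cat rel_cart C"
  by (simp add: same_ord_cat_def rel_cart_def)

lemma rel_cart_simps:
  "TensObj rel_cart = Pr" "Tens rel_cart = Times" "UnitObj rel_cart = U" "Assoc rel_cart = assoc"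
  "LUnit rel_cart = (\<lambda>X. P2 U X)" "RUnit rel_cart = (\<lambda>X. P1 X U)" "Braid rel_cart = exchange"
  "Dup rel_cart = diag" "Del rel_cart = bang"
  by (simp_all add: rel_cart_def)

lemma symmetric_monoidal_rel_cart: "symmetric_monoidal_ord_category rel_cart"
proof -
  have LU: "is_iso C (P2 U X)" "is_iso C (P1 X U)" if "X \<in> Obj C" for X
    using LUnit_inverse[OF that] RUnit_inverse[OF that] by (auto simp: is_iso_def)
  have A: "is_iso C (assoc X Y Z)" if "X \<in> Obj C" "Y \<in> Obj C" "Z \<in> Obj C" for X Y Z
    using assoc_inverse[OF that] by (auto simp: is_iso_def)
  have B: "is_iso C (exchange X Y)" if "X \<in> Obj C" "Y \<in> Obj C" for X Y
    using that by (auto intro!: is_isoI[where g = "exchange Y X"] simp: exchange_inverse)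
  have le: "Le C r s \<longleftrightarrow> r \<preceq> s" if "r \<in> Arr C" "s \<in> Arr C" "Dom C r = Dom C s" "Cod C r = Cod C s" for r s
    using that by (simp add: le_def)
  note S = same_ord_catD[OF same_rel_cart] rel_cart_simps
  show ?thesis
  proof (intro symmetric_monoidal_ord_category.intro symmetric_monoidal_ord_category_axioms.intro)
    show "ord_category rel_cart"
      using same_ord_cat_ord_category[OF same_rel_cart] ord_category_axioms by simp
  qed (auto simp: S LU A B le Times_Ident Times_Comp Times_mono assoc_nat LUnit_nat RUnit_nat exchange_nat
      assoc_pentagon assoc_triangle exchange_hexagon exchange_inverse)
qed

lemma comonoid_diag:
  assumes [simp]: "X \<in> Obj C"
  shows "commutative_comonoid rel_cart X (diag X) (bang X)"
proof -
  note S = same_ord_catD[OF same_rel_cart] rel_cart_simps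
  have "assoc X X X \<cdot> (Times (diag X) (Ident C X) \<cdot> diag X) = Times (Ident C X) (diag X) \<cdot> diag X"
    by (simp add: diag_def Times_Tuple assoc_Tuple)
  moreover have "P2 U X \<cdot> (Times (bang X) (Ident C X) \<cdot> diag X) = Ident C X"
    "P1 X U \<cdot> (Times (Ident C X) (bang X) \<cdot> diag X) = Ident C X"
    "exchange X X \<cdot> diag X = diag X"
    by (simp_all add: diag_def Times_Tuple exchange_Tuple)
  ultimately show ?thesis
    by (simp add: commutative_comonoid_def S)
qed

text \<open>The counit laws say that both projections of \<open>d\<close> are identities.\<close>

lemma comonoid_diag_unique:
  assumes [simp]: "X \<in> Obj C" and com: "commutative_comonoid rel_cart X d e" and maps [simp]: "is_map C d" "is_map C e"
  shows "d = diag X" "e = bang X"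
proof -
  note S = same_ord_catD[OF same_rel_cart] rel_cart_simps
  have [simp]: "d \<in> Arr C" "Dom C d = X" "Cod C d = X \<times>\<times> X" "e \<in> Arr C" "Dom C e = X" "Cod C e = U"
    and l: "P2 U X \<cdot> (Times e (Ident C X) \<cdot> d) = Ident C X"
    and r: "P1 X U \<cdot> (Times (Ident C X) e \<cdot> d) = Ident C X"
    using com by (auto simp: commutative_comonoid_def S)
  show "e = bang X" by (rule map_to_U) auto
  show "d = diag X"
    using l r by - (rule Tuple_ext[of _ _ X X], simp_all add: Times_def diag_def)
qed

theorem bicategory_rel_cart: "bicategory_of_relations rel_cart"
proof -
  have le: "Le C r s \<longleftrightarrow> r \<preceq> s" if "r \<in> Arr C" "s \<in> Arr C" "Dom C r = Dom C s" "Cod C r = Cod C s" for r s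
    using that by (simp add: le_def)
  note S = same_ord_catD[OF same_rel_cart] rel_cart_simps
  have *: "cartesian_bicategory rel_cart"
  proof (intro cartesian_bicategory.intro cartesian_bicategory_axioms.intro)
    fix X d e
    assume *: "X \<in> Obj rel_cart" "commutative_comonoid rel_cart X d e" "is_map rel_cart d" "is_map rel_cart e"
    then show "d = Dup rel_cart X \<and> e = Del rel_cart X" using comonoid_diag_unique[of X d e] by (simp add: S)
  qed (auto simp: S symmetric_monoidal_rel_cart comonoid_diag le le_bang diag_lax)
  show ?thesis
  proof (intro bicategory_of_relations.intro bicategory_of_relations_axioms.intro *)
    fix X
    assume "X \<in> Obj rel_cart"
    then have [simp]: "X \<in> Obj C" by (simp add: S)
    show "Dup rel_cart X \<cdot>\<^bsub>rel_cart\<^esub> right_adj rel_cart (Dup rel_cart X)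
        = (right_adj rel_cart (Dup rel_cart X) \<otimes>\<^bsub>rel_cart\<^esub> Ident rel_cart X) \<cdot>\<^bsub>rel_cart\<^esub>
          inv_arr rel_cart (Assoc rel_cart X X X) \<cdot>\<^bsub>rel_cart\<^esub> (Ident rel_cart X \<otimes>\<^bsub>rel_cart\<^esub> Dup rel_cart X)"
      using diag_frobenius[of X] inv_arr_eq[OF assoc_inverse[of X X X]] by (simp add: S map_cv)
  qed
qed

end

section \<open>Functors and products\<close>

context conv_ord_category
begin

definition unit_object :: "'o \<Rightarrow> bool" where
  "unit_object V \<longleftrightarrow> V \<in> Obj C \<and> (\<forall>r \<in> Arr C. Dom C r = V \<and> Cod C r = V \<longrightarrow> r \<preceq> Ident C V) \<and>
     (\<forall>X \<in> Obj C. \<exists>p \<in> Arr C. Dom C p = X \<and> Cod C p = V \<and> Ident C X \<preceq> p\<^sup>\<circ> \<cdot> p)"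

lemma unit_object_Obj: "unit_object V \<Longrightarrow> V \<in> Obj C"
  by (simp add: unit_object_def)

lemma unit_object_total:
  "unit_object V \<Longrightarrow> X \<in> Obj C \<Longrightarrow> \<exists>p \<in> Arr C. Dom C p = X \<and> Cod C p = V \<and> Ident C X \<preceq> p\<^sup>\<circ> \<cdot> p"
  by (simp add: unit_object_def)

lemma unit_object_le:
  assumes V: "unit_object V" and p: "is_map C p" and [simp]: "r \<in> Arr C" "Dom C r = Dom C p" "Cod C p = V" "Cod C r = V"
  shows "r \<preceq> p"
proof -
  note [simp] = map_Arr[OF p]
  have "r \<cdot> Ident C (Dom C p) \<preceq> r \<cdot> (p\<^sup>\<circ> \<cdot> p)" using map_unit[OF p] by (intro comp_le_right) auto
  then have "r \<preceq> (r \<cdot> p\<^sup>\<circ>) \<cdot> p" by simp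
  also have "\<dots> \<preceq> Ident C V \<cdot> p" using V by (intro comp_le_left) (auto simp: unit_object_def)
  finally show ?thesis by simp
qed

lemma unit_object_map_unique:
  "\<lbrakk>unit_object V; is_map C p; is_map C q; Dom C p = Dom C q; Cod C p = V; Cod C q = V\<rbrakk> \<Longrightarrow> p = q"
  using map_Arr[of p] map_Arr[of q] by (intro map_le_eq unit_object_le) auto

lemma unit_object_map_exists:
  assumes V: "unit_object V" and [simp]: "X \<in> Obj C"
  shows "\<exists>p. is_map C p \<and> Dom C p = X \<and> Cod C p = V"
proof -
  obtain p where p: "p \<in> Arr C" "Dom C p = X" "Cod C p = V" "Ident C X \<preceq> p\<^sup>\<circ> \<cdot> p"
    using unit_object_total[OF V assms(2)] by blast
  moreover have "p \<cdot> p\<^sup>\<circ> \<preceq> Ident C V" using V p by (simp add: unit_object_def)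
  ultimately show ?thesis by (auto intro: mapI)
qed

lemma unit_object_iso:
  assumes V: "unit_object V" and W: "unit_object W" and p: "is_map C p" "Dom C p = V" "Cod C p = W"
  shows "is_iso C p"
proof -
  note [simp] = unit_object_Obj[OF V] unit_object_Obj[OF W] p map_Arr[OF p(1)]
  obtain q where q [simp]: "is_map C q" "Dom C q = W" "Cod C q = V"
    using unit_object_map_exists[OF V, of W] by auto
  note [simp] = map_Arr[OF q(1)]
  have "q \<cdot> p = Ident C V" by (rule unit_object_map_unique[OF V]) auto
  moreover have "p \<cdot> q = Ident C W" by (rule unit_object_map_unique[OF W]) auto
  ultimately show ?thesis by (intro is_isoI[where g = q]) auto
qed

lemma unit_object_transport:
  assumes V: "unit_object V" and k: "is_iso C k" "Dom C k = V" "Cod C k = W"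
  shows "unit_object W"
proof -
  let ?k = "inv_arr C k"
  note ki = iso_inv_arr[OF k(1)]
  note [simp] = ki(1-6)[unfolded k(2,3)] k(2,3)
  have [simp]: "V \<in> Obj C" "W \<in> Obj C" using V Obj_Dom_Cod(2)[of k] by (auto simp: unit_object_def)
  have kc: "?k = k\<^sup>\<circ>" by (rule adj_cv[OF inverse_arrows_adj[OF ki(7)]])
  have 1: "r \<preceq> Ident C W" if [simp]: "r \<in> Arr C" "Dom C r = W" "Cod C r = W" for r
  proof -
    have "?k \<cdot> (r \<cdot> k) \<preceq> Ident C V" using V by (simp add: unit_object_def)
    then have "k \<cdot> ((?k \<cdot> (r \<cdot> k)) \<cdot> ?k) \<preceq> k \<cdot> (Ident C V \<cdot> ?k)"
      by (intro comp_le_right comp_le_left) auto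
    then show ?thesis by (simp add: comp_extend[OF ki(6)])
  qed
  have 2: "\<exists>p \<in> Arr C. Dom C p = X \<and> Cod C p = W \<and> Ident C X \<preceq> p\<^sup>\<circ> \<cdot> p" if X: "X \<in> Obj C" for X
  proof -
    obtain p where p: "p \<in> Arr C" "Dom C p = X" "Cod C p = V" "Ident C X \<preceq> p\<^sup>\<circ> \<cdot> p"
      using unit_object_total[OF V X] by blast
    then have "Ident C X \<preceq> (k \<cdot> p)\<^sup>\<circ> \<cdot> (k \<cdot> p)"
      by (simp add: kc[symmetric] comp_extend[OF ki(5)])
    then show ?thesis using p by (intro bexI[of _ "k \<cdot> p"]) auto
  qed
  from 1 2 show ?thesis by (simp add: unit_object_def)
qed

end

lemma (in conv_product_category) unit_object_U: "unit_object U"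
  using U_top U_total by (simp add: unit_object_def)

locale ord_fun = S: ord_category C + T: ord_category D
  for C :: "('o, 'a, 'z) ord_cat_data_scheme" and D :: "('p, 'b, 'y) ord_cat_data_scheme"
    and f0 :: "'o \<Rightarrow> 'p" and f1 :: "'a \<Rightarrow> 'b" +
  assumes is_functor: "is_functor C D f0 f1"
    and mono: "r \<preceq>\<^bsub>C\<^esub> s \<Longrightarrow> f1 r \<preceq>\<^bsub>D\<^esub> f1 s"
begin

lemma f_typed [simp]:
  "X \<in> Obj C \<Longrightarrow> f0 X \<in> Obj D"
  "r \<in> Arr C \<Longrightarrow> f1 r \<in> Arr D"
  "r \<in> Arr C \<Longrightarrow> Dom D (f1 r) = f0 (Dom C r)"
  "r \<in> Arr C \<Longrightarrow> Cod D (f1 r) = f0 (Cod C r)"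
  "X \<in> Obj C \<Longrightarrow> f1 (Ident C X) = Ident D (f0 X)"
  "\<lbrakk>r \<in> Arr C; s \<in> Arr C; Dom C s = Cod C r\<rbrakk> \<Longrightarrow> f1 (s \<cdot>\<^bsub>C\<^esub> r) = f1 s \<cdot>\<^bsub>D\<^esub> f1 r"
  using is_functor by (auto simp: is_functor_def)

lemma f_adj: "S.adj f g \<Longrightarrow> T.adj (f1 f) (f1 g)"
  using mono[of "Ident C (Dom C f)" "g \<cdot>\<^bsub>C\<^esub> f"] mono[of "f \<cdot>\<^bsub>C\<^esub> g" "Ident C (Cod C f)"]
  by (auto simp: S.adj_def T.adj_def)

lemma f_map [simp]: "is_map C f \<Longrightarrow> is_map D (f1 f)"
  using f_adj S.map_adj T.adj_map by blast

lemma f_right_adj: "is_map C f \<Longrightarrow> f1 (right_adj C f) = right_adj D (f1 f)"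
  using f_adj S.map_adj T.right_adj_eq by metis

lemma f_iso: "is_iso C f \<Longrightarrow> is_iso D (f1 f)"
proof -
  assume f: "is_iso C f"
  note t = S.iso_inv_arr[OF f]
  have "f1 (inv_arr C f) \<cdot>\<^bsub>D\<^esub> f1 f = f1 (inv_arr C f \<cdot>\<^bsub>C\<^esub> f)" "f1 f \<cdot>\<^bsub>D\<^esub> f1 (inv_arr C f) = f1 (f \<cdot>\<^bsub>C\<^esub> inv_arr C f)"
    using t(1-4) by simp_all
  then show ?thesis using t by (intro T.is_isoI[where g = "f1 (inv_arr C f)"]) auto
qed

end

text \<open>Monotone functors out of a category with spans below which everything lies preserve
  converses, since relations decompose into maps, converses of maps and coreflexives.\<close>

locale conv_fun = ord_fun C D f0 f1 + S: conv_product_category C cC U Pr P1 P2 + T: conv_ord_category D cD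
  for C :: "('o, 'a, 'z) ord_cat_data_scheme" and D :: "('p, 'b, 'y) ord_cat_data_scheme"
    and f0 :: "'o \<Rightarrow> 'p" and f1 :: "'a \<Rightarrow> 'b" and cC U Pr P1 P2 cD
begin

lemma f_cv_map: "is_map C f \<Longrightarrow> f1 (cC f) = cD (f1 f)"
  using f_right_adj[of f] by (simp add: S.map_cv T.map_cv)

lemma f_cv [simp]:
  assumes [simp]: "r \<in> Arr C"
  shows "f1 (cC r) = cD (f1 r)"
proof -
  let ?X = "Dom C r" and ?Y = "Cod C r"
  let ?p = "P1 ?X ?Y" and ?q = "P2 ?X ?Y"
  define W where "W = Pr ?X ?Y"
  have [simp]: "W \<in> Obj C" "Dom C ?p = W" "Dom C ?q = W" by (simp_all add: W_def)
  define c where "c = Ident C W \<sqinter>\<^bsub>C\<^esub> (cC ?q \<cdot>\<^bsub>C\<^esub> (r \<cdot>\<^bsub>C\<^esub> ?p))"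
  have [simp]: "c \<in> Arr C" "Dom C c = W" "Cod C c = W" by (simp_all add: c_def)
  have r: "r = ?q \<cdot>\<^bsub>C\<^esub> (c \<cdot>\<^bsub>C\<^esub> cC ?p)"
    unfolding c_def by (rule S.le_span_decomp) (simp_all add: S.span_top)
  have c: "c \<preceq>\<^bsub>C\<^esub> Ident C W" by (simp add: c_def S.meet_le)
  then have "cC c = c" by (rule S.coreflexive) simp
  then have "cC r = ?p \<cdot>\<^bsub>C\<^esub> (c \<cdot>\<^bsub>C\<^esub> cC ?q)" by (subst r) simp
  moreover have "f1 r = f1 ?q \<cdot>\<^bsub>D\<^esub> (f1 c \<cdot>\<^bsub>D\<^esub> cD (f1 ?p))"
    by (subst r) (simp add: f_cv_map)
  moreover have "cD (f1 c) = f1 c"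
    using mono[OF c] T.coreflexive(1)[of "f1 c" "f0 W"] by simp
  ultimately show ?thesis by (simp add: f_cv_map)
qed

end

locale product_fun = conv_fun C D f0 f1 cC U Pr P1 P2 cD + T: conv_product_category D cD V Qr Q1 Q2
  for C :: "('o, 'a, 'z) ord_cat_data_scheme" and D :: "('p, 'b, 'y) ord_cat_data_scheme"
    and f0 :: "'o \<Rightarrow> 'p" and f1 :: "'a \<Rightarrow> 'b" and cC U Pr P1 P2 cD V Qr Q1 Q2 +
  assumes f_meet [simp]: "\<lbrakk>r \<in> Arr C; s \<in> Arr C; Dom C r = Dom C s; Cod C r = Cod C s\<rbrakk>
      \<Longrightarrow> f1 (r \<sqinter>\<^bsub>C\<^esub> s) = f1 r \<sqinter>\<^bsub>D\<^esub> f1 s"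
    and f_unit: "T.unit_object (f0 U)"
begin

text \<open>The comparison map from the product of the images is the factorization of the projections
  through the image of the product span; its inverse \<open>cmp\<close> is the pairing of the images.\<close>

definition mult :: "'o \<Rightarrow> 'o \<Rightarrow> 'b" where
  "mult X Y = (cD (f1 (P1 X Y)) \<cdot>\<^bsub>D\<^esub> Q1 (f0 X) (f0 Y)) \<sqinter>\<^bsub>D\<^esub> (cD (f1 (P2 X Y)) \<cdot>\<^bsub>D\<^esub> Q2 (f0 X) (f0 Y))"

definition cmp :: "'o \<Rightarrow> 'o \<Rightarrow> 'b" where
  "cmp X Y = T.Tuple (f1 (P1 X Y)) (f1 (P2 X Y))"

lemma f_span_mono:
  assumes [simp]: "X \<in> Obj C" "Y \<in> Obj C"
  shows "(cD (f1 (P1 X Y)) \<cdot>\<^bsub>D\<^esub> f1 (P1 X Y)) \<sqinter>\<^bsub>D\<^esub> (cD (f1 (P2 X Y)) \<cdot>\<^bsub>D\<^esub> f1 (P2 X Y)) = Ident D (f0 (Pr X Y))"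
  using arg_cong[OF S.span_mono[of X Y], of f1] by simp

text \<open>The image of a unit object is a unit object, so the image of the top relation is a top
  relation.\<close>

lemma f_span_top:
  assumes [simp]: "r \<in> Arr D" "Dom D r = f0 X" "Cod D r = f0 Y" "X \<in> Obj C" "Y \<in> Obj C"
  shows "r \<preceq>\<^bsub>D\<^esub> f1 (P2 X Y) \<cdot>\<^bsub>D\<^esub> cD (f1 (P1 X Y))"
proof -
  have "r \<preceq>\<^bsub>D\<^esub> right_adj D (f1 (S.bang Y)) \<cdot>\<^bsub>D\<^esub> f1 (S.bang X)"
    by (rule T.map_transpose_left) (auto intro!: T.unit_object_le[OF f_unit])
  also have "\<dots> = f1 (cC (S.bang Y) \<cdot>\<^bsub>C\<^esub> S.bang X)" by (simp add: T.map_cv)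
  also have "\<dots> \<preceq>\<^bsub>D\<^esub> f1 (P2 X Y \<cdot>\<^bsub>C\<^esub> cC (P1 X Y))" by (intro mono S.span_top) auto
  finally show ?thesis by simp
qed

lemma mult:
  assumes [simp]: "X \<in> Obj C" "Y \<in> Obj C"
  shows "is_map D (mult X Y)" "f1 (P1 X Y) \<cdot>\<^bsub>D\<^esub> mult X Y = Q1 (f0 X) (f0 Y)" "f1 (P2 X Y) \<cdot>\<^bsub>D\<^esub> mult X Y = Q2 (f0 X) (f0 Y)"
  unfolding mult_def
  by (rule T.tabulation_factor[where Z = "f0 (Pr X Y)" and W = "Qr (f0 X) (f0 Y)"];
      simp add: f_span_mono f_span_top)+

lemma mult_typed [simp]:
  assumes [simp]: "X \<in> Obj C" "Y \<in> Obj C"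
  shows "mult X Y \<in> Arr D" "Dom D (mult X Y) = Qr (f0 X) (f0 Y)" "Cod D (mult X Y) = f0 (Pr X Y)"
    "is_map D (mult X Y)" "cmp X Y \<in> Arr D" "Dom D (cmp X Y) = f0 (Pr X Y)" "Cod D (cmp X Y) = Qr (f0 X) (f0 Y)"
    "is_map D (cmp X Y)"
  using mult(1)[OF assms] by (simp_all add: mult_def cmp_def)

lemma mult_eq_cv: "X \<in> Obj C \<Longrightarrow> Y \<in> Obj C \<Longrightarrow> mult X Y = cD (cmp X Y)"
  by (simp add: mult_def cmp_def T.Tuple_def)

lemma mult_cmp: "X \<in> Obj C \<Longrightarrow> Y \<in> Obj C \<Longrightarrow> mult X Y \<cdot>\<^bsub>D\<^esub> cmp X Y = Ident D (f0 (Pr X Y))"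
  by (simp add: mult_eq_cv) (simp add: cmp_def T.cv_Tuple_comp_Tuple f_span_mono)

lemma cmp_mult: "X \<in> Obj C \<Longrightarrow> Y \<in> Obj C \<Longrightarrow> cmp X Y \<cdot>\<^bsub>D\<^esub> mult X Y = Ident D (Qr (f0 X) (f0 Y))"
  by (rule T.Tuple_ext[of _ _ "f0 X" "f0 Y"]) (simp_all add: mult, simp_all add: cmp_def mult)

lemma mult_iso: "X \<in> Obj C \<Longrightarrow> Y \<in> Obj C \<Longrightarrow> is_iso D (mult X Y)"
  by (rule T.is_isoI[where g = "cmp X Y"]) (simp_all add: mult_cmp cmp_mult)

lemma f_ext:
  assumes h: "is_map D h" and k: "is_map D k" and [simp]: "Dom D h = Dom D k" "Cod D h = f0 (Pr X Y)" "Cod D k = f0 (Pr X Y)"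
    "X \<in> Obj C" "Y \<in> Obj C"
    and eq: "f1 (P1 X Y) \<cdot>\<^bsub>D\<^esub> h = f1 (P1 X Y) \<cdot>\<^bsub>D\<^esub> k" "f1 (P2 X Y) \<cdot>\<^bsub>D\<^esub> h = f1 (P2 X Y) \<cdot>\<^bsub>D\<^esub> k"
  shows "h = k"
proof -
  note [simp] = T.map_Arr[OF h] T.map_Arr[OF k]
  have "cmp X Y \<cdot>\<^bsub>D\<^esub> h = cmp X Y \<cdot>\<^bsub>D\<^esub> k"
    using h k by - (rule T.Tuple_ext[of _ _ "f0 X" "f0 Y"], simp_all add: cmp_def eq)
  moreover have "is_iso D (cmp X Y)"
    by (rule T.is_isoI[where g = "mult X Y"]) (simp_all add: mult_cmp cmp_mult)
  ultimately show ?thesis by (intro T.iso_mono[of "cmp X Y" h k]) auto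
qed

lemma mult_unique:
  "\<lbrakk>is_map D m; Dom D m = Qr (f0 X) (f0 Y); Cod D m = f0 (Pr X Y); X \<in> Obj C; Y \<in> Obj C;
    f1 (P1 X Y) \<cdot>\<^bsub>D\<^esub> m = Q1 (f0 X) (f0 Y); f1 (P2 X Y) \<cdot>\<^bsub>D\<^esub> m = Q2 (f0 X) (f0 Y)\<rbrakk> \<Longrightarrow> m = mult X Y"
  by (rule f_ext[of _ _ X Y]) (simp_all add: mult)

lemma mult_nat:
  assumes [simp]: "r \<in> Arr C" "s \<in> Arr C"
  shows "mult (Cod C r) (Cod C s) \<cdot>\<^bsub>D\<^esub> T.Times (f1 r) (f1 s) = f1 (S.Times r s) \<cdot>\<^bsub>D\<^esub> mult (Dom C r) (Dom C s)"
proof -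
  let ?X = "Dom C r" and ?Y = "Dom C s" and ?X' = "Cod C r" and ?Y' = "Cod C s"
  let ?R = "(cD (f1 (P1 ?X' ?Y')) \<cdot>\<^bsub>D\<^esub> (f1 r \<cdot>\<^bsub>D\<^esub> Q1 (f0 ?X) (f0 ?Y))) \<sqinter>\<^bsub>D\<^esub>
    (cD (f1 (P2 ?X' ?Y')) \<cdot>\<^bsub>D\<^esub> (f1 s \<cdot>\<^bsub>D\<^esub> Q2 (f0 ?X) (f0 ?Y)))"
  have "f1 (S.Times r s) \<cdot>\<^bsub>D\<^esub> mult ?X ?Y = ?R"
    by (simp add: S.Times_eq T.meet_comp_map mult)
  moreover have "mult ?X' ?Y' \<cdot>\<^bsub>D\<^esub> T.Times (f1 r) (f1 s) = ?R"
    by (simp add: mult_eq_cv) (simp add: cmp_def T.Times_def T.cv_Tuple_comp_Tuple)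
  ultimately show ?thesis by simp
qed

lemma mult_assoc:
  assumes [simp]: "X \<in> Obj C" "Y \<in> Obj C" "Z \<in> Obj C"
  shows "f1 (S.assoc X Y Z) \<cdot>\<^bsub>D\<^esub> (mult (Pr X Y) Z \<cdot>\<^bsub>D\<^esub> T.Times (mult X Y) (Ident D (f0 Z)))
     = mult X (Pr Y Z) \<cdot>\<^bsub>D\<^esub> (T.Times (Ident D (f0 X)) (mult Y Z) \<cdot>\<^bsub>D\<^esub> T.assoc (f0 X) (f0 Y) (f0 Z))"
    (is "?l = ?r")
proof -
  have a: "f1 (P1 X (Pr Y Z)) \<cdot>\<^bsub>D\<^esub> f1 (S.assoc X Y Z) = f1 (P1 X Y) \<cdot>\<^bsub>D\<^esub> f1 (P1 (Pr X Y) Z)"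
    using arg_cong[OF S.P_assoc(1)[of X Y Z], of f1] by simp
  have b: "f1 (P2 X (Pr Y Z)) \<cdot>\<^bsub>D\<^esub> f1 (S.assoc X Y Z) = f1 (S.Tuple (P2 X Y \<cdot>\<^bsub>C\<^esub> P1 (Pr X Y) Z) (P2 (Pr X Y) Z))"
    using arg_cong[OF S.P_assoc(2)[of X Y Z], of f1] by simp
  have c: "f1 (P1 Y Z) \<cdot>\<^bsub>D\<^esub> f1 (S.Tuple (P2 X Y \<cdot>\<^bsub>C\<^esub> P1 (Pr X Y) Z) (P2 (Pr X Y) Z)) = f1 (P2 X Y) \<cdot>\<^bsub>D\<^esub> f1 (P1 (Pr X Y) Z)"
    "f1 (P2 Y Z) \<cdot>\<^bsub>D\<^esub> f1 (S.Tuple (P2 X Y \<cdot>\<^bsub>C\<^esub> P1 (Pr X Y) Z) (P2 (Pr X Y) Z)) = f1 (P2 (Pr X Y) Z)"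
    using arg_cong[OF S.P_Tuple(1)[of "P2 X Y \<cdot>\<^bsub>C\<^esub> P1 (Pr X Y) Z" "P2 (Pr X Y) Z" Y Z], of f1]
      arg_cong[OF S.P_Tuple(2)[of "P2 X Y \<cdot>\<^bsub>C\<^esub> P1 (Pr X Y) Z" "P2 (Pr X Y) Z" Y Z], of f1]
    by (simp_all del: S.P_Tuple)
  note M = mult(2,3) T.comp_extend[OF mult(2)] T.comp_extend[OF mult(3)] a T.comp_extend[OF a] b T.comp_extend[OF b]
    c T.comp_extend[OF c(1)] T.comp_extend[OF c(2)] T.P_simps
  show ?thesis
  proof (rule f_ext[of _ _ X "Pr Y Z"])
    show "f1 (P2 X (Pr Y Z)) \<cdot>\<^bsub>D\<^esub> ?l = f1 (P2 X (Pr Y Z)) \<cdot>\<^bsub>D\<^esub> ?r"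
      by (rule f_ext[of _ _ Y Z]) (simp_all add: M)
  qed (simp_all add: M)
qed

lemma mult_left_unit:
  assumes [simp]: "X \<in> Obj C" and u: "is_map D u" "Dom D u = V" "Cod D u = f0 U"
  shows "f1 (P2 U X) \<cdot>\<^bsub>D\<^esub> (mult U X \<cdot>\<^bsub>D\<^esub> T.Times u (Ident D (f0 X))) = Q2 V (f0 X)"
  using u T.map_Arr[OF u(1)] by (simp add: T.comp_extend[OF mult(3)] T.P_Times)

lemma mult_right_unit:
  assumes [simp]: "X \<in> Obj C" and u: "is_map D u" "Dom D u = V" "Cod D u = f0 U"
  shows "f1 (P1 X U) \<cdot>\<^bsub>D\<^esub> (mult X U \<cdot>\<^bsub>D\<^esub> T.Times (Ident D (f0 X)) u) = Q1 (f0 X) V"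
  using u T.map_Arr[OF u(1)] by (simp add: T.comp_extend[OF mult(2)] T.P_Times)

end

section \<open>The correspondence on objects\<close>

lemma allegory_iff: "allegory A \<longleftrightarrow> conv_ord_category A (Conv A)"
proof
  assume "allegory A"
  then interpret allegory A .
  interpret M: meet_ord_category A by unfold_locales (rule meet_exists)
  show "conv_ord_category A (Conv A)"
  proof unfold_locales
    fix r assume [simp]: "r \<in> Arr A"
    show "r\<degree>\<^bsub>A\<^esub> \<in> Arr A" "Dom A (r\<degree>\<^bsub>A\<^esub>) = Cod A r" "Cod A (r\<degree>\<^bsub>A\<^esub>) = Dom A r" "(r\<degree>\<^bsub>A\<^esub>)\<degree>\<^bsub>A\<^esub> = r"
      using Conv_in_hom[of r "Dom A r" "Cod A r"] Conv_Conv[of r "Dom A r" "Cod A r"] by auto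
    fix s assume s [simp]: "s \<in> Arr A"
    show "Dom A s = Cod A r \<Longrightarrow> (s \<cdot>\<^bsub>A\<^esub> r)\<degree>\<^bsub>A\<^esub> = r\<degree>\<^bsub>A\<^esub> \<cdot>\<^bsub>A\<^esub> s\<degree>\<^bsub>A\<^esub>"
      using Conv_Comp[of r "Dom A r" "Cod A r" s "Cod A s"] by simp
    fix t assume [simp]: "t \<in> Arr A" and t: "Dom A s = Cod A r" "Dom A t = Dom A r" "Cod A t = Cod A s"
    have "r\<degree>\<^bsub>A\<^esub> \<in> Arr A" "Dom A (r\<degree>\<^bsub>A\<^esub>) = Cod A r" "Cod A (r\<degree>\<^bsub>A\<^esub>) = Dom A r"
      using Conv_in_hom[of r "Dom A r" "Cod A r"] by auto
    then show "(s \<cdot>\<^bsub>A\<^esub> r) \<sqinter>\<^bsub>A\<^esub> t \<preceq>\<^bsub>A\<^esub> (s \<sqinter>\<^bsub>A\<^esub> (t \<cdot>\<^bsub>A\<^esub> r\<degree>\<^bsub>A\<^esub>)) \<cdot>\<^bsub>A\<^esub> r"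
      using modular_law[of r "Dom A r" "Cod A r" s "Cod A s" t] t by (simp add: le_def)
  next
    fix r s assume "r \<preceq>\<^bsub>A\<^esub> s"
    then show "r\<degree>\<^bsub>A\<^esub> \<preceq>\<^bsub>A\<^esub> s\<degree>\<^bsub>A\<^esub>"
      using Conv_mono[of r "Dom A r" "Cod A r" s] Conv_in_hom[of r "Dom A r" "Cod A r"] Conv_in_hom[of s "Dom A r" "Cod A r"]
      by (auto simp: le_def)
  qed (simp add: Conv_Ident)
next
  assume "conv_ord_category A (Conv A)"
  then interpret conv_ord_category A "Conv A" .
  show "allegory A"
  proof unfold_locales
    fix r s t X Y Z
    assume "r \<in> hom A X Y" "s \<in> hom A Y Z" "t \<in> hom A X Z"
    then show "(s \<cdot>\<^bsub>A\<^esub> r) \<sqinter>\<^bsub>A\<^esub> t \<sqsubseteq>\<^bsub>A\<^esub> (s \<sqinter>\<^bsub>A\<^esub> (t \<cdot>\<^bsub>A\<^esub> r\<degree>\<^bsub>A\<^esub>)) \<cdot>\<^bsub>A\<^esub> r" using modular[of r s t] by (simp add: le_def)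
  next
    fix r s X Y assume "r \<in> hom A X Y" "s \<in> hom A X Y" "r \<sqsubseteq>\<^bsub>A\<^esub> s"
    then show "r\<degree>\<^bsub>A\<^esub> \<sqsubseteq>\<^bsub>A\<^esub> s\<degree>\<^bsub>A\<^esub>" using cv_mono[of r s] by (auto simp: le_def)
  qed (auto intro: meets)
qed

lemma is_unit_iff:
  assumes "allegory A"
  shows "is_unit A V \<longleftrightarrow> conv_ord_category.unit_object A (Conv A) V"
proof -
  interpret conv_ord_category A "Conv A" using assms by (simp add: allegory_iff)
  have 1: "(\<exists>p \<in> hom A X V. Ident A X \<sqsubseteq>\<^bsub>A\<^esub> p\<degree>\<^bsub>A\<^esub> \<cdot>\<^bsub>A\<^esub> p) \<longleftrightarrow>
      (\<exists>p \<in> Arr A. Dom A p = X \<and> Cod A p = V \<and> Ident A X \<preceq>\<^bsub>A\<^esub> p\<degree>\<^bsub>A\<^esub> \<cdot>\<^bsub>A\<^esub> p)" if "X \<in> Obj A" for X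
    using that unfolding Bex_def by (intro iff_exI) (auto simp: le_def)
  have 2: "(\<forall>r \<in> hom A V V. r \<sqsubseteq>\<^bsub>A\<^esub> Ident A V) \<longleftrightarrow>
      (\<forall>r \<in> Arr A. Dom A r = V \<and> Cod A r = V \<longrightarrow> r \<preceq>\<^bsub>A\<^esub> Ident A V)" if "V \<in> Obj A"
    using that by (auto simp: le_def)
  show ?thesis
  proof (cases "V \<in> Obj A")
    case True
    show ?thesis unfolding is_unit_def unit_object_def
      by (simp only: 1 2[OF True] True cong: ball_cong)
  qed (simp add: is_unit_def unit_object_def)
qed

lemma products_unitary_pre_tabular:
  assumes "conv_product_category A (Conv A) U Pr P1 P2"
  shows "unitary A" "pre_tabular A"
proof -
  interpret conv_product_category A "Conv A" U Pr P1 P2 by (rule assms)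
  have A: "allegory A" by (simp add: allegory_iff conv_ord_category_axioms)
  show "unitary A"
    using unit_object_U is_unit_iff[OF A] by (auto simp: unitary_def)
  show "pre_tabular A"
    unfolding pre_tabular_def
  proof
    fix r assume [simp]: "r \<in> Arr A"
    let ?X = "Dom A r" and ?Y = "Cod A r"
    let ?s = "P2 ?X ?Y \<cdot>\<^bsub>A\<^esub> (P1 ?X ?Y)\<degree>\<^bsub>A\<^esub>"
    have "is_tabulation A ?s (P1 ?X ?Y) (P2 ?X ?Y)"
      by (auto simp: is_tabulation_def span_mono intro!: bexI[of _ "Pr ?X ?Y"])
    moreover have "r \<preceq>\<^bsub>A\<^esub> ?s" by (rule span_top) auto
    ultimately show "\<exists>s\<in>hom A ?X ?Y. r \<sqsubseteq>\<^bsub>A\<^esub> s \<and> (\<exists>f g. is_tabulation A s f g)"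
      by (intro bexI[of _ ?s]) (auto simp: le_def)
  qed
qed

text \<open>A relation containing the top relation is the top relation, so pre-tabularity tabulates it.\<close>

lemma unitary_pre_tabular_products:
  assumes A: "allegory A" and "unitary A" and pt: "pre_tabular A"
  shows "\<exists>U Pr P1 P2. conv_product_category A (Conv A) U Pr P1 P2"
proof -
  interpret conv_ord_category A "Conv A" using A by (simp add: allegory_iff)
  obtain U where U: "unit_object U" using assms by (auto simp: unitary_def is_unit_iff)
  define tab where "tab X Y = (\<lambda>(Z, f, g). Z \<in> Obj A \<and> is_map A f \<and> is_map A g \<and> Dom A f = Z \<and> Dom A g = Z \<and>
     Cod A f = X \<and> Cod A g = Y \<and> (f\<degree>\<^bsub>A\<^esub> \<cdot>\<^bsub>A\<^esub> f) \<sqinter>\<^bsub>A\<^esub> (g\<degree>\<^bsub>A\<^esub> \<cdot>\<^bsub>A\<^esub> g) = Ident A Z \<and>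
     (\<forall>r \<in> Arr A. Dom A r = X \<and> Cod A r = Y \<longrightarrow> r \<preceq>\<^bsub>A\<^esub> g \<cdot>\<^bsub>A\<^esub> f\<degree>\<^bsub>A\<^esub>))" for X Y
  have "\<exists>t. tab X Y t" if [simp]: "X \<in> Obj A" "Y \<in> Obj A" for X Y
  proof -
    obtain x where x [simp]: "is_map A x" "Dom A x = X" "Cod A x = U" using unit_object_map_exists[OF U, of X] by auto
    obtain y where y [simp]: "is_map A y" "Dom A y = Y" "Cod A y = U" using unit_object_map_exists[OF U, of Y] by auto
    note [simp] = map_Arr[OF x(1)] map_Arr[OF y(1)]
    have top: "r \<preceq>\<^bsub>A\<^esub> y\<degree>\<^bsub>A\<^esub> \<cdot>\<^bsub>A\<^esub> x" if "r \<in> Arr A" "Dom A r = X" "Cod A r = Y" for r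
    proof -
      have "r \<preceq>\<^bsub>A\<^esub> right_adj A y \<cdot>\<^bsub>A\<^esub> x"
        by (rule map_transpose_left) (use that in \<open>auto intro!: unit_object_le[OF U]\<close>)
      then show ?thesis by (simp add: map_cv)
    qed
    have "y\<degree>\<^bsub>A\<^esub> \<cdot>\<^bsub>A\<^esub> x \<in> Arr A" by simp
    then obtain s f g where s: "s \<in> hom A (Dom A (y\<degree>\<^bsub>A\<^esub> \<cdot>\<^bsub>A\<^esub> x)) (Cod A (y\<degree>\<^bsub>A\<^esub> \<cdot>\<^bsub>A\<^esub> x))" "y\<degree>\<^bsub>A\<^esub> \<cdot>\<^bsub>A\<^esub> x \<sqsubseteq>\<^bsub>A\<^esub> s" "is_tabulation A s f g"
      using pt unfolding pre_tabular_def by blast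
    then have sa: "s \<in> Arr A" "Dom A s = X" "Cod A s = Y" and "y\<degree>\<^bsub>A\<^esub> \<cdot>\<^bsub>A\<^esub> x \<preceq>\<^bsub>A\<^esub> s" by (simp_all add: le_def)
    then have "r \<preceq>\<^bsub>A\<^esub> s" if "r \<in> Arr A" "Dom A r = X" "Cod A r = Y" for r
      using top[OF that] le_trans by blast
    then have "tab X Y (Dom A f, f, g)" using s(3) sa by (auto simp: tab_def is_tabulation_def)
    then show ?thesis by blast
  qed
  define T where "T X Y = (SOME t. tab X Y t)" for X Y
  have T: "tab X Y (T X Y)" if "X \<in> Obj A" "Y \<in> Obj A" for X Y
    unfolding T_def using \<open>\<And>X Y. _ \<Longrightarrow> _ \<Longrightarrow> \<exists>t. tab X Y t\<close>[OF that] by (rule someI_ex)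
  let ?Pr = "\<lambda>X Y. fst (T X Y)" and ?P1 = "\<lambda>X Y. fst (snd (T X Y))" and ?P2 = "\<lambda>X Y. snd (snd (T X Y))"
  have t: "?Pr X Y \<in> Obj A" "is_map A (?P1 X Y)" "is_map A (?P2 X Y)"
     "Dom A (?P1 X Y) = ?Pr X Y" "Dom A (?P2 X Y) = ?Pr X Y" "Cod A (?P1 X Y) = X" "Cod A (?P2 X Y) = Y"
     "((?P1 X Y)\<degree>\<^bsub>A\<^esub> \<cdot>\<^bsub>A\<^esub> ?P1 X Y) \<sqinter>\<^bsub>A\<^esub> ((?P2 X Y)\<degree>\<^bsub>A\<^esub> \<cdot>\<^bsub>A\<^esub> ?P2 X Y) = Ident A (?Pr X Y)"
     "\<And>r. r \<in> Arr A \<Longrightarrow> Dom A r = X \<Longrightarrow> Cod A r = Y \<Longrightarrow> r \<preceq>\<^bsub>A\<^esub> ?P2 X Y \<cdot>\<^bsub>A\<^esub> (?P1 X Y)\<degree>\<^bsub>A\<^esub>"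
    if "X \<in> Obj A" "Y \<in> Obj A" for X Y
    using T[OF that] by (auto simp: tab_def split: prod.splits)
  have "conv_product_category A (Conv A) U ?Pr ?P1 ?P2"
  proof unfold_locales
    fix r X Y assume "r \<in> Arr A" "Dom A r = X" "Cod A r = Y"
    then show "r \<preceq>\<^bsub>A\<^esub> ?P2 X Y \<cdot>\<^bsub>A\<^esub> (?P1 X Y)\<degree>\<^bsub>A\<^esub>" using t(9)[of X Y r] Obj_Dom_Cod[of r] by simp
  qed (use U in \<open>auto simp: t unit_object_def\<close>)
  then show ?thesis by blast
qed

lemma same_ord_cat_conv:
  "same_ord_cat C D \<Longrightarrow> conv_ord_category C cv \<longleftrightarrow> conv_ord_category D cv"
  by (simp add: conv_ord_category_def conv_ord_category_axioms_def meet_ord_category_def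
      meet_ord_category_axioms_def same_ord_cat_ord_category same_ord_catD)

lemma same_ord_cat_products:
  "same_ord_cat C D \<Longrightarrow> conv_product_category C cv U Pr P1 P2 \<longleftrightarrow> conv_product_category D cv U Pr P1 P2"
  by (simp add: conv_product_category_def conv_product_category_axioms_def same_ord_cat_conv same_ord_catD)

lemma same_ord_cat_unit_object:
  assumes "same_ord_cat C D" "conv_ord_category C cv"
  shows "conv_ord_category.unit_object C cv = conv_ord_category.unit_object D cv"
  using assms same_ord_cat_conv[OF assms(1), of cv]
  by (simp add: fun_eq_iff conv_ord_category.unit_object_def same_ord_catD)

context bicategory_of_relations
begin

lemma conv_ord_category_conv: "conv_ord_category C conv"
  by unfold_locales
    (auto simp: conv_mono conv_Comp conv_conv conv_eq[OF conv_of_Ident] intro!: modular)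

lemma conv_product_category_conv: "conv_product_category C conv (UnitObj C) (TensObj C) p1 p2"
proof -
  interpret A: conv_ord_category C conv by (rule conv_ord_category_conv)
  show ?thesis
  proof unfold_locales
    fix r assume "r \<in> Arr C" "Dom C r = \<I>" "Cod C r = \<I>"
    then show "r \<preceq> \<one> \<I>" using total_pred[of r] by simp
  next
    fix X assume [simp]: "X \<in> Obj C"
    show "\<exists>p\<in>Arr C. Dom C p = X \<and> Cod C p = \<I> \<and> \<one> X \<preceq> conv p \<cdot> p"
      using A.map_unit[of "Del C X" X] by (intro bexI[of _ "Del C X"]) auto
  next
    fix r X Y assume r [simp]: "r \<in> Arr C" and XY: "Dom C r = X" "Cod C r = Y"
    have [simp]: "X \<in> Obj C" "Y \<in> Obj C" using XY by auto
    note [simp] = XY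
    have "pair (\<one> X) r \<preceq> (p1 X Y)\<^sup>\<bullet> \<cdot> \<one> X"
      by (rule map_transpose_left) (auto intro!: p1_le_pair)
    then have "p2 X Y \<cdot> pair (\<one> X) r \<preceq> p2 X Y \<cdot> conv (p1 X Y)"
      by (intro comp_le_right) (auto simp: A.map_cv)
    then show "r \<preceq> p2 X Y \<cdot> conv (p1 X Y)" by (simp add: p2_pair)
  next
    fix X Y assume [simp]: "X \<in> Obj C" "Y \<in> Obj C"
    show "(conv (p1 X Y) \<cdot> p1 X Y) \<sqinter> (conv (p2 X Y) \<cdot> p2 X Y) = \<one> (X \<odot> Y)"
      using pair_eq_meet[of "p1 X Y" "p2 X Y" X Y] by (simp add: pair_projections A.map_cv)
  qed auto
qed

sublocale R: conv_product_category C conv "UnitObj C" "TensObj C" p1 p2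
  by (rule conv_product_category_conv)

lemma Tuple_eq_pair: "\<lbrakk>r \<in> Arr C; s \<in> Arr C; Dom C r = Dom C s\<rbrakk> \<Longrightarrow> R.Tuple r s = pair r s"
  by (simp add: R.Tuple_def pair_eq_meet R.map_cv)

lemma Times_eq_Tens: "\<lbrakk>r \<in> Arr C; s \<in> Arr C\<rbrakk> \<Longrightarrow> R.Times r s = r \<otimes> s"
  using Tens_eq_pair[of r s "Dom C r" "Dom C s"] by (simp add: R.Times_def Tuple_eq_pair)

text \<open>Both agree on the triple of projections, whose tuple is the identity.\<close>

lemma assoc_eq_Assoc:
  assumes [simp]: "X \<in> Obj C" "Y \<in> Obj C" "Z \<in> Obj C"
  shows "R.assoc X Y Z = \<alpha> X Y Z"
proof -
  have "pair (pair (p1 X Y \<cdot> p1 (X \<odot> Y) Z) (p2 X Y \<cdot> p1 (X \<odot> Y) Z)) (p2 (X \<odot> Y) Z) = \<one> (X \<odot> Y \<odot> Z)"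
    by (simp add: pair_comp_map[symmetric] pair_projections)
  then have "\<beta> X Y Z \<cdot> R.assoc X Y Z = \<one> (X \<odot> Y \<odot> Z)"
    by (simp add: R.assoc_def Tuple_eq_pair Assoc_inv_pair)
  then have "\<alpha> X Y Z \<cdot> (\<beta> X Y Z \<cdot> R.assoc X Y Z) = \<alpha> X Y Z" by simp
  then show ?thesis by simp
qed

lemma p2_unit: "X \<in> Obj C \<Longrightarrow> p2 \<I> X = \<ll> X"
  by (simp add: p2_def)

lemma p1_unit: "X \<in> Obj C \<Longrightarrow> p1 X \<I> = \<rr> X"
  by (simp add: p1_def)

lemma Dup_eq_pair: "X \<in> Obj C \<Longrightarrow> Dup C X = pair (\<one> X) (\<one> X)"
  by (simp add: pair_def)

end

definition allegory_of :: "('o, 'a) cart_data \<Rightarrow> ('o, 'a) allegory_data" where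
  "allegory_of C = \<lparr>Obj = Obj C, Arr = Arr C, Dom = Dom C, Cod = Cod C, Ident = Ident C, Comp = Comp C,
     Le = Le C, Conv = bicategory_of_relations.conv C\<rparr>"

lemma same_allegory_of: "same_ord_cat (allegory_of C) C"
  by (simp add: same_ord_cat_def allegory_of_def)

lemma Conv_allegory_of: "Conv (allegory_of C) = bicategory_of_relations.conv C"
  by (simp add: allegory_of_def)

theorem allegory_of_bicategory:
  assumes "bicategory_of_relations C"
  shows "allegory (allegory_of C)" "unitary (allegory_of C)" "pre_tabular (allegory_of C)"
proof -
  interpret bicategory_of_relations C by (rule assms)
  have "conv_product_category (allegory_of C) (Conv (allegory_of C)) (UnitObj C) (TensObj C) p1 p2"
    using conv_product_category_conv by (simp add: Conv_allegory_of same_ord_cat_products[OF same_allegory_of])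
  then show "unitary (allegory_of C)" "pre_tabular (allegory_of C)" by (rule products_unitary_pre_tabular)+
  show "allegory (allegory_of C)"
    using conv_ord_category_conv by (simp add: allegory_iff Conv_allegory_of same_ord_cat_conv[OF same_allegory_of])
qed

theorem bicategory_of_allegory_exists:
  fixes A :: "('o, 'a) allegory_data"
  assumes "allegory A" "unitary A" "pre_tabular A"
  shows "\<exists>C :: ('o, 'a) cart_data. bicategory_of_relations C \<and> same_ord_cat C A"
proof -
  obtain U Pr P1 P2 where "conv_product_category A (Conv A) U Pr P1 P2"
    using unitary_pre_tabular_products[OF assms] by blast
  then interpret conv_product_category A "Conv A" U Pr P1 P2 .
  show ?thesis using bicategory_rel_cart same_rel_cart by blast
qed

section \<open>Cartesian functors\<close>

definition meet_fun :: "('o, 'a, 'z) ord_cat_data_scheme \<Rightarrow> ('p, 'b, 'y) ord_cat_data_scheme \<Rightarrow> ('o \<Rightarrow> 'p) \<Rightarrow> ('a \<Rightarrow> 'b) \<Rightarrow> bool" where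
  "meet_fun C D f0 f1 \<longleftrightarrow> ord_fun C D f0 f1 \<and>
     (\<forall>r \<in> Arr C. \<forall>s \<in> Arr C. Dom C r = Dom C s \<and> Cod C r = Cod C s \<longrightarrow>
        f1 (r \<sqinter>\<^bsub>C\<^esub> s) = f1 r \<sqinter>\<^bsub>D\<^esub> f1 s)"

text \<open>What remains of a cartesian functor on the underlying ordered categories: it preserves meets
  and sends the unit object to an object with the same property.\<close>

definition relational_fun :: "('o, 'a) cart_data \<Rightarrow> ('o, 'a) cart_data \<Rightarrow> ('o \<Rightarrow> 'o) \<Rightarrow> ('a \<Rightarrow> 'a) \<Rightarrow> bool" where
  "relational_fun C D f0 f1 \<longleftrightarrow> bicategory_of_relations C \<and> bicategory_of_relations D \<and> meet_fun C D f0 f1 \<and>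
     conv_ord_category.unit_object D (bicategory_of_relations.conv D) (f0 (UnitObj C))"

abbreviation (input) proj1 where "proj1 \<equiv> cartesian_bicategory.p1"
abbreviation (input) proj2 where "proj2 \<equiv> cartesian_bicategory.p2"

lemma relational_fun_product_fun:
  assumes "relational_fun C D f0 f1"
  shows "product_fun C D f0 f1 (bicategory_of_relations.conv C) (UnitObj C) (TensObj C) (proj1 C) (proj2 C)
    (bicategory_of_relations.conv D) (UnitObj D) (TensObj D) (proj1 D) (proj2 D)"
proof -
  interpret S: bicategory_of_relations C using assms by (simp add: relational_fun_def)
  interpret T: bicategory_of_relations D using assms by (simp add: relational_fun_def)
  interpret ord_fun C D f0 f1 using assms by (simp add: relational_fun_def meet_fun_def)
  show ?thesis
    by unfold_locales (use assms in \<open>auto simp: relational_fun_def meet_fun_def\<close>)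
qed

definition projection_compatible :: "('o, 'a) cart_fun \<Rightarrow> bool" where
  "projection_compatible F \<longleftrightarrow>
     (let C = FDom F; D = FCod F in
       FMult F \<in> extensional (Obj C \<times> Obj C) \<and>
       (\<forall>X \<in> Obj C. \<forall>Y \<in> Obj C. is_map D (FMult F (X, Y)) \<and>
          FMult F (X, Y) \<in> hom D (FObj F X \<odot>\<^bsub>D\<^esub> FObj F Y) (FObj F (X \<odot>\<^bsub>C\<^esub> Y)) \<and>
          FArr F (proj1 C X Y) \<cdot>\<^bsub>D\<^esub> FMult F (X, Y) = proj1 D (FObj F X) (FObj F Y) \<and>
          FArr F (proj2 C X Y) \<cdot>\<^bsub>D\<^esub> FMult F (X, Y) = proj2 D (FObj F X) (FObj F Y)) \<and>
       is_map D (FUnit F) \<and> FUnit F \<in> hom D (UnitObj D) (FObj F (UnitObj C)))"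

lemma ord_functor_iff:
  assumes "ord_category (FDom F)" "ord_category (FCod F)"
  shows "ord_functor F \<longleftrightarrow> ord_fun (FDom F) (FCod F) (FObj F) (FArr F) \<and>
    FObj F \<in> extensional (Obj (FDom F)) \<and> FArr F \<in> extensional (Arr (FDom F))"
proof -
  have "is_functor (FDom F) (FCod F) (FObj F) (FArr F) \<Longrightarrow>
    (\<forall>r \<in> Arr (FDom F). \<forall>s \<in> Arr (FDom F).
        Dom (FDom F) r = Dom (FDom F) s \<and> Cod (FDom F) r = Cod (FDom F) s \<and>
        r \<sqsubseteq>\<^bsub>FDom F\<^esub> s \<longrightarrow> FArr F r \<sqsubseteq>\<^bsub>FCod F\<^esub> FArr F s) \<longleftrightarrow>
    (\<forall>r s. r \<preceq>\<^bsub>FDom F\<^esub> s \<longrightarrow> FArr F r \<preceq>\<^bsub>FCod F\<^esub> FArr F s)"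
    unfolding is_functor_def le_def by auto
  then show ?thesis
    using assms unfolding ord_functor_def ord_fun_def ord_fun_axioms_def by blast
qed

theorem cartesian_functorI:
  assumes F: "ord_functor F" "relational_fun (FDom F) (FCod F) (FObj F) (FArr F)" "projection_compatible F"
  shows "cartesian_functor F"
proof -
  let ?C = "FDom F" and ?D = "FCod F" and ?f0 = "FObj F" and ?f1 = "FArr F"
  interpret S: bicategory_of_relations ?C using F by (simp add: relational_fun_def)
  interpret T: bicategory_of_relations ?D using F by (simp add: relational_fun_def)
  interpret product_fun ?C ?D ?f0 ?f1 S.conv "UnitObj ?C" "TensObj ?C" S.p1 S.p2 T.conv "UnitObj ?D" "TensObj ?D" T.p1 T.p2
    using F(2) by (rule relational_fun_product_fun)
  have ext: "FMult F \<in> extensional (Obj ?C \<times> Obj ?C)"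
    and u: "is_map ?D (FUnit F)" "Dom ?D (FUnit F) = UnitObj ?D" "Cod ?D (FUnit F) = ?f0 (UnitObj ?C)"
    using F(3) by (auto simp: projection_compatible_def Let_def)
  note [simp] = u T.map_Arr[OF u(1)]
  have m [simp]: "FMult F (X, Y) = mult X Y" if "X \<in> Obj ?C" "Y \<in> Obj ?C" for X Y
    using F(3) that by (intro mult_unique) (auto simp: projection_compatible_def Let_def)
  have nat: "mult (Cod ?C r) (Cod ?C s) \<cdot>\<^bsub>?D\<^esub> (?f1 r \<otimes>\<^bsub>?D\<^esub> ?f1 s) = ?f1 (r \<otimes>\<^bsub>?C\<^esub> s) \<cdot>\<^bsub>?D\<^esub> mult (Dom ?C r) (Dom ?C s)"
    if "r \<in> Arr ?C" "s \<in> Arr ?C" for r s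
    using mult_nat[OF that] that by (simp add: S.Times_eq_Tens T.Times_eq_Tens)
  have assoc: "?f1 (Assoc ?C X Y Z) \<cdot>\<^bsub>?D\<^esub> (mult (X \<odot>\<^bsub>?C\<^esub> Y) Z \<cdot>\<^bsub>?D\<^esub> (mult X Y \<otimes>\<^bsub>?D\<^esub> Ident ?D (?f0 Z)))
     = mult X (Y \<odot>\<^bsub>?C\<^esub> Z) \<cdot>\<^bsub>?D\<^esub> ((Ident ?D (?f0 X) \<otimes>\<^bsub>?D\<^esub> mult Y Z) \<cdot>\<^bsub>?D\<^esub> Assoc ?D (?f0 X) (?f0 Y) (?f0 Z))"
    if "X \<in> Obj ?C" "Y \<in> Obj ?C" "Z \<in> Obj ?C" for X Y Z
    using mult_assoc[OF that] that by (simp add: T.Times_eq_Tens S.assoc_eq_Assoc T.assoc_eq_Assoc)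
  have l: "?f1 (LUnit ?C X) \<cdot>\<^bsub>?D\<^esub> (mult (UnitObj ?C) X \<cdot>\<^bsub>?D\<^esub> (FUnit F \<otimes>\<^bsub>?D\<^esub> Ident ?D (?f0 X))) = LUnit ?D (?f0 X)"
    and r: "?f1 (RUnit ?C X) \<cdot>\<^bsub>?D\<^esub> (mult X (UnitObj ?C) \<cdot>\<^bsub>?D\<^esub> (Ident ?D (?f0 X) \<otimes>\<^bsub>?D\<^esub> FUnit F)) = RUnit ?D (?f0 X)"
    if "X \<in> Obj ?C" for X
    using mult_left_unit[OF that u] mult_right_unit[OF that u] that
    by (simp_all add: T.Times_eq_Tens S.p1_unit S.p2_unit T.p1_unit T.p2_unit)
  have iu: "is_iso ?D (FUnit F)"
    by (rule T.R.unit_object_iso[OF T.R.unit_object_U f_unit]) simp_all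
  show ?thesis
    unfolding cartesian_functor_def strong_monoidal_def Let_def
    by (intro conjI ballI S.bicategory_of_relations_axioms T.bicategory_of_relations_axioms F(1) ext)
      (simp_all add: mult_iso nat assoc l r iu)
qed

text \<open>The unit coherence of \<open>FMult\<close> identifies its composites with the images of the projections.
  Hence the duplication is preserved, and with it and the tensor product so are the meets.\<close>

theorem cartesian_functorD:
  assumes F: "cartesian_functor F"
  shows "ord_functor F" "relational_fun (FDom F) (FCod F) (FObj F) (FArr F)" "projection_compatible F"
proof -
  show of: "ord_functor F" using F by (simp add: cartesian_functor_def)
  let ?C = "FDom F" and ?D = "FCod F" and ?f0 = "FObj F" and ?f1 = "FArr F"
  let ?I = "UnitObj ?C" and ?J = "UnitObj ?D" and ?m = "\<lambda>X Y. FMult F (X, Y)" and ?u = "FUnit F"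
  interpret S: bicategory_of_relations ?C using F by (simp add: cartesian_functor_def)
  interpret T: bicategory_of_relations ?D using F by (simp add: cartesian_functor_def)
  interpret ord_fun ?C ?D ?f0 ?f1
    using of ord_functor_iff[of F] S.ord_category_axioms T.ord_category_axioms by simp
  have sm: "strong_monoidal F" using F by (simp add: cartesian_functor_def)
  note sm = sm[unfolded strong_monoidal_def Let_def]
  have ext: "FMult F \<in> extensional (Obj ?C \<times> Obj ?C)" using sm by blast
  have m [simp]: "?m X Y \<in> Arr ?D" "Dom ?D (?m X Y) = ?f0 X \<odot>\<^bsub>?D\<^esub> ?f0 Y" "Cod ?D (?m X Y) = ?f0 (X \<odot>\<^bsub>?C\<^esub> Y)"
    "is_iso ?D (?m X Y)" if "X \<in> Obj ?C" "Y \<in> Obj ?C" for X Y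
    using sm that by auto
  have u [simp]: "?u \<in> Arr ?D" "Dom ?D ?u = ?J" "Cod ?D ?u = ?f0 ?I" "is_iso ?D ?u" using sm by auto
  have nat: "?f1 (r \<otimes>\<^bsub>?C\<^esub> s) \<cdot>\<^bsub>?D\<^esub> ?m (Dom ?C r) (Dom ?C s) = ?m (Cod ?C r) (Cod ?C s) \<cdot>\<^bsub>?D\<^esub> (?f1 r \<otimes>\<^bsub>?D\<^esub> ?f1 s)"
    if "r \<in> Arr ?C" "s \<in> Arr ?C" for r s using sm that by simp
  have l: "?f1 (LUnit ?C X) \<cdot>\<^bsub>?D\<^esub> (?m ?I X \<cdot>\<^bsub>?D\<^esub> (?u \<otimes>\<^bsub>?D\<^esub> Ident ?D (?f0 X))) = LUnit ?D (?f0 X)"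
    and r: "?f1 (RUnit ?C X) \<cdot>\<^bsub>?D\<^esub> (?m X ?I \<cdot>\<^bsub>?D\<^esub> (Ident ?D (?f0 X) \<otimes>\<^bsub>?D\<^esub> ?u)) = RUnit ?D (?f0 X)"
    if [simp]: "X \<in> Obj ?C" for X
  proof -
    have "?f1 (LUnit ?C X) \<cdot>\<^bsub>?D\<^esub> ?m ?I X \<cdot>\<^bsub>?D\<^esub> (?u \<otimes>\<^bsub>?D\<^esub> Ident ?D (?f0 X)) = LUnit ?D (?f0 X)"
      "?f1 (RUnit ?C X) \<cdot>\<^bsub>?D\<^esub> ?m X ?I \<cdot>\<^bsub>?D\<^esub> (Ident ?D (?f0 X) \<otimes>\<^bsub>?D\<^esub> ?u) = RUnit ?D (?f0 X)"
      using sm that by blast+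
    then show "?f1 (LUnit ?C X) \<cdot>\<^bsub>?D\<^esub> (?m ?I X \<cdot>\<^bsub>?D\<^esub> (?u \<otimes>\<^bsub>?D\<^esub> Ident ?D (?f0 X))) = LUnit ?D (?f0 X)"
      "?f1 (RUnit ?C X) \<cdot>\<^bsub>?D\<^esub> (?m X ?I \<cdot>\<^bsub>?D\<^esub> (Ident ?D (?f0 X) \<otimes>\<^bsub>?D\<^esub> ?u)) = RUnit ?D (?f0 X)"
      by simp_all
  qed
  have mm [simp]: "is_map ?D (?m X Y)" if "X \<in> Obj ?C" "Y \<in> Obj ?C" for X Y
    using that by (intro T.iso_map) simp
  have um [simp]: "is_map ?D ?u" by (intro T.iso_map) simp
  note ui = T.iso_inv_arr[OF u(4), unfolded u]
  note [simp] = ui(2-4)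
  have uim [simp]: "is_map ?D (inv_arr ?D ?u)"
    using ui by (intro T.iso_map T.is_isoI[where g = ?u]) auto
  have e: "?f1 (Del ?C Y) = ?u \<cdot>\<^bsub>?D\<^esub> Del ?D (?f0 Y)" if [simp]: "Y \<in> Obj ?C" for Y
  proof -
    have "inv_arr ?D ?u \<cdot>\<^bsub>?D\<^esub> ?f1 (Del ?C Y) = Del ?D (?f0 Y)"
      using T.map_to_unit[of "inv_arr ?D ?u \<cdot>\<^bsub>?D\<^esub> ?f1 (Del ?C Y)"] by simp
    then have "?u \<cdot>\<^bsub>?D\<^esub> (inv_arr ?D ?u \<cdot>\<^bsub>?D\<^esub> ?f1 (Del ?C Y)) = ?u \<cdot>\<^bsub>?D\<^esub> Del ?D (?f0 Y)" by simp
    then show ?thesis by (simp add: T.comp_extend[OF ui(6)])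
  qed
  have p1: "?f1 (S.p1 X Y) \<cdot>\<^bsub>?D\<^esub> ?m X Y = T.p1 (?f0 X) (?f0 Y)" if [simp]: "X \<in> Obj ?C" "Y \<in> Obj ?C" for X Y
  proof -
    have "?f1 (S.p1 X Y) \<cdot>\<^bsub>?D\<^esub> ?m X Y = ?f1 (RUnit ?C X) \<cdot>\<^bsub>?D\<^esub> (?f1 (Ident ?C X \<otimes>\<^bsub>?C\<^esub> Del ?C Y) \<cdot>\<^bsub>?D\<^esub> ?m X Y)"
      by (simp add: S.p1_def)
    also have "\<dots> = (?f1 (RUnit ?C X) \<cdot>\<^bsub>?D\<^esub> (?m X ?I \<cdot>\<^bsub>?D\<^esub> (Ident ?D (?f0 X) \<otimes>\<^bsub>?D\<^esub> ?u))) \<cdot>\<^bsub>?D\<^esub> (Ident ?D (?f0 X) \<otimes>\<^bsub>?D\<^esub> Del ?D (?f0 Y))"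
      using nat[of "Ident ?C X" "Del ?C Y"] by (simp add: e T.whisker)
    also have "\<dots> = T.p1 (?f0 X) (?f0 Y)" by (simp only: r that) (simp add: T.p1_def)
    finally show ?thesis .
  qed
  have p2: "?f1 (S.p2 X Y) \<cdot>\<^bsub>?D\<^esub> ?m X Y = T.p2 (?f0 X) (?f0 Y)" if [simp]: "X \<in> Obj ?C" "Y \<in> Obj ?C" for X Y
  proof -
    have "?f1 (S.p2 X Y) \<cdot>\<^bsub>?D\<^esub> ?m X Y = ?f1 (LUnit ?C Y) \<cdot>\<^bsub>?D\<^esub> (?f1 (Del ?C X \<otimes>\<^bsub>?C\<^esub> Ident ?C Y) \<cdot>\<^bsub>?D\<^esub> ?m X Y)"
      by (simp add: S.p2_def)
    also have "\<dots> = (?f1 (LUnit ?C Y) \<cdot>\<^bsub>?D\<^esub> (?m ?I Y \<cdot>\<^bsub>?D\<^esub> (?u \<otimes>\<^bsub>?D\<^esub> Ident ?D (?f0 Y)))) \<cdot>\<^bsub>?D\<^esub> (Del ?D (?f0 X) \<otimes>\<^bsub>?D\<^esub> Ident ?D (?f0 Y))"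
      using nat[of "Del ?C X" "Ident ?C Y"] by (simp add: e T.whisker)
    also have "\<dots> = T.p2 (?f0 X) (?f0 Y)" by (simp only: l that) (simp add: T.p2_def)
    finally show ?thesis .
  qed
  show "projection_compatible F"
    unfolding projection_compatible_def Let_def by (simp add: ext p1 p2)
  have dup: "?f1 (Dup ?C Y) = ?m Y Y \<cdot>\<^bsub>?D\<^esub> Dup ?D (?f0 Y)" if [simp]: "Y \<in> Obj ?C" for Y
  proof -
    have Y: "is_iso ?D (?m Y Y)" by simp
    note mi = T.iso_inv_arr[OF Y]
    note [simp] = mi(2-4)
    have [simp]: "is_map ?D (inv_arr ?D (?m Y Y))"
      using mi by (intro T.iso_map T.is_isoI[where g = "?m Y Y"]) auto
    have a: "T.p1 (?f0 Y) (?f0 Y) \<cdot>\<^bsub>?D\<^esub> inv_arr ?D (?m Y Y) = ?f1 (S.p1 Y Y)"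
      "T.p2 (?f0 Y) (?f0 Y) \<cdot>\<^bsub>?D\<^esub> inv_arr ?D (?m Y Y) = ?f1 (S.p2 Y Y)"
      using mi(6) by (simp_all add: p1[symmetric] p2[symmetric])
    have b: "S.p1 Y Y \<cdot>\<^bsub>?C\<^esub> Dup ?C Y = Ident ?C Y" "S.p2 Y Y \<cdot>\<^bsub>?C\<^esub> Dup ?C Y = Ident ?C Y"
      "T.p1 (?f0 Y) (?f0 Y) \<cdot>\<^bsub>?D\<^esub> Dup ?D (?f0 Y) = Ident ?D (?f0 Y)"
      "T.p2 (?f0 Y) (?f0 Y) \<cdot>\<^bsub>?D\<^esub> Dup ?D (?f0 Y) = Ident ?D (?f0 Y)"
      by (simp_all add: S.Dup_eq_pair T.Dup_eq_pair S.projection_pair_maps T.projection_pair_maps)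
    have c: "?f1 (S.p1 Y Y) \<cdot>\<^bsub>?D\<^esub> ?f1 (Dup ?C Y) = Ident ?D (?f0 Y)"
      "?f1 (S.p2 Y Y) \<cdot>\<^bsub>?D\<^esub> ?f1 (Dup ?C Y) = Ident ?D (?f0 Y)"
      using b(1,2)[THEN arg_cong, of ?f1] by simp_all
    have "inv_arr ?D (?m Y Y) \<cdot>\<^bsub>?D\<^esub> ?f1 (Dup ?C Y) = Dup ?D (?f0 Y)"
      by (rule T.R.Tuple_ext[of _ _ "?f0 Y" "?f0 Y"])
         (simp_all add: T.comp_extend[OF a(1)] T.comp_extend[OF a(2)] b c)
    then have "?m Y Y \<cdot>\<^bsub>?D\<^esub> (inv_arr ?D (?m Y Y) \<cdot>\<^bsub>?D\<^esub> ?f1 (Dup ?C Y)) = ?m Y Y \<cdot>\<^bsub>?D\<^esub> Dup ?D (?f0 Y)" by simp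
    then show ?thesis by (simp add: T.comp_extend[OF mi(6)])
  qed
  have meet: "?f1 (r \<sqinter>\<^bsub>?C\<^esub> s) = ?f1 r \<sqinter>\<^bsub>?D\<^esub> ?f1 s"
    if [simp]: "r \<in> Arr ?C" "s \<in> Arr ?C" "Dom ?C r = Dom ?C s" "Cod ?C r = Cod ?C s" for r s
  proof -
    let ?X = "Dom ?C s" and ?Y = "Cod ?C s"
    have Y: "is_iso ?D (?m ?Y ?Y)" by simp
    note mi = T.iso_inv_arr[OF Y]
    note [simp] = mi(2-4)
    have d: "?f1 (right_adj ?C (Dup ?C ?Y)) = right_adj ?D (Dup ?D (?f0 ?Y)) \<cdot>\<^bsub>?D\<^esub> inv_arr ?D (?m ?Y ?Y)"
      by (simp add: f_right_adj dup T.right_adj_Comp T.iso_right_adj)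
    have "?f1 (r \<sqinter>\<^bsub>?C\<^esub> s) = right_adj ?D (Dup ?D (?f0 ?Y)) \<cdot>\<^bsub>?D\<^esub> (inv_arr ?D (?m ?Y ?Y) \<cdot>\<^bsub>?D\<^esub>
       ((?f1 (r \<otimes>\<^bsub>?C\<^esub> s) \<cdot>\<^bsub>?D\<^esub> ?m ?X ?X) \<cdot>\<^bsub>?D\<^esub> Dup ?D (?f0 ?X)))"
      by (simp add: S.meet_eq_pair S.pair_def d dup)
    also have "\<dots> = right_adj ?D (Dup ?D (?f0 ?Y)) \<cdot>\<^bsub>?D\<^esub> ((?f1 r \<otimes>\<^bsub>?D\<^esub> ?f1 s) \<cdot>\<^bsub>?D\<^esub> Dup ?D (?f0 ?X))"
      using nat[of r s] by (simp add: T.comp_extend[OF mi(5)])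
    also have "\<dots> = ?f1 r \<sqinter>\<^bsub>?D\<^esub> ?f1 s" by (simp add: T.meet_eq_pair T.pair_def)
    finally show ?thesis .
  qed
  have "T.R.unit_object (?f0 ?I)"
    by (rule T.R.unit_object_transport[OF T.R.unit_object_U u(4)]) simp_all
  then show "relational_fun ?C ?D ?f0 ?f1"
    using meet by (simp add: relational_fun_def meet_fun_def S.bicategory_of_relations_axioms
        T.bicategory_of_relations_axioms ord_fun_axioms)
qed

theorem cartesian_functor_exists:
  assumes f: "relational_fun C D f0 f1" "f0 \<in> extensional (Obj C)" "f1 \<in> extensional (Arr C)"
  shows "\<exists>F. cartesian_functor F \<and> FDom F = C \<and> FCod F = D \<and> FObj F = f0 \<and> FArr F = f1"
proof -
  interpret S: bicategory_of_relations C using f by (simp add: relational_fun_def)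
  interpret T: bicategory_of_relations D using f by (simp add: relational_fun_def)
  interpret product_fun C D f0 f1 S.conv "UnitObj C" "TensObj C" S.p1 S.p2 T.conv "UnitObj D" "TensObj D" T.p1 T.p2
    using f(1) by (rule relational_fun_product_fun)
  obtain u where u: "is_map D u" "Dom D u = UnitObj D" "Cod D u = f0 (UnitObj C)"
    using T.R.unit_object_map_exists[OF f_unit, of "UnitObj D"] by auto
  define F where "F = \<lparr>FDom = C, FCod = D, FObj = f0, FArr = f1,
    FMult = (\<lambda>XY \<in> Obj C \<times> Obj C. mult (fst XY) (snd XY)), FUnit = u\<rparr>"
  have "cartesian_functor F"
  proof (rule cartesian_functorI)
    show "ord_functor F"
      using f ord_fun_axioms ord_functor_iff[of F] S.ord_category_axioms T.ord_category_axioms by (simp add: F_def)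
    show "relational_fun (FDom F) (FCod F) (FObj F) (FArr F)" using f by (simp add: F_def)
    show "projection_compatible F"
      using u T.map_Arr[OF u(1)] by (auto simp: projection_compatible_def F_def mult)
  qed
  then show ?thesis by (intro exI[of _ F]) (simp add: F_def)
qed

text \<open>Compatibility with projections leaves no choice for \<open>FMult\<close>, nor terminality for \<open>FUnit\<close>.\<close>

theorem cartesian_functor_eqI:
  assumes F: "cartesian_functor F" and G: "cartesian_functor G"
    and eq: "FDom F = FDom G" "FCod F = FCod G" "FObj F = FObj G" "FArr F = FArr G"
  shows "F = G"
proof -
  let ?C = "FDom G" and ?D = "FCod G" and ?f0 = "FObj G" and ?f1 = "FArr G"
  have rf: "relational_fun ?C ?D ?f0 ?f1" using cartesian_functorD[OF G] by simp
  interpret S: bicategory_of_relations ?C using rf by (simp add: relational_fun_def)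
  interpret T: bicategory_of_relations ?D using rf by (simp add: relational_fun_def)
  interpret product_fun ?C ?D ?f0 ?f1 S.conv "UnitObj ?C" "TensObj ?C" S.p1 S.p2 T.conv "UnitObj ?D" "TensObj ?D" T.p1 T.p2
    using rf by (rule relational_fun_product_fun)
  note pc = cartesian_functorD(3)[OF F] cartesian_functorD(3)[OF G]
  have "FMult F = FMult G"
  proof (rule extensionalityI[where A = "Obj ?C \<times> Obj ?C"])
    fix XY assume "XY \<in> Obj ?C \<times> Obj ?C"
    then obtain X Y where XY: "XY = (X, Y)" "X \<in> Obj ?C" "Y \<in> Obj ?C" by auto
    have "FMult F (X, Y) = mult X Y" "FMult G (X, Y) = mult X Y"
      using pc XY by (auto simp: projection_compatible_def Let_def eq intro!: mult_unique)
    then show "FMult F XY = FMult G XY" using XY by simp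
  qed (use pc in \<open>auto simp: projection_compatible_def Let_def eq\<close>)
  moreover have "FUnit F = FUnit G"
    by (rule T.R.unit_object_map_unique[OF f_unit])
      (use pc in \<open>auto simp: projection_compatible_def Let_def eq\<close>)
  ultimately show ?thesis using eq by simp
qed

section \<open>2-categories of functors and transformations\<close>

lemma is_map_Arr: "is_map C f \<Longrightarrow> f \<in> Arr C"
  by (auto simp: is_map_def is_right_adjoint_def)

text \<open>The assumptions common to both sides: functors are determined by their action, and comparable
  parallel maps are equal.\<close>

locale transformation_setup =
  fixes Ob :: "('o, 'a, 'z) ord_cat_data_scheme set"
    and Fn :: "(('o, 'a, 'z) ord_cat_data_scheme, 'o, 'a, 'y) fun_data_scheme set"
    and idf compf
  assumes Ob_ord: "C \<in> Ob \<Longrightarrow> ord_category C"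
    and maps_discrete: "\<lbrakk>C \<in> Ob; is_map C f; is_map C g; f \<preceq>\<^bsub>C\<^esub> g\<rbrakk> \<Longrightarrow> f = g"
    and Fn_Ob [simp]: "F \<in> Fn \<Longrightarrow> FDom F \<in> Ob" "F \<in> Fn \<Longrightarrow> FCod F \<in> Ob"
    and Fn_ord: "F \<in> Fn \<Longrightarrow> ord_functor F"
    and idf [simp]: "C \<in> Ob \<Longrightarrow> idf C \<in> Fn" "C \<in> Ob \<Longrightarrow> FDom (idf C) = C" "C \<in> Ob \<Longrightarrow> FCod (idf C) = C"
      "C \<in> Ob \<Longrightarrow> FObj (idf C) = (\<lambda>X \<in> Obj C. X)" "C \<in> Ob \<Longrightarrow> FArr (idf C) = (\<lambda>r \<in> Arr C. r)"
    and compf [simp]: "\<lbrakk>F \<in> Fn; G \<in> Fn; FDom G = FCod F\<rbrakk> \<Longrightarrow> compf G F \<in> Fn"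
      "\<lbrakk>F \<in> Fn; G \<in> Fn; FDom G = FCod F\<rbrakk> \<Longrightarrow> FDom (compf G F) = FDom F"
      "\<lbrakk>F \<in> Fn; G \<in> Fn; FDom G = FCod F\<rbrakk> \<Longrightarrow> FCod (compf G F) = FCod G"
      "\<lbrakk>F \<in> Fn; G \<in> Fn; FDom G = FCod F\<rbrakk> \<Longrightarrow> FObj (compf G F) = compose (Obj (FDom F)) (FObj G) (FObj F)"
      "\<lbrakk>F \<in> Fn; G \<in> Fn; FDom G = FCod F\<rbrakk> \<Longrightarrow> FArr (compf G F) = compose (Arr (FDom F)) (FArr G) (FArr F)"
    and Fn_eqI: "\<lbrakk>F \<in> Fn; G \<in> Fn; FDom F = FDom G; FCod F = FCod G; FObj F = FObj G; FArr F = FArr G\<rbrakk> \<Longrightarrow> F = G"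
begin

abbreviation (input) T where "T \<equiv> transformation_2cat Ob Fn idf compf"

lemma Fn_ord_fun: "F \<in> Fn \<Longrightarrow> ord_fun (FDom F) (FCod F) (FObj F) (FArr F)"
  using Fn_ord[of F] ord_functor_iff[of F] Ob_ord[of "FDom F"] Ob_ord[of "FCod F"] by simp

lemma Fn_ext: "F \<in> Fn \<Longrightarrow> FObj F \<in> extensional (Obj (FDom F))" "F \<in> Fn \<Longrightarrow> FArr F \<in> extensional (Arr (FDom F))"
  using Fn_ord[of F] by (auto simp: ord_functor_def)

lemma Fn_typed [simp]:
  assumes "F \<in> Fn"
  shows "X \<in> Obj (FDom F) \<Longrightarrow> FObj F X \<in> Obj (FCod F)"
    "r \<in> Arr (FDom F) \<Longrightarrow> FArr F r \<in> Arr (FCod F)"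
    "r \<in> Arr (FDom F) \<Longrightarrow> Dom (FCod F) (FArr F r) = FObj F (Dom (FDom F) r)"
    "r \<in> Arr (FDom F) \<Longrightarrow> Cod (FCod F) (FArr F r) = FObj F (Cod (FDom F) r)"
    "X \<in> Obj (FDom F) \<Longrightarrow> FArr F (Ident (FDom F) X) = Ident (FCod F) (FObj F X)"
    "\<lbrakk>r \<in> Arr (FDom F); s \<in> Arr (FDom F); Dom (FDom F) s = Cod (FDom F) r\<rbrakk>
      \<Longrightarrow> FArr F (s \<cdot>\<^bsub>FDom F\<^esub> r) = FArr F s \<cdot>\<^bsub>FCod F\<^esub> FArr F r"
    "is_map (FDom F) r \<Longrightarrow> is_map (FCod F) (FArr F r)"
    "r \<preceq>\<^bsub>FDom F\<^esub> s \<Longrightarrow> FArr F r \<preceq>\<^bsub>FCod F\<^esub> FArr F s"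
proof -
  interpret ord_fun "FDom F" "FCod F" "FObj F" "FArr F" using assms by (rule Fn_ord_fun)
  show "X \<in> Obj (FDom F) \<Longrightarrow> FObj F X \<in> Obj (FCod F)"
    "r \<in> Arr (FDom F) \<Longrightarrow> FArr F r \<in> Arr (FCod F)"
    "r \<in> Arr (FDom F) \<Longrightarrow> Dom (FCod F) (FArr F r) = FObj F (Dom (FDom F) r)"
    "r \<in> Arr (FDom F) \<Longrightarrow> Cod (FCod F) (FArr F r) = FObj F (Cod (FDom F) r)"
    "X \<in> Obj (FDom F) \<Longrightarrow> FArr F (Ident (FDom F) X) = Ident (FCod F) (FObj F X)"
    "\<lbrakk>r \<in> Arr (FDom F); s \<in> Arr (FDom F); Dom (FDom F) s = Cod (FDom F) r\<rbrakk>
      \<Longrightarrow> FArr F (s \<cdot>\<^bsub>FDom F\<^esub> r) = FArr F s \<cdot>\<^bsub>FCod F\<^esub> FArr F r"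
    "is_map (FDom F) r \<Longrightarrow> is_map (FCod F) (FArr F r)"
    "r \<preceq>\<^bsub>FDom F\<^esub> s \<Longrightarrow> FArr F r \<preceq>\<^bsub>FCod F\<^esub> FArr F s" by (simp_all add: mono)
qed

lemma T_simps [simp]:
  "Obj T = Ob" "Arr T = Fn" "Dom T = FDom" "Cod T = FCod" "Ident T = idf" "Comp T = compf"
  "Src T = TSrc" "Tgt T = TTgt"
  by (simp_all add: transformation_2cat_def)

text \<open>The 2-cells, with naturality expressed by the typed order.\<close>

definition cell :: "((('o, 'a, 'z) ord_cat_data_scheme, 'o, 'a, 'y) fun_data_scheme, 'o, 'a) trans_data \<Rightarrow> bool" where
  "cell \<alpha> \<longleftrightarrow> TSrc \<alpha> \<in> Fn \<and> TTgt \<alpha> \<in> Fn \<and> FDom (TTgt \<alpha>) = FDom (TSrc \<alpha>) \<and> FCod (TTgt \<alpha>) = FCod (TSrc \<alpha>) \<and>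
     TComp \<alpha> \<in> extensional (Obj (FDom (TSrc \<alpha>))) \<and>
     (\<forall>X \<in> Obj (FDom (TSrc \<alpha>)). is_map (FCod (TSrc \<alpha>)) (TComp \<alpha> X) \<and>
        Dom (FCod (TSrc \<alpha>)) (TComp \<alpha> X) = FObj (TSrc \<alpha>) X \<and> Cod (FCod (TSrc \<alpha>)) (TComp \<alpha> X) = FObj (TTgt \<alpha>) X) \<and>
     (\<forall>s \<in> Arr (FDom (TSrc \<alpha>)). TComp \<alpha> (Cod (FDom (TSrc \<alpha>)) s) \<cdot>\<^bsub>FCod (TSrc \<alpha>)\<^esub> FArr (TSrc \<alpha>) s
        \<preceq>\<^bsub>FCod (TSrc \<alpha>)\<^esub> FArr (TTgt \<alpha>) s \<cdot>\<^bsub>FCod (TSrc \<alpha>)\<^esub> TComp \<alpha> (Dom (FDom (TSrc \<alpha>)) s))"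

lemma cellD:
  assumes "cell \<alpha>"
  shows "TSrc \<alpha> \<in> Fn" "TTgt \<alpha> \<in> Fn" "FDom (TTgt \<alpha>) = FDom (TSrc \<alpha>)" "FCod (TTgt \<alpha>) = FCod (TSrc \<alpha>)"
    "TComp \<alpha> \<in> extensional (Obj (FDom (TSrc \<alpha>)))"
    "X \<in> Obj (FDom (TSrc \<alpha>)) \<Longrightarrow> is_map (FCod (TSrc \<alpha>)) (TComp \<alpha> X)"
    "X \<in> Obj (FDom (TSrc \<alpha>)) \<Longrightarrow> TComp \<alpha> X \<in> Arr (FCod (TSrc \<alpha>))"
    "X \<in> Obj (FDom (TSrc \<alpha>)) \<Longrightarrow> Dom (FCod (TSrc \<alpha>)) (TComp \<alpha> X) = FObj (TSrc \<alpha>) X"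
    "X \<in> Obj (FDom (TSrc \<alpha>)) \<Longrightarrow> Cod (FCod (TSrc \<alpha>)) (TComp \<alpha> X) = FObj (TTgt \<alpha>) X"
    "s \<in> Arr (FDom (TSrc \<alpha>)) \<Longrightarrow> TComp \<alpha> (Cod (FDom (TSrc \<alpha>)) s) \<cdot>\<^bsub>FCod (TSrc \<alpha>)\<^esub> FArr (TSrc \<alpha>) s
        \<preceq>\<^bsub>FCod (TSrc \<alpha>)\<^esub> FArr (TTgt \<alpha>) s \<cdot>\<^bsub>FCod (TSrc \<alpha>)\<^esub> TComp \<alpha> (Dom (FDom (TSrc \<alpha>)) s)"
  using assms by (auto simp: cell_def intro: is_map_Arr)

lemma Cells_T [simp]: "\<alpha> \<in> Cells T \<longleftrightarrow> cell \<alpha>"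
proof -
  let ?A = "FDom (TSrc \<alpha>)" and ?B = "FCod (TSrc \<alpha>)"
  have "\<alpha> \<in> Cells T \<longleftrightarrow> TSrc \<alpha> \<in> Fn \<and> TTgt \<alpha> \<in> Fn \<and> oplax_transformation \<alpha> \<and> map_components \<alpha>"
    by (simp add: transformation_2cat_def)
  also have "\<dots> \<longleftrightarrow> cell \<alpha>"
  proof (cases "TSrc \<alpha> \<in> Fn \<and> TTgt \<alpha> \<in> Fn \<and> FDom (TTgt \<alpha>) = ?A \<and> FCod (TTgt \<alpha>) = ?B \<and>
      (\<forall>X \<in> Obj ?A. TComp \<alpha> X \<in> hom ?B (FObj (TSrc \<alpha>) X) (FObj (TTgt \<alpha>) X))")
    case True
    interpret A: ord_category ?A using True Ob_ord by simp
    interpret B: ord_category ?B using True Ob_ord by simp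
    have "TComp \<alpha> (Cod ?A s) \<cdot>\<^bsub>?B\<^esub> FArr (TSrc \<alpha>) s \<preceq>\<^bsub>?B\<^esub> FArr (TTgt \<alpha>) s \<cdot>\<^bsub>?B\<^esub> TComp \<alpha> (Dom ?A s) \<longleftrightarrow>
       TComp \<alpha> (Cod ?A s) \<cdot>\<^bsub>?B\<^esub> FArr (TSrc \<alpha>) s \<sqsubseteq>\<^bsub>?B\<^esub> FArr (TTgt \<alpha>) s \<cdot>\<^bsub>?B\<^esub> TComp \<alpha> (Dom ?A s)"
      if "s \<in> Arr ?A" for s
      using True that Fn_typed[of "TTgt \<alpha>"] by (simp add: le_def)
    then show ?thesis using True
      by (auto simp: oplax_transformation_def map_components_def cell_def Let_def)
  next
    case False
    then show ?thesis
      by (auto simp: oplax_transformation_def map_components_def cell_def Let_def is_map_def is_right_adjoint_def)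
  qed
  finally show ?thesis .
qed

lemma VIdent_T: "VIdent T F = \<lparr>TSrc = F, TTgt = F, TComp = (\<lambda>X \<in> Obj (FDom F). Ident (FCod F) (FObj F X))\<rparr>"
  and VComp_T: "VComp T \<beta> \<alpha> = \<lparr>TSrc = TSrc \<alpha>, TTgt = TTgt \<beta>,
        TComp = (\<lambda>X \<in> Obj (FDom (TSrc \<alpha>)). TComp \<beta> X \<cdot>\<^bsub>FCod (TSrc \<alpha>)\<^esub> TComp \<alpha> X)\<rparr>"
  and HComp_T: "HComp T \<beta> \<alpha> = \<lparr>TSrc = compf (TSrc \<beta>) (TSrc \<alpha>), TTgt = compf (TTgt \<beta>) (TTgt \<alpha>),
        TComp = (\<lambda>X \<in> Obj (FDom (TSrc \<alpha>)).
          FArr (TTgt \<beta>) (TComp \<alpha> X) \<cdot>\<^bsub>FCod (TSrc \<beta>)\<^esub> TComp \<beta> (FObj (TSrc \<alpha>) X))\<rparr>"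
  by (simp_all add: transformation_2cat_def)

lemma cell_eqI:
  assumes "cell \<alpha>" "cell \<beta>" "TSrc \<alpha> = TSrc \<beta>" "TTgt \<alpha> = TTgt \<beta>"
    "\<And>X. X \<in> Obj (FDom (TSrc \<beta>)) \<Longrightarrow> TComp \<alpha> X = TComp \<beta> X"
  shows "\<alpha> = \<beta>"
proof -
  have "TComp \<alpha> = TComp \<beta>"
    by (rule extensionalityI[where A = "Obj (FDom (TSrc \<beta>))"])
       (use assms cellD(5)[OF assms(1)] cellD(5)[OF assms(2)] in auto)
  then show ?thesis using assms by simp
qed

lemma cell_VIdent:
  assumes F [simp]: "F \<in> Fn" shows "cell (VIdent T F)"
proof -
  interpret A: ord_category "FDom F" using Ob_ord by simp
  interpret B: ord_category "FCod F" using Ob_ord by simp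
  show ?thesis by (simp add: cell_def VIdent_T)
qed

lemma cell_VComp:
  assumes a: "cell \<alpha>" and b: "cell \<beta>" and e: "TSrc \<beta> = TTgt \<alpha>"
  shows "cell (VComp T \<beta> \<alpha>)"
proof -
  let ?A = "FDom (TSrc \<alpha>)" and ?B = "FCod (TSrc \<alpha>)"
  note [simp] = cellD(1-9)[OF a] cellD(2-9)[OF b, unfolded e cellD(3,4)[OF a]] e
  interpret A: ord_category ?A using Ob_ord by simp
  interpret B: ord_category ?B using Ob_ord by simp
  note ty = Fn_typed[OF cellD(1)[OF a]] Fn_typed[OF cellD(2)[OF a], simplified] Fn_typed[OF cellD(2)[OF b], simplified]
  have "(TComp \<beta> (Cod ?A s) \<cdot>\<^bsub>?B\<^esub> TComp \<alpha> (Cod ?A s)) \<cdot>\<^bsub>?B\<^esub> FArr (TSrc \<alpha>) s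
     \<preceq>\<^bsub>?B\<^esub> FArr (TTgt \<beta>) s \<cdot>\<^bsub>?B\<^esub> (TComp \<beta> (Dom ?A s) \<cdot>\<^bsub>?B\<^esub> TComp \<alpha> (Dom ?A s))"
    if [simp]: "s \<in> Arr ?A" for s
  proof -
    have "(TComp \<beta> (Cod ?A s) \<cdot>\<^bsub>?B\<^esub> TComp \<alpha> (Cod ?A s)) \<cdot>\<^bsub>?B\<^esub> FArr (TSrc \<alpha>) s
       = TComp \<beta> (Cod ?A s) \<cdot>\<^bsub>?B\<^esub> (TComp \<alpha> (Cod ?A s) \<cdot>\<^bsub>?B\<^esub> FArr (TSrc \<alpha>) s)"
      using ty by simp
    also have "\<dots> \<preceq>\<^bsub>?B\<^esub> TComp \<beta> (Cod ?A s) \<cdot>\<^bsub>?B\<^esub> (FArr (TTgt \<alpha>) s \<cdot>\<^bsub>?B\<^esub> TComp \<alpha> (Dom ?A s))"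
      using cellD(10)[OF a, of s] ty by (intro B.comp_le_right) auto
    also have "\<dots> = (TComp \<beta> (Cod ?A s) \<cdot>\<^bsub>?B\<^esub> FArr (TTgt \<alpha>) s) \<cdot>\<^bsub>?B\<^esub> TComp \<alpha> (Dom ?A s)"
      using ty by simp
    also have "\<dots> \<preceq>\<^bsub>?B\<^esub> (FArr (TTgt \<beta>) s \<cdot>\<^bsub>?B\<^esub> TComp \<beta> (Dom ?A s)) \<cdot>\<^bsub>?B\<^esub> TComp \<alpha> (Dom ?A s)"
      using cellD(10)[OF b, of s] ty by (intro B.comp_le_left) auto
    also have "\<dots> = FArr (TTgt \<beta>) s \<cdot>\<^bsub>?B\<^esub> (TComp \<beta> (Dom ?A s) \<cdot>\<^bsub>?B\<^esub> TComp \<alpha> (Dom ?A s))"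
      using ty by simp
    finally show ?thesis .
  qed
  then show ?thesis by (simp add: cell_def VComp_T)
qed

lemma cell_HComp:
  assumes a: "cell \<alpha>" and b: "cell \<beta>" and e: "FDom (TSrc \<beta>) = FCod (TSrc \<alpha>)"
  shows "cell (HComp T \<beta> \<alpha>)"
proof -
  let ?A = "FDom (TSrc \<alpha>)" and ?B = "FCod (TSrc \<alpha>)" and ?E = "FCod (TSrc \<beta>)"
  let ?F = "TSrc \<alpha>" and ?G = "TTgt \<alpha>" and ?H = "TSrc \<beta>" and ?K = "TTgt \<beta>"
  note [simp] = cellD(1-9)[OF a] cellD(1-9)[OF b, unfolded e] e
  interpret A: ord_category ?A using Ob_ord by simp
  interpret B: ord_category ?B using Ob_ord by simp
  interpret E: ord_category ?E using Ob_ord by simp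
  note ty [simp] = Fn_typed[OF cellD(1)[OF a], simplified] Fn_typed[OF cellD(2)[OF a], simplified]
    Fn_typed[OF cellD(1)[OF b], simplified] Fn_typed[OF cellD(2)[OF b], simplified]
  have "(FArr ?K (TComp \<alpha> (Cod ?A s)) \<cdot>\<^bsub>?E\<^esub> TComp \<beta> (FObj ?F (Cod ?A s))) \<cdot>\<^bsub>?E\<^esub> FArr ?H (FArr ?F s)
     \<preceq>\<^bsub>?E\<^esub> FArr ?K (FArr ?G s) \<cdot>\<^bsub>?E\<^esub> (FArr ?K (TComp \<alpha> (Dom ?A s)) \<cdot>\<^bsub>?E\<^esub> TComp \<beta> (FObj ?F (Dom ?A s)))"
    if [simp]: "s \<in> Arr ?A" for s
  proof -
    have "(FArr ?K (TComp \<alpha> (Cod ?A s)) \<cdot>\<^bsub>?E\<^esub> TComp \<beta> (FObj ?F (Cod ?A s))) \<cdot>\<^bsub>?E\<^esub> FArr ?H (FArr ?F s)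
       = FArr ?K (TComp \<alpha> (Cod ?A s)) \<cdot>\<^bsub>?E\<^esub> (TComp \<beta> (Cod ?B (FArr ?F s)) \<cdot>\<^bsub>?E\<^esub> FArr ?H (FArr ?F s))"
      by simp
    also have "\<dots> \<preceq>\<^bsub>?E\<^esub> FArr ?K (TComp \<alpha> (Cod ?A s)) \<cdot>\<^bsub>?E\<^esub> (FArr ?K (FArr ?F s) \<cdot>\<^bsub>?E\<^esub> TComp \<beta> (Dom ?B (FArr ?F s)))"
      using cellD(10)[OF b, of "FArr ?F s"] by (intro E.comp_le_right) auto
    also have "\<dots> = FArr ?K (TComp \<alpha> (Cod ?A s) \<cdot>\<^bsub>?B\<^esub> FArr ?F s) \<cdot>\<^bsub>?E\<^esub> TComp \<beta> (FObj ?F (Dom ?A s))"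
      by simp
    also have "\<dots> \<preceq>\<^bsub>?E\<^esub> FArr ?K (FArr ?G s \<cdot>\<^bsub>?B\<^esub> TComp \<alpha> (Dom ?A s)) \<cdot>\<^bsub>?E\<^esub> TComp \<beta> (FObj ?F (Dom ?A s))"
      using ty(32)[OF cellD(10)[OF a, of s]] by (intro E.comp_le_left) auto
    also have "\<dots> = FArr ?K (FArr ?G s) \<cdot>\<^bsub>?E\<^esub> (FArr ?K (TComp \<alpha> (Dom ?A s)) \<cdot>\<^bsub>?E\<^esub> TComp \<beta> (FObj ?F (Dom ?A s)))"
      by simp
    finally show ?thesis .
  qed
  then show ?thesis by (simp add: cell_def HComp_T compose_def)
qed

lemma category_T: "category T"
proof (unfold_locales, goal_cases)
  case (3 X)
  then show ?case by simp
next
  case (5 F X Y)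
  then show ?case using Fn_ext[of F] Fn_typed(2)[of F]
    by (intro Fn_eqI) (auto simp: compose_def extensional_def fun_eq_iff category.Obj_Dom_Cod)
next
  case (6 F X Y)
  then show ?case using Fn_ext[of F] by (intro Fn_eqI) (auto simp: compose_def extensional_def fun_eq_iff)
next
  case (7 F W X G Y H Z)
  then show ?case by (intro Fn_eqI) (auto simp: compose_def fun_eq_iff)
qed auto


lemma category_vertical: "category (vertical T)"
proof (unfold_locales, goal_cases)
  case (5 \<alpha> F G)
  then have a: "cell \<alpha>" "F = TSrc \<alpha>" by (simp_all add: vertical_def)
  note D [simp] = cellD(1-9)[OF a(1)]
  interpret B: ord_category "FCod (TSrc \<alpha>)" using Ob_ord by simp
  have "VComp T \<alpha> (VIdent T F) = \<alpha>"
    by (rule cell_eqI[OF cell_VComp[OF cell_VIdent a(1)] a(1)]) (simp_all add: a VIdent_T VComp_T)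
  then show ?case by (simp add: vertical_def)
next
  case (6 \<alpha> F G)
  then have a: "cell \<alpha>" "G = TTgt \<alpha>" by (simp_all add: vertical_def)
  note D [simp] = cellD(1-9)[OF a(1)]
  interpret B: ord_category "FCod (TSrc \<alpha>)" using Ob_ord by simp
  have "VComp T (VIdent T G) \<alpha> = \<alpha>"
    by (rule cell_eqI[OF cell_VComp[OF a(1) cell_VIdent] a(1)]) (simp_all add: a VIdent_T VComp_T)
  then show ?case by (simp add: vertical_def)
next
  case (7 \<alpha> F G \<beta> H \<gamma> K)
  then have a: "cell \<alpha>" "cell \<beta>" "cell \<gamma>" and e: "TSrc \<beta> = TTgt \<alpha>" "TSrc \<gamma> = TTgt \<beta>" by (simp_all add: vertical_def)
  note D [simp] = cellD(1-9)[OF a(1)] cellD(2-9)[OF a(2), unfolded e cellD(3,4)[OF a(1)]]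
  have e4: "FDom (TSrc \<gamma>) = FDom (TSrc \<alpha>)" "FCod (TSrc \<gamma>) = FCod (TSrc \<alpha>)" by (simp_all add: e)
  note D' [simp] = cellD(7-9)[OF a(3), unfolded e4]
  interpret B: ord_category "FCod (TSrc \<alpha>)" using Ob_ord by simp
  have "VComp T (VComp T \<gamma> \<beta>) \<alpha> = VComp T \<gamma> (VComp T \<beta> \<alpha>)"
  proof (rule cell_eqI)
    show "cell (VComp T (VComp T \<gamma> \<beta>) \<alpha>)" "cell (VComp T \<gamma> (VComp T \<beta> \<alpha>))"
      by (intro cell_VComp a; simp add: VComp_T e)+
  qed (simp_all add: VComp_T e)
  then show ?case by (simp add: vertical_def)
qed (auto simp: vertical_def cell_VIdent cellD intro: cell_VComp, auto simp: VIdent_T VComp_T)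

lemma category_horizontal: "category (horizontal T)"
proof (unfold_locales, goal_cases)
  case (5 \<alpha> F G)
  then have a: "cell \<alpha>" "F = FDom (TSrc \<alpha>)" by (simp_all add: horizontal_def)
  note D [simp] = cellD(1-9)[OF a(1)]
  interpret A: ord_category "FDom (TSrc \<alpha>)" using Ob_ord by simp
  interpret B: ord_category "FCod (TSrc \<alpha>)" using Ob_ord by simp
  note ty [simp] = Fn_typed[OF cellD(1)[OF a(1)]] Fn_typed[OF cellD(2)[OF a(1)], simplified]
  have i: "compf (TSrc \<alpha>) (idf F) = TSrc \<alpha>" "compf (TTgt \<alpha>) (idf F) = TTgt \<alpha>"
    using category.Comp_Ident(1)[OF category_T, of "TSrc \<alpha>"] category.Comp_Ident(1)[OF category_T, of "TTgt \<alpha>"]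
    by (simp_all add: a)
  have "HComp T \<alpha> (VIdent T (idf F)) = \<alpha>"
  proof (rule cell_eqI)
    show "cell (HComp T \<alpha> (VIdent T (idf F)))"
      by (intro cell_HComp cell_VIdent a) (simp_all add: VIdent_T a)
  qed (simp_all add: a VIdent_T HComp_T i[unfolded a])
  then show ?case by (simp add: horizontal_def)
next
  case (6 \<alpha> F G)
  then have a: "cell \<alpha>" "G = FCod (TSrc \<alpha>)" by (simp_all add: horizontal_def)
  note D [simp] = cellD(1-9)[OF a(1)]
  interpret A: ord_category "FDom (TSrc \<alpha>)" using Ob_ord by simp
  interpret B: ord_category "FCod (TSrc \<alpha>)" using Ob_ord by simp
  note ty [simp] = Fn_typed[OF cellD(1)[OF a(1)]] Fn_typed[OF cellD(2)[OF a(1)], simplified]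
  have i: "compf (idf G) (TSrc \<alpha>) = TSrc \<alpha>" "compf (idf G) (TTgt \<alpha>) = TTgt \<alpha>"
    using category.Comp_Ident(2)[OF category_T, of "TSrc \<alpha>"] category.Comp_Ident(2)[OF category_T, of "TTgt \<alpha>"]
    by (simp_all add: a)
  have "HComp T (VIdent T (idf G)) \<alpha> = \<alpha>"
  proof (rule cell_eqI)
    show "cell (HComp T (VIdent T (idf G)) \<alpha>)"
      by (intro cell_HComp cell_VIdent a) (simp_all add: VIdent_T a)
  qed (simp_all add: a VIdent_T HComp_T i[unfolded a])
  then show ?case by (simp add: horizontal_def)
next
  case (7 \<alpha> F G \<beta> H \<gamma> K)
  then have a: "cell \<alpha>" "cell \<beta>" "cell \<gamma>" and e: "FDom (TSrc \<beta>) = FCod (TSrc \<alpha>)" "FDom (TSrc \<gamma>) = FCod (TSrc \<beta>)"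
    by (simp_all add: horizontal_def)
  note D [simp] = cellD(1-9)[OF a(1)] cellD(1-9)[OF a(2), unfolded e] cellD(1-9)[OF a(3), unfolded e] e
  interpret A: ord_category "FDom (TSrc \<alpha>)" using Ob_ord by simp
  interpret B: ord_category "FCod (TSrc \<alpha>)" using Ob_ord by simp
  interpret E: ord_category "FCod (TSrc \<beta>)" using Ob_ord by simp
  interpret G: ord_category "FCod (TSrc \<gamma>)" using Ob_ord by simp
  note ty [simp] = Fn_typed[OF cellD(1)[OF a(1)]] Fn_typed[OF cellD(2)[OF a(1)], simplified]
    Fn_typed[OF cellD(1)[OF a(2)], simplified] Fn_typed[OF cellD(2)[OF a(2)], simplified]
    Fn_typed[OF cellD(1)[OF a(3)], simplified] Fn_typed[OF cellD(2)[OF a(3)], simplified]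
  have i: "compf (compf (TSrc \<gamma>) (TSrc \<beta>)) (TSrc \<alpha>) = compf (TSrc \<gamma>) (compf (TSrc \<beta>) (TSrc \<alpha>))"
    "compf (compf (TTgt \<gamma>) (TTgt \<beta>)) (TTgt \<alpha>) = compf (TTgt \<gamma>) (compf (TTgt \<beta>) (TTgt \<alpha>))"
    using category.Comp_assoc'[OF category_T, of "TSrc \<alpha>" "TSrc \<beta>" "TSrc \<gamma>"]
      category.Comp_assoc'[OF category_T, of "TTgt \<alpha>" "TTgt \<beta>" "TTgt \<gamma>"] by simp_all
  have "HComp T (HComp T \<gamma> \<beta>) \<alpha> = HComp T \<gamma> (HComp T \<beta> \<alpha>)"
  proof (rule cell_eqI)
    show "cell (HComp T (HComp T \<gamma> \<beta>) \<alpha>)" "cell (HComp T \<gamma> (HComp T \<beta> \<alpha>))"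
      by (intro cell_HComp a; simp add: HComp_T)+
  qed (simp_all add: HComp_T i compose_def)
  then show ?case by (simp add: horizontal_def)
qed (auto simp: horizontal_def cell_VIdent cellD intro: cell_HComp, auto simp: VIdent_T HComp_T cellD)

text \<open>The two ways of composing horizontally agree because comparable maps are equal.\<close>

lemma cell_exchange:
  assumes a: "cell \<alpha>" and f: "is_map (FDom (TSrc \<alpha>)) f"
  shows "TComp \<alpha> (Cod (FDom (TSrc \<alpha>)) f) \<cdot>\<^bsub>FCod (TSrc \<alpha>)\<^esub> FArr (TSrc \<alpha>) f
    = FArr (TTgt \<alpha>) f \<cdot>\<^bsub>FCod (TSrc \<alpha>)\<^esub> TComp \<alpha> (Dom (FDom (TSrc \<alpha>)) f)"
proof -
  note [simp] = cellD(1-9)[OF a] f is_map_Arr[OF f]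
  interpret A: ord_category "FDom (TSrc \<alpha>)" using Ob_ord by simp
  interpret B: ord_category "FCod (TSrc \<alpha>)" using Ob_ord by simp
  note ty [simp] = Fn_typed[OF cellD(1)[OF a]] Fn_typed[OF cellD(2)[OF a], simplified]
  show ?thesis
    by (rule maps_discrete[of "FCod (TSrc \<alpha>)"]) (simp_all add: cellD(10)[OF a])
qed

theorem two_category_T: "two_category T"
proof (intro two_category.intro two_category_axioms.intro category_T category_vertical category_horizontal, goal_cases)
  case (5 f g)
  then have f [simp]: "f \<in> Fn" "g \<in> Fn" "FDom g = FCod f" by simp_all
  interpret A: ord_category "FDom f" using Ob_ord by simp
  interpret B: ord_category "FCod f" using Ob_ord by simp
  interpret E: ord_category "FCod g" using Ob_ord by simp
  note ty [simp] = Fn_typed[OF f(1)] Fn_typed[OF f(2), simplified]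
  show ?case
  proof (rule cell_eqI)
    show "cell (HComp T (VIdent T g) (VIdent T f))"
      by (intro cell_HComp cell_VIdent) (simp_all add: VIdent_T)
    show "cell (VIdent T (Comp T g f))" by (intro cell_VIdent) simp
  qed (simp_all add: VIdent_T HComp_T compose_def)
next
  case (6 s s' t t')
  then have a: "cell s" "cell s'" "cell t" "cell t'" and e: "TSrc s' = TTgt s" "TSrc t' = TTgt t" "FDom (TSrc t) = FCod (TSrc s)"
    by simp_all
  let ?A = "FDom (TSrc s)" and ?B = "FCod (TSrc s)" and ?E = "FCod (TSrc t)"
  note D [simp] = cellD(1-9)[OF a(1)] cellD(2-9)[OF a(2), unfolded e cellD(3,4)[OF a(1)]]
    cellD(1-9)[OF a(3), unfolded e] cellD(2-9)[OF a(4), unfolded e cellD(3,4)[OF a(3)] e(3)] e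
  interpret A: ord_category ?A using Ob_ord by simp
  interpret B: ord_category ?B using Ob_ord by simp
  interpret E: ord_category ?E using Ob_ord by simp
  note ty [simp] = Fn_typed[OF cellD(1)[OF a(1)]] Fn_typed[OF cellD(2)[OF a(1)], simplified]
    Fn_typed[OF cellD(2)[OF a(2)], simplified]
    Fn_typed[OF cellD(1)[OF a(3)], simplified] Fn_typed[OF cellD(2)[OF a(3)], simplified]
    Fn_typed[OF cellD(2)[OF a(4)], simplified]
  have x: "TComp t' (FObj (TTgt s) X) \<cdot>\<^bsub>?E\<^esub> FArr (TTgt t) (TComp s X)
     = FArr (TTgt t') (TComp s X) \<cdot>\<^bsub>?E\<^esub> TComp t' (FObj (TSrc s) X)" if "X \<in> Obj ?A" for X
    using cell_exchange[OF a(4), of "TComp s X"] that by simp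
  have y: "FArr (TTgt t') (TComp s' X) \<cdot>\<^bsub>?E\<^esub> (FArr (TTgt t') (TComp s X) \<cdot>\<^bsub>?E\<^esub> (TComp t' (FObj (TSrc s) X) \<cdot>\<^bsub>?E\<^esub> TComp t (FObj (TSrc s) X)))
    = FArr (TTgt t') (TComp s' X) \<cdot>\<^bsub>?E\<^esub> (TComp t' (FObj (TTgt s) X) \<cdot>\<^bsub>?E\<^esub> (FArr (TTgt t) (TComp s X) \<cdot>\<^bsub>?E\<^esub> TComp t (FObj (TSrc s) X)))"
    if [simp]: "X \<in> Obj ?A" for X
    by (simp add: E.comp_extend[OF x])
  show ?case
  proof (rule cell_eqI)
    show "cell (HComp T (VComp T t' t) (VComp T s' s))" "cell (VComp T (HComp T t' s') (HComp T t s))"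
      by (intro cell_HComp cell_VComp a; simp add: HComp_T VComp_T)+
  qed (simp_all add: HComp_T VComp_T y)
qed (auto simp: cellD HComp_T)

end

section \<open>An equivalence that is the identity on underlying ordered categories\<close>

context transformation_setup
begin

text \<open>Functors as properties of an action on objects and arrows. Two sides are compared through
  the actions that they represent.\<close>

definition arrow :: "('o, 'a, 'z) ord_cat_data_scheme \<Rightarrow> ('o, 'a, 'z) ord_cat_data_scheme \<Rightarrow> ('o \<Rightarrow> 'o) \<Rightarrow> ('a \<Rightarrow> 'a) \<Rightarrow>
    (('o, 'a, 'z) ord_cat_data_scheme, 'o, 'a, 'y) fun_data_scheme \<Rightarrow> bool" where
  "arrow C D f0 f1 F \<longleftrightarrow> F \<in> Fn \<and> FDom F = C \<and> FCod F = D \<and> FObj F = f0 \<and> FArr F = f1"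

definition represented where
  "represented C D f0 f1 \<longleftrightarrow> (\<exists>F. arrow C D f0 f1 F)"

definition the_arrow where
  "the_arrow C D f0 f1 = (SOME F. arrow C D f0 f1 F)"

lemma the_arrow: "represented C D f0 f1 \<Longrightarrow> arrow C D f0 f1 (the_arrow C D f0 f1)"
  unfolding represented_def the_arrow_def by (rule someI_ex)

lemma represented_Fn: "F \<in> Fn \<Longrightarrow> represented (FDom F) (FCod F) (FObj F) (FArr F)"
  by (auto simp: represented_def arrow_def)

lemma represented_comp:
  "\<lbrakk>represented C D f0 f1; represented D E g0 g1\<rbrakk> \<Longrightarrow> represented C E (compose (Obj C) g0 f0) (compose (Arr C) g1 f1)"
  unfolding represented_def arrow_def by (metis compf)

lemma represented_ext: "represented C D f0 f1 \<Longrightarrow> f0 \<in> extensional (Obj C)" "represented C D f0 f1 \<Longrightarrow> f1 \<in> extensional (Arr C)"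
  using Fn_ext by (auto simp: represented_def arrow_def)

end

locale transformation_equivalence =
  S: transformation_setup Ob Fn idf compf + T: transformation_setup Ob' Fn' idf' compf'
  for Ob :: "('o, 'a, 'z) ord_cat_data_scheme set"
    and Fn :: "(('o, 'a, 'z) ord_cat_data_scheme, 'o, 'a, 'y) fun_data_scheme set"
    and idf compf
    and Ob' :: "('o, 'a, 'w) ord_cat_data_scheme set"
    and Fn' :: "(('o, 'a, 'w) ord_cat_data_scheme, 'o, 'a, 'x) fun_data_scheme set"
    and idf' compf' +
  fixes U :: "('o, 'a, 'z) ord_cat_data_scheme \<Rightarrow> ('o, 'a, 'w) ord_cat_data_scheme"
    and V :: "('o, 'a, 'w) ord_cat_data_scheme \<Rightarrow> ('o, 'a, 'z) ord_cat_data_scheme"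
  assumes U: "C \<in> Ob \<Longrightarrow> U C \<in> Ob'" "C \<in> Ob \<Longrightarrow> same_ord_cat (U C) C"
    and V: "A \<in> Ob' \<Longrightarrow> V A \<in> Ob" "A \<in> Ob' \<Longrightarrow> same_ord_cat (V A) A"
    and represented_iff: "\<lbrakk>C \<in> Ob; D \<in> Ob\<rbrakk> \<Longrightarrow> S.represented C D f0 f1 \<longleftrightarrow> T.represented (U C) (U D) f0 f1"
    and represented_same: "\<lbrakk>A \<in> Ob'; B \<in> Ob'; same_ord_cat A B\<rbrakk>
      \<Longrightarrow> T.represented A B (\<lambda>X \<in> Obj A. X) (\<lambda>r \<in> Arr A. r)"
begin

abbreviation (input) "SS \<equiv> transformation_2cat Ob Fn idf compf"
abbreviation (input) "TT \<equiv> transformation_2cat Ob' Fn' idf' compf'"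

definition down where
  "down F = T.the_arrow (U (FDom F)) (U (FCod F)) (FObj F) (FArr F)"

definition up where
  "up H = S.the_arrow (V (FDom H)) (V (FCod H)) (FObj H) (FArr H)"

definition unit where
  "unit C = S.the_arrow C (V (U C)) (\<lambda>X \<in> Obj C. X) (\<lambda>r \<in> Arr C. r)"

definition unit_inv where
  "unit_inv C = S.the_arrow (V (U C)) C (\<lambda>X \<in> Obj C. X) (\<lambda>r \<in> Arr C. r)"

definition counit where
  "counit A = T.the_arrow (U (V A)) A (\<lambda>X \<in> Obj A. X) (\<lambda>r \<in> Arr A. r)"

definition counit_inv where
  "counit_inv A = T.the_arrow A (U (V A)) (\<lambda>X \<in> Obj A. X) (\<lambda>r \<in> Arr A. r)"

lemma down:
  assumes "F \<in> Fn"
  shows "down F \<in> Fn'" "FDom (down F) = U (FDom F)" "FCod (down F) = U (FCod F)" "FObj (down F) = FObj F" "FArr (down F) = FArr F"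
  using T.the_arrow[of "U (FDom F)" "U (FCod F)" "FObj F" "FArr F"] S.represented_Fn[OF assms]
    represented_iff[of "FDom F" "FCod F"] assms
  by (auto simp: down_def T.arrow_def)

lemma UV: "A \<in> Ob' \<Longrightarrow> same_ord_cat (U (V A)) A"
  using same_ord_cat_trans[OF U(2)[OF V(1)] V(2)] .

text \<open>An action on the second side is transported along the identities between \<open>A\<close> and \<open>U (V A)\<close> and
  then comes from the first side.\<close>

lemma represented_up:
  assumes H: "H \<in> Fn'"
  shows "S.represented (V (FDom H)) (V (FCod H)) (FObj H) (FArr H)"
proof -
  let ?A = "FDom H" and ?B = "FCod H"
  have o [simp]: "?A \<in> Ob'" "?B \<in> Ob'" using H by auto
  note s = same_ord_catD[OF UV[OF o(1)]] same_ord_catD[OF UV[OF o(2)]]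
  have a: "T.represented (U (V ?A)) ?A (\<lambda>X \<in> Obj ?A. X) (\<lambda>r \<in> Arr ?A. r)"
    using represented_same[of "U (V ?A)" ?A] UV[of ?A] U(1) V(1) by (simp add: s)
  have b: "T.represented ?B (U (V ?B)) (\<lambda>X \<in> Obj ?B. X) (\<lambda>r \<in> Arr ?B. r)"
    using represented_same[of ?B "U (V ?B)"] same_ord_cat_sym[OF UV[of ?B]] U(1) V(1) by simp
  have c: "T.represented (U (V ?A)) (U (V ?B))
     (compose (Obj ?A) (\<lambda>X \<in> Obj ?B. X) (compose (Obj ?A) (FObj H) (\<lambda>X \<in> Obj ?A. X)))
     (compose (Arr ?A) (\<lambda>X \<in> Arr ?B. X) (compose (Arr ?A) (FArr H) (\<lambda>X \<in> Arr ?A. X)))"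
    using T.represented_comp[OF T.represented_comp[OF a T.represented_Fn[OF H]] b] by (simp add: s)
  have "compose (Obj ?A) (\<lambda>X \<in> Obj ?B. X) (compose (Obj ?A) (FObj H) (\<lambda>X \<in> Obj ?A. X)) = FObj H"
    using T.Fn_ext(1)[OF H] T.Fn_typed(1)[OF H] by (auto simp: compose_def extensional_def fun_eq_iff)
  moreover have "compose (Arr ?A) (\<lambda>X \<in> Arr ?B. X) (compose (Arr ?A) (FArr H) (\<lambda>X \<in> Arr ?A. X)) = FArr H"
    using T.Fn_ext(2)[OF H] T.Fn_typed(2)[OF H] by (auto simp: compose_def extensional_def fun_eq_iff)
  ultimately have "T.represented (U (V ?A)) (U (V ?B)) (FObj H) (FArr H)" using c by simp
  then show ?thesis by (simp add: represented_iff V)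
qed

lemma up:
  assumes "H \<in> Fn'"
  shows "up H \<in> Fn" "FDom (up H) = V (FDom H)" "FCod (up H) = V (FCod H)" "FObj (up H) = FObj H" "FArr (up H) = FArr H"
  using S.the_arrow[OF represented_up[OF assms]] by (auto simp: up_def S.arrow_def)

lemma S_represented_same:
  assumes "C \<in> Ob" "D \<in> Ob" "same_ord_cat C D"
  shows "S.represented C D (\<lambda>X \<in> Obj C. X) (\<lambda>r \<in> Arr C. r)"
proof -
  have "same_ord_cat (U C) (U D)"
    using same_ord_cat_trans[OF U(2)[OF assms(1)] same_ord_cat_trans[OF assms(3) same_ord_cat_sym[OF U(2)[OF assms(2)]]]] .
  then show ?thesis
    using represented_same[of "U C" "U D"] assms same_ord_catD(1,2)[OF U(2)[OF assms(1)]] by (simp add: represented_iff U)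
qed

lemma unit:
  assumes [simp]: "C \<in> Ob"
  shows "unit C \<in> Fn" "FDom (unit C) = C" "FCod (unit C) = V (U C)" "FObj (unit C) = (\<lambda>X \<in> Obj C. X)" "FArr (unit C) = (\<lambda>r \<in> Arr C. r)"
    "unit_inv C \<in> Fn" "FDom (unit_inv C) = V (U C)" "FCod (unit_inv C) = C" "FObj (unit_inv C) = (\<lambda>X \<in> Obj C. X)" "FArr (unit_inv C) = (\<lambda>r \<in> Arr C. r)"
proof -
  have s: "same_ord_cat (V (U C)) C" using same_ord_cat_trans[OF V(2)[OF U(1)] U(2)] by simp
  have "S.represented C (V (U C)) (\<lambda>X \<in> Obj C. X) (\<lambda>r \<in> Arr C. r)"
    by (rule S_represented_same) (simp_all add: U V same_ord_cat_sym[OF s])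
  from S.the_arrow[OF this]
  show "unit C \<in> Fn" "FDom (unit C) = C" "FCod (unit C) = V (U C)" "FObj (unit C) = (\<lambda>X \<in> Obj C. X)" "FArr (unit C) = (\<lambda>r \<in> Arr C. r)"
    by (auto simp: unit_def S.arrow_def)
  have "S.represented (V (U C)) C (\<lambda>X \<in> Obj C. X) (\<lambda>r \<in> Arr C. r)"
    using S_represented_same[of "V (U C)" C] s by (simp add: U V same_ord_catD(1,2)[OF s])
  from S.the_arrow[OF this]
  show "unit_inv C \<in> Fn" "FDom (unit_inv C) = V (U C)" "FCod (unit_inv C) = C" "FObj (unit_inv C) = (\<lambda>X \<in> Obj C. X)" "FArr (unit_inv C) = (\<lambda>r \<in> Arr C. r)"
    by (auto simp: unit_inv_def S.arrow_def)
qed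

lemma counit:
  assumes [simp]: "A \<in> Ob'"
  shows "counit A \<in> Fn'" "FDom (counit A) = U (V A)" "FCod (counit A) = A" "FObj (counit A) = (\<lambda>X \<in> Obj A. X)" "FArr (counit A) = (\<lambda>r \<in> Arr A. r)"
    "counit_inv A \<in> Fn'" "FDom (counit_inv A) = A" "FCod (counit_inv A) = U (V A)" "FObj (counit_inv A) = (\<lambda>X \<in> Obj A. X)" "FArr (counit_inv A) = (\<lambda>r \<in> Arr A. r)"
proof -
  have s: "same_ord_cat (U (V A)) A" by (rule UV) simp
  have "T.represented (U (V A)) A (\<lambda>X \<in> Obj A. X) (\<lambda>r \<in> Arr A. r)"
    using represented_same[of "U (V A)" A] s by (simp add: U V same_ord_catD(1,2)[OF s])
  from T.the_arrow[OF this]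
  show "counit A \<in> Fn'" "FDom (counit A) = U (V A)" "FCod (counit A) = A" "FObj (counit A) = (\<lambda>X \<in> Obj A. X)" "FArr (counit A) = (\<lambda>r \<in> Arr A. r)"
    by (auto simp: counit_def T.arrow_def)
  have "T.represented A (U (V A)) (\<lambda>X \<in> Obj A. X) (\<lambda>r \<in> Arr A. r)"
    by (rule represented_same) (simp_all add: U V same_ord_cat_sym[OF s])
  from T.the_arrow[OF this]
  show "counit_inv A \<in> Fn'" "FDom (counit_inv A) = A" "FCod (counit_inv A) = U (V A)" "FObj (counit_inv A) = (\<lambda>X \<in> Obj A. X)" "FArr (counit_inv A) = (\<lambda>r \<in> Arr A. r)"
    by (auto simp: counit_inv_def T.arrow_def)
qed

definition down_cell where
  "down_cell t = \<lparr>TSrc = down (TSrc t), TTgt = down (TTgt t), TComp = TComp t\<rparr>"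

definition up_cell where
  "up_cell t = \<lparr>TSrc = up (TSrc t), TTgt = up (TTgt t), TComp = TComp t\<rparr>"

lemma down_cell: "S.cell t \<Longrightarrow> T.cell (down_cell t)"
proof -
  assume t: "S.cell t"
  note D = S.cellD(1-4)[OF t]
  have o: "FDom (TSrc t) \<in> Ob" "FCod (TSrc t) \<in> Ob" using D(1) by auto
  show ?thesis using t D
    by (simp add: S.cell_def T.cell_def down_cell_def down same_ord_catD[OF U(2)[OF o(1)]] same_ord_catD[OF U(2)[OF o(2)]])
qed

lemma up_cell: "T.cell t \<Longrightarrow> S.cell (up_cell t)"
proof -
  assume t: "T.cell t"
  note D = T.cellD(1-4)[OF t]
  have o: "FDom (TSrc t) \<in> Ob'" "FCod (TSrc t) \<in> Ob'" using D(1) by auto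
  show ?thesis using t D
    by (simp add: S.cell_def T.cell_def up_cell_def up same_ord_catD[OF V(2)[OF o(1)]] same_ord_catD[OF V(2)[OF o(2)]])
qed

lemma down_comp:
  assumes [simp]: "f \<in> Fn" "g \<in> Fn" "FDom g = FCod f"
  shows "down (compf g f) = compf' (down g) (down f)"
  by (rule T.Fn_eqI) (simp_all add: down same_ord_catD[OF U(2)])

lemma up_comp:
  assumes [simp]: "f \<in> Fn'" "g \<in> Fn'" "FDom g = FCod f"
  shows "up (compf' g f) = compf (up g) (up f)"
  by (rule S.Fn_eqI) (simp_all add: up same_ord_catD[OF V(2)])

lemma down_idf: "C \<in> Ob \<Longrightarrow> down (idf C) = idf' (U C)"
  by (rule T.Fn_eqI) (simp_all add: U down same_ord_catD[OF U(2)])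

lemma up_idf: "A \<in> Ob' \<Longrightarrow> up (idf' A) = idf (V A)"
  by (rule S.Fn_eqI) (simp_all add: V up same_ord_catD[OF V(2)])

lemma two_functor_down: "two_functor SS TT \<lparr>F0 = U, F1 = down, F2 = down_cell\<rparr>"
proof -
  have o: "FDom f \<in> Ob" "FCod f \<in> Ob" if "f \<in> Fn" for f using that by auto
  have "is_functor SS TT U down"
    by (auto simp: is_functor_def U down down_comp intro!: T.Fn_eqI simp: same_ord_catD[OF U(2)])
  moreover have "is_functor (vertical SS) (vertical TT) down down_cell"
    by (auto simp: is_functor_def vertical_def down down_cell S.cellD S.VIdent_T T.VIdent_T S.VComp_T T.VComp_T
        down_cell_def[of "\<lparr>TSrc = _, TTgt = _, TComp = _\<rparr>"] same_ord_catD[OF U(2)])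
      (auto simp: down_cell_def S.cellD down same_ord_catD[OF U(2)])
  moreover have "is_functor (horizontal SS) (horizontal TT) U down_cell"
    by (auto simp: is_functor_def horizontal_def U down down_cell S.cellD S.VIdent_T T.VIdent_T S.HComp_T T.HComp_T
        down_cell_def[of "\<lparr>TSrc = _, TTgt = _, TComp = _\<rparr>"] same_ord_catD[OF U(2)])
      (auto simp: down_cell_def S.cellD U down down_comp down_idf same_ord_catD[OF U(2)])
  ultimately show ?thesis by (simp add: two_functor_def)
qed

lemma two_functor_up: "two_functor TT SS \<lparr>F0 = V, F1 = up, F2 = up_cell\<rparr>"
proof -
  have "is_functor TT SS V up"
    by (auto simp: is_functor_def V up up_comp intro!: S.Fn_eqI simp: same_ord_catD[OF V(2)])
  moreover have "is_functor (vertical TT) (vertical SS) up up_cell"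
    by (auto simp: is_functor_def vertical_def up up_cell T.cellD S.VIdent_T T.VIdent_T S.VComp_T T.VComp_T
        up_cell_def[of "\<lparr>TSrc = _, TTgt = _, TComp = _\<rparr>"] same_ord_catD[OF V(2)])
      (auto simp: up_cell_def T.cellD up same_ord_catD[OF V(2)])
  moreover have "is_functor (horizontal TT) (horizontal SS) V up_cell"
    by (auto simp: is_functor_def horizontal_def V up up_cell T.cellD S.VIdent_T T.VIdent_T S.HComp_T T.HComp_T
        up_cell_def[of "\<lparr>TSrc = _, TTgt = _, TComp = _\<rparr>"] same_ord_catD[OF V(2)])
      (auto simp: up_cell_def T.cellD V up up_comp up_idf same_ord_catD[OF V(2)])
  ultimately show ?thesis by (simp add: two_functor_def)
qed


lemma unit_iso:
  assumes [simp]: "C \<in> Ob" shows "is_iso SS (unit C)"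
proof -
  have s: "Obj (V (U C)) = Obj C" "Arr (V (U C)) = Arr C"
    using same_ord_catD(1,2)[OF V(2)[OF U(1)]] same_ord_catD(1,2)[OF U(2)] by simp_all
  have "compf (unit_inv C) (unit C) = idf C" "compf (unit C) (unit_inv C) = idf (V (U C))"
    by (rule S.Fn_eqI; simp add: unit U V s compose_def cong: restrict_cong)+
  then have "inverse_arrows SS (unit C) (unit_inv C)"
    by (simp add: inverse_arrows_def unit)
  then show ?thesis by (auto simp: is_iso_def)
qed

lemma counit_iso:
  assumes [simp]: "A \<in> Ob'" shows "is_iso TT (counit A)"
proof -
  have s: "Obj (U (V A)) = Obj A" "Arr (U (V A)) = Arr A"
    using same_ord_catD(1,2)[OF UV] by simp_all
  have "compf' (counit_inv A) (counit A) = idf' (U (V A))" "compf' (counit A) (counit_inv A) = idf' A"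
    by (rule T.Fn_eqI; simp add: counit U V s compose_def cong: restrict_cong)+
  then have "inverse_arrows TT (counit A) (counit_inv A)"
    by (simp add: inverse_arrows_def counit)
  then show ?thesis by (auto simp: is_iso_def)
qed

lemma unit_natural:
  assumes f [simp]: "f \<in> Fn"
  shows "compf (unit (FCod f)) f = compf (up (down f)) (unit (FDom f))"
  using S.Fn_ext[OF f] S.Fn_typed(1,2)[OF f]
  by (intro S.Fn_eqI) (auto simp: unit U V up down compose_def fun_eq_iff)

lemma counit_natural:
  assumes f [simp]: "f \<in> Fn'"
  shows "compf' (counit (FCod f)) (down (up f)) = compf' f (counit (FDom f))"
proof -
  have s: "Obj (V (FDom f)) = Obj (FDom f)" "Arr (V (FDom f)) = Arr (FDom f)"
     "Obj (U (V (FDom f))) = Obj (FDom f)" "Arr (U (V (FDom f))) = Arr (FDom f)"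
    using same_ord_catD(1,2)[OF V(2)] same_ord_catD(1,2)[OF UV] by simp_all
  show ?thesis
    using T.Fn_ext[OF f] T.Fn_typed(1,2)[OF f]
    by (intro T.Fn_eqI) (auto simp: counit U V up down compose_def fun_eq_iff s)
qed

lemma unit_natural_cell:
  assumes t: "S.cell t"
  shows "HComp SS (VIdent SS (unit (FCod (TSrc t)))) t = HComp SS (up_cell (down_cell t)) (VIdent SS (unit (FDom (TSrc t))))"
proof -
  let ?C = "FDom (TSrc t)" and ?D = "FCod (TSrc t)"
  note D [simp] = S.cellD(1-9)[OF t]
  have o [simp]: "?C \<in> Ob" "?D \<in> Ob" by simp_all
  interpret D: ord_category ?D using S.Ob_ord by simp
  note s = same_ord_catD[OF same_ord_cat_trans[OF V(2)[OF U(1)[OF o(1)]] U(2)[OF o(1)]]]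
    same_ord_catD[OF same_ord_cat_trans[OF V(2)[OF U(1)[OF o(2)]] U(2)[OF o(2)]]]
  note c = up_cell[OF down_cell[OF t]]
  have k: "TSrc (up_cell (down_cell t)) = up (down (TSrc t))" "TTgt (up_cell (down_cell t)) = up (down (TTgt t))"
    "TComp (up_cell (down_cell t)) = TComp t"
    by (simp_all add: up_cell_def down_cell_def)
  note ty = S.Fn_typed[OF D(1)] S.Fn_typed[OF D(2), simplified]
  show ?thesis
  proof (rule S.cell_eqI)
    show "S.cell (HComp SS (VIdent SS (unit ?D)) t)"
      by (intro S.cell_HComp S.cell_VIdent t) (simp_all add: S.VIdent_T unit)
    show "S.cell (HComp SS (up_cell (down_cell t)) (VIdent SS (unit ?C)))"
      by (intro S.cell_HComp S.cell_VIdent c) (simp_all add: S.VIdent_T unit k up down)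
  qed (simp_all add: S.HComp_T S.VIdent_T unit k up down s ty unit_natural
      unit_natural[of "TTgt t", simplified] U V)
qed

lemma counit_natural_cell:
  assumes t: "T.cell t"
  shows "HComp TT (VIdent TT (counit (FCod (TSrc t)))) (down_cell (up_cell t)) = HComp TT t (VIdent TT (counit (FDom (TSrc t))))"
proof -
  let ?C = "FDom (TSrc t)" and ?D = "FCod (TSrc t)"
  note D [simp] = T.cellD(1-9)[OF t]
  have o [simp]: "?C \<in> Ob'" "?D \<in> Ob'" by simp_all
  interpret D: ord_category ?D using T.Ob_ord by simp
  note s = same_ord_catD[OF UV[OF o(1)]] same_ord_catD[OF UV[OF o(2)]]
  note c = down_cell[OF up_cell[OF t]]
  have k: "TSrc (down_cell (up_cell t)) = down (up (TSrc t))" "TTgt (down_cell (up_cell t)) = down (up (TTgt t))"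
    "TComp (down_cell (up_cell t)) = TComp t"
    by (simp_all add: up_cell_def down_cell_def)
  note ty = T.Fn_typed[OF D(1)] T.Fn_typed[OF D(2), simplified]
  show ?thesis
  proof (rule T.cell_eqI)
    show "T.cell (HComp TT (VIdent TT (counit ?D)) (down_cell (up_cell t)))"
      by (intro T.cell_HComp T.cell_VIdent c) (simp_all add: T.VIdent_T counit k up down)
    show "T.cell (HComp TT t (VIdent TT (counit ?C)))"
      by (intro T.cell_HComp T.cell_VIdent t) (simp_all add: T.VIdent_T counit)
  qed (simp_all add: T.HComp_T T.VIdent_T counit k up down s ty counit_natural
      counit_natural[of "TTgt t", simplified] U V)
qed

theorem two_equivalent_transformation_2cats: "two_equivalent SS TT"
  unfolding two_equivalent_def
proof (intro conjI exI)
  show "two_category SS" "two_category TT" by (rule S.two_category_T T.two_category_T)+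
  show "two_functor SS TT \<lparr>F0 = U, F1 = down, F2 = down_cell\<rparr>" by (rule two_functor_down)
  show "two_functor TT SS \<lparr>F0 = V, F1 = up, F2 = up_cell\<rparr>" by (rule two_functor_up)
  show "two_natural_iso SS SS two_functor_id
     (two_functor_comp \<lparr>F0 = V, F1 = up, F2 = up_cell\<rparr> \<lparr>F0 = U, F1 = down, F2 = down_cell\<rparr>) unit"
    by (auto simp: two_natural_iso_def two_functor_id_def two_functor_comp_def unit unit_iso unit_natural unit_natural_cell)
  show "two_natural_iso TT TT
     (two_functor_comp \<lparr>F0 = U, F1 = down, F2 = down_cell\<rparr> \<lparr>F0 = V, F1 = up, F2 = up_cell\<rparr>) two_functor_id counit"
    by (auto simp: two_natural_iso_def two_functor_id_def two_functor_comp_def counit counit_iso counit_natural counit_natural_cell)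
qed

end

section \<open>The equivalence\<close>

definition unitary_pre_tabular :: "('o, 'a) allegory_data \<Rightarrow> bool" where
  "unitary_pre_tabular A \<longleftrightarrow> allegory A \<and> unitary A \<and> pre_tabular A"

text \<open>The counterpart of \<open>relational_fun\<close> for allegories. Preservation of converses is left out since
  it follows (\<open>meet_fun_Conv\<close>).\<close>

definition unital_fun :: "('o, 'a) allegory_data \<Rightarrow> ('o, 'a) allegory_data \<Rightarrow> ('o \<Rightarrow> 'o) \<Rightarrow> ('a \<Rightarrow> 'a) \<Rightarrow> bool" where
  "unital_fun A B f0 f1 \<longleftrightarrow> unitary_pre_tabular A \<and> unitary_pre_tabular B \<and> meet_fun A B f0 f1 \<and> (\<forall>V. is_unit A V \<longrightarrow> is_unit B (f0 V))"

lemma meet_fun_ord_fun: "meet_fun C D f0 f1 \<Longrightarrow> ord_fun C D f0 f1"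
  by (simp add: meet_fun_def)

lemma meet_fun_Conv:
  assumes f: "meet_fun A B f0 f1" and A: "unitary_pre_tabular A" and B: "allegory B" and r: "r \<in> Arr A"
  shows "f1 (r\<degree>\<^bsub>A\<^esub>) = (f1 r)\<degree>\<^bsub>B\<^esub>"
proof -
  obtain U Pr P1 P2 where "conv_product_category A (Conv A) U Pr P1 P2"
    using unitary_pre_tabular_products[of A] A by (auto simp: unitary_pre_tabular_def)
  then interpret S: conv_product_category A "Conv A" U Pr P1 P2 .
  interpret T: conv_ord_category B "Conv B" using B by (simp add: allegory_iff)
  interpret ord_fun A B f0 f1 using f by (rule meet_fun_ord_fun)
  interpret conv_fun A B f0 f1 "Conv A" U Pr P1 P2 "Conv B" ..
  show ?thesis using r by (rule f_cv)
qed

lemma meet_fun_compose: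
  assumes f: "meet_fun A B f0 f1" and g: "meet_fun B E g0 g1" and A: "meet_ord_category A"
  shows "meet_fun A E (compose (Obj A) g0 f0) (compose (Arr A) g1 f1)"
proof -
  interpret F: ord_fun A B f0 f1 using f by (rule meet_fun_ord_fun)
  interpret G: ord_fun B E g0 g1 using g by (rule meet_fun_ord_fun)
  have "is_functor A E (compose (Obj A) g0 f0) (compose (Arr A) g1 f1)"
    by (auto simp: is_functor_def compose_def)
  moreover have "compose (Arr A) g1 f1 r \<preceq>\<^bsub>E\<^esub> compose (Arr A) g1 f1 s" if "r \<preceq>\<^bsub>A\<^esub> s" for r s
    using G.mono[OF F.mono[OF that]] F.S.le_typed[OF that] by (simp add: compose_def)
  ultimately have o: "ord_fun A E (compose (Obj A) g0 f0) (compose (Arr A) g1 f1)"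
    by unfold_locales
  have "compose (Arr A) g1 f1 (r \<sqinter>\<^bsub>A\<^esub> s) = compose (Arr A) g1 f1 r \<sqinter>\<^bsub>E\<^esub> compose (Arr A) g1 f1 s"
    if "r \<in> Arr A" "s \<in> Arr A" "Dom A r = Dom A s" "Cod A r = Cod A s" for r s
    using f g that meet_ord_category.meet_typed(1)[OF A that] by (simp add: meet_fun_def compose_def)
  then show ?thesis using o by (simp add: meet_fun_def)
qed

lemma meet_fun_same:
  assumes s: "same_ord_cat A B" and A: "meet_ord_category A"
  shows "meet_fun A B (\<lambda>X \<in> Obj A. X) (\<lambda>r \<in> Arr A. r)"
proof -
  interpret meet_ord_category A by (rule A)
  have "ord_category B" using s same_ord_cat_ord_category[OF s] ord_category_axioms by simp
  moreover have "is_functor A B (\<lambda>X \<in> Obj A. X) (\<lambda>r \<in> Arr A. r)"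
    by (auto simp: is_functor_def same_ord_catD[OF s, symmetric])
  moreover have "(\<lambda>r \<in> Arr A. r) r \<preceq>\<^bsub>B\<^esub> (\<lambda>r \<in> Arr A. r) t" if "r \<preceq>\<^bsub>A\<^esub> t" for r t
    using that le_typed[OF that] by (simp add: same_ord_catD[OF s, symmetric])
  ultimately show ?thesis
    using ord_category_axioms
    by (simp add: meet_fun_def ord_fun_def ord_fun_axioms_def) (simp add: same_ord_catD[OF s, symmetric])
qed

lemma unital_functor_iff:
  "allegory_functor F \<and> unitary_pre_tabular (FDom F) \<and> unitary_pre_tabular (FCod F) \<and> unit_preserving F \<longleftrightarrow>
     unital_fun (FDom F) (FCod F) (FObj F) (FArr F) \<and>
     FObj F \<in> extensional (Obj (FDom F)) \<and> FArr F \<in> extensional (Arr (FDom F))" (is "?l \<longleftrightarrow> ?r")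
proof (cases "unitary_pre_tabular (FDom F) \<and> unitary_pre_tabular (FCod F)")
  case True
  then have A: "allegory (FDom F)" "allegory (FCod F)" by (auto simp: unitary_pre_tabular_def)
  interpret S: conv_ord_category "FDom F" "Conv (FDom F)" using A by (simp add: allegory_iff)
  interpret T: conv_ord_category "FCod F" "Conv (FCod F)" using A by (simp add: allegory_iff)
  have o: "ord_functor F \<longleftrightarrow> ord_fun (FDom F) (FCod F) (FObj F) (FArr F) \<and>
    FObj F \<in> extensional (Obj (FDom F)) \<and> FArr F \<in> extensional (Arr (FDom F))"
    by (rule ord_functor_iff; unfold_locales)
  have m: "meet_fun (FDom F) (FCod F) (FObj F) (FArr F) \<longleftrightarrow> ord_fun (FDom F) (FCod F) (FObj F) (FArr F) \<and>
    (\<forall>r \<in> Arr (FDom F). \<forall>s \<in> hom (FDom F) (Dom (FDom F) r) (Cod (FDom F) r).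
        FArr F (r \<sqinter>\<^bsub>FDom F\<^esub> s) = FArr F r \<sqinter>\<^bsub>FCod F\<^esub> FArr F s)"
    unfolding meet_fun_def by auto
  show ?thesis
    using True A o m meet_fun_Conv[of "FDom F" "FCod F" "FObj F" "FArr F"]
    unfolding allegory_functor_def unital_fun_def unit_preserving_def by blast
next
  case False
  then show ?thesis by (auto simp: unital_fun_def)
qed

lemma unital_fun_compose:
  "unital_fun A B f0 f1 \<Longrightarrow> unital_fun B E g0 g1 \<Longrightarrow> unital_fun A E (compose (Obj A) g0 f0) (compose (Arr A) g1 f1)"
proof -
  assume f: "unital_fun A B f0 f1" "unital_fun B E g0 g1"
  then interpret conv_ord_category A "Conv A" by (simp add: unital_fun_def unitary_pre_tabular_def allegory_iff)
  show ?thesis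
    using f meet_fun_compose[OF _ _ meet_ord_category_axioms, of B f0 f1 E g0 g1]
    by (auto simp: unital_fun_def compose_def is_unit_def)
qed

text \<open>An ordered category carries at most one structure of a unitary pre-tabular allegory, because the
  identity functor preserves converses.\<close>

lemma unital_fun_same:
  assumes s: "same_ord_cat A B" and A: "unitary_pre_tabular A" "unitary_pre_tabular B"
  shows "unital_fun A B (\<lambda>X \<in> Obj A. X) (\<lambda>r \<in> Arr A. r)"
proof -
  have a: "allegory A" "allegory B" using A by (auto simp: unitary_pre_tabular_def)
  interpret S: conv_ord_category A "Conv A" using a by (simp add: allegory_iff)
  have m: "meet_fun A B (\<lambda>X \<in> Obj A. X) (\<lambda>r \<in> Arr A. r)"
    by (rule meet_fun_same[OF s]) unfold_locales
  have c: "r\<degree>\<^bsub>A\<^esub> = r\<degree>\<^bsub>B\<^esub>" if "r \<in> Arr A" for r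
    using meet_fun_Conv[OF m A(1) a(2) that] that by simp
  have "is_unit B V" if "is_unit A V" for V
    using that unfolding is_unit_def by (auto simp: same_ord_catD[OF s, symmetric] c[symmetric])
  then show ?thesis using m A by (auto simp: unital_fun_def is_unit_def)
qed

lemma unital_fun_allegory_of:
  assumes C: "bicategory_of_relations C" and D: "bicategory_of_relations D"
  shows "unital_fun (allegory_of C) (allegory_of D) f0 f1 \<longleftrightarrow> relational_fun C D f0 f1"
proof -
  interpret S: bicategory_of_relations C by (rule C)
  interpret T: bicategory_of_relations D by (rule D)
  note s = same_ord_catD[OF same_allegory_of[of C]] same_ord_catD[OF same_allegory_of[of D]]
  have u: "unitary_pre_tabular (allegory_of C)" "unitary_pre_tabular (allegory_of D)"
    using allegory_of_bicategory[OF C] allegory_of_bicategory[OF D] by (auto simp: unitary_pre_tabular_def)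
  have m: "meet_fun (allegory_of C) (allegory_of D) f0 f1 \<longleftrightarrow> meet_fun C D f0 f1"
    by (simp add: meet_fun_def ord_fun_def ord_fun_axioms_def is_functor_def s
      same_ord_cat_ord_category[OF same_allegory_of])
  have is_unit: "is_unit (allegory_of C) V \<longleftrightarrow> S.R.unit_object V" "is_unit (allegory_of D) V \<longleftrightarrow> T.R.unit_object V" for V
    using allegory_of_bicategory(1)[OF C] allegory_of_bicategory(1)[OF D]
      same_ord_cat_unit_object[OF same_ord_cat_sym[OF same_allegory_of] S.conv_ord_category_conv]
      same_ord_cat_unit_object[OF same_ord_cat_sym[OF same_allegory_of] T.conv_ord_category_conv]
    by (simp_all add: is_unit_iff Conv_allegory_of)
  have "T.R.unit_object (f0 V)" if f: "meet_fun C D f0 f1" "T.R.unit_object (f0 (UnitObj C))" and V: "S.R.unit_object V" for V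
  proof -
    interpret ord_fun C D f0 f1 using f(1) by (rule meet_fun_ord_fun)
    obtain k where k: "is_map C k" "Dom C k = UnitObj C" "Cod C k = V"
      using S.R.unit_object_map_exists[OF V, of "UnitObj C"] by auto
    have "is_iso D (f1 k)"
      by (rule f_iso[OF S.R.unit_object_iso[OF S.R.unit_object_U V k]])
    then show ?thesis
      by (rule T.R.unit_object_transport[OF f(2)]) (use k S.map_Arr[OF k(1)] in auto)
  qed
  then show ?thesis
    using C D u S.R.unit_object_U by (auto simp: unital_fun_def relational_fun_def m is_unit)
qed

interpretation UP: transformation_setup "{A. unitary_pre_tabular A}" "{F. allegory_functor F \<and> unitary_pre_tabular (FDom F) \<and> unitary_pre_tabular (FCod F) \<and> unit_preserving F}"
  fun_id fun_comp
proof (rule transformation_setup.intro, goal_cases)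
  case (1 A)
  then interpret conv_ord_category A "Conv A" by (simp add: unitary_pre_tabular_def allegory_iff)
  show ?case by unfold_locales
next
  case (2 A f g)
  then interpret conv_ord_category A "Conv A" by (simp add: unitary_pre_tabular_def allegory_iff)
  show ?case using 2 by (intro map_le_eq) auto
next
  case (6 A)
  then show ?case unfolding mem_Collect_eq unital_functor_iff
    using unital_fun_same[of A A] by (simp add: fun_id_def same_ord_cat_def)
next
  case (11 F G)
  then show ?case unfolding mem_Collect_eq unital_functor_iff
    using unital_fun_compose[of "FDom F" "FCod F" "FObj F" "FArr F" "FCod G" "FObj G" "FArr G"]
    by (simp add: fun_comp_def)
qed (auto simp: fun_id_def fun_comp_def allegory_functor_def)

lemma relational_fun_same: "bicategory_of_relations C \<Longrightarrow> relational_fun C C (\<lambda>X \<in> Obj C. X) (\<lambda>r \<in> Arr C. r)"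
  using unital_fun_same[of "allegory_of C" "allegory_of C"] allegory_of_bicategory[of C]
  by (simp add: unital_fun_allegory_of[symmetric] same_ord_cat_def unitary_pre_tabular_def same_ord_catD[OF same_allegory_of])

lemma relational_fun_compose:
  "relational_fun C D f0 f1 \<Longrightarrow> relational_fun D E g0 g1 \<Longrightarrow> relational_fun C E (compose (Obj C) g0 f0) (compose (Arr C) g1 f1)"
  using unital_fun_compose[of "allegory_of C" "allegory_of D" f0 f1 "allegory_of E" g0 g1]
    unital_fun_allegory_of[of C D] unital_fun_allegory_of[of D E] unital_fun_allegory_of[of C E]
  by (simp add: relational_fun_def same_ord_catD[OF same_allegory_of])

lemma cart_fun_id_sel:
  "FDom (cart_fun_id C) = C" "FCod (cart_fun_id C) = C" "FObj (cart_fun_id C) = (\<lambda>X \<in> Obj C. X)"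
  "FArr (cart_fun_id C) = (\<lambda>r \<in> Arr C. r)" "FUnit (cart_fun_id C) = Ident C (UnitObj C)"
  "FMult (cart_fun_id C) = (\<lambda>(X, Y) \<in> Obj C \<times> Obj C. Ident C (X \<odot>\<^bsub>C\<^esub> Y))"
  by (simp_all add: cart_fun_id_def fun_id_def fun_data.extend_def)

lemma cart_fun_comp_sel:
  "FDom (cart_fun_comp G F) = FDom F" "FCod (cart_fun_comp G F) = FCod G"
  "FObj (cart_fun_comp G F) = compose (Obj (FDom F)) (FObj G) (FObj F)"
  "FArr (cart_fun_comp G F) = compose (Arr (FDom F)) (FArr G) (FArr F)"
  "FUnit (cart_fun_comp G F) = FArr G (FUnit F) \<cdot>\<^bsub>FCod G\<^esub> FUnit G"
  "FMult (cart_fun_comp G F) = (\<lambda>(X, Y) \<in> Obj (FDom F) \<times> Obj (FDom F).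
     FArr G (FMult F (X, Y)) \<cdot>\<^bsub>FCod G\<^esub> FMult G (FObj F X, FObj F Y))"
  by (simp_all add: cart_fun_comp_def fun_comp_def fun_data.extend_def)

lemma cartesian_functor_objects:
  "cartesian_functor F \<Longrightarrow> bicategory_of_relations (FDom F)"
  "cartesian_functor F \<Longrightarrow> bicategory_of_relations (FCod F)"
  by (simp_all add: cartesian_functor_def)

lemma cartesian_functor_id:
  assumes C: "bicategory_of_relations C"
  shows "cartesian_functor (cart_fun_id C)"
proof (rule cartesian_functorI)
  interpret bicategory_of_relations C by (rule C)
  note sel = cart_fun_id_sel[of C]
  show r: "relational_fun (FDom (cart_fun_id C)) (FCod (cart_fun_id C)) (FObj (cart_fun_id C)) (FArr (cart_fun_id C))"
    using relational_fun_same[OF C] by (simp add: sel)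
  then show "ord_functor (cart_fun_id C)"
    using ord_functor_iff[of "cart_fun_id C"] ord_category_axioms by (simp add: relational_fun_def meet_fun_def sel)
  show "projection_compatible (cart_fun_id C)"
    by (auto simp: projection_compatible_def sel)
qed

lemma cartesian_functor_comp:
  assumes F: "cartesian_functor F" and G: "cartesian_functor G" and e: "FDom G = FCod F"
  shows "cartesian_functor (cart_fun_comp G F)"
proof (rule cartesian_functorI)
  let ?C = "FDom F" and ?D = "FCod F" and ?E = "FCod G" and ?H = "cart_fun_comp G F"
  note f = cartesian_functorD[OF F] and g = cartesian_functorD[OF G, unfolded e]
  interpret C: bicategory_of_relations ?C using f(2) by (simp add: relational_fun_def)
  interpret D: bicategory_of_relations ?D using f(2) by (simp add: relational_fun_def)
  interpret E: bicategory_of_relations ?E using g(2) by (simp add: relational_fun_def)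
  interpret F: ord_fun ?C ?D "FObj F" "FArr F" using f(2) by (simp add: relational_fun_def meet_fun_def)
  interpret G: ord_fun ?D ?E "FObj G" "FArr G" using g(2) by (simp add: relational_fun_def meet_fun_def)
  note sel = cart_fun_comp_sel[of G F]
  show r: "relational_fun (FDom ?H) (FCod ?H) (FObj ?H) (FArr ?H)"
    using relational_fun_compose[OF f(2) g(2)] by (simp add: sel)
  then show "ord_functor ?H"
    using ord_functor_iff[of ?H] C.ord_category_axioms E.ord_category_axioms
    by (simp add: relational_fun_def meet_fun_def sel compose_def)
  have m [simp]: "is_map ?D (FMult F (X, Y))" "FMult F (X, Y) \<in> Arr ?D"
      "Dom ?D (FMult F (X, Y)) = FObj F X \<odot>\<^bsub>?D\<^esub> FObj F Y" "Cod ?D (FMult F (X, Y)) = FObj F (X \<odot>\<^bsub>?C\<^esub> Y)"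
    and mp: "FArr F (C.p1 X Y) \<cdot>\<^bsub>?D\<^esub> FMult F (X, Y) = D.p1 (FObj F X) (FObj F Y)"
      "FArr F (C.p2 X Y) \<cdot>\<^bsub>?D\<^esub> FMult F (X, Y) = D.p2 (FObj F X) (FObj F Y)"
    if "X \<in> Obj ?C" "Y \<in> Obj ?C" for X Y
    using f(3) that by (auto simp: projection_compatible_def Let_def)
  have n [simp]: "is_map ?E (FMult G (X, Y))" "FMult G (X, Y) \<in> Arr ?E"
      "Dom ?E (FMult G (X, Y)) = FObj G X \<odot>\<^bsub>?E\<^esub> FObj G Y" "Cod ?E (FMult G (X, Y)) = FObj G (X \<odot>\<^bsub>?D\<^esub> Y)"
    and np: "FArr G (D.p1 X Y) \<cdot>\<^bsub>?E\<^esub> FMult G (X, Y) = E.p1 (FObj G X) (FObj G Y)"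
      "FArr G (D.p2 X Y) \<cdot>\<^bsub>?E\<^esub> FMult G (X, Y) = E.p2 (FObj G X) (FObj G Y)"
    if "X \<in> Obj ?D" "Y \<in> Obj ?D" for X Y
    using g(3) e that by (auto simp: projection_compatible_def Let_def)
  have u [simp]: "is_map ?D (FUnit F)" "FUnit F \<in> Arr ?D" "Dom ?D (FUnit F) = UnitObj ?D" "Cod ?D (FUnit F) = FObj F (UnitObj ?C)"
    using f(3) by (auto simp: projection_compatible_def Let_def)
  have v [simp]: "is_map ?E (FUnit G)" "FUnit G \<in> Arr ?E" "Dom ?E (FUnit G) = UnitObj ?E" "Cod ?E (FUnit G) = FObj G (UnitObj ?D)"
    using g(3) e by (auto simp: projection_compatible_def Let_def)
  have p: "FArr G (FArr F (C.p1 X Y)) \<cdot>\<^bsub>?E\<^esub> (FArr G (FMult F (X, Y)) \<cdot>\<^bsub>?E\<^esub> FMult G (FObj F X, FObj F Y))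
       = E.p1 (FObj G (FObj F X)) (FObj G (FObj F Y))"
    "FArr G (FArr F (C.p2 X Y)) \<cdot>\<^bsub>?E\<^esub> (FArr G (FMult F (X, Y)) \<cdot>\<^bsub>?E\<^esub> FMult G (FObj F X, FObj F Y))
       = E.p2 (FObj G (FObj F X)) (FObj G (FObj F Y))"
    if [simp]: "X \<in> Obj ?C" "Y \<in> Obj ?C" for X Y
  proof -
    have "FArr G (FArr F (C.p1 X Y)) \<cdot>\<^bsub>?E\<^esub> FArr G (FMult F (X, Y)) = FArr G (D.p1 (FObj F X) (FObj F Y))"
      "FArr G (FArr F (C.p2 X Y)) \<cdot>\<^bsub>?E\<^esub> FArr G (FMult F (X, Y)) = FArr G (D.p2 (FObj F X) (FObj F Y))"
      using mp[THEN arg_cong, of X Y "FArr G"] by simp_all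
    note q = this
    show "FArr G (FArr F (C.p1 X Y)) \<cdot>\<^bsub>?E\<^esub> (FArr G (FMult F (X, Y)) \<cdot>\<^bsub>?E\<^esub> FMult G (FObj F X, FObj F Y))
       = E.p1 (FObj G (FObj F X)) (FObj G (FObj F Y))"
      "FArr G (FArr F (C.p2 X Y)) \<cdot>\<^bsub>?E\<^esub> (FArr G (FMult F (X, Y)) \<cdot>\<^bsub>?E\<^esub> FMult G (FObj F X, FObj F Y))
       = E.p2 (FObj G (FObj F X)) (FObj G (FObj F Y))"
      by (simp_all add: E.comp_extend[OF q(1)] E.comp_extend[OF q(2)] np)
  qed
  show "projection_compatible ?H"
    by (auto simp: projection_compatible_def sel compose_def p)
qed

interpretation BR: transformation_setup "{C. bicategory_of_relations C}" "{F. cartesian_functor F}" cart_fun_id cart_fun_comp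
proof (rule transformation_setup.intro, goal_cases)
  case (1 C)
  then interpret bicategory_of_relations C by simp
  show ?case by unfold_locales
next
  case (2 C f g)
  then interpret bicategory_of_relations C by simp
  show ?case using 2 by (intro R.map_le_eq) auto
next
  case (16 F G)
  then show ?case by (auto intro: cartesian_functor_eqI)
qed (auto simp: cart_fun_id_sel cart_fun_comp_sel cartesian_functor_id cartesian_functor_comp
    cartesian_functor_objects cartesian_functorD(1))

lemma UPtAll_2cat_eq: "UPtAll_2cat = transformation_2cat {A. unitary_pre_tabular A}
    {F. allegory_functor F \<and> unitary_pre_tabular (FDom F) \<and> unitary_pre_tabular (FCod F) \<and> unit_preserving F} fun_id fun_comp"
proof -
  have "allegory_functor F \<Longrightarrow> allegory (FDom F) \<and> allegory (FCod F)" for F by (simp add: allegory_functor_def)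
  then show ?thesis
    by (auto simp: UPtAll_2cat_def All_2cat_def locally_full_sub_def transformation_2cat_def Let_def unitary_pre_tabular_def)
qed


text \<open>Any choice of products does; all of them give isomorphic bicategories of relations.\<close>

definition bicategory_of :: "('o, 'a) allegory_data \<Rightarrow> ('o, 'a) cart_data" where
  "bicategory_of A = (SOME C. bicategory_of_relations C \<and> same_ord_cat C A)"

lemma bicategory_of: "unitary_pre_tabular A \<Longrightarrow> bicategory_of_relations (bicategory_of A) \<and> same_ord_cat (bicategory_of A) A"
  unfolding bicategory_of_def by (rule someI_ex) (use bicategory_of_allegory_exists[of A] in \<open>simp add: unitary_pre_tabular_def\<close>)

theorem mainTheorem7:
  shows "two_equivalent (BiRel_2cat :: ('o, 'a) cart_2cat) (UPtAll_2cat :: ('o, 'a) allegory_2cat)"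
proof -
  have BR: "BR.represented C D f0 f1 \<longleftrightarrow> relational_fun C D f0 f1 \<and> f0 \<in> extensional (Obj C) \<and> f1 \<in> extensional (Arr C)"
    for C D :: "('o, 'a) cart_data" and f0 f1
  proof
    assume "BR.represented C D f0 f1"
    then show "relational_fun C D f0 f1 \<and> f0 \<in> extensional (Obj C) \<and> f1 \<in> extensional (Arr C)"
      using cartesian_functorD BR.represented_ext by (auto simp: BR.represented_def BR.arrow_def ord_functor_def)
  next
    assume "relational_fun C D f0 f1 \<and> f0 \<in> extensional (Obj C) \<and> f1 \<in> extensional (Arr C)"
    then show "BR.represented C D f0 f1"
      using cartesian_functor_exists[of C D f0 f1] by (auto simp: BR.represented_def BR.arrow_def)
  qed
  have UP: "UP.represented A B f0 f1 \<longleftrightarrow> unital_fun A B f0 f1 \<and> f0 \<in> extensional (Obj A) \<and> f1 \<in> extensional (Arr A)"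
    for A B :: "('o, 'a) allegory_data" and f0 f1
  proof -
    have "UP.represented A B f0 f1 \<longleftrightarrow> (\<exists>F :: ('o, 'a) allegory_fun. (unital_fun (FDom F) (FCod F) (FObj F) (FArr F) \<and>
     FObj F \<in> extensional (Obj (FDom F)) \<and> FArr F \<in> extensional (Arr (FDom F))) \<and> FDom F = A \<and> FCod F = B \<and> FObj F = f0 \<and> FArr F = f1)"
      unfolding UP.represented_def UP.arrow_def by (simp only: mem_Collect_eq unital_functor_iff)
    also have "\<dots> \<longleftrightarrow> unital_fun A B f0 f1 \<and> f0 \<in> extensional (Obj A) \<and> f1 \<in> extensional (Arr A)"
      by (auto intro: exI[of _ "\<lparr>FDom = A, FCod = B, FObj = f0, FArr = f1\<rparr>"])
    finally show ?thesis .
  qed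
  interpret transformation_equivalence
    "{C :: ('o, 'a) cart_data. bicategory_of_relations C}" "{F :: ('o, 'a) cart_fun. cartesian_functor F}" cart_fun_id cart_fun_comp
    "{A :: ('o, 'a) allegory_data. unitary_pre_tabular A}" "{F :: ('o, 'a) allegory_fun. allegory_functor F \<and> unitary_pre_tabular (FDom F) \<and> unitary_pre_tabular (FCod F) \<and> unit_preserving F}"
    fun_id fun_comp allegory_of bicategory_of
  proof (intro transformation_equivalence.intro BR.transformation_setup_axioms UP.transformation_setup_axioms
      transformation_equivalence_axioms.intro, goal_cases)
    case (5 C D f0 f1)
    then show ?case
      by (simp add: BR UP unital_fun_allegory_of same_ord_catD[OF same_allegory_of])
  next
    case (6 A B)
    then show ?case by (simp add: UP unital_fun_same)
  qed (auto simp: unitary_pre_tabular_def allegory_of_bicategory same_allegory_of bicategory_of)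
  show ?thesis
    using two_equivalent_transformation_2cats by (simp add: BiRel_2cat_def UPtAll_2cat_eq)
qed

end
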